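(* Assume $c_->0$ (equivalently $\alpha\rho<1$). Let $\xi$ be the (killed) Lévy process with characteristic exponent \[\Phi(\lambda)=ia\lambda+\int_{\mathbb{R}}\big(e^{i\lambda y}-1-i\lambda(e^y-1)\mathbf 1_{\{|e^y-1|<1\}}\big)\pi(y)\,dy-k,\qquad \pi(y)=e^y\nu(e^y-1),\] started from $0$, with lifetime $\zeta$, and let $\underline{\xi}=\inf_{0\le s<\zeta}\xi_s$. Then for any $\lambda>0$, \[\mathbb{E}(e^{\lambda\underline{\xi}})=\frac{\Gamma(\lambda+1-\alpha\rho)}{\Gamma(\lambda+1)\,\Gamma(1-\alpha\rho)}.\] In other words, $\exp\underline{\xi}$ is a Beta variable with density \[\mathbb{P}(\exp\underline{\xi}\in dt)=\mathrm{B}(1-\alpha\rho,\alpha\rho)^{-1}\,t^{-\alpha\rho}(1-t)^{\alpha\rho-1}\mathbf 1_{\{t\in(0,1)\}}\,dt,\] where $\mathrm{B}(\cdot,\cdot)$ is the Beta function.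
   Context: Fix $\alpha\in(0,2)$ and constants $c_+,c_-\ge 0$ with $c_++c_->0$. Under $P_x$, $X=(X_t)_{t\ge0}$ is a stable Lévy process of index $\alpha$ started at $x\in\mathbb{R}$, with $E_0[e^{i\lambda X_t}]=e^{t\psi(\lambda)}$, where \[\psi(\lambda)=ia\lambda+\int_{\mathbb{R}}(e^{i\lambda y}-1-i\lambda y\mathbf 1_{\{|y|<1\}})\,\nu(y)\,dy,\qquad \nu(y)=c_+y^{-\alpha-1}\mathbf 1_{\{y>0\}}+c_-|y|^{-\alpha-1}\mathbf 1_{\{y<0\}}.\] If $\alpha\ne1$, then $a=\frac{c_+-c_-}{1-\alpha}$; if $\alpha=1$, the process is a symmetric Cauchy process, i.e. $c_+=c_-$ and $a=0$. It is assumed that neither $X$ nor $-X$ is a subordinator. Put $T=\inf\{t\ge0:X_t\le0\}$ and $\rho=P_0(X_1\le0)=P_0(X_1<0)$. The constant $k$: if $\alpha\neq1$, let $c=-(c_++c_-)\Gamma(-\alpha)\cos\frac{\pi\alpha}{2}$ and $\beta=\frac{c_+-c_-}{c_++c_-}$, and set $k=c\,(1+\beta^2\tan^2(\pi\alpha/2))^{1/2}\,\Gamma(\alpha)\sin(\pi\alpha\rho)/\pi$; if $\alpha=1$, set $k=c_+$ $(=c_-)$. The characteristic exponent of a Lévy process $\xi$ with (independent exponential, possibly infinite) lifetime $\zeta$ is defined by $\mathbb{E}[e^{i\lambda\xi_t}\mathbf 1_{\{t<\zeta\}}]=e^{t\Phi(\lambda)}$; here $\zeta$ is exponential with parameter $k$.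 The process $\xi$ is the one in the Lamperti representation of the killed stable process $X_t\mathbf 1_{\{t<T\}}$ started at $x>0$: $X_t=x\exp\xi_{\tau(tx^{-\alpha})}$ for $0\le t<T$, where $\tau(t)=\inf\{s\ge0:\int_0^s\exp(\alpha\xi_u)\,du\ge t\}$. *)

theory Defs
  imports "HOL-Probability.Probability"
begin

text \<open>Real Levy processes issued from 0, indexed by \<open>{0..}\<close>; values at negative times
  are irrelevant. Paths are cadlag for every outcome, so that path functionals such as infima are
  measurable without completing the probability space.\<close>

locale levy_process = prob_space M
  for M :: "'a measure" and X :: "real \<Rightarrow> 'a \<Rightarrow> real" +
  assumes measurable_process: "\<And>t. 0 \<le> t \<Longrightarrow> X t \<in> borel_measurable M"
    and start_zero: "AE \<omega> in M. X 0 \<omega> = 0"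
    and indep_increments: "\<And>(t :: nat \<Rightarrow> real) n. 0 \<le> t 0 \<Longrightarrow> mono t \<Longrightarrow>
      indep_vars (\<lambda>_. borel) (\<lambda>i \<omega>. X (t (Suc i)) \<omega> - X (t i) \<omega>) {..<n}"
    and stationary_increments: "\<And>s h. 0 \<le> s \<Longrightarrow> 0 \<le> h \<Longrightarrow>
      distr M borel (\<lambda>\<omega>. X (s + h) \<omega> - X s \<omega>) = distr M borel (X h)"
    and right_continuous: "\<And>\<omega> t. \<omega> \<in> space M \<Longrightarrow> 0 \<le> t \<Longrightarrow>
      continuous (at_right t) (\<lambda>s. X s \<omega>)"
    and left_limits: "\<And>\<omega> t. \<omega> \<in> space M \<Longrightarrow> 0 < t \<Longrightarrow>
      \<exists>l. ((\<lambda>s. X s \<omega>) \<longlongrightarrow> l) (at_left t)"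

definition has_char_exponent ::
    "'a measure \<Rightarrow> (real \<Rightarrow> 'a \<Rightarrow> real) \<Rightarrow> (real \<Rightarrow> complex) \<Rightarrow> bool" where
  "has_char_exponent M X \<psi> \<longleftrightarrow>
     (\<forall>t\<ge>0. \<forall>l. char (distr M borel (X t)) l = exp (complex_of_real t * \<psi> l))"

definition subordinator :: "'a measure \<Rightarrow> (real \<Rightarrow> 'a \<Rightarrow> real) \<Rightarrow> bool" where
  "subordinator M X \<longleftrightarrow> levy_process M X \<and>
     (AE \<omega> in M. \<forall>s t. 0 \<le> s \<longrightarrow> s \<le> t \<longrightarrow> X s \<omega> \<le> X t \<omega>)"

text \<open>A Levy process killed at rate \<open>q\<close> is given by a Levy process \<open>\<xi>\<close> and an independent lifetime
  \<open>\<zeta>\<close>, exponential with parameter \<open>q\<close> (almost surely infinite if \<open>q = 0\<close>). The killed process is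
  \<open>\<xi> t\<close> for \<open>t < \<zeta>\<close>; the values of \<open>\<xi>\<close> from time \<open>\<zeta>\<close> on are not part of it and do not enter
  the two definitions that follow.\<close>

locale killed_levy_process = levy_process M \<xi>
  for M :: "'a measure" and q :: real and \<xi> :: "real \<Rightarrow> 'a \<Rightarrow> real" and \<zeta> :: "'a \<Rightarrow> ereal" +
  assumes rate_nonneg: "0 \<le> q"
    and lifetime_measurable: "\<zeta> \<in> borel_measurable M"
    and lifetime_exponential: "\<And>t. 0 \<le> t \<Longrightarrow> prob {\<omega> \<in> space M. ereal t < \<zeta> \<omega>} = exp (- q * t)"
    and lifetime_indep: "indep_set
      (sets (vimage_algebra (space M) (\<lambda>\<omega>. \<lambda>t\<in>{0..}. \<xi> t \<omega>) (\<Pi>\<^sub>M t\<in>{0..}. borel)))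
      (sets (vimage_algebra (space M) \<zeta> borel))"

definition has_killed_char_exponent ::
    "'a measure \<Rightarrow> (real \<Rightarrow> 'a \<Rightarrow> real) \<Rightarrow> ('a \<Rightarrow> ereal) \<Rightarrow> (real \<Rightarrow> complex) \<Rightarrow> bool" where
  "has_killed_char_exponent M \<xi> \<zeta> \<Phi> \<longleftrightarrow>
     (\<forall>t\<ge>0. \<forall>l. (\<integral>\<omega>. iexp (l * \<xi> t \<omega>) * indicator {\<omega>. ereal t < \<zeta> \<omega>} \<omega> \<partial>M)
        = exp (complex_of_real t * \<Phi> l))"

text \<open>The infimum is taken over the reals: it is over a nonempty set bounded below
  whenever \<open>0 < \<zeta> \<omega> < \<infinity>\<close> and the path is cadlag, hence almost surely if the killing rate is
  positive.\<close>

definition overall_infimum :: "(real \<Rightarrow> 'a \<Rightarrow> real) \<Rightarrow> ('a \<Rightarrow> ereal) \<Rightarrow> 'a \<Rightarrow> real" where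
  "overall_infimum \<xi> \<zeta> \<omega> = (INF s\<in>{s. 0 \<le> s \<and> ereal s < \<zeta> \<omega>}. \<xi> s \<omega>)"

definition stable_density :: "real \<Rightarrow> real \<Rightarrow> real \<Rightarrow> real \<Rightarrow> real" where
  "stable_density \<alpha> cp cm y =
     cp * y powr (- \<alpha> - 1) * indicator {0<..} y + cm * \<bar>y\<bar> powr (- \<alpha> - 1) * indicator {..<0} y"

text \<open>With this drift the process is strictly stable; for \<open>\<alpha> = 1\<close> only the symmetric case
  \<open>cp = cm\<close> is intended, both here and in \<open>killing_rate\<close>.\<close>

definition stable_drift :: "real \<Rightarrow> real \<Rightarrow> real \<Rightarrow> real" where
  "stable_drift \<alpha> cp cm = (if \<alpha> = 1 then 0 else (cp - cm) / (1 - \<alpha>))"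

definition stable_exponent :: "real \<Rightarrow> real \<Rightarrow> real \<Rightarrow> real \<Rightarrow> complex" where
  "stable_exponent \<alpha> cp cm l =
     \<i> * complex_of_real (stable_drift \<alpha> cp cm * l) +
     (\<integral>y. (iexp (l * y) - 1 - \<i> * complex_of_real (l * y) * indicator {y. \<bar>y\<bar> < 1} y)
        * complex_of_real (stable_density \<alpha> cp cm y) \<partial>lborel)"

text \<open>Here \<open>\<rho>\<close> is the negativity parameter, the probability that the stable process started at 0 is
  nonpositive at time 1 (not the positivity parameter of other conventions).\<close>

definition killing_rate :: "real \<Rightarrow> real \<Rightarrow> real \<Rightarrow> real \<Rightarrow> real" where
  "killing_rate \<alpha> cp cm \<rho> =
     (if \<alpha> = 1 then cp
      else let c = - (cp + cm) * Gamma (- \<alpha>) * cos (pi * \<alpha> / 2);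
               \<beta> = (cp - cm) / (cp + cm)
           in c * sqrt (1 + \<beta>\<^sup>2 * (tan (pi * \<alpha> / 2))\<^sup>2) * Gamma \<alpha> * sin (pi * \<alpha> * \<rho>) / pi)"

text \<open>Image of the stable jump density on \<open>{-1<..}\<close> under \<open>x \<mapsto> ln (1 + x)\<close>.\<close>

definition lamperti_density :: "real \<Rightarrow> real \<Rightarrow> real \<Rightarrow> real \<Rightarrow> real" where
  "lamperti_density \<alpha> cp cm y = exp y * stable_density \<alpha> cp cm (exp y - 1)"

definition lamperti_exponent :: "real \<Rightarrow> real \<Rightarrow> real \<Rightarrow> real \<Rightarrow> real \<Rightarrow> complex" where
  "lamperti_exponent \<alpha> cp cm \<rho> l =
     \<i> * complex_of_real (stable_drift \<alpha> cp cm * l) +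
     (\<integral>y. (iexp (l * y) - 1 -
            \<i> * complex_of_real (l * (exp y - 1)) * indicator {y. \<bar>exp y - 1\<bar> < 1} y)
        * complex_of_real (lamperti_density \<alpha> cp cm y) \<partial>lborel)
     - complex_of_real (killing_rate \<alpha> cp cm \<rho>)"

end

theory Submission
  imports Defs "HOL-Complex_Analysis.Complex_Analysis"
begin

text \<open>The compensated integral in \<open>\<Phi>\<close> is evaluated by analytic continuation of the Beta integral. Together
  with Zolotarev's formula for \<open>\<rho>\<close>, which fixes the killing rate as \<open>cm / \<alpha>\<close>, this gives the hypergeometric form
  \<open>\<Phi>(l) = - C \<Gamma>(\<alpha> - il) \<Gamma>(1 + il) / (\<Gamma>(\<alpha>\<rho> - il) \<Gamma>(1 - \<alpha>\<rho> + il))\<close> with \<open>C > 0\<close>.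
  On the other hand, \<open>- q / \<Phi>\<close>, with \<open>q\<close> the killing rate, is the product of the Laplace transforms of the overall infimum and of the overall
  supremum, by Spitzer's identity on dyadic grids; each factor is holomorphic without zeros in its half-plane and its
  inverse grows subexponentially. The quotient of the infimum factor by
  \<open>\<Gamma>(w + 1 - \<alpha>\<rho>) / \<Gamma>(w + 1)\<close> therefore extends across the imaginary axis to an entire function without zeros
  of subexponential growth, which is constant.\<close>

section \<open>Entire functions without zeros\<close>

text \<open>The limit in the grid has to be controlled: zero-free functions may converge to one with
  zeros, and a quotient bounded by exp (a |z|) for some fixed a could still be exp (b z). Both
  dangers are met by comparing the complex argument w with the real argument |w|: for x \<le> 0,
  |exp (w x) - 1| \<le> 4 (1 - exp (|w| x)). Inserted into the exponent of Spitzer's identity this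
  yields |f(w)| \<ge> |f(|w|)|^4 for the infimum factor f on every grid, hence in the limit. On the
  positive axis f decays more slowly than every exp (- e x), because with positive probability the
  process dies before going below -e. The growth of 1 / f is thus obtained from the paths, not from
  asymptotics of \<Phi>.

  The closed form of \<Phi> has a trigonometric origin: the evaluated integral leaves a combination
  of sin (pi (\<alpha> - s)) and sin (pi s) with s = i l, and Zolotarev's angle pi \<alpha> \<rho>
  is the phase that merges it into the single sine C sin (pi (\<alpha> \<rho> - s)). The reflection
  formula splits that sine into two reciprocal Gamma factors, one for each half-plane.\<close>

lemma continuous_on_dominated_integral:
  fixes f :: "'b::metric_space \<Rightarrow> 'a \<Rightarrow> 'c::{banach, second_countable_topology}"
  assumes cont: "\<And>\<omega>. \<omega> \<in> space M \<Longrightarrow> continuous_on S (\<lambda>z. f z \<omega>)"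
    and meas: "\<And>z. z \<in> S \<Longrightarrow> f z \<in> borel_measurable M"
    and dom: "\<And>z. z \<in> S \<Longrightarrow> \<exists>r>0. \<exists>g. integrable M g \<and>
      (\<forall>u\<in>S \<inter> cball z r. \<forall>\<omega>\<in>space M. norm (f u \<omega>) \<le> g \<omega>)"
  shows "continuous_on S (\<lambda>z. \<integral>\<omega>. f z \<omega> \<partial>M)"
  unfolding continuous_on_sequentially
proof (intro allI ballI impI, elim conjE)
  fix X :: "nat \<Rightarrow> 'b" and z assume z: "z \<in> S" and X: "\<forall>n. X n \<in> S" "X \<longlonglongrightarrow> z"
  obtain r g where r: "r > 0" and g: "integrable M g"
    and b: "\<And>u \<omega>. u \<in> S \<Longrightarrow> u \<in> cball z r \<Longrightarrow> \<omega> \<in> space M \<Longrightarrow> norm (f u \<omega>) \<le> g \<omega>"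
    using dom[OF z] by (metis IntI)
  obtain k where k: "\<And>n. n \<ge> k \<Longrightarrow> dist (X n) z < r"
    using X(2) r by (metis lim_sequentially)
  have "(\<lambda>n. \<integral>\<omega>. f (X (n + k)) \<omega> \<partial>M) \<longlonglongrightarrow> (\<integral>\<omega>. f z \<omega> \<partial>M)"
  proof (rule integral_dominated_convergence[where w=g])
    show "AE \<omega> in M. (\<lambda>n. f (X (n + k)) \<omega>) \<longlonglongrightarrow> f z \<omega>"
    proof (intro AE_I2)
      fix \<omega> assume "\<omega> \<in> space M"
      then have "(\<lambda>n. f (X n) \<omega>) \<longlonglongrightarrow> f z \<omega>"
        using cont[of \<omega>] X z unfolding continuous_on_sequentially comp_def by blast
      then show "(\<lambda>n. f (X (n + k)) \<omega>) \<longlonglongrightarrow> f z \<omega>" by (rule LIMSEQ_ignore_initial_segment)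
    qed
    show "AE \<omega> in M. norm (f (X (n + k)) \<omega>) \<le> g \<omega>" for n
      using X(1) k[of "n + k"] by (intro AE_I2 b) (auto simp: dist_commute less_imp_le)
  qed (use meas X z g in auto)
  then show "((\<lambda>z. \<integral>\<omega>. f z \<omega> \<partial>M) \<circ> X) \<longlonglongrightarrow> (\<integral>\<omega>. f z \<omega> \<partial>M)"
    unfolding comp_def by (rule LIMSEQ_offset)
qed

text \<open>Cauchy's estimate on discs of half the radius turns the bound on \<open>f\<close> into a
  Lipschitz bound for its difference quotients, so domination is asked of \<open>f\<close> alone and
  never of its derivative. Dominated convergence along sequences tending to \<open>z\<close> then
  gives the complex derivative of the integral.\<close>

lemma holomorphic_on_dominated_integral:
  fixes f :: "complex \<Rightarrow> 'a \<Rightarrow> complex"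
  assumes S: "open S"
    and hol: "\<And>\<omega>. \<omega> \<in> space M \<Longrightarrow> (\<lambda>z. f z \<omega>) holomorphic_on S"
    and meas: "\<And>z. z \<in> S \<Longrightarrow> f z \<in> borel_measurable M"
    and dom: "\<And>z. z \<in> S \<Longrightarrow> \<exists>r>0. cball z r \<subseteq> S \<and> (\<exists>g. integrable M g \<and>
      (\<forall>u\<in>cball z r. \<forall>\<omega>\<in>space M. norm (f u \<omega>) \<le> g \<omega>))"
  shows "(\<lambda>z. \<integral>\<omega>. f z \<omega> \<partial>M) holomorphic_on S"
proof -
  have "\<exists>D. ((\<lambda>z. \<integral>\<omega>. f z \<omega> \<partial>M) has_field_derivative D) (at z)" if z: "z \<in> S" for z
  proof -
    obtain r g where r: "r > 0" "cball z r \<subseteq> S" and g: "integrable M g"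
      and b: "\<And>u \<omega>. u \<in> cball z r \<Longrightarrow> \<omega> \<in> space M \<Longrightarrow> norm (f u \<omega>) \<le> g \<omega>"
      using dom[OF z] by metis
    define D where "D \<omega> = deriv (\<lambda>z. f z \<omega>) z" for \<omega>
    have lip: "norm (f u \<omega> - f z \<omega>) \<le> (g \<omega> / (r / 2)) * norm (u - z)"
      if u: "u \<in> ball z (r / 2)" and \<omega>: "\<omega> \<in> space M" for u \<omega>
    proof (rule field_differentiable_bound[where S = "ball z (r/2)" and f' = "deriv (\<lambda>z. f z \<omega>)"])
      fix v assume v: "v \<in> ball z (r / 2)"
      have sub: "cball v (r/2) \<subseteq> cball z r"
      proof
        fix x assume "x \<in> cball v (r / 2)"
        then show "x \<in> cball z r" using v dist_triangle[of z x v] by auto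
      qed
      have h: "(\<lambda>z. f z \<omega>) holomorphic_on cball v (r/2)"
        using hol[OF \<omega>] sub r by (meson holomorphic_on_subset order_trans)
      show "((\<lambda>z. f z \<omega>) has_field_derivative deriv (\<lambda>z. f z \<omega>) v) (at v within ball z (r / 2))"
      proof (rule has_field_derivative_at_within[OF holomorphic_derivI[OF hol[OF \<omega>] S]])
        have "v \<in> cball z r" using v r(1) by auto
        then show "v \<in> S" using r(2) by blast
      qed
      have "norm ((deriv ^^ 1) (\<lambda>z. f z \<omega>) v) \<le> fact 1 * g \<omega> / (r / 2) ^ 1"
      proof (rule Cauchy_inequality)
        show "(\<lambda>z. f z \<omega>) holomorphic_on ball v (r / 2)"
          using h ball_subset_cball holomorphic_on_subset by blast
        show "continuous_on (cball v (r / 2)) (\<lambda>z. f z \<omega>)"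
          using h holomorphic_on_imp_continuous_on by blast
        show "cmod (f x \<omega>) \<le> g \<omega>" if "cmod (v - x) = r / 2" for x
        proof (rule b[OF _ \<omega>])
          have "x \<in> cball v (r/2)" using that by (simp add: dist_norm)
          then show "x \<in> cball z r" using sub by blast
        qed
      qed (use r in auto)
      then show "norm (deriv (\<lambda>z. f z \<omega>) v) \<le> g \<omega> / (r / 2)" by simp
    qed (use u r in auto)
    have "((\<lambda>u. ((\<integral>\<omega>. f u \<omega> \<partial>M) - (\<integral>\<omega>. f z \<omega> \<partial>M)) / (u - z)) \<longlongrightarrow> (\<integral>\<omega>. D \<omega> \<partial>M)) (at z)"
      unfolding tendsto_at_iff_sequentially
    proof (intro allI impI)
      fix X assume X: "\<forall>n. X n \<in> UNIV - {z}" "X \<longlonglongrightarrow> z"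
      then obtain k where k: "\<And>n. n \<ge> k \<Longrightarrow> dist (X n) z < r / 2"
        using r by (metis lim_sequentially half_gt_zero)
      then have kb: "X (n + k) \<in> ball z (r/2)" for n by (simp add: dist_commute)
      then have kS: "X (n + k) \<in> S" for n
      proof -
        have "X (n + k) \<in> cball z r" using kb[of n] r(1) by auto
        then show ?thesis using r by blast
      qed
      have lim: "(\<lambda>n. (f (X (n + k)) \<omega> - f z \<omega>) / (X (n + k) - z)) \<longlonglongrightarrow> D \<omega>" if \<omega>: "\<omega> \<in> space M" for \<omega>
      proof -
        have "((\<lambda>z. f z \<omega>) has_field_derivative D \<omega>) (at z)"
          unfolding D_def using holomorphic_derivI[OF hol[OF \<omega>] S z] by simp
        then have "(\<lambda>n. (f (X n) \<omega> - f z \<omega>) / (X n - z)) \<longlonglongrightarrow> D \<omega>"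
          using X unfolding has_field_derivative_iff tendsto_at_iff_sequentially comp_def by blast
        then show ?thesis by (rule LIMSEQ_ignore_initial_segment)
      qed
      have q: "(\<lambda>\<omega>. (f (X (n + k)) \<omega> - f z \<omega>) / (X (n + k) - z)) \<in> borel_measurable M" for n
        using meas[OF z] meas[OF kS] by measurable
      have "(\<lambda>n. \<integral>\<omega>. (f (X (n + k)) \<omega> - f z \<omega>) / (X (n + k) - z) \<partial>M) \<longlonglongrightarrow> (\<integral>\<omega>. D \<omega> \<partial>M)"
      proof (rule integral_dominated_convergence[where w="\<lambda>\<omega>. g \<omega> / (r/2)"])
        show "D \<in> borel_measurable M" by (rule borel_measurable_LIMSEQ_metric[OF q lim])
        show "AE \<omega> in M. norm ((f (X (n + k)) \<omega> - f z \<omega>) / (X (n + k) - z)) \<le> g \<omega> / (r/2)" for n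
        proof (intro AE_I2)
          fix \<omega> assume "\<omega> \<in> space M"
          moreover have "norm (X (n + k) - z) > 0" using X(1) by auto
          ultimately show "norm ((f (X (n + k)) \<omega> - f z \<omega>) / (X (n + k) - z)) \<le> g \<omega> / (r/2)"
            using lip[OF kb, of \<omega> n] by (simp add: norm_divide pos_divide_le_eq)
        qed
      qed (use q g lim in auto)
      moreover have "(\<integral>\<omega>. (f (X (n + k)) \<omega> - f z \<omega>) / (X (n + k) - z) \<partial>M)
          = ((\<integral>\<omega>. f (X (n + k)) \<omega> \<partial>M) - (\<integral>\<omega>. f z \<omega> \<partial>M)) / (X (n + k) - z)" for n
      proof -
        have "integrable M (f u)" if "u \<in> cball z r" for u
          by (rule Bochner_Integration.integrable_bound[OF g])
            (use meas r that b in \<open>auto intro!: AE_I2 order_trans[OF b abs_ge_self]\<close>)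
        then have "integrable M (f (X (n + k)))" "integrable M (f z)"
          using kb[of n] r(1) by auto
        then show ?thesis by simp
      qed
      ultimately have "(\<lambda>n. ((\<integral>\<omega>. f (X (n + k)) \<omega> \<partial>M) - (\<integral>\<omega>. f z \<omega> \<partial>M)) / (X (n + k) - z)) \<longlonglongrightarrow> (\<integral>\<omega>. D \<omega> \<partial>M)"
        by (simp only: )
      then show "((\<lambda>u. ((\<integral>\<omega>. f u \<omega> \<partial>M) - (\<integral>\<omega>. f z \<omega> \<partial>M)) / (u - z)) \<circ> X) \<longlonglongrightarrow> (\<integral>\<omega>. D \<omega> \<partial>M)"
        unfolding comp_def by (rule LIMSEQ_offset)
    qed
    then show ?thesis unfolding has_field_derivative_iff by blast
  qed
  then show ?thesis using S by (simp add: holomorphic_on_open)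
qed

text \<open>Continuity across the axis is enough for holomorphy, by Morera's argument. The
  Wiener-Hopf factors are known on closed half-planes only, so continuity is all that is available
  at the boundary.\<close>

lemma holomorphic_paste_imaginary_axis:
  assumes f: "f holomorphic_on {z. Re z > 0}" "continuous_on {z. Re z \<ge> 0} f"
    and g: "g holomorphic_on {z. Re z < 0}" "continuous_on {z. Re z \<le> 0} g"
    and eq: "\<And>z. Re z = 0 \<Longrightarrow> f z = g z"
  shows "(\<lambda>z. if Re z \<ge> 0 then f z else g z) holomorphic_on UNIV"
proof (rule holomorphic_on_paste_across_line[where d = 1 and k = 0])
  have *: "{z. 1 \<bullet> z < 0} = {z. Re z < 0}" "{z. 0 < 1 \<bullet> z} = {z. 0 < Re z}"
    by (auto simp: inner_complex_def)
  show "(\<lambda>z. if Re z \<ge> 0 then f z else g z) holomorphic_on UNIV \<inter> {z. 1 \<bullet> z < 0}"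
    unfolding * by (rule holomorphic_transform[where f = g]) (use g in auto)
  show "(\<lambda>z. if Re z \<ge> 0 then f z else g z) holomorphic_on UNIV \<inter> {z. 0 < 1 \<bullet> z}"
    unfolding * by (rule holomorphic_transform[where f = f]) (use f in auto)
  have "continuous_on ({z. Re z \<ge> 0} \<union> {z. Re z \<le> 0}) (\<lambda>z. if Re z \<ge> 0 then f z else g z)"
    by (rule continuous_on_cases)
      (use f g eq closed_halfspace_Re_ge[of 0] closed_halfspace_Re_le[of 0] in \<open>auto simp: eq_iff\<close>)
  also have "{z. Re z \<ge> 0} \<union> {z. Re z \<le> 0} = UNIV" by auto
  finally show "continuous_on UNIV (\<lambda>z. if Re z \<ge> 0 then f z else g z)" .
qed auto

text \<open>Borel-Caratheodory: with \<open>A\<close> a bound for the real part on the disc of radius \<open>R\<close>, Schwarz' lemma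
  applies to \<open>L / (2 A - L)\<close>.\<close>

lemma entire_Re_bound_imp_zero:
  assumes L: "L holomorphic_on UNIV" "L 0 = 0"
    and bd: "\<And>e. e > 0 \<Longrightarrow> \<exists>C. \<forall>z. Re (L z) \<le> C + e * norm z"
  shows "L z = 0"
proof -
  have est: "norm (L z) \<le> 2 * A * norm z / (R - norm z)"
    if A: "A > 0" "\<And>u. norm u < R \<Longrightarrow> Re (L u) < A" and R: "R > norm z" for A R :: real
  proof -
    have R0: "R > 0" using R norm_ge_zero[of z] by linarith
    define g where "g u = L (of_real R * u) / (2 * of_real A - L (of_real R * u))" for u
    have lt: "norm (L u) < norm (2 * of_real A - L u)" "2 * of_real A - L u \<noteq> 0" if "norm u < R" for u
    proof -
      have a: "Re (L u) < A" using A that by blast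
      then have "(2 * A - Re (L u))\<^sup>2 > (Re (L u))\<^sup>2"
        using A(1) by (simp add: power2_eq_square algebra_simps)
      then show "norm (L u) < norm (2 * of_real A - L u)"
        unfolding cmod_def by (intro real_sqrt_less_mono) (simp add: power2_commute)
      then show "2 * of_real A - L u \<noteq> 0" by (metis norm_not_less_zero norm_zero)
    qed
    have sc: "norm (of_real R * u) < R" if "norm u < 1" for u :: complex
      using that R0 by (simp add: norm_mult)
    have hol: "g holomorphic_on ball 0 1"
      unfolding g_def
      by (intro holomorphic_intros holomorphic_on_compose_gen[OF _ L(1), unfolded comp_def])
        (use lt(2)[OF sc] in auto)
    have "norm (g (z / of_real R)) \<le> norm (z / of_real R)"
    proof (rule Schwarz_Lemma(1)[OF hol])
      show "g 0 = 0" using L by (simp add: g_def)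
      show "norm (g u) < 1" if "norm u < 1" for u
      proof -
        have "0 < norm (2 * of_real A - L (of_real R * u))" using lt(2)[OF sc[OF that]] by simp
        then show ?thesis using lt(1)[OF sc[OF that]] unfolding g_def by (simp add: norm_divide)
      qed
      show "norm (z / of_real R) < 1" using R R0 by (simp add: norm_divide)
    qed
    then have "norm (L z) / norm (2 * of_real A - L z) \<le> norm z / R"
      using R0 by (simp add: g_def norm_divide)
    then have "norm (L z) * R \<le> norm z * norm (2 * of_real A - L z)"
      using R0 lt(2)[OF R] by (simp add: field_simps)
    also have "\<dots> \<le> norm z * (2 * A + norm (L z))"
      using norm_triangle_ineq4[of "2 * of_real A" "L z"] A by (intro mult_left_mono) auto
    finally have "norm (L z) * (R - norm z) \<le> 2 * A * norm z" by (simp add: algebra_simps)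
    then show ?thesis using R by (simp add: field_simps)
  qed
  \<comment> \<open>The estimate is used with A = C + e R. As R tends to infinity the constant C
    disappears and only the slope e survives, which is arbitrary.\<close>
  have *: "norm (L z) \<le> 2 * e * norm z" if e: "e > 0" for e
  proof -
    obtain C0 where C0: "\<And>z. Re (L z) \<le> C0 + e * norm z" using bd[OF e] by auto
    define C where "C = max C0 0 + 1"
    have C: "C > 0" "Re (L z) < C + e * norm z" for z using C0[of z] by (auto simp: C_def)
    have "((\<lambda>R. 2 * (C + e * R) * norm z / (R - norm z)) \<longlongrightarrow> 2 * e * norm z) at_top"
    proof -
      have "((\<lambda>R. (C + e * R) / (R - norm z)) \<longlongrightarrow> e) at_top" using e by real_asymp
      then have "((\<lambda>R. 2 * norm z * ((C + e * R) / (R - norm z))) \<longlongrightarrow> 2 * norm z * e) at_top"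
        by (intro tendsto_intros)
      then show ?thesis by (simp add: mult_ac)
    qed
    moreover have "\<forall>\<^sub>F R in at_top. norm (L z) \<le> 2 * (C + e * R) * norm z / (R - norm z)"
      using eventually_gt_at_top[of "norm z"]
    proof eventually_elim
      case (elim R)
      show ?case
      proof (rule est[OF _ _ elim])
        have "R > 0" using elim norm_ge_zero[of z] by linarith
        then show "C + e * R > 0" using C e by (simp add: add_pos_pos)
        show "Re (L u) < C + e * R" if "norm u < R" for u
          using C(2)[of u] mult_left_mono[of "norm u" R e] that e by linarith
      qed
    qed
    ultimately show ?thesis by (intro tendsto_lowerbound) auto
  qed
  show ?thesis
  proof (cases "z = 0")
    case False
    have "norm (L z) \<le> 0 + e" if "e > 0" for e
      using *[of "e / (2 * norm z)"] that False by simp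
    then have "norm (L z) \<le> 0" by (rule field_le_epsilon)
    then show ?thesis by simp
  qed (use L in simp)
qed

text \<open>A zero-free entire function has an entire logarithm, and the bound makes the real part
  of that logarithm sublinear. A bound for a single \<open>e\<close> would leave exp (a z) possible;
  asking it for all \<open>e > 0\<close> leaves only constants.\<close>

lemma entire_nonvanishing_subexponential:
  assumes F: "F holomorphic_on UNIV" "\<And>z. F z \<noteq> 0"
    and bd: "\<And>e. e > 0 \<Longrightarrow> \<exists>C. \<forall>z. norm (F z) \<le> C * exp (e * norm z)"
  shows "F z = F 0"
proof -
  obtain g where g: "g holomorphic_on UNIV" "\<And>z. F z = exp (g z)"
    using contractible_imp_holomorphic_log[OF F(1)] F(2) by auto
  have "g z - g 0 = 0"
  proof (rule entire_Re_bound_imp_zero[where L = "\<lambda>z. g z - g 0"])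
    fix e :: real assume "e > 0"
    then obtain C where C: "\<And>z. norm (F z) \<le> C * exp (e * norm z)" using bd by auto
    have "0 < norm (F 0)" using F(2)[of 0] by simp
    then have C0: "C > 0" using C[of 0] by (simp del: zero_less_norm_iff)
    have "Re (g z - g 0) \<le> (ln C - Re (g 0)) + e * norm z" for z
    proof -
      have "exp (Re (g z)) \<le> exp (ln C + e * norm z)"
        using C[of z] C0 by (simp add: g(2) exp_add)
      then show ?thesis by simp
    qed
    then show "\<exists>C. \<forall>z. Re (g z - g 0) \<le> C + e * norm z" by blast
  qed (use g in \<open>auto intro!: holomorphic_intros\<close>)
  then show ?thesis by (simp add: g(2))
qed

section \<open>Spitzer's identity for random walks\<close>

text \<open>Seen as an integral over the counting measure, a series inherits continuity and
  holomorphy in a parameter from the two domination results for integrals.\<close>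

lemma suminf_eq_integral_count_space:
  fixes f :: "nat \<Rightarrow> complex"
  assumes "\<And>n. norm (f n) \<le> b n" "summable b"
  shows "(\<Sum>n. f n) = (\<integral>n. f n \<partial>count_space UNIV)"
proof -
  have "summable (\<lambda>n. norm (f n))"
    by (rule summable_comparison_test'[OF assms(2)]) (use assms in auto)
  then show ?thesis by (simp add: integral_count_space_nat integrable_count_space_nat_iff)
qed

lemma continuous_on_suminf_bounded:
  fixes f :: "nat \<Rightarrow> complex \<Rightarrow> complex"
  assumes "\<And>n. continuous_on S (f n)" "\<And>n z. z \<in> S \<Longrightarrow> norm (f n z) \<le> b n" "summable b"
  shows "continuous_on S (\<lambda>z. \<Sum>n. f n z)"
proof -
  have b: "\<bar>b n\<bar> = b n" if "z \<in> S" for n z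
    using order_trans[OF norm_ge_zero assms(2)[OF that, of n]] by simp
  have "continuous_on S (\<lambda>z. \<integral>n. f n z \<partial>count_space UNIV)"
  proof (rule continuous_on_dominated_integral)
    fix z assume "z \<in> S"
    then show "\<exists>r>0. \<exists>g. integrable (count_space UNIV) g \<and>
      (\<forall>u\<in>S \<inter> cball z r. \<forall>n\<in>space (count_space UNIV). norm (f n u) \<le> g n)"
      using assms b by (intro exI[of _ 1] conjI exI[of _ b]) (auto simp: integrable_count_space_nat_iff)
  qed (use assms in auto)
  then show ?thesis
    by (rule continuous_on_cong[THEN iffD1, rotated 2])
      (use assms in \<open>auto intro!: suminf_eq_integral_count_space[symmetric, where b=b]\<close>)
qed

lemma holomorphic_on_suminf_bounded:
  fixes f :: "nat \<Rightarrow> complex \<Rightarrow> complex"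
  assumes S: "open S"
    and "\<And>n. f n holomorphic_on S" "\<And>n z. z \<in> S \<Longrightarrow> norm (f n z) \<le> b n" "summable b"
  shows "(\<lambda>z. \<Sum>n. f n z) holomorphic_on S"
proof -
  have b: "\<bar>b n\<bar> = b n" if "z \<in> S" for n z
    using order_trans[OF norm_ge_zero assms(3)[OF that, of n]] by simp
  have "(\<lambda>z. \<integral>n. f n z \<partial>count_space UNIV) holomorphic_on S"
  proof (rule holomorphic_on_dominated_integral[OF S])
    fix z assume z: "z \<in> S"
    then obtain r where r: "r > 0" "cball z r \<subseteq> S" using S open_contains_cball by blast
    then show "\<exists>r>0. cball z r \<subseteq> S \<and> (\<exists>g. integrable (count_space UNIV) g \<and>
      (\<forall>u\<in>cball z r. \<forall>n\<in>space (count_space UNIV). norm (f n u) \<le> g n))"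
      using assms b[OF z] by (intro exI[of _ r] conjI exI[of _ b]) (auto simp: integrable_count_space_nat_iff subset_iff)
  qed (use assms in auto)
  then show ?thesis
    by (rule holomorphic_transform)
      (use assms in \<open>auto intro!: suminf_eq_integral_count_space[symmetric, where b=b]\<close>)
qed

section \<open>Laplace transforms of one-sided parts of a law\<close>

definition neg_laplace :: "real measure \<Rightarrow> complex \<Rightarrow> complex" where
  "neg_laplace Q w = (\<integral>x. exp (w * of_real (min x 0)) \<partial>Q)"

lemma norm_exp_nonpos_le: "Re w \<ge> 0 \<Longrightarrow> x \<le> 0 \<Longrightarrow> norm (exp (w * complex_of_real x)) \<le> 1"
  by (simp add: mult_nonneg_nonpos)

lemma (in prob_space) laplace_nonpos:
  assumes X: "X \<in> borel_measurable M" "\<And>\<omega>. X \<omega> \<le> (0::real)"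
  shows continuous_laplace_nonpos:
      "continuous_on {w. Re w \<ge> 0} (\<lambda>w. \<integral>\<omega>. exp (w * of_real (X \<omega>)) \<partial>M)"
    and holomorphic_laplace_nonpos:
      "(\<lambda>w. \<integral>\<omega>. exp (w * of_real (X \<omega>)) \<partial>M) holomorphic_on {w. Re w > 0}"
    and integrable_laplace_nonpos: "Re w \<ge> 0 \<Longrightarrow> integrable M (\<lambda>\<omega>. exp (w * of_real (X \<omega>)))"
    and norm_laplace_nonpos_le: "Re w \<ge> 0 \<Longrightarrow> norm (\<integral>\<omega>. exp (w * of_real (X \<omega>)) \<partial>M) \<le> 1"
proof -
  have [measurable]: "X \<in> borel_measurable M" by (rule X)
  note b = norm_exp_nonpos_le[OF _ X(2)]
  show i: "integrable M (\<lambda>\<omega>. exp (w * of_real (X \<omega>)))" if "Re w \<ge> 0" for w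
    by (rule integrable_const_bound[where B=1]) (use b[OF that] in auto)
  show "norm (\<integral>\<omega>. exp (w * of_real (X \<omega>)) \<partial>M) \<le> 1" if "Re w \<ge> 0"
  proof -
    have "norm (\<integral>\<omega>. exp (w * of_real (X \<omega>)) \<partial>M) \<le> (\<integral>\<omega>. norm (exp (w * of_real (X \<omega>))) \<partial>M)"
      by (rule integral_norm_bound)
    also have "\<dots> \<le> (\<integral>\<omega>. 1 \<partial>M)"
      by (rule integral_mono) (use b[OF that] integrable_norm[OF i[OF that]] in auto)
    finally show ?thesis by (simp add: prob_space)
  qed
  show "continuous_on {w. Re w \<ge> 0} (\<lambda>w. \<integral>\<omega>. exp (w * of_real (X \<omega>)) \<partial>M)"
    by (rule continuous_on_dominated_integral)
      (use b in \<open>auto intro!: continuous_intros exI[of _ "1::real"] exI[of _ "\<lambda>_. 1 :: real"]\<close>)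
  show "(\<lambda>w. \<integral>\<omega>. exp (w * of_real (X \<omega>)) \<partial>M) holomorphic_on {w. Re w > 0}"
  proof (rule holomorphic_on_dominated_integral)
    show o: "open {w. 0 < Re w}" by (rule open_halfspace_Re_gt)
    fix z :: complex assume "z \<in> {w. 0 < Re w}"
    then obtain r where r: "r > 0" "cball z r \<subseteq> {w. 0 < Re w}" using o open_contains_cball by blast
    then show "\<exists>r>0. cball z r \<subseteq> {w. 0 < Re w} \<and> (\<exists>g. integrable M g \<and>
      (\<forall>u\<in>cball z r. \<forall>\<omega>\<in>space M. cmod (exp (u * complex_of_real (X \<omega>))) \<le> g \<omega>))"
      by (intro exI[of _ r] conjI exI[of _ "\<lambda>_. 1"] ballI b) (auto dest: subsetD less_imp_le)
  qed (auto intro!: holomorphic_intros)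
qed

lemma
  assumes "real_distribution Q"
  shows continuous_neg_laplace: "continuous_on {w. Re w \<ge> 0} (neg_laplace Q)"
    and holomorphic_neg_laplace: "neg_laplace Q holomorphic_on {w. Re w > 0}"
    and norm_neg_laplace_le: "Re w \<ge> 0 \<Longrightarrow> norm (neg_laplace Q w) \<le> 1"
    and neg_laplace_0: "neg_laplace Q 0 = 1"
proof -
  interpret real_distribution Q by fact
  have m: "(\<lambda>x. min x 0) \<in> borel_measurable Q" "min x 0 \<le> 0" for x :: real by auto
  show "continuous_on {w. Re w \<ge> 0} (neg_laplace Q)"
    unfolding neg_laplace_def[abs_def] by (rule continuous_laplace_nonpos) (use m in auto)
  show "neg_laplace Q holomorphic_on {w. Re w > 0}"
    unfolding neg_laplace_def[abs_def] by (rule holomorphic_laplace_nonpos) (use m in auto)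
  show "Re w \<ge> 0 \<Longrightarrow> norm (neg_laplace Q w) \<le> 1"
    unfolding neg_laplace_def by (rule norm_laplace_nonpos_le) (use m in auto)
  show "neg_laplace Q 0 = 1" using prob_space by (simp add: neg_laplace_def)
qed

lemma neg_laplace_of_real:
  "neg_laplace Q (of_real r) = of_real (\<integral>x. exp (r * min x 0) \<partial>Q)"
  unfolding neg_laplace_def
  by (subst integral_complex_of_real[symmetric]) (simp add: exp_of_real flip: of_real_mult)

text \<open>This compares a complex argument with the real argument \<open>norm w\<close>. With u =
  - |w| x the left-hand side is at most min 2 u, by the triangle inequality and by the mean value
  bound, and min 2 u \<le> 4 (1 - exp (- u)). The factor 4 reappears as the fourth power in
  \<open>geometric_min_laplace_lower_bound\<close>.\<close>

lemma norm_exp_minus_one_le: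
  assumes "Re w \<ge> 0" "x \<le> 0"
  shows "norm (exp (w * complex_of_real x) - 1) \<le> 4 * (1 - exp (norm w * x))"
proof -
  define u where "u = norm w * (- x)"
  have u: "u \<ge> 0" using assms by (simp add: u_def mult_nonneg_nonpos)
  have a: "norm (exp (w * of_real x) - 1) \<le> 2"
    using norm_triangle_ineq4[of "exp (w * of_real x)" 1] norm_exp_nonpos_le[OF assms]
    by (simp del: norm_exp_eq_Re)
  have b: "norm (exp (w * of_real x) - 1) \<le> u"
  proof -
    have "norm (exp (w * of_real x) - exp 0) \<le> 1 * norm (w * of_real x - 0)"
    proof (rule field_differentiable_bound[where S="{z. Re z \<le> 0}" and f'=exp])
      show "convex {z. Re z \<le> 0}" by (rule convex_halfspace_Re_le)
      show "w * complex_of_real x \<in> {z. Re z \<le> 0}" using assms by (simp add: mult_nonneg_nonpos)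
    qed (auto intro!: derivative_eq_intros)
    then show ?thesis using assms by (simp add: norm_mult u_def)
  qed
  have "min 2 u \<le> 4 * (1 - exp (- u))"
  proof (cases "u \<ge> 1")
    case True
    have "exp (1::real) \<ge> 2" using exp_ge_add_one_self[of 1] by simp
    then have "exp (-1::real) \<le> 1/2" by (simp add: exp_minus divide_simps)
    moreover have "exp (- u) \<le> exp (-1)" using True by simp
    ultimately have "exp (- u) \<le> 1/2" by linarith
    then show ?thesis by (simp add: min_le_iff_disj)
  next
    case False
    have "1 + u \<le> exp u" by (rule exp_ge_add_one_self)
    then have "exp (- u) \<le> 1 / (1 + u)" using u by (simp add: exp_minus divide_simps)
    also have "\<dots> \<le> 1 - u / 2" using u False by (simp add: divide_simps) (simp add: algebra_simps mult_left_le)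
    finally show ?thesis using u by (simp add: min_le_iff_disj)
  qed
  then show ?thesis using a b by (simp add: u_def)
qed

section \<open>Random walks and their minima\<close>

primrec walk_law :: "real measure \<Rightarrow> nat \<Rightarrow> real measure" where
  "walk_law \<mu> 0 = return borel 0"
| "walk_law \<mu> (Suc n) = distr (\<mu> \<Otimes>\<^sub>M walk_law \<mu> n) borel (\<lambda>z. fst z + snd z)"

text \<open>The recursion peels off the first step: the minimum of 0 and all partial sums is the
  minimum of 0 and of the first step plus the same quantity for the remaining walk, which is
  independent of that step.\<close>

primrec walk_min_law :: "real measure \<Rightarrow> nat \<Rightarrow> real measure" where
  "walk_min_law \<mu> 0 = return borel 0"
| "walk_min_law \<mu> (Suc n) = distr (\<mu> \<Otimes>\<^sub>M walk_min_law \<mu> n) borel (\<lambda>z. min 0 (fst z + snd z))"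

lemma real_distribution_pair_distr:
  assumes "real_distribution \<mu>" "real_distribution Q"
    "f \<in> borel_measurable (borel \<Otimes>\<^sub>M borel)"
  shows "real_distribution (distr (\<mu> \<Otimes>\<^sub>M Q) borel f)"
proof -
  interpret \<mu>: real_distribution \<mu> by fact
  interpret Q: real_distribution Q by fact
  interpret P: pair_prob_space \<mu> Q ..
  have "f \<in> borel_measurable (\<mu> \<Otimes>\<^sub>M Q)"
    using assms(3) by (subst measurable_cong_sets[OF sets_pair_measure_cong refl]) auto
  then show ?thesis by (rule P.real_distribution_distr)
qed

lemma real_distribution_return: "real_distribution (return borel (x::real))"
  unfolding real_distribution_def real_distribution_axioms_def by (simp add: prob_space_return)

lemma real_distribution_walk_law: "real_distribution \<mu> \<Longrightarrow> real_distribution (walk_law \<mu> n)"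
  by (induction n) (auto simp: real_distribution_return intro!: real_distribution_pair_distr)

lemma real_distribution_walk_min_law: "real_distribution \<mu> \<Longrightarrow> real_distribution (walk_min_law \<mu> n)"
  by (induction n) (auto simp: real_distribution_return intro!: real_distribution_pair_distr)

lemma real_distribution_uminus: "real_distribution \<mu> \<Longrightarrow> real_distribution (distr \<mu> borel uminus)"
proof -
  assume "real_distribution \<mu>"
  then interpret real_distribution \<mu> .
  show ?thesis by (rule real_distribution_distr) simp
qed

lemma integral_pair_prob_mult:
  fixes f g :: "real \<Rightarrow> complex"
  assumes "real_distribution \<mu>" "real_distribution Q"
    and [measurable]: "f \<in> borel_measurable borel" "g \<in> borel_measurable borel"
    and b: "\<And>x. norm (f x) \<le> 1" "\<And>x. norm (g x) \<le> 1"
  shows "(\<integral>z. f (fst z) * g (snd z) \<partial>(\<mu> \<Otimes>\<^sub>M Q)) = (\<integral>x. f x \<partial>\<mu>) * (\<integral>x. g x \<partial>Q)"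
proof -
  interpret \<mu>: real_distribution \<mu> by fact
  interpret Q: real_distribution Q by fact
  interpret P: pair_prob_space \<mu> Q ..
  have "integrable (\<mu> \<Otimes>\<^sub>M Q) (\<lambda>z. f (fst z) * g (snd z))"
    by (rule P.integrable_const_bound[where B=1])
      (auto intro!: AE_I2 mult_le_one b simp: norm_mult)
  from P.integral_fst'[OF this] show ?thesis by simp
qed

text \<open>On the imaginary axis, \<open>e^(wa) = e^(w min(a,0)) + e^(w max(a,0)) - 1\<close>; the second exponential
  extends to the left half-plane.\<close>

lemma exp_min_max: "exp (w * complex_of_real (min a 0)) + exp (w * complex_of_real (max a 0))
    = exp (w * complex_of_real a) + 1"
  by (cases "a \<le> 0") (auto simp: min_def max_def)

text \<open>Obtained from \<open>neg_laplace\<close> by reflection, so that continuity, holomorphy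
  and bounds in the left half-plane are inherited.\<close>

definition pos_laplace :: "real measure \<Rightarrow> complex \<Rightarrow> complex" where
  "pos_laplace Q w = neg_laplace (distr Q borel uminus) (- w)"

lemma pos_laplace_eq:
  assumes "real_distribution Q"
  shows "pos_laplace Q w = (\<integral>x. exp (w * of_real (max x 0)) \<partial>Q)"
proof -
  interpret real_distribution Q by fact
  have "- w * complex_of_real (min (- x) 0) = w * complex_of_real (max x 0)" for x
    by (auto simp: min_def max_def)
  then show ?thesis unfolding pos_laplace_def neg_laplace_def
    by (subst integral_distr) (auto simp del: mult_minus_left)
qed

lemma neg_pos_laplace:
  assumes "real_distribution Q" "Re w = 0"
  shows "neg_laplace Q w + pos_laplace Q w = (\<integral>x. exp (w * of_real x) \<partial>Q) + 1"
proof -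
  interpret real_distribution Q by fact
  have i: "integrable Q (\<lambda>x. exp (w * complex_of_real (f x)))" if [measurable]: "f \<in> borel_measurable borel" for f
    by (rule integrable_const_bound[where B=1]) (use assms in auto)
  have "neg_laplace Q w + pos_laplace Q w
      = (\<integral>x. exp (w * complex_of_real (min x 0)) + exp (w * complex_of_real (max x 0)) \<partial>Q)"
    unfolding pos_laplace_eq[OF assms(1)] neg_laplace_def
    by (rule Bochner_Integration.integral_add[symmetric]) (auto intro!: i)
  also have "\<dots> = (\<integral>x. exp (w * of_real x) + 1 \<partial>Q)" by (simp only: exp_min_max)
  also have "\<dots> = (\<integral>x. exp (w * of_real x) \<partial>Q) + 1"
    using i[of "\<lambda>x. x"] prob_space by simp
  finally show ?thesis .
qed

lemma
  assumes Q: "real_distribution Q"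
  shows continuous_pos_laplace: "continuous_on {w. Re w \<le> 0} (pos_laplace Q)"
    and holomorphic_pos_laplace: "pos_laplace Q holomorphic_on {w. Re w < 0}"
    and norm_pos_laplace_le: "Re w \<le> 0 \<Longrightarrow> norm (pos_laplace Q w) \<le> 1"
proof -
  note Q' = real_distribution_uminus[OF Q]
  show "continuous_on {w. Re w \<le> 0} (pos_laplace Q)"
    unfolding pos_laplace_def[abs_def]
    by (intro continuous_on_compose2[OF continuous_neg_laplace[OF Q']] continuous_intros) auto
  show "pos_laplace Q holomorphic_on {w. Re w < 0}"
    unfolding pos_laplace_def[abs_def]
    by (intro holomorphic_on_compose_gen[OF _ holomorphic_neg_laplace[OF Q'], unfolded comp_def] holomorphic_intros) auto
  show "Re w \<le> 0 \<Longrightarrow> norm (pos_laplace Q w) \<le> 1"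
    unfolding pos_laplace_def by (rule norm_neg_laplace_le[OF Q']) auto
qed

lemma exp_add_integral:
  assumes "real_distribution \<mu>" "real_distribution Q" "Re w = 0"
  shows "(\<integral>a. exp (w * of_real a) \<partial>distr (\<mu> \<Otimes>\<^sub>M Q) borel (\<lambda>z. fst z + snd z))
    = (\<integral>x. exp (w * of_real x) \<partial>\<mu>) * (\<integral>x. exp (w * of_real x) \<partial>Q)"
proof -
  interpret \<mu>: real_distribution \<mu> by fact
  interpret Q: real_distribution Q by fact
  have "(\<integral>a. exp (w * of_real a) \<partial>distr (\<mu> \<Otimes>\<^sub>M Q) borel (\<lambda>z. fst z + snd z))
      = (\<integral>z. exp (w * of_real (fst z)) * exp (w * of_real (snd z)) \<partial>(\<mu> \<Otimes>\<^sub>M Q))"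
    by (subst integral_distr) (auto simp: ring_distribs exp_add)
  also have "\<dots> = (\<integral>x. exp (w * of_real x) \<partial>\<mu>) * (\<integral>x. exp (w * of_real x) \<partial>Q)"
    by (rule integral_pair_prob_mult) (use assms in auto)
  finally show ?thesis .
qed

lemma walk_law_transform:
  assumes "real_distribution \<mu>" "Re w = 0"
  shows "(\<integral>a. exp (w * of_real a) \<partial>walk_law \<mu> n) = (\<integral>x. exp (w * of_real x) \<partial>\<mu>) ^ n"
  by (induction n) (auto simp: integral_return exp_add_integral[OF assms(1) real_distribution_walk_law[OF assms(1)] assms(2)])

lemma walk_min_law_transform:
  assumes "real_distribution \<mu>"
  shows "(\<integral>a. exp (w * of_real a) \<partial>walk_min_law \<mu> n) = neg_laplace (walk_min_law \<mu> n) w"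
proof (cases n)
  case 0
  then show ?thesis by (simp add: neg_laplace_def integral_return)
next
  case (Suc m)
  interpret \<mu>: real_distribution \<mu> by fact
  interpret Q: real_distribution "walk_min_law \<mu> m" by (rule real_distribution_walk_min_law) fact
  show ?thesis unfolding Suc neg_laplace_def walk_min_law.simps
    by (subst (1 2) integral_distr) (auto simp: min.commute min.left_commute)
qed

text \<open>Before truncation at 0, adding a step multiplies the transform by that of
  \<open>\<mu>\<close>. Truncation removes the positive part, and by \<open>exp_min_max\<close> this
  part enters only through a term that continues to the left half-plane. Summed over
  \<open>n\<close>, the recursion becomes the Wiener-Hopf equation solved in
  \<open>spitzer\<close>.\<close>

lemma walk_min_law_Suc_transform:
  assumes \<mu>: "real_distribution \<mu>" and w: "Re w = 0"
  shows "neg_laplace (walk_min_law \<mu> (Suc n)) w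
    = (\<integral>x. exp (w * of_real x) \<partial>\<mu>) * neg_laplace (walk_min_law \<mu> n) w + 1
      - pos_laplace (distr (\<mu> \<Otimes>\<^sub>M walk_min_law \<mu> n) borel (\<lambda>z. fst z + snd z)) w"
proof -
  interpret \<mu>: real_distribution \<mu> by fact
  note Q = real_distribution_walk_min_law[OF \<mu>, of n]
  interpret Q: real_distribution "walk_min_law \<mu> n" by (rule Q)
  define D where "D = distr (\<mu> \<Otimes>\<^sub>M walk_min_law \<mu> n) borel (\<lambda>z. fst z + snd z)"
  have D: "real_distribution D"
    unfolding D_def by (intro real_distribution_pair_distr \<mu> Q) measurable
  have "neg_laplace (walk_min_law \<mu> (Suc n)) w = neg_laplace D w"
    unfolding neg_laplace_def walk_min_law.simps D_def
    by (subst (1 2) integral_distr) (auto simp: min.commute)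
  also have "\<dots> = (\<integral>x. exp (w * of_real x) \<partial>D) + 1 - pos_laplace D w"
    using neg_pos_laplace[OF D w] by (simp add: algebra_simps)
  also have "(\<integral>x. exp (w * of_real x) \<partial>D) = (\<integral>x. exp (w * of_real x) \<partial>\<mu>) * neg_laplace (walk_min_law \<mu> n) w"
    unfolding D_def exp_add_integral[OF \<mu> Q w] walk_min_law_transform[OF \<mu>] ..
  finally show ?thesis unfolding D_def .
qed

section \<open>The walk minimum at an independent geometric time\<close>

definition geometric_min_laplace :: "real measure \<Rightarrow> real \<Rightarrow> complex \<Rightarrow> complex" where
  "geometric_min_laplace \<mu> p w = (\<Sum>n. of_real ((1 - p) * p ^ n) * neg_laplace (walk_min_law \<mu> n) w)"

text \<open>The exponent in Spitzer's identity: the sum over n \<ge> 1 of p^n / n times the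
  expectation of exp (w min(S_n, 0)) - 1, with the series index shifted by one.\<close>

definition spitzer_exponent :: "real measure \<Rightarrow> real \<Rightarrow> complex \<Rightarrow> complex" where
  "spitzer_exponent \<mu> p w =
    (\<Sum>n. of_real (p ^ Suc n / Suc n) * (neg_laplace (walk_law \<mu> (Suc n)) w - 1))"

lemma walk_law_uminus:
  assumes \<mu>: "real_distribution \<mu>"
  shows "walk_law (distr \<mu> borel uminus) n = distr (walk_law \<mu> n) borel uminus"
proof (induction n)
  case 0
  show ?case by (simp add: distr_return)
next
  case (Suc n)
  interpret \<mu>: real_distribution \<mu> by fact
  interpret Q: real_distribution "walk_law \<mu> n" by (rule real_distribution_walk_law) fact
  interpret \<mu>': real_distribution "distr \<mu> borel uminus" by (rule real_distribution_uminus) fact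
  interpret Q': real_distribution "distr (walk_law \<mu> n) borel uminus" by (rule real_distribution_uminus) unfold_locales
  have "distr \<mu> borel uminus \<Otimes>\<^sub>M distr (walk_law \<mu> n) borel uminus
      = distr (\<mu> \<Otimes>\<^sub>M walk_law \<mu> n) (borel \<Otimes>\<^sub>M borel) (\<lambda>(x, y). (- x, - y))"
    by (rule pair_measure_distr) (auto intro: Q'.sigma_finite_measure)
  then show ?case
    by (simp add: Suc distr_distr comp_def case_prod_beta)
qed

context
  fixes \<mu> :: "real measure" and p :: real
  assumes \<mu>: "real_distribution \<mu>" and p: "0 < p" "p < 1"
begin

lemma summable_geometric_over: "summable (\<lambda>n. 2 * (p ^ Suc n / real (Suc n)))"
proof (rule summable_comparison_test'[where N=0])
  show "summable (\<lambda>n. 2 * p ^ n)" using p by (intro summable_mult summable_geometric) auto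
  show "norm (2 * (p ^ Suc n / real (Suc n))) \<le> 2 * p ^ n" for n
  proof -
    have "p ^ Suc n / real (Suc n) \<le> p ^ Suc n" using p by (simp add: divide_simps)
    also have "\<dots> \<le> p ^ n" using p by (intro power_decreasing) auto
    finally show ?thesis using p by simp
  qed
qed

lemma spitzer_term_bound:
  assumes "norm T \<le> 1"
  shows "norm (of_real (p ^ Suc n / Suc n) * (T - 1) :: complex) \<le> 2 * (p ^ Suc n / real (Suc n))"
proof -
  have "norm (T - 1) \<le> 2" using norm_triangle_ineq4[of T 1] assms by simp
  then have "norm (of_real (p ^ Suc n / Suc n) :: complex) * norm (T - 1) \<le> p ^ Suc n / real (Suc n) * 2"
    using p by (intro mult_mono) (auto simp: norm_power norm_divide norm_mult simp del: of_nat_Suc)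
  then show ?thesis by (simp only: norm_mult mult.commute)
qed

lemma
  shows continuous_spitzer_exponent: "continuous_on {w. Re w \<ge> 0} (spitzer_exponent \<mu> p)"
    and holomorphic_spitzer_exponent: "spitzer_exponent \<mu> p holomorphic_on {w. Re w > 0}"
    and norm_spitzer_exponent_le:
      "Re w \<ge> 0 \<Longrightarrow> norm (spitzer_exponent \<mu> p w) \<le> (\<Sum>n. 2 * (p ^ Suc n / real (Suc n)))"
    and spitzer_exponent_0: "spitzer_exponent \<mu> p 0 = 0"
proof -
  note Q = real_distribution_walk_law[OF \<mu>]
  have b: "norm (of_real (p ^ Suc n / Suc n) * (neg_laplace (walk_law \<mu> (Suc n)) w - 1))
      \<le> 2 * (p ^ Suc n / real (Suc n))" if "Re w \<ge> 0" for n w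
    by (rule spitzer_term_bound[OF norm_neg_laplace_le[OF Q that]])
  show "continuous_on {w. Re w \<ge> 0} (spitzer_exponent \<mu> p)"
    unfolding spitzer_exponent_def[abs_def]
    by (rule continuous_on_suminf_bounded[OF _ b summable_geometric_over])
      (auto intro!: continuous_intros continuous_neg_laplace Q simp del: walk_law.simps of_nat_Suc)
  show "spitzer_exponent \<mu> p holomorphic_on {w. Re w > 0}"
    unfolding spitzer_exponent_def[abs_def]
    by (rule holomorphic_on_suminf_bounded[OF _ _ b summable_geometric_over])
      (auto intro!: holomorphic_intros holomorphic_neg_laplace Q open_halfspace_Re_gt simp del: walk_law.simps)
  show "norm (spitzer_exponent \<mu> p w) \<le> (\<Sum>n. 2 * (p ^ Suc n / real (Suc n)))" if "Re w \<ge> 0"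
    unfolding spitzer_exponent_def
    by (rule norm_suminf_le[OF b[OF that] summable_geometric_over])
  show "spitzer_exponent \<mu> p 0 = 0"
    unfolding spitzer_exponent_def by (simp add: neg_laplace_0[OF Q] del: walk_law.simps)
qed

lemma
  shows continuous_geometric_min_laplace: "continuous_on {w. Re w \<ge> 0} (geometric_min_laplace \<mu> p)"
    and holomorphic_geometric_min_laplace: "geometric_min_laplace \<mu> p holomorphic_on {w. Re w > 0}"
    and norm_geometric_min_laplace_le: "Re w \<ge> 0 \<Longrightarrow> norm (geometric_min_laplace \<mu> p w) \<le> 1"
    and geometric_min_laplace_0: "geometric_min_laplace \<mu> p 0 = 1"
    and summable_geometric_min_laplace:
      "Re w \<ge> 0 \<Longrightarrow> summable (\<lambda>n. of_real ((1 - p) * p ^ n) * neg_laplace (walk_min_law \<mu> n) w)"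
proof -
  note Q = real_distribution_walk_min_law[OF \<mu>]
  have s: "(\<lambda>n. (1 - p) * p ^ n) sums 1"
    using sums_mult[OF geometric_sums[of p], of "1 - p"] p by simp
  have b: "norm (of_real ((1 - p) * p ^ n) * neg_laplace (walk_min_law \<mu> n) w)
      \<le> (1 - p) * p ^ n" if "Re w \<ge> 0" for n w
  proof -
    have "(1 - p) * p ^ n * norm (neg_laplace (walk_min_law \<mu> n) w) \<le> (1 - p) * p ^ n * 1"
      using p by (intro mult_left_mono norm_neg_laplace_le Q that) auto
    then show ?thesis using p by (simp add: norm_mult norm_power flip: of_real_diff)
  qed
  show "continuous_on {w. Re w \<ge> 0} (geometric_min_laplace \<mu> p)"
    unfolding geometric_min_laplace_def[abs_def]
    by (rule continuous_on_suminf_bounded[OF _ b sums_summable[OF s]])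
      (auto intro!: continuous_intros continuous_neg_laplace Q)
  show "geometric_min_laplace \<mu> p holomorphic_on {w. Re w > 0}"
    unfolding geometric_min_laplace_def[abs_def]
    by (rule holomorphic_on_suminf_bounded[OF _ _ b sums_summable[OF s]])
      (auto intro!: holomorphic_intros holomorphic_neg_laplace Q open_halfspace_Re_gt)
  show "norm (geometric_min_laplace \<mu> p w) \<le> 1" if "Re w \<ge> 0"
    unfolding geometric_min_laplace_def using norm_suminf_le[OF b[OF that] sums_summable[OF s]] s
    by (simp add: sums_iff)
  show "geometric_min_laplace \<mu> p 0 = 1"
    unfolding geometric_min_laplace_def
    using sums_of_real[OF s, where 'a=complex] by (simp add: neg_laplace_0[OF Q] sums_iff)
  show "summable (\<lambda>n. of_real ((1 - p) * p ^ n) * neg_laplace (walk_min_law \<mu> n) w)" if "Re w \<ge> 0"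
    by (rule summable_norm_cancel, rule summable_comparison_test'[OF sums_summable[OF s]])
      (use b[OF that] in auto)
qed

end

text \<open>Let phi be the transform of one step. On the imaginary axis the negative and positive
  parts of S_n together contribute phi^n + 1, so the two exponents add up to the sum of p^n / n
  times (phi^n - 1). This is a difference of two logarithmic series, log (1 - p) - log (1 - p
  phi).\<close>

lemma spitzer_exponent_sum:
  assumes \<mu>: "real_distribution \<mu>" and p: "0 < p" "p < 1" and w: "Re w = 0"
  shows "exp (spitzer_exponent \<mu> p w + spitzer_exponent (distr \<mu> borel uminus) p (- w))
    = (1 - p) / (1 - p * (\<integral>x. exp (w * of_real x) \<partial>\<mu>))"
proof -
  define \<phi> where "\<phi> = (\<integral>x. exp (w * of_real x) \<partial>\<mu>)"
  interpret real_distribution \<mu> by fact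
  have \<phi>: "norm \<phi> \<le> 1"
    using integral_norm_bound[of \<mu> "\<lambda>x. exp (w * of_real x)"] w prob_space unfolding \<phi>_def by simp
  have p\<phi>: "norm (p * \<phi>) < 1"
  proof -
    have "p * norm \<phi> \<le> p * 1" using \<phi> p by (intro mult_left_mono) auto
    then have "p * norm \<phi> < 1" using p by linarith
    then show ?thesis using p by (simp add: norm_mult)
  qed
  have "(\<lambda>n. (of_real (p ^ Suc n / Suc n) * (\<phi> ^ Suc n - 1))) sums (Ln (1 - of_real p) - Ln (1 - p * \<phi>))"
  proof -
    have a: "(\<lambda>n. z ^ Suc n / of_nat (Suc n)) sums (- Ln (1 - z))" if "norm z < 1" for z :: complex
    proof -
      have "(\<lambda>n. (-1)^Suc n / of_nat n * (- z) ^ n) sums Ln (1 + - z)"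
        by (rule Ln_series) (use that in auto)
      then have "(\<lambda>n. - ((-1)^Suc n / of_nat n * (- z) ^ n)) sums (- Ln (1 - z))"
        by (intro sums_minus) simp
      also have "(\<lambda>n. - ((-1)^Suc n / of_nat n * (- z) ^ n)) = (\<lambda>n. z ^ n / of_nat n)"
        by (auto simp: fun_eq_iff simp flip: power_mult_distrib)
      finally show ?thesis by (subst sums_Suc_iff) simp
    qed
    have "(\<lambda>n. (p * \<phi>) ^ Suc n / of_nat (Suc n) - of_real p ^ Suc n / of_nat (Suc n)) sums
        (- Ln (1 - p * \<phi>) - - Ln (1 - of_real p))"
      using p by (intro sums_diff a p\<phi>) auto
    moreover have "(p * \<phi>) ^ Suc n / of_nat (Suc n) - of_real p ^ Suc n / of_nat (Suc n)
        = of_real (p ^ Suc n / Suc n) * (\<phi> ^ Suc n - 1)" for n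
      by (simp add: power_mult_distrib algebra_simps diff_divide_distrib)
    ultimately show ?thesis by (simp add: algebra_simps)
  qed
  moreover have "spitzer_exponent \<mu> p w + spitzer_exponent (distr \<mu> borel uminus) p (- w)
      = (\<Sum>n. of_real (p ^ Suc n / Suc n) * (\<phi> ^ Suc n - 1))"
  proof -
    have s: "summable (\<lambda>n. of_real (p ^ Suc n / Suc n) * (neg_laplace (walk_law \<nu> (Suc n)) u - 1))"
      if "real_distribution \<nu>" "Re u = 0" for \<nu> u
      by (rule summable_norm_cancel, rule summable_comparison_test'[OF summable_geometric_over[OF \<mu> p]])
        (unfold real_norm_def abs_norm_cancel, rule spitzer_term_bound[OF \<mu> p norm_neg_laplace_le[OF real_distribution_walk_law[OF that(1)]]],
          use that in simp)
    show ?thesis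
      unfolding spitzer_exponent_def
    proof (subst suminf_add)
      note Q = real_distribution_walk_law[OF \<mu>]
      have "neg_laplace (walk_law \<mu> (Suc n)) w + neg_laplace (walk_law (distr \<mu> borel uminus) (Suc n)) (- w)
          = \<phi> ^ Suc n + 1" for n
        unfolding walk_law_uminus[OF \<mu>] pos_laplace_def[symmetric] neg_pos_laplace[OF Q w]
          walk_law_transform[OF \<mu> w] \<phi>_def ..
      then have "neg_laplace (walk_law \<mu> (Suc n)) w - 1 + (neg_laplace (walk_law (distr \<mu> borel uminus) (Suc n)) (- w) - 1)
          = \<phi> ^ Suc n - 1" for n
        by (simp add: algebra_simps)
      then show "(\<Sum>n. of_real (p ^ Suc n / Suc n) * (neg_laplace (walk_law \<mu> (Suc n)) w - 1)
          + of_real (p ^ Suc n / Suc n) * (neg_laplace (walk_law (distr \<mu> borel uminus) (Suc n)) (- w) - 1))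
          = (\<Sum>n. of_real (p ^ Suc n / Suc n) * (\<phi> ^ Suc n - 1))"
        by (simp only: distrib_left[symmetric])
    qed (use s \<mu> w real_distribution_uminus in auto)
  qed
  ultimately have "spitzer_exponent \<mu> p w + spitzer_exponent (distr \<mu> borel uminus) p (- w)
      = Ln (1 - of_real p) - Ln (1 - p * \<phi>)" by (simp only: sums_iff)
  moreover have "1 - p * \<phi> \<noteq> 0" using p\<phi> by auto
  ultimately show ?thesis using p by (simp add: exp_diff exp_Ln flip: \<phi>_def of_real_diff)
qed

text \<open>The recursion for the minima, summed with geometric weights, reads M (1 - p phi) = (1 -
  p) K on the imaginary axis, with M living on the right half-plane and K on the left. Writing (1 -
  p) / (1 - p phi) as exp (L + L') separates the two sides: M exp (- L) = K exp L', each bounded in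
  its half-plane. Glued together they form a bounded entire function, constant by Liouville and
  equal to 1 at the origin.\<close>

theorem spitzer:
  assumes \<mu>: "real_distribution \<mu>" and p: "0 < p" "p < 1" and w: "Re w \<ge> 0"
  shows "geometric_min_laplace \<mu> p w = exp (spitzer_exponent \<mu> p w)"
proof -
  define D where "D n = distr (\<mu> \<Otimes>\<^sub>M walk_min_law \<mu> n) borel (\<lambda>z. fst z + snd z)" for n
  have D: "real_distribution (D n)" for n
    unfolding D_def by (intro real_distribution_pair_distr \<mu> real_distribution_walk_min_law) measurable
  define M where "M = geometric_min_laplace \<mu> p"
  define L where "L = spitzer_exponent \<mu> p"
  define L' where "L' z = spitzer_exponent (distr \<mu> borel uminus) p (- z)" for z
  \<comment> \<open>The left half-plane side of the recursion: the leading 1 comes from the empty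
    walk, each further term is the correction made by one truncation at 0.\<close>
  define K where "K z = 1 + (\<Sum>n. of_real (p ^ Suc n) * (1 - pos_laplace (D n) z))" for z
  define B where "B = (\<Sum>n. 2 * (p ^ Suc n / real (Suc n)))"
  have s: "summable (\<lambda>n. 2 * p ^ Suc n)"
    using p by (intro summable_mult summable_Suc_iff[THEN iffD2] summable_geometric) auto
  have b: "norm (of_real (p ^ Suc n) * (1 - pos_laplace (D n) z)) \<le> 2 * p ^ Suc n" if "Re z \<le> 0" for n z
  proof -
    have "norm (1 - pos_laplace (D n) z) \<le> 2"
      using norm_triangle_ineq4[of 1 "pos_laplace (D n) z"] norm_pos_laplace_le[OF D that, of n] by simp
    then have "norm (1 - pos_laplace (D n) z) * p ^ Suc n \<le> 2 * p ^ Suc n"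
      using p by (intro mult_right_mono) auto
    then show ?thesis using p by (simp add: norm_mult norm_power mult_ac)
  qed
  have eq: "M z * exp (- L z) = K z * exp (L' z)" if z: "Re z = 0" for z
  proof -
    define \<phi> where "\<phi> = (\<integral>x. exp (z * of_real x) \<partial>\<mu>)"
    define T where "T n = neg_laplace (walk_min_law \<mu> n) z" for n
    have T: "T (Suc n) = \<phi> * T n + 1 - pos_laplace (D n) z" for n
      unfolding T_def \<phi>_def D_def by (rule walk_min_law_Suc_transform[OF \<mu> z])
    have sT: "summable (\<lambda>n. of_real ((1 - p) * p ^ n) * T n)"
      unfolding T_def by (rule summable_geometric_min_laplace[OF \<mu> p]) (use z in auto)
    have M: "M z = (\<Sum>n. of_real ((1 - p) * p ^ n) * T n)"
      unfolding M_def geometric_min_laplace_def T_def ..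
    have T0: "T 0 = 1" unfolding T_def by (simp add: neg_laplace_def integral_return)
    have "M z = (1 - p) + (\<Sum>n. of_real ((1 - p) * p ^ Suc n) * T (Suc n))"
      unfolding M using suminf_split_head[OF sT] T0 by simp
    also have "(\<Sum>n. of_real ((1 - p) * p ^ Suc n) * T (Suc n))
        = (\<Sum>n. (p * \<phi>) * (of_real ((1 - p) * p ^ n) * T n) + (1 - p) * (of_real (p ^ Suc n) * (1 - pos_laplace (D n) z)))"
      unfolding T by (simp add: algebra_simps)
    also have "\<dots> = p * \<phi> * M z + (1 - p) * (K z - 1)"
    proof (subst suminf_add[symmetric])
      have "summable (\<lambda>n. of_real (p ^ Suc n) * (1 - pos_laplace (D n) z))"
        by (rule summable_norm_cancel, rule summable_comparison_test'[OF s])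
          (use b[of z] z in auto)
      then show "summable (\<lambda>n. (1 - p) * (of_real (p ^ Suc n) * (1 - pos_laplace (D n) z)))"
        and "(\<Sum>n. (p * \<phi>) * (of_real ((1 - p) * p ^ n) * T n)) + (\<Sum>n. (1 - p) * (of_real (p ^ Suc n) * (1 - pos_laplace (D n) z)))
          = p * \<phi> * M z + (1 - p) * (K z - 1)"
        unfolding M K_def using sT by (auto simp: suminf_mult summable_mult simp del: power_Suc)
      show "summable (\<lambda>n. p * \<phi> * (of_real ((1 - p) * p ^ n) * T n))" by (rule summable_mult[OF sT])
    qed
    finally have "M z * (1 - p * \<phi>) = (1 - p) * K z" by (simp add: algebra_simps)
    moreover have e: "exp (L z) * exp (L' z) = (1 - p) / (1 - p * \<phi>)"
      using spitzer_exponent_sum[OF \<mu> p z] by (simp add: exp_add L_def L'_def \<phi>_def)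
    \<comment> \<open>If the denominator were 0, the quotient in \<open>e\<close> would be 0 by the
      convention for division, but a product of exponentials is not 0.\<close>
    moreover have "1 - p * \<phi> \<noteq> 0"
      using e by (metis div_by_0 exp_not_eq_zero mult_eq_0_iff)
    ultimately have "M z = (1 - p) * K z / (1 - p * \<phi>)" by (simp add: nonzero_eq_divide_eq)
    then have "M z = K z * (exp (L z) * exp (L' z))" unfolding e by simp
    then show ?thesis by (simp add: exp_minus)
  qed
  define F where "F z = (if Re z \<ge> 0 then M z * exp (- L z) else K z * exp (L' z))" for z
  note \<mu>' = real_distribution_uminus[OF \<mu>]
  have cK: "continuous_on {z. Re z \<le> 0} K"
    unfolding K_def[abs_def] by (intro continuous_intros continuous_on_suminf_bounded[OF _ b s])
      (auto intro!: continuous_intros continuous_pos_laplace D)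
  have hK: "K holomorphic_on {z. Re z < 0}"
    unfolding K_def[abs_def] by (intro holomorphic_intros holomorphic_on_suminf_bounded[OF _ _ b s])
      (auto intro!: holomorphic_intros holomorphic_pos_laplace D open_halfspace_Re_lt)
  have cL': "continuous_on {z. Re z \<le> 0} L'"
    unfolding L'_def[abs_def]
    by (intro continuous_on_compose2[OF continuous_spitzer_exponent[OF \<mu>' p]] continuous_intros) auto
  have hL': "L' holomorphic_on {z. Re z < 0}"
    unfolding L'_def[abs_def]
    by (intro holomorphic_on_compose_gen[OF _ holomorphic_spitzer_exponent[OF \<mu>' p], unfolded comp_def] holomorphic_intros) auto
  have "F holomorphic_on UNIV"
    unfolding F_def[abs_def]
    by (rule holomorphic_paste_imaginary_axis)
      (use eq cK hK cL' hL' in \<open>auto simp: M_def L_def intro!: holomorphic_intros continuous_intros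
        continuous_geometric_min_laplace holomorphic_geometric_min_laplace
        continuous_spitzer_exponent holomorphic_spitzer_exponent \<mu> p\<close>)
  moreover have "bounded (range F)"
    unfolding bounded_iff
  proof (intro exI ballI)
    fix y assume "y \<in> range F"
    then obtain z where y: "y = F z" by auto
    have e: "norm (exp u) \<le> exp B" if "norm u \<le> B" for u :: complex
      using complex_Re_le_cmod[of u] that by simp
    show "norm y \<le> exp B + (1 + (\<Sum>n. 2 * p ^ Suc n)) * exp B"
    proof (cases "Re z \<ge> 0")
      case True
      have "norm (M z * exp (- L z)) \<le> 1 * exp B"
        unfolding norm_mult M_def L_def B_def
        using norm_geometric_min_laplace_le[OF \<mu> p True] norm_spitzer_exponent_le[OF \<mu> p True]
        by (intro mult_mono e[unfolded B_def]) auto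
      moreover have "0 \<le> (1 + (\<Sum>n. 2 * p ^ Suc n)) * exp B"
        using p s by (intro mult_nonneg_nonneg add_nonneg_nonneg suminf_nonneg) auto
      ultimately show ?thesis using True by (simp add: y F_def)
    next
      case False
      have "norm (K z) \<le> 1 + (\<Sum>n. 2 * p ^ Suc n)"
        unfolding K_def
        by (rule order_trans[OF norm_triangle_ineq])
          (use False norm_suminf_le[OF b[of z] s] in \<open>simp del: power_Suc\<close>)
      moreover have "norm (exp (L' z)) \<le> exp B"
        unfolding L'_def B_def
        by (intro e[unfolded B_def] norm_spitzer_exponent_le[OF \<mu>' p]) (use False in auto)
      ultimately have "norm (K z * exp (L' z)) \<le> (1 + (\<Sum>n. 2 * p ^ Suc n)) * exp B"
        unfolding norm_mult by (intro mult_mono) (auto intro: order_trans[OF norm_ge_zero])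
      then show ?thesis using False by (simp add: y F_def add_increasing)
    qed
  qed
  ultimately obtain c where c: "\<And>z. F z = c" using Liouville_theorem unfolding constant_on_def by blast
  have "F 0 = 1" unfolding F_def M_def L_def
    by (simp add: geometric_min_laplace_0[OF \<mu> p] spitzer_exponent_0[OF \<mu> p])
  then have "F w = 1" using c by metis
  then have "M w * exp (- L w) = 1" using w by (simp add: F_def)
  then show ?thesis unfolding M_def L_def by (simp add: exp_minus field_simps)
qed

corollary geometric_min_laplace_factorisation:
  assumes \<mu>: "real_distribution \<mu>" and p: "0 < p" "p < 1" and w: "Re w = 0"
  shows "geometric_min_laplace \<mu> p w * geometric_min_laplace (distr \<mu> borel uminus) p (- w)
    = (1 - p) / (1 - p * (\<integral>x. exp (w * of_real x) \<partial>\<mu>))"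
  using spitzer[OF \<mu> p, of w] spitzer[OF real_distribution_uminus[OF \<mu>] p, of "- w"]
    spitzer_exponent_sum[OF assms] w by (simp add: exp_add)

text \<open>The exponents are compared term by term with \<open>norm_exp_minus_one_le\<close>. At
  the real point |w| every term of the exponent is real and nonpositive, so the norms of the terms
  at w sum to at most -4 times the exponent at |w|; exponentiating gives the fourth power.\<close>

corollary geometric_min_laplace_lower_bound:
  assumes \<mu>: "real_distribution \<mu>" and p: "0 < p" "p < 1" and w: "Re w \<ge> 0"
  shows "norm (geometric_min_laplace \<mu> p w) \<ge> norm (geometric_min_laplace \<mu> p (of_real (norm w))) ^ 4"
proof -
  note Q = real_distribution_walk_law[OF \<mu>]
  define A where "A u n = of_real (p ^ Suc n / Suc n) * (neg_laplace (walk_law \<mu> (Suc n)) u - 1)" for u n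
  have s: "summable (\<lambda>n. norm (A u n))" if "Re u \<ge> 0" for u
    unfolding A_def
    by (rule summable_comparison_test'[OF summable_geometric_over[OF \<mu> p]])
      (unfold real_norm_def abs_norm_cancel, rule spitzer_term_bound[OF \<mu> p norm_neg_laplace_le[OF Q that]])
  have L: "spitzer_exponent \<mu> p u = (\<Sum>n. A u n)" for u
    unfolding spitzer_exponent_def A_def ..
  have b: "norm (A w n) \<le> 4 * Re (- A (of_real (norm w)) n)" for n
  proof -
    interpret Q: real_distribution "walk_law \<mu> (Suc n)" by (rule Q)
    have i: "integrable (walk_law \<mu> (Suc n)) (\<lambda>x. exp (w * complex_of_real (min x 0)))"
      by (rule Q.integrable_laplace_nonpos) (use w in auto)
    have ir: "integrable (walk_law \<mu> (Suc n)) (\<lambda>x. exp (norm w * min x 0))"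
      by (rule Q.integrable_const_bound[where B=1]) (auto simp: mult_nonneg_nonpos)
    have "norm (neg_laplace (walk_law \<mu> (Suc n)) w - 1)
        = norm (\<integral>x. exp (w * complex_of_real (min x 0)) - 1 \<partial>walk_law \<mu> (Suc n))"
      unfolding neg_laplace_def using i Q.prob_space by (simp del: walk_law.simps)
    also have "\<dots> \<le> (\<integral>x. norm (exp (w * complex_of_real (min x 0)) - 1) \<partial>walk_law \<mu> (Suc n))"
      by (rule integral_norm_bound)
    also have "\<dots> \<le> (\<integral>x. 4 * (1 - exp (norm w * min x 0)) \<partial>walk_law \<mu> (Suc n))"
      by (rule integral_mono)
        (use i ir norm_exp_minus_one_le[OF w] in \<open>auto intro!: integrable_norm simp del: walk_law.simps\<close>)
    also have "\<dots> = 4 * Re (1 - neg_laplace (walk_law \<mu> (Suc n)) (of_real (norm w)))"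
      unfolding neg_laplace_of_real using ir Q.prob_space by (simp del: walk_law.simps)
    finally have "p ^ Suc n / Suc n * norm (neg_laplace (walk_law \<mu> (Suc n)) w - 1)
        \<le> p ^ Suc n / Suc n * (4 * Re (1 - neg_laplace (walk_law \<mu> (Suc n)) (of_real (norm w))))"
      using p by (intro mult_left_mono) auto
    moreover have "norm (A w n) = p ^ Suc n / Suc n * norm (neg_laplace (walk_law \<mu> (Suc n)) w - 1)"
      unfolding A_def norm_mult norm_of_real using p by simp
    moreover have "4 * Re (- A (of_real (norm w)) n)
        = p ^ Suc n / Suc n * (4 * Re (1 - neg_laplace (walk_law \<mu> (Suc n)) (of_real (norm w))))"
      by (simp add: A_def algebra_simps del: of_nat_Suc walk_law.simps power_Suc of_real_power of_real_divide)
    ultimately show ?thesis by simp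
  qed
  have w': "Re (complex_of_real (norm w)) \<ge> 0" by simp
  have sr: "summable (\<lambda>n. Re (- A (of_real (norm w)) n))"
    using summable_Re[OF summable_minus[OF summable_norm_cancel[OF s[OF w']]]] .
  have "norm (\<Sum>n. A w n) \<le> (\<Sum>n. 4 * Re (- A (of_real (norm w)) n))"
    by (rule norm_suminf_le[OF b summable_mult[OF sr]])
  also have "\<dots> = - 4 * Re (\<Sum>n. A (of_real (norm w)) n)"
    using suminf_mult[OF sr, of 4] Re_suminf[OF summable_minus[OF summable_norm_cancel[OF s[OF w']]]]
      suminf_minus[OF summable_norm_cancel[OF s[OF w']]]
    by simp
  finally have "4 * Re (spitzer_exponent \<mu> p (of_real (norm w))) \<le> Re (spitzer_exponent \<mu> p w)"
    unfolding L using abs_Re_le_cmod[of "\<Sum>n. A w n"] by linarith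
  then have "exp (4 * Re (spitzer_exponent \<mu> p (of_real (norm w)))) \<le> exp (Re (spitzer_exponent \<mu> p w))"
    by simp
  then show ?thesis
    unfolding spitzer[OF \<mu> p w] spitzer[OF \<mu> p w'] norm_exp_eq_Re by (simp add: exp_of_nat_mult[symmetric])
qed

section \<open>Killed Levy processes on a grid\<close>

text \<open>Pathwise counterpart of \<open>walk_min_law\<close>. It takes the sequence of increments
  and has the same first-step recursion, so that the two can be matched by induction.\<close>

primrec run_min :: "nat \<Rightarrow> (nat \<Rightarrow> real) \<Rightarrow> real" where
  "run_min 0 x = 0"
| "run_min (Suc n) x = min 0 (x 0 + run_min n (\<lambda>i. x (Suc i)))"

lemma run_min_eq_Min: "run_min n (\<lambda>i. s (Suc i) - s i) = Min ((\<lambda>j. s j - s 0) ` {..n})"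
proof (induction n arbitrary: s)
  case (Suc n)
  have "Min ((\<lambda>j. s j - s 0) ` {..Suc n}) = Min (insert 0 ((\<lambda>j. s (Suc j) - s 0) ` {..n}))"
    unfolding atMost_Suc_eq_insert_0 by (simp add: image_image)
  also have "\<dots> = min 0 (Min ((\<lambda>j. s (Suc j) - s 0) ` {..n}))"
    by (subst Min_insert) auto
  also have "(\<lambda>j. s (Suc j) - s 0) = (\<lambda>j. (s (Suc j) - s 1) + (s 1 - s 0))" by auto
  also have "Min (\<dots> ` {..n}) = Min ((\<lambda>j. s (Suc j) - s 1) ` {..n}) + (s 1 - s 0)"
    by (rule Min_add_commute) auto
  also have "Min ((\<lambda>j. s (Suc j) - s 1) ` {..n}) = run_min n (\<lambda>i. s (Suc (Suc i)) - s (Suc i))"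
    using Suc[of "\<lambda>i. s (Suc i)"] by simp
  finally show ?case by (simp add: add.commute)
qed simp

lemma run_min_cong: "(\<And>i. i < n \<Longrightarrow> x i = y i) \<Longrightarrow> run_min n x = run_min n y"
proof (induction n arbitrary: x y)
  case (Suc n)
  have "run_min n (\<lambda>i. x (Suc i)) = run_min n (\<lambda>i. y (Suc i))" by (rule Suc.IH) (use Suc.prems in auto)
  then show ?case using Suc.prems[of 0] by simp
qed simp

lemma run_min_nonpos: "run_min n x \<le> 0"
  by (cases n) auto

lemma measurable_run_min:
  assumes "\<And>i. i < n \<Longrightarrow> X i \<in> borel_measurable M"
  shows "(\<lambda>\<omega>. run_min n (\<lambda>i. X i \<omega>)) \<in> borel_measurable M"
  using assms
proof (induction n arbitrary: X)
  case (Suc n)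
  have [measurable]: "X 0 \<in> borel_measurable M" using Suc.prems by simp
  have [measurable]: "(\<lambda>\<omega>. run_min n (\<lambda>i. X (Suc i) \<omega>)) \<in> borel_measurable M"
    by (rule Suc.IH) (use Suc.prems in auto)
  show ?case by simp
qed simp

text \<open>The shift \<open>k\<close> serves the induction: once the first step is split off, the
  remaining minimum starts one index later. Independence of that step from the block of later ones
  turns the joint law into the product measure in \<open>walk_min_law\<close>.\<close>

lemma (in prob_space) distr_run_min:
  assumes ind: "\<And>n. indep_vars (\<lambda>_. borel) X {..<n}"
    and law: "\<And>i. distr M borel (X i) = \<mu>"
  shows "distr M borel (\<lambda>\<omega>. run_min n (\<lambda>i. X (i + k) \<omega>)) = walk_min_law \<mu> n"
proof (induction n arbitrary: k)
  case 0
  show ?case by (simp add: measure_eqI_finite distr_const)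
next
  case (Suc n)
  have rv [measurable]: "X i \<in> borel_measurable M" for i
    using ind[of "Suc i"] unfolding indep_vars_def by auto
  let ?R = "\<lambda>\<omega>. run_min n (\<lambda>i. X (i + Suc k) \<omega>)"
  let ?I = "{Suc k..<Suc k + n}"
  have [measurable]: "?R \<in> borel_measurable M" "(\<lambda>\<omega>. run_min n (\<lambda>i. X (Suc (i + k)) \<omega>)) \<in> borel_measurable M"
    by (rule measurable_run_min; simp)+
  have "indep_var borel ((\<lambda>f. f k) \<circ> (\<lambda>\<omega>. restrict (\<lambda>i. X i \<omega>) {k}))
      borel ((\<lambda>f. run_min n (\<lambda>i. f (i + Suc k))) \<circ> (\<lambda>\<omega>. restrict (\<lambda>i. X i \<omega>) ?I))"
    by (intro indep_var_compose[OF indep_var_restrict[OF ind[of "Suc k + n"]]] measurable_run_min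
        measurable_component_singleton) auto
  also have "(\<lambda>f. f k) \<circ> (\<lambda>\<omega>. restrict (\<lambda>i. X i \<omega>) {k}) = X k" by auto
  also have "(\<lambda>f. run_min n (\<lambda>i. f (i + Suc k))) \<circ> (\<lambda>\<omega>. restrict (\<lambda>i. X i \<omega>) ?I) = ?R"
    by (auto simp: fun_eq_iff intro!: run_min_cong)
  finally have "distr M borel (X k) \<Otimes>\<^sub>M distr M borel ?R = distr M (borel \<Otimes>\<^sub>M borel) (\<lambda>\<omega>. (X k \<omega>, ?R \<omega>))"
    by (simp add: indep_var_distribution_eq)
  then have eq: "\<mu> \<Otimes>\<^sub>M walk_min_law \<mu> n = distr M (borel \<Otimes>\<^sub>M borel) (\<lambda>\<omega>. (X k \<omega>, ?R \<omega>))"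
    using law Suc.IH[of "Suc k"] by simp
  show ?case unfolding walk_min_law.simps eq
    by (subst distr_distr) (auto simp: comp_def)
qed

section \<open>Dyadic times and cadlag paths\<close>

lemma dyadic_right_dense:
  assumes "0 \<le> s" "0 < d"
  shows "\<exists>N. \<forall>m\<ge>N. \<exists>j::nat. s < real j / 2 ^ m \<and> real j / 2 ^ m < s + d"
proof -
  obtain N where N: "(1 / 2) ^ N < d" using real_arch_pow_inv[OF assms(2), of "1/2"] by auto
  show ?thesis
  proof (rule exI[of _ N], intro allI impI)
    fix m assume m: "m \<ge> N"
    have "(1 / 2 :: real) ^ m \<le> (1 / 2) ^ N" using m by (intro power_decreasing) auto
    then have a: "1 / 2 ^ m < d" using N by (simp add: power_one_over)
    \<comment> \<open>The first point strictly to the right of s on the grid of mesh 2^(-m).\<close>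
    define j where "j = nat \<lfloor>s * 2 ^ m\<rfloor> + 1"
    have j: "real j = of_int \<lfloor>s * 2 ^ m\<rfloor> + 1" using assms by (simp add: j_def)
    have "s * 2 ^ m < real j" "real j \<le> s * 2 ^ m + 1" unfolding j by linarith+
    then have "s < real j / 2 ^ m" "real j / 2 ^ m \<le> s + 1 / 2 ^ m"
      by (simp_all add: field_simps)
    then show "\<exists>j::nat. s < real j / 2 ^ m \<and> real j / 2 ^ m < s + d" using a by (intro exI[of _ j] conjI) linarith+
  qed
qed

lemma right_continuous_below_near:
  fixes f :: "real \<Rightarrow> real" and a :: ereal
  assumes "continuous (at_right s) f" "f s < z" "ereal s < a"
  shows "\<exists>d>0. \<forall>u. s < u \<longrightarrow> u < s + d \<longrightarrow> f u < z \<and> ereal u < a"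
proof -
  have "eventually (\<lambda>u. f u < z) (at_right s)"
    using assms(1,2) unfolding continuous_within by (rule order_tendstoD)
  moreover have "eventually (\<lambda>u. ereal u < a) (at_right s)"
  proof -
    have "((\<lambda>u. ereal u) \<longlongrightarrow> ereal s) (at_right s)" by (intro tendsto_intros)
    then show ?thesis using assms(3) by (rule order_tendstoD)
  qed
  ultimately have "eventually (\<lambda>u. f u < z \<and> ereal u < a) (at_right s)" by eventually_elim auto
  then obtain b where "b > s" "\<forall>y>s. y < b \<longrightarrow> f y < z \<and> ereal y < a"
    by (auto simp: eventually_at_right_field)
  then show ?thesis by (intro exI[of _ "b - s"]) auto
qed

definition dyadics :: "real set" where
  "dyadics = (\<lambda>(j, m). real j / 2 ^ m) ` (UNIV :: (nat \<times> nat) set)"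

lemma countable_dyadics: "countable dyadics"
  unfolding dyadics_def by auto

lemma dyadic_mem: "real j / 2 ^ m \<in> dyadics"
  unfolding dyadics_def by (rule image_eqI[where x="(j, m)"]) auto

lemma dyadics_nonneg: "s \<in> dyadics \<Longrightarrow> s \<ge> 0"
  unfolding dyadics_def by auto

text \<open>A value below z persists on a short interval to the right, still before
  \<open>a\<close>, and such an interval contains a dyadic point. Lower bounds over all times are
  therefore decided at countably many of them, which is what makes infima of paths
  measurable.\<close>

lemma right_continuous_lower_bound_dyadics:
  fixes f :: "real \<Rightarrow> real" and a :: ereal
  assumes rc: "\<And>t. 0 \<le> t \<Longrightarrow> continuous (at_right t) f"
  shows "(\<forall>s. 0 \<le> s \<longrightarrow> ereal s < a \<longrightarrow> z \<le> f s) \<longleftrightarrow> (\<forall>s\<in>dyadics. ereal s < a \<longrightarrow> z \<le> f s)"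
proof (intro iffI allI impI ballI)
  fix s assume h: "\<forall>s\<in>dyadics. ereal s < a \<longrightarrow> z \<le> f s" and s: "0 \<le> s" "ereal s < a"
  show "z \<le> f s"
  proof (rule ccontr)
    assume "\<not> z \<le> f s"
    then obtain d where d: "d > 0" "\<And>u. s < u \<Longrightarrow> u < s + d \<Longrightarrow> f u < z \<and> ereal u < a"
      using right_continuous_below_near[OF rc[OF s(1)] _ s(2), of z] by auto
    obtain N where "\<forall>m\<ge>N. \<exists>j::nat. s < real j / 2 ^ m \<and> real j / 2 ^ m < s + d"
      using dyadic_right_dense[OF s(1) d(1)] by auto
    then obtain j :: nat where "s < real j / 2 ^ N" "real j / 2 ^ N < s + d" by blast
    then show False using d(2) h dyadic_mem[of j N] by force
  qed
qed (use dyadics_nonneg in auto)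

text \<open>The infimum of reals is defined through the bounds of the set alone. The equality
  therefore extends to empty sets and to sets unbounded below, where the infimum is a default
  value.\<close>

lemma real_Inf_cong_bounds:
  fixes A B :: "real set"
  assumes "\<And>z. (\<forall>x\<in>A. z \<le> x) \<longleftrightarrow> (\<forall>x\<in>B. z \<le> x)"
  shows "Inf A = Inf B"
proof -
  have "(\<forall>x\<in>uminus ` A. x \<le> z) \<longleftrightarrow> (\<forall>x\<in>uminus ` B. x \<le> z)" for z :: real
    using assms[of "- z"] by (auto simp: minus_le_iff)
  then show ?thesis unfolding Inf_real_def Sup_real_def by simp
qed

text \<open>Right continuity and left limits bound the path near each point, and a finite subcover
  of the interval makes the bound uniform.\<close>

lemma cadlag_bounded:
  fixes f :: "real \<Rightarrow> real"
  assumes rc: "\<And>t. 0 \<le> t \<Longrightarrow> continuous (at_right t) f"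
    and ll: "\<And>t. 0 < t \<Longrightarrow> \<exists>l. (f \<longlongrightarrow> l) (at_left t)"
  shows "\<exists>B. \<forall>s\<in>{0..T}. \<bar>f s\<bar> \<le> B"
proof -
  have loc: "\<exists>d>0. \<exists>B. \<forall>s\<ge>0. \<bar>s - t\<bar> < d \<longrightarrow> \<bar>f s\<bar> \<le> B" if t: "t \<ge> 0" for t
  proof -
    have "eventually (\<lambda>u. dist (f u) (f t) < 1) (at_right t)"
      using rc[OF t] unfolding continuous_within by (rule tendstoD) simp
    then obtain b where b: "b > t" "\<And>u. t < u \<Longrightarrow> u < b \<Longrightarrow> \<bar>f u\<bar> \<le> \<bar>f t\<bar> + 1"
      unfolding eventually_at_right_field dist_real_def by fastforce
    have "\<exists>c<t. \<exists>B. \<forall>u\<ge>0. c < u \<longrightarrow> u < t \<longrightarrow> \<bar>f u\<bar> \<le> B"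
    proof (cases "t = 0")
      \<comment> \<open>There is no left limit at 0. No nonnegative time lies to the left of 0
        either, so any \<open>c < 0\<close> serves.\<close>
      case True
      then show ?thesis by (intro exI[of _ "-1"]) auto
    next
      case False
      then obtain l where "(f \<longlongrightarrow> l) (at_left t)" using ll t by fastforce
      then have "eventually (\<lambda>u. dist (f u) l < 1) (at_left t)" by (rule tendstoD) simp
      then obtain c where "c < t" "\<And>u. c < u \<Longrightarrow> u < t \<Longrightarrow> \<bar>f u\<bar> \<le> \<bar>l\<bar> + 1"
        unfolding eventually_at_left_field dist_real_def by fastforce
      then show ?thesis by (intro exI[of _ c] conjI exI[of _ "\<bar>l\<bar> + 1"]) auto
    qed
    then obtain c B where c: "c < t" "\<And>u. u \<ge> 0 \<Longrightarrow> c < u \<Longrightarrow> u < t \<Longrightarrow> \<bar>f u\<bar> \<le> B" by auto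
    show ?thesis
    proof (rule exI[of _ "min (b - t) (t - c)"], intro conjI, goal_cases)
      case 2
      show ?case
      proof (rule exI[of _ "max B (\<bar>f t\<bar> + 1)"], intro allI impI)
      fix s assume s: "s \<ge> 0" "\<bar>s - t\<bar> < min (b - t) (t - c)"
      show "\<bar>f s\<bar> \<le> max B (\<bar>f t\<bar> + 1)"
        using b(2)[of s] c(2)[of s] s by (cases s t rule: linorder_cases) auto
      qed
    qed (use b c in auto)
  qed
  then obtain d B where d: "\<And>t. t \<ge> 0 \<Longrightarrow> d t > 0"
    and B: "\<And>t s. t \<ge> 0 \<Longrightarrow> s \<ge> 0 \<Longrightarrow> \<bar>s - t\<bar> < d t \<Longrightarrow> \<bar>f s\<bar> \<le> B t" by metis
  have "{0..T} \<subseteq> (\<Union>t\<in>{0..T}. ball t (d t))"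
    using d by force
  then obtain C where C: "C \<subseteq> {0..T}" "finite C" "{0..T} \<subseteq> (\<Union>t\<in>C. ball t (d t))"
    by (rule compactE_image[OF compact_Icc, rotated]) auto
  show ?thesis
  proof (intro exI[of _ "\<Sum>t\<in>C. \<bar>B t\<bar>"] ballI)
    fix s assume s: "s \<in> {0..T}"
    then obtain t where t: "t \<in> C" "\<bar>s - t\<bar> < d t" using C(3) by (force simp: dist_real_def abs_minus_commute)
    have "\<bar>f s\<bar> \<le> \<bar>B t\<bar>" using B[of t s] t C(1) s by force
    also have "\<dots> \<le> (\<Sum>t\<in>C. \<bar>B t\<bar>)" using t C by (intro member_le_sum) auto
    finally show "\<bar>f s\<bar> \<le> (\<Sum>t\<in>C. \<bar>B t\<bar>)" .
  qed
qed

lemma (in prob_space) integral_indicator_complex: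
  assumes "A \<in> events"
  shows "(\<integral>\<omega>. indicator A \<omega> \<partial>M) = complex_of_real (prob A)"
proof -
  have "(\<integral>\<omega>. indicator A \<omega> \<partial>M) = (\<integral>\<omega>. complex_of_real (indicator A \<omega>) \<partial>M)"
    by (rule Bochner_Integration.integral_cong) (auto simp: indicator_def)
  also have "\<dots> = complex_of_real (prob A)" using assms by (subst integral_complex_of_real) simp
  finally show ?thesis .
qed

lemma levy_process_uminus:
  assumes "levy_process M X"
  shows "levy_process M (\<lambda>t \<omega>. - X t \<omega>)"
proof -
  interpret levy_process M X by fact
  note measurable_process[measurable]
  show ?thesis
  proof
    show "indep_vars (\<lambda>_. borel) (\<lambda>i \<omega>. - X (t (Suc i)) \<omega> - - X (t i) \<omega>) {..<n}"
      if "0 \<le> t 0" "mono t" for t :: "nat \<Rightarrow> real" and n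
    proof -
      have "indep_vars (\<lambda>_. borel) (\<lambda>i. uminus \<circ> (\<lambda>\<omega>. X (t (Suc i)) \<omega> - X (t i) \<omega>)) {..<n}"
        by (rule indep_vars_compose[OF indep_increments[OF that]]) auto
      then show ?thesis by (simp add: comp_def)
    qed
    show "distr M borel (\<lambda>\<omega>. - X (s + h) \<omega> - - X s \<omega>) = distr M borel (\<lambda>\<omega>. - X h \<omega>)"
      if "0 \<le> s" "0 \<le> h" for s h
    proof -
      have "distr (distr M borel (\<lambda>\<omega>. X (s + h) \<omega> - X s \<omega>)) borel uminus = distr (distr M borel (X h)) borel uminus"
        using stationary_increments[OF that] by simp
      then show ?thesis using that by (simp add: distr_distr comp_def)
    qed
    show "\<exists>l. ((\<lambda>s. - X s \<omega>) \<longlongrightarrow> l) (at_left t)" if "\<omega> \<in> space M" "0 < t" for \<omega> t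
      using left_limits[OF that] by (auto intro: tendsto_minus)
  qed (use start_zero right_continuous in \<open>auto intro!: continuous_intros\<close>)
qed

section \<open>Path functionals and the independent lifetime\<close>

context killed_levy_process
begin

text \<open>The sigma-algebra of the path is kept apart from \<open>M\<close>: the lifetime is
  independent of it, so a functional of the path must be shown measurable here and not only with
  respect to \<open>M\<close>.\<close>

definition path_algebra :: "'a measure" where
  "path_algebra = vimage_algebra (space M) (\<lambda>\<omega>. \<lambda>t\<in>{0..}. \<xi> t \<omega>) (\<Pi>\<^sub>M t\<in>{0..}. borel)"

lemma space_path_algebra [simp]: "space path_algebra = space M"
  by (simp add: path_algebra_def)

lemma measurable_path_algebra: "0 \<le> t \<Longrightarrow> \<xi> t \<in> borel_measurable path_algebra"
proof -
  assume t: "0 \<le> t"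
  have "(\<lambda>\<omega>. \<lambda>t\<in>{0..}. \<xi> t \<omega>) \<in> measurable path_algebra (\<Pi>\<^sub>M t\<in>{0..}. borel)"
    unfolding path_algebra_def by (rule measurable_vimage_algebra1) (auto simp: space_PiM)
  then have "(\<lambda>\<omega>. (\<lambda>t\<in>{0..}. \<xi> t \<omega>) t) \<in> borel_measurable path_algebra"
    by (rule measurable_compose[OF _ measurable_component_singleton]) (use t in auto)
  then show ?thesis using t by simp
qed

lemma indep_path_lifetime:
  assumes X: "X \<in> measurable path_algebra A" "X \<in> measurable M A" and g: "g \<in> measurable borel B"
  shows "indep_var A X B (\<lambda>\<omega>. g (\<zeta> \<omega>))"
  unfolding indep_var_eq
proof (intro conjI)
  note lifetime_measurable[measurable] g[measurable]
  show "random_variable A X" by fact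
  show "random_variable B (\<lambda>\<omega>. g (\<zeta> \<omega>))" by measurable
  have *: "sigma_sets (space M) {X -` S \<inter> space M |S. S \<in> sets A} \<subseteq> sets path_algebra"
  proof -
    have "{X -` S \<inter> space M |S. S \<in> sets A} \<subseteq> sets path_algebra"
      using measurable_sets[OF X(1)] by auto
    then show ?thesis using sets.sigma_sets_subset[of _ path_algebra] by simp
  qed
  have **: "sigma_sets (space M) {(\<lambda>\<omega>. g (\<zeta> \<omega>)) -` S \<inter> space M |S. S \<in> sets B}
      \<subseteq> sets (vimage_algebra (space M) \<zeta> borel)"
  proof -
    have "\<zeta> \<in> measurable (vimage_algebra (space M) \<zeta> borel) borel"
      by (rule measurable_vimage_algebra1) auto
    then have "(\<lambda>\<omega>. g (\<zeta> \<omega>)) \<in> measurable (vimage_algebra (space M) \<zeta> borel) B"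
      by (rule measurable_compose[OF _ g])
    from measurable_sets[OF this]
    have "{(\<lambda>\<omega>. g (\<zeta> \<omega>)) -` S \<inter> space M |S. S \<in> sets B} \<subseteq> sets (vimage_algebra (space M) \<zeta> borel)"
      by auto
    then show ?thesis using sets.sigma_sets_subset[of _ "vimage_algebra (space M) \<zeta> borel"] by simp
  qed
  show "indep_set (sigma_sets (space M) {X -` S \<inter> space M |S. S \<in> sets A})
      (sigma_sets (space M) {(\<lambda>\<omega>. g (\<zeta> \<omega>)) -` S \<inter> space M |S. S \<in> sets B})"
    unfolding indep_set_def
    by (rule indep_sets_mono_sets[OF lifetime_indep[unfolded indep_set_def]])
      (use * ** in \<open>auto simp: path_algebra_def split: bool.splits\<close>)
qed

lemma killed_levy_process_uminus: "killed_levy_process M q (\<lambda>t \<omega>. - \<xi> t \<omega>) \<zeta>"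
proof -
  interpret neg: levy_process M "\<lambda>t \<omega>. - \<xi> t \<omega>" by (rule levy_process_uminus) unfold_locales
  show ?thesis
  proof
    have "(\<lambda>\<omega>. \<lambda>t\<in>{0..}. - \<xi> t \<omega>) \<in> measurable path_algebra (\<Pi>\<^sub>M t\<in>{0..}. borel)"
      by (intro measurable_restrict borel_measurable_uminus measurable_path_algebra) auto
    from measurable_sets[OF this]
    have "{(\<lambda>\<omega>. \<lambda>t\<in>{0..}. - \<xi> t \<omega>) -` A \<inter> space M |A. A \<in> sets (\<Pi>\<^sub>M t\<in>{0..}. borel)} \<subseteq> sets path_algebra"
      by auto
    then have "sets (vimage_algebra (space M) (\<lambda>\<omega>. \<lambda>t\<in>{0..}. - \<xi> t \<omega>) (\<Pi>\<^sub>M t\<in>{0..}. borel)) \<subseteq> sets path_algebra"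
      using sets.sigma_sets_subset[of _ path_algebra] by (simp add: sets_vimage_algebra)
    then show "indep_set (sets (vimage_algebra (space M) (\<lambda>\<omega>. \<lambda>t\<in>{0..}. - \<xi> t \<omega>) (\<Pi>\<^sub>M t\<in>{0..}. borel)))
        (sets (vimage_algebra (space M) \<zeta> borel))"
      unfolding indep_set_def
      by (intro indep_sets_mono_sets[OF lifetime_indep[unfolded indep_set_def]])
        (auto simp: path_algebra_def split: bool.splits)
  qed (use rate_nonneg lifetime_measurable lifetime_exponential in auto)
qed

lemma AE_lifetime_pos: "AE \<omega> in M. 0 < \<zeta> \<omega>"
proof -
  note lifetime_measurable[measurable]
  have "prob {\<omega> \<in> space M. ereal 0 < \<zeta> \<omega>} = 1" using lifetime_exponential[of 0] by simp
  then show ?thesis by (simp add: prob_Collect_eq_1 zero_ereal_def)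
qed

end

text \<open>At a positive rate the lifetime is almost surely finite, so the infimum runs over a
  bounded stretch of a cadlag path. For the Lamperti process the rate turns out to be cm /
  \<alpha>.\<close>

locale strictly_killed_levy_process = killed_levy_process +
  assumes rate_pos: "0 < q"
begin

lemma strictly_killed_uminus: "strictly_killed_levy_process M q (\<lambda>t \<omega>. - \<xi> t \<omega>) \<zeta>"
  using killed_levy_process_uminus rate_pos
  by (simp add: strictly_killed_levy_process_def strictly_killed_levy_process_axioms_def)

lemma AE_lifetime_finite: "AE \<omega> in M. \<zeta> \<omega> < \<infinity>"
proof -
  note lifetime_measurable[measurable]
  have "prob {\<omega> \<in> space M. \<zeta> \<omega> = \<infinity>} \<le> exp (- q * real n)" for n
  proof -
    have "prob {\<omega> \<in> space M. \<zeta> \<omega> = \<infinity>} \<le> prob {\<omega> \<in> space M. ereal (real n) < \<zeta> \<omega>}"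
      by (rule finite_measure_mono) auto
    then show ?thesis using lifetime_exponential[of "real n"] by simp
  qed
  moreover have "(\<lambda>n. exp (- q * real n)) \<longlonglongrightarrow> 0" using rate_pos by real_asymp
  ultimately have "prob {\<omega> \<in> space M. \<zeta> \<omega> = \<infinity>} \<le> 0"
    by (intro LIMSEQ_le_const) auto
  then have "prob {\<omega> \<in> space M. \<zeta> \<omega> = \<infinity>} = 0" by (simp add: measure_le_0_iff)
  then show ?thesis by (subst (asm) prob_Collect_eq_0) auto
qed

text \<open>For a positive finite lifetime this is the index of the last grid point strictly before
  it: n h < \<zeta> \<le> (n + 1) h. It is geometric and starts at 0, with weight 1 - exp (- q h)
  there.\<close>

definition grid_life :: "real \<Rightarrow> 'a \<Rightarrow> nat" where
  "grid_life h \<omega> = (LEAST n. \<zeta> \<omega> \<le> ereal (real (Suc n) * h))"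

definition grid_inf :: "real \<Rightarrow> 'a \<Rightarrow> real" where
  "grid_inf h \<omega> = run_min (grid_life h \<omega>) (\<lambda>i. \<xi> (real (Suc i) * h) \<omega> - \<xi> (real i * h) \<omega>)"

lemma measurable_grid_life [measurable]: "grid_life h \<in> measurable M (count_space UNIV)"
  unfolding grid_life_def using lifetime_measurable by measurable

lemma le_grid_life_iff:
  assumes h: "h > 0" and z: "0 < \<zeta> \<omega>" "\<zeta> \<omega> < \<infinity>"
  shows "j \<le> grid_life h \<omega> \<longleftrightarrow> ereal (real j * h) < \<zeta> \<omega>"
proof -
  obtain r where r: "\<zeta> \<omega> = ereal r" "r > 0" using z by (cases "\<zeta> \<omega>") auto
  obtain n :: nat where n: "r / h < real n" using reals_Archimedean2 by blast
  have "\<zeta> \<omega> \<le> ereal (real (Suc n) * h)"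
    using n h r by (simp add: field_simps)
  then have ex: "\<zeta> \<omega> \<le> ereal (real (Suc (grid_life h \<omega>)) * h)" unfolding grid_life_def by (rule LeastI)
  show ?thesis
  proof
    assume j: "j \<le> grid_life h \<omega>"
    show "ereal (real j * h) < \<zeta> \<omega>"
    proof (cases j)
      case 0
      then show ?thesis using z by (simp flip: zero_ereal_def)
    next
      case (Suc i)
      then have "i < grid_life h \<omega>" using j by simp
      then have "\<not> \<zeta> \<omega> \<le> ereal (real (Suc i) * h)" unfolding grid_life_def by (rule not_less_Least)
      then show ?thesis using Suc by simp
    qed
  next
    assume "ereal (real j * h) < \<zeta> \<omega>"
    then have "ereal (real j * h) < ereal (real (Suc (grid_life h \<omega>)) * h)" using ex by (rule less_le_trans)
    then have "real j * h < real (Suc (grid_life h \<omega>)) * h" by (simp only: less_ereal.simps)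
    then show "j \<le> grid_life h \<omega>" using h by simp
  qed
qed

lemma prob_grid_life:
  assumes h: "h > 0"
  shows "prob {\<omega> \<in> space M. grid_life h \<omega> = n} = (1 - exp (- q * h)) * exp (- q * h) ^ n"
proof -
  note lifetime_measurable[measurable]
  let ?A = "\<lambda>j::nat. {\<omega> \<in> space M. ereal (real j * h) < \<zeta> \<omega>}"
  have P: "prob (?A j) = exp (- q * h) ^ j" for j
    using lifetime_exponential[of "real j * h"] h by (simp add: exp_of_nat_mult[symmetric] mult_ac)
  have "prob {\<omega> \<in> space M. grid_life h \<omega> = n} = prob (?A n - ?A (Suc n))"
  proof (rule finite_measure_eq_AE)
    show "AE \<omega> in M. (\<omega> \<in> {\<omega> \<in> space M. grid_life h \<omega> = n}) = (\<omega> \<in> ?A n - ?A (Suc n))"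
      using AE_lifetime_pos AE_lifetime_finite
    proof eventually_elim
      case (elim \<omega>)
      note * = le_grid_life_iff[OF h elim]
      show ?case using *[of n] *[of "Suc n"] by auto
    qed
  qed measurable
  also have "\<dots> = prob (?A n) - prob (?A (Suc n))"
  proof (rule finite_measure_Diff)
    have "ereal (real n * h) \<le> ereal (real (Suc n) * h)" using h by simp
    then show "?A (Suc n) \<subseteq> ?A n" using le_less_trans by blast
  qed measurable
  finally show ?thesis unfolding P by (simp add: algebra_simps)
qed

lemma grid_steps_indep:
  assumes "h > 0"
  shows "indep_vars (\<lambda>_. borel) (\<lambda>i \<omega>. \<xi> (real (Suc i) * h) \<omega> - \<xi> (real i * h) \<omega>) {..<n}"
  using indep_increments[of "\<lambda>i. real i * h" n] assms by (auto simp: mono_def intro: mult_right_mono)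

lemma grid_steps_law:
  assumes "h > 0"
  shows "distr M borel (\<lambda>\<omega>. \<xi> (real (Suc i) * h) \<omega> - \<xi> (real i * h) \<omega>) = distr M borel (\<xi> h)"
  using stationary_increments[of "real i * h" h] assms by (simp add: algebra_simps)

lemma measurable_grid_run_min:
  assumes h: "h > 0" and M': "\<And>t. t \<ge> 0 \<Longrightarrow> \<xi> t \<in> borel_measurable M'"
  shows "(\<lambda>\<omega>. run_min n (\<lambda>i. \<xi> (real (Suc i) * h) \<omega> - \<xi> (real i * h) \<omega>)) \<in> borel_measurable M'"
  by (intro measurable_run_min borel_measurable_diff M') (use h in auto)

lemma measurable_grid_inf:
  assumes h: "h > 0"
  shows "grid_inf h \<in> borel_measurable M"
proof -
  note [measurable] = measurable_grid_run_min[OF h measurable_process]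
  show ?thesis
    unfolding grid_inf_def
    by (rule measurable_compose_countable'[where I=UNIV and g="grid_life h"]) (auto simp del: of_nat_Suc)
qed

text \<open>The expectation is split according to the value of \<open>grid_life\<close>. On each
  piece the lifetime enters through an indicator that is independent of the path, and the running
  minimum of the increments has the law \<open>walk_min_law\<close>; the geometric weights then
  assemble \<open>geometric_min_laplace\<close>.\<close>

lemma grid_inf_laplace:
  assumes h: "h > 0" and w: "Re w \<ge> 0"
  shows "(\<integral>\<omega>. exp (w * of_real (grid_inf h \<omega>)) \<partial>M)
    = geometric_min_laplace (distr M borel (\<xi> h)) (exp (- q * h)) w"
proof -
  define p where "p = exp (- q * h)"
  have p: "0 < p" "p < 1" using h rate_pos by (auto simp: p_def)
  define R where "R n \<omega> = run_min n (\<lambda>i. \<xi> (real (Suc i) * h) \<omega> - \<xi> (real i * h) \<omega>)" for n \<omega>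
  define \<mu> where "\<mu> = distr M borel (\<xi> h)"
  have \<mu>: "real_distribution \<mu>"
    unfolding \<mu>_def using h by (intro real_distribution_distr measurable_process) auto
  have Rm [measurable]: "R n \<in> borel_measurable M" for n
    unfolding R_def by (rule measurable_grid_run_min[OF h measurable_process])
  have Rn: "R n \<omega> \<le> 0" for n \<omega> unfolding R_def by (rule run_min_nonpos)
  define A where "A n = {\<omega> \<in> space M. grid_life h \<omega> = n}" for n
  have A [measurable]: "A n \<in> sets M" for n unfolding A_def by measurable
  define f where "f n \<omega> = indicator (A n) \<omega> * exp (w * of_real (R n \<omega>))" for n \<omega>
  have nf: "norm (f n \<omega>) \<le> indicator (A n) \<omega>" for n \<omega>
    using norm_exp_nonpos_le[OF w Rn] by (auto simp: f_def indicator_def norm_mult)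
  have fi: "integrable M (f n)" for n
  proof (rule integrable_const_bound[where B=1])
    show "f n \<in> borel_measurable M" unfolding f_def[abs_def] by measurable
    show "AE \<omega> in M. norm (f n \<omega>) \<le> 1"
      by (intro AE_I2 order_trans[OF nf]) (simp add: indicator_def)
  qed
  have PA: "prob (A n) = (1 - p) * p ^ n" for n
    unfolding A_def p_def by (rule prob_grid_life[OF h])
  have "(\<integral>\<omega>. exp (w * of_real (grid_inf h \<omega>)) \<partial>M) = (\<integral>\<omega>. (\<Sum>n. f n \<omega>) \<partial>M)"
  proof (rule Bochner_Integration.integral_cong)
    fix \<omega> assume "\<omega> \<in> space M"
    then have "f n \<omega> = (if n = grid_life h \<omega> then exp (w * of_real (R n \<omega>)) else 0)" for n
      by (auto simp: f_def A_def)
    then show "exp (w * of_real (grid_inf h \<omega>)) = (\<Sum>n. f n \<omega>)"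
      using sums_single[of "grid_life h \<omega>" "\<lambda>n. exp (w * of_real (R n \<omega>))"]
      by (simp add: sums_iff grid_inf_def R_def)
  qed simp
  also have "\<dots> = (\<Sum>n. \<integral>\<omega>. f n \<omega> \<partial>M)"
  proof (rule integral_suminf[OF fi])
    show "AE \<omega> in M. summable (\<lambda>n. norm (f n \<omega>))"
    proof (intro AE_I2)
      fix \<omega>
      have "norm (f n \<omega>) = 0" if "n \<notin> {grid_life h \<omega>}" for n
        using that by (auto simp: f_def A_def)
      then show "summable (\<lambda>n. norm (f n \<omega>))" by (rule summable_finite[rotated]) auto
    qed
    show "summable (\<lambda>n. \<integral>\<omega>. norm (f n \<omega>) \<partial>M)"
    proof (rule summable_comparison_test'[where N=0])
      show "summable (\<lambda>n. (1 - p) * p ^ n)" using p by (intro summable_mult summable_geometric) auto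
      fix n
      have "(\<integral>\<omega>. norm (f n \<omega>) \<partial>M) \<le> (\<integral>\<omega>. indicator (A n) \<omega> \<partial>M)"
        using fi nf by (intro integral_mono) (auto intro!: integrable_real_indicator simp: less_top[symmetric])
      also have "\<dots> = (1 - p) * p ^ n" using PA by simp
      finally show "norm (\<integral>\<omega>. norm (f n \<omega>) \<partial>M) \<le> (1 - p) * p ^ n" by simp
    qed
  qed
  also have "(\<lambda>n. \<integral>\<omega>. f n \<omega> \<partial>M) = (\<lambda>n. of_real ((1 - p) * p ^ n) * neg_laplace (walk_min_law \<mu> n) w)"
  proof
    fix n
    \<comment> \<open>The event that the grid lifetime equals n, written as a function of \<zeta>
      alone so that independence from the path applies.\<close>
    define g :: "ereal \<Rightarrow> complex" where "g z = (if (LEAST n. z \<le> ereal (real (Suc n) * h)) = n then 1 else 0)" for z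
    have g: "g \<in> borel_measurable borel" unfolding g_def by measurable
    have g_le: "norm (g z) \<le> 1" for z by (simp add: g_def)
    have gA: "g (\<zeta> \<omega>) = indicator (A n) \<omega>" if "\<omega> \<in> space M" for \<omega>
      using that by (auto simp: g_def A_def grid_life_def)
    have ind: "indep_var borel (\<lambda>\<omega>. exp (w * of_real (R n \<omega>))) borel (\<lambda>\<omega>. g (\<zeta> \<omega>))"
    proof (rule indep_path_lifetime[OF _ _ g])
      have [measurable]: "R n \<in> borel_measurable path_algebra"
        unfolding R_def by (rule measurable_grid_run_min[OF h measurable_path_algebra])
      show "(\<lambda>\<omega>. exp (w * of_real (R n \<omega>))) \<in> borel_measurable path_algebra" by measurable
    qed measurable
    have [measurable]: "(\<lambda>\<omega>. g (\<zeta> \<omega>)) \<in> borel_measurable M" using ind by (rule indep_var_rv2)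
    have "(\<integral>\<omega>. f n \<omega> \<partial>M) = (\<integral>\<omega>. exp (w * of_real (R n \<omega>)) * g (\<zeta> \<omega>) \<partial>M)"
      by (rule Bochner_Integration.integral_cong) (auto simp: f_def gA)
    also have "\<dots> = (\<integral>\<omega>. exp (w * of_real (R n \<omega>)) \<partial>M) * (\<integral>\<omega>. g (\<zeta> \<omega>) \<partial>M)"
      by (rule indep_var_lebesgue_integral[OF ind])
        (auto intro!: integrable_const_bound[where B=1] AE_I2 norm_exp_nonpos_le w Rn g_le simp del: norm_exp_eq_Re)
    also have "(\<integral>\<omega>. g (\<zeta> \<omega>) \<partial>M) = (\<integral>\<omega>. indicator (A n) \<omega> \<partial>M)"
      by (rule Bochner_Integration.integral_cong) (auto simp: gA)
    also have "\<dots> = of_real ((1 - p) * p ^ n)" using PA[of n] by (simp only: integral_indicator_complex[OF A])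
    also have "(\<integral>\<omega>. exp (w * of_real (R n \<omega>)) \<partial>M) = (\<integral>a. exp (w * of_real a) \<partial>distr M borel (R n))"
      by (subst integral_distr) auto
    also have "distr M borel (R n) = walk_min_law \<mu> n"
      using distr_run_min[OF grid_steps_indep[OF h] grid_steps_law[OF h], of n 0]
      unfolding R_def \<mu>_def by simp
    finally show "(\<integral>\<omega>. f n \<omega> \<partial>M) = of_real ((1 - p) * p ^ n) * neg_laplace (walk_min_law \<mu> n) w"
      unfolding walk_min_law_transform[OF \<mu>] by (simp add: mult.commute)
  qed
  finally show ?thesis unfolding geometric_min_laplace_def \<mu>_def p_def .
qed

end

section \<open>Wiener-Hopf factorisation of the overall infimum\<close>

context strictly_killed_levy_process
begin

lemma overall_infimum_dyadics:
  assumes "\<omega> \<in> space M"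
  shows "overall_infimum \<xi> \<zeta> \<omega> = Inf ((\<lambda>s. \<xi> s \<omega>) ` {s \<in> dyadics. ereal s < \<zeta> \<omega>})"
  unfolding overall_infimum_def
proof (rule real_Inf_cong_bounds)
  fix z
  have "(\<forall>s. 0 \<le> s \<longrightarrow> ereal s < \<zeta> \<omega> \<longrightarrow> z \<le> \<xi> s \<omega>)
      \<longleftrightarrow> (\<forall>s\<in>dyadics. ereal s < \<zeta> \<omega> \<longrightarrow> z \<le> \<xi> s \<omega>)"
    by (rule right_continuous_lower_bound_dyadics) (rule right_continuous[OF assms])
  then show "(\<forall>x\<in>(\<lambda>s. \<xi> s \<omega>) ` {s. 0 \<le> s \<and> ereal s < \<zeta> \<omega>}. z \<le> x)
      = (\<forall>x\<in>(\<lambda>s. \<xi> s \<omega>) ` {s \<in> dyadics. ereal s < \<zeta> \<omega>}. z \<le> x)"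
    unfolding ball_simps mem_Collect_eq Ball_def by blast
qed

text \<open>The real infimum takes arbitrary but fixed values on the empty set and on sets that are unbounded
  below; \<open>E\<close> is the extended infimum, which tells these cases apart.\<close>

lemma measurable_overall_infimum: "overall_infimum \<xi> \<zeta> \<in> borel_measurable M"
proof -
  note lifetime_measurable[measurable]
  define E where "E \<omega> = (INF s\<in>dyadics. if ereal s < \<zeta> \<omega> then ereal (\<xi> s \<omega>) else \<infinity>)" for \<omega>
  have [measurable]: "E \<in> borel_measurable M"
    unfolding E_def[abs_def]
  proof (rule borel_measurable_INF[OF countable_dyadics])
    fix s assume "s \<in> dyadics"
    then have [measurable]: "\<xi> s \<in> borel_measurable M" using dyadics_nonneg measurable_process by blast
    show "(\<lambda>\<omega>. if ereal s < \<zeta> \<omega> then ereal (\<xi> s \<omega>) else \<infinity>) \<in> borel_measurable M" by measurable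
  qed
  have *: "overall_infimum \<xi> \<zeta> \<omega>
      = (if E \<omega> = \<infinity> then Inf {} else if E \<omega> = - \<infinity> then Inf UNIV else real_of_ereal (E \<omega>))"
    if \<omega>: "\<omega> \<in> space M" for \<omega>
  proof -
    define A where "A = (\<lambda>s. \<xi> s \<omega>) ` {s \<in> dyadics. ereal s < \<zeta> \<omega>}"
    have I: "overall_infimum \<xi> \<zeta> \<omega> = Inf A"
      unfolding A_def by (rule overall_infimum_dyadics[OF \<omega>])
    have E: "E \<omega> = (INF a\<in>A. ereal a)"
    proof (rule antisym)
      show "E \<omega> \<le> (INF a\<in>A. ereal a)"
      proof (rule INF_greatest)
        fix a assume "a \<in> A"
        then obtain s where s: "s \<in> dyadics" "ereal s < \<zeta> \<omega>" "a = \<xi> s \<omega>" unfolding A_def by blast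
        then show "E \<omega> \<le> ereal a" unfolding E_def by (intro INF_lower2[OF s(1)]) simp
      qed
      show "(INF a\<in>A. ereal a) \<le> E \<omega>"
        unfolding E_def
      proof (rule INF_greatest)
        fix s assume "s \<in> dyadics"
        show "(INF a\<in>A. ereal a) \<le> (if ereal s < \<zeta> \<omega> then ereal (\<xi> s \<omega>) else \<infinity>)"
        proof (cases "ereal s < \<zeta> \<omega>")
          case True
          then have "\<xi> s \<omega> \<in> A" using \<open>s \<in> dyadics\<close> unfolding A_def by blast
          then show ?thesis unfolding if_P[OF True] by (rule INF_lower)
        next
          case False
          show ?thesis unfolding if_not_P[OF False] by (rule ereal_less_eq(1))
        qed
      qed
    qed
    consider "A = {}" | "A \<noteq> {}" "\<not> bdd_below A" | "A \<noteq> {}" "bdd_below A" by argo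
    then show ?thesis
    proof cases
      case 1
      then have "E \<omega> = \<infinity>" unfolding E by (simp add: top_ereal_def)
      then show ?thesis using 1 I by simp
    next
      case 2
      have "E \<omega> \<le> ereal B" for B
      proof -
        have "\<not> (\<forall>x\<in>A. B \<le> x)" using 2(2) unfolding bdd_below_def by blast
        then obtain a where a: "a \<in> A" "a \<le> B" using linear by blast
        then show ?thesis unfolding E by (intro INF_lower2[OF a(1)]) simp
      qed
      then have "E \<omega> = - \<infinity>" by (rule ereal_bot)
      moreover have "Inf A = Inf UNIV"
      proof (rule real_Inf_cong_bounds)
        fix z :: real
        have "\<not> (\<forall>x\<in>A. z \<le> x)" using 2(2) unfolding bdd_below_def by blast
        moreover have "\<not> (\<forall>x\<in>UNIV. z \<le> x)" by (auto intro!: exI[of _ "z - 1"])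
        ultimately show "(\<forall>x\<in>A. z \<le> x) = (\<forall>x\<in>UNIV. z \<le> x)" by blast
      qed
      ultimately show ?thesis using I by simp
    next
      case 3
      then have "E \<omega> = ereal (Inf A)" unfolding E by (metis ereal_Inf')
      then show ?thesis using I by simp
    qed
  qed
  have "(\<lambda>\<omega>. if E \<omega> = \<infinity> then Inf {} else if E \<omega> = - \<infinity> then Inf UNIV else real_of_ereal (E \<omega>)) \<in> borel_measurable M"
    by measurable
  then show ?thesis by (rule measurable_cong[THEN iffD2, rotated]) (rule *)
qed

definition regular_outcome :: "'a \<Rightarrow> bool" where
  "regular_outcome \<omega> \<longleftrightarrow> \<omega> \<in> space M \<and> \<xi> 0 \<omega> = 0 \<and> 0 < \<zeta> \<omega> \<and> \<zeta> \<omega> < \<infinity>"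

lemma AE_regular_outcome: "AE \<omega> in M. regular_outcome \<omega>"
  using AE_space start_zero AE_lifetime_pos AE_lifetime_finite
  unfolding regular_outcome_def by eventually_elim auto

lemma bdd_below_path:
  assumes "regular_outcome \<omega>"
  shows "bdd_below ((\<lambda>s. \<xi> s \<omega>) ` {s. 0 \<le> s \<and> ereal s < \<zeta> \<omega>})"
proof -
  have \<omega>: "\<omega> \<in> space M" "\<zeta> \<omega> < \<infinity>" "0 < \<zeta> \<omega>" using assms by (auto simp: regular_outcome_def)
  then obtain T where T: "\<zeta> \<omega> = ereal T" by (cases "\<zeta> \<omega>") auto
  obtain B where B: "\<forall>s\<in>{0..T}. \<bar>\<xi> s \<omega>\<bar> \<le> B"
    using cadlag_bounded[where f="\<lambda>s. \<xi> s \<omega>" and T=T] right_continuous[OF \<omega>(1)] left_limits[OF \<omega>(1)] by auto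
  show ?thesis
  proof (rule bdd_belowI2[where m="- B"])
    fix s assume "s \<in> {s. 0 \<le> s \<and> ereal s < \<zeta> \<omega>}"
    then have "\<bar>\<xi> s \<omega>\<bar> \<le> B" using B T by auto
    then show "- B \<le> \<xi> s \<omega>" by linarith
  qed
qed

lemma overall_infimum_nonpos:
  assumes "regular_outcome \<omega>"
  shows "overall_infimum \<xi> \<zeta> \<omega> \<le> 0"
proof -
  have "overall_infimum \<xi> \<zeta> \<omega> \<le> \<xi> 0 \<omega>"
    unfolding overall_infimum_def
    by (rule cINF_lower[OF bdd_below_path[OF assms]]) (use assms in \<open>auto simp: regular_outcome_def zero_ereal_def\<close>)
  then show ?thesis using assms by (simp add: regular_outcome_def)
qed

text \<open>Grid infima approach from above. A time at which the path nearly attains its infimum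
  has, by right continuity, points of every sufficiently fine dyadic grid just to its right where
  the path is still nearly as low.\<close>

lemma grid_inf_tendsto:
  assumes "regular_outcome \<omega>"
  shows "(\<lambda>m. grid_inf (1 / 2 ^ m) \<omega>) \<longlonglongrightarrow> overall_infimum \<xi> \<zeta> \<omega>"
proof -
  have \<omega>: "\<omega> \<in> space M" "\<xi> 0 \<omega> = 0" "0 < \<zeta> \<omega>" "\<zeta> \<omega> < \<infinity>"
    using assms by (auto simp: regular_outcome_def)
  let ?A = "{s. 0 \<le> s \<and> ereal s < \<zeta> \<omega>}"
  have g: "grid_inf (1 / 2 ^ m) \<omega> = Min ((\<lambda>j. \<xi> (real j / 2 ^ m) \<omega>) ` {j. ereal (real j / 2 ^ m) < \<zeta> \<omega>})"
    and fin: "finite {j. ereal (real j / 2 ^ m) < \<zeta> \<omega>}" for m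
  proof -
    have *: "{..grid_life (1 / 2 ^ m) \<omega>} = {j. ereal (real j / 2 ^ m) < \<zeta> \<omega>}"
      using le_grid_life_iff[OF _ \<omega>(3,4), of "1 / 2 ^ m"] by auto
    show "grid_inf (1 / 2 ^ m) \<omega> = Min ((\<lambda>j. \<xi> (real j / 2 ^ m) \<omega>) ` {j. ereal (real j / 2 ^ m) < \<zeta> \<omega>})"
      unfolding *[symmetric] grid_inf_def
      using run_min_eq_Min[of "grid_life (1 / 2 ^ m) \<omega>" "\<lambda>j. \<xi> (real j * (1 / 2 ^ m)) \<omega>"] \<omega>(2)
      by (simp del: of_nat_Suc)
    show "finite {j. ereal (real j / 2 ^ m) < \<zeta> \<omega>}" unfolding *[symmetric] by simp
  qed
  have ne: "{j. ereal (real j / 2 ^ m) < \<zeta> \<omega>} \<noteq> {}" for m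
    using \<omega>(3) by (auto intro!: exI[of _ 0] simp flip: zero_ereal_def)
  have lower: "overall_infimum \<xi> \<zeta> \<omega> \<le> grid_inf (1 / 2 ^ m) \<omega>" for m
    unfolding g using fin ne
    by (subst Min_ge_iff) (auto simp: overall_infimum_def intro!: cINF_lower[OF bdd_below_path[OF assms]])
  show ?thesis
  proof (rule LIMSEQ_I)
    fix e :: real assume "e > 0"
    then have "Inf ((\<lambda>s. \<xi> s \<omega>) ` ?A) < overall_infimum \<xi> \<zeta> \<omega> + e" by (simp add: overall_infimum_def)
    moreover have "?A \<noteq> {}" using \<omega>(3) by (auto intro!: exI[of _ 0] simp flip: zero_ereal_def)
    ultimately obtain s where s: "0 \<le> s" "ereal s < \<zeta> \<omega>" "\<xi> s \<omega> < overall_infimum \<xi> \<zeta> \<omega> + e"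
      by (subst (asm) cInf_less_iff) (auto simp: bdd_below_path[OF assms])
    obtain d where d: "d > 0" "\<And>u. s < u \<Longrightarrow> u < s + d \<Longrightarrow> \<xi> u \<omega> < overall_infimum \<xi> \<zeta> \<omega> + e \<and> ereal u < \<zeta> \<omega>"
      using right_continuous_below_near[where f="\<lambda>u. \<xi> u \<omega>", OF right_continuous[OF \<omega>(1) s(1)] s(3,2)] by auto
    obtain N where N: "\<forall>m\<ge>N. \<exists>j::nat. s < real j / 2 ^ m \<and> real j / 2 ^ m < s + d"
      using dyadic_right_dense[OF s(1) d(1)] by auto
    show "\<exists>no. \<forall>m\<ge>no. norm (grid_inf (1 / 2 ^ m) \<omega> - overall_infimum \<xi> \<zeta> \<omega>) < e"
    proof (intro exI[of _ N] allI impI)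
      fix m assume "m \<ge> N"
      then obtain j :: nat where "s < real j / 2 ^ m" "real j / 2 ^ m < s + d" using N by blast
      then have "\<xi> (real j / 2 ^ m) \<omega> < overall_infimum \<xi> \<zeta> \<omega> + e" "ereal (real j / 2 ^ m) < \<zeta> \<omega>"
        using d(2) by auto
      then have "grid_inf (1 / 2 ^ m) \<omega> < overall_infimum \<xi> \<zeta> \<omega> + e"
        unfolding g using fin[of m] by (subst Min_less_iff) auto
      then show "norm (grid_inf (1 / 2 ^ m) \<omega> - overall_infimum \<xi> \<zeta> \<omega>) < e" using lower[of m] by simp
    qed
  qed
qed

text \<open>Almost surely the infimum is nonpositive, so the cut at 0 leaves the transform
  unchanged. It makes the integrand bounded for Re w \<ge> 0 at every outcome, exceptional ones
  included.\<close>

definition infimum_laplace :: "complex \<Rightarrow> complex" where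
  "infimum_laplace w = (\<integral>\<omega>. exp (w * of_real (min (overall_infimum \<xi> \<zeta> \<omega>) 0)) \<partial>M)"

lemma
  shows continuous_infimum_laplace: "continuous_on {w. Re w \<ge> 0} infimum_laplace"
    and holomorphic_infimum_laplace: "infimum_laplace holomorphic_on {w. Re w > 0}"
    and norm_infimum_laplace_le: "Re w \<ge> 0 \<Longrightarrow> norm (infimum_laplace w) \<le> 1"
    and infimum_laplace_0: "infimum_laplace 0 = 1"
proof -
  note [measurable] = measurable_overall_infimum
  have m: "(\<lambda>\<omega>. min (overall_infimum \<xi> \<zeta> \<omega>) 0) \<in> borel_measurable M" "min (overall_infimum \<xi> \<zeta> \<omega>) 0 \<le> 0" for \<omega>
    by auto
  show "continuous_on {w. Re w \<ge> 0} infimum_laplace"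
    unfolding infimum_laplace_def[abs_def] by (rule continuous_laplace_nonpos[OF m])
  show "infimum_laplace holomorphic_on {w. Re w > 0}"
    unfolding infimum_laplace_def[abs_def] by (rule holomorphic_laplace_nonpos[OF m])
  show "Re w \<ge> 0 \<Longrightarrow> norm (infimum_laplace w) \<le> 1"
    unfolding infimum_laplace_def by (rule norm_laplace_nonpos_le[OF m])
  show "infimum_laplace 0 = 1" by (simp add: infimum_laplace_def prob_space)
qed

lemma infimum_laplace_eq:
  "infimum_laplace w = (\<integral>\<omega>. exp (w * of_real (overall_infimum \<xi> \<zeta> \<omega>)) \<partial>M)"
  unfolding infimum_laplace_def
proof (rule integral_cong_AE)
  note [measurable] = measurable_overall_infimum
  show "AE \<omega> in M. exp (w * complex_of_real (min (overall_infimum \<xi> \<zeta> \<omega>) 0))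
      = exp (w * complex_of_real (overall_infimum \<xi> \<zeta> \<omega>))"
    using AE_regular_outcome by eventually_elim (simp add: overall_infimum_nonpos min_absorb1)
qed (use measurable_overall_infimum in measurable)

lemma infimum_laplace_limit:
  assumes w: "Re w \<ge> 0"
  shows "(\<lambda>m. geometric_min_laplace (distr M borel (\<xi> (1 / 2 ^ m))) (exp (- q * (1 / 2 ^ m))) w)
    \<longlonglongrightarrow> infimum_laplace w"
proof -
  have "(\<lambda>m. \<integral>\<omega>. exp (w * of_real (grid_inf (1 / 2 ^ m) \<omega>)) \<partial>M) \<longlonglongrightarrow> infimum_laplace w"
    unfolding infimum_laplace_eq
  proof (rule integral_dominated_convergence[where w="\<lambda>_. 1"])
    note [measurable] = measurable_overall_infimum measurable_grid_inf
    show "(\<lambda>\<omega>. exp (w * complex_of_real (overall_infimum \<xi> \<zeta> \<omega>))) \<in> borel_measurable M" by measurable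
    show "(\<lambda>\<omega>. exp (w * complex_of_real (grid_inf (1 / 2 ^ m) \<omega>))) \<in> borel_measurable M" for m
      using measurable_grid_inf[of "1 / 2 ^ m"] by measurable
    show "AE \<omega> in M. (\<lambda>m. exp (w * complex_of_real (grid_inf (1 / 2 ^ m) \<omega>)))
        \<longlonglongrightarrow> exp (w * complex_of_real (overall_infimum \<xi> \<zeta> \<omega>))"
      using AE_regular_outcome by eventually_elim (intro tendsto_intros grid_inf_tendsto)
    show "AE \<omega> in M. norm (exp (w * complex_of_real (grid_inf (1 / 2 ^ m) \<omega>))) \<le> 1" for m
      by (intro AE_I2 norm_exp_nonpos_le w) (simp add: grid_inf_def run_min_nonpos)
  qed simp
  then show ?thesis using w by (simp add: grid_inf_laplace)
qed

lemma step_distribution: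
  assumes "0 \<le> h"
  shows "real_distribution (distr M borel (\<xi> h))"
  using assms by (intro real_distribution_distr measurable_process)

lemma kill_prob:
  assumes "0 < h"
  shows "0 < exp (- q * h)" "exp (- q * h) < 1"
  using assms rate_pos by auto

lemma infimum_laplace_lower_bound:
  assumes w: "Re w \<ge> 0"
  shows "norm (infimum_laplace w) \<ge> norm (infimum_laplace (of_real (norm w))) ^ 4"
proof (rule LIMSEQ_le)
  show "(\<lambda>m. norm (geometric_min_laplace (distr M borel (\<xi> (1 / 2 ^ m))) (exp (- q * (1 / 2 ^ m))) w))
    \<longlonglongrightarrow> norm (infimum_laplace w)"
    by (intro tendsto_intros infimum_laplace_limit w)
  show "(\<lambda>m. norm (geometric_min_laplace (distr M borel (\<xi> (1 / 2 ^ m))) (exp (- q * (1 / 2 ^ m))) (of_real (norm w))) ^ 4)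
    \<longlonglongrightarrow> norm (infimum_laplace (of_real (norm w))) ^ 4"
    by (intro tendsto_intros infimum_laplace_limit) simp
  show "\<exists>N. \<forall>m\<ge>N. norm (geometric_min_laplace (distr M borel (\<xi> (1 / 2 ^ m))) (exp (- q * (1 / 2 ^ m))) (of_real (norm w))) ^ 4
      \<le> norm (geometric_min_laplace (distr M borel (\<xi> (1 / 2 ^ m))) (exp (- q * (1 / 2 ^ m))) w)"
    by (intro exI[of _ 0] allI impI geometric_min_laplace_lower_bound step_distribution kill_prob w) auto
qed

text \<open>With positive probability the path stays above -e up to a small time \<delta> and the
  lifetime ends by \<delta>, since the two events are independent. On their intersection the infimum
  is at least -e, so the transform at x is at least that probability times exp (- e x).\<close>

lemma infimum_laplace_real_lower_bound:
  assumes e: "e > 0"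
  shows "\<exists>c>0. \<forall>x\<ge>0. c * exp (- e * x) \<le> norm (infimum_laplace (of_real x))"
proof -
  note lifetime_measurable[measurable] measurable_overall_infimum[measurable]
  define \<delta> where "\<delta> n = 1 / real (Suc n)" for n
  have \<delta>: "\<delta> n > 0" for n by (simp add: \<delta>_def)
  \<comment> \<open>Restricting to dyadic times makes this a countable intersection of path
    events.\<close>
  define A where "A n = {\<omega> \<in> space M. \<forall>s\<in>dyadics. s \<le> \<delta> n \<longrightarrow> - e \<le> \<xi> s \<omega>}" for n
  have Ap: "A n \<in> sets path_algebra" for n
  proof -
    have "{\<omega> \<in> space path_algebra. s \<le> \<delta> n \<longrightarrow> - e \<le> \<xi> s \<omega>} \<in> sets path_algebra" if "s \<in> dyadics" for s
      using measurable_path_algebra[OF dyadics_nonneg[OF that]] by measurable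
    then have "{\<omega> \<in> space path_algebra. \<forall>s\<in>dyadics. s \<le> \<delta> n \<longrightarrow> - e \<le> \<xi> s \<omega>} \<in> sets path_algebra"
      by (rule sets.sets_Collect_countable_All'[OF _ countable_dyadics])
    then show ?thesis by (simp add: A_def)
  qed
  have A: "A n \<in> events" for n
    using indep_setD_ev1[OF lifetime_indep] Ap[of n] unfolding path_algebra_def by (rule subsetD)
  \<comment> \<open>Almost every path starts at 0, and right continuity there puts it into some
    \<open>A n\<close>; hence not all of these events can be null.\<close>
  have "\<exists>n. prob (A n) > 0"
  proof (rule ccontr)
    assume "\<not> ?thesis"
    then have "prob (A n) = 0" for n by (simp add: not_less measure_le_0_iff)
    then have "AE \<omega> in M. \<omega> \<notin> A n" for n by (rule prob_eq_0[OF A, THEN iffD1])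
    then have "AE \<omega> in M. \<forall>n. \<omega> \<notin> A n" by (simp add: AE_all_countable)
    then have "AE \<omega> in M. False"
      using AE_regular_outcome
    proof eventually_elim
      case (elim \<omega>)
      then have \<omega>: "\<omega> \<in> space M" "\<xi> 0 \<omega> = 0" by (auto simp: regular_outcome_def)
      have "continuous (at_right 0) (\<lambda>s. - \<xi> s \<omega>)"
        using right_continuous[OF \<omega>(1), of 0] by (intro continuous_intros) auto
      then obtain d where d: "d > 0" "\<And>u. 0 < u \<Longrightarrow> u < d \<Longrightarrow> - \<xi> u \<omega> < e"
        using right_continuous_below_near[of 0 "\<lambda>s. - \<xi> s \<omega>" e \<infinity>] \<omega>(2) e by fastforce
      obtain n where n: "\<delta> n < d" using reals_Archimedean[OF d(1)] by (auto simp: \<delta>_def inverse_eq_divide)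
      have "- e \<le> \<xi> s \<omega>" if "s \<in> dyadics" "s \<le> \<delta> n" for s
      proof (cases "s = 0")
        case False
        then have "s > 0" using dyadics_nonneg[OF that(1)] by simp
        then show ?thesis using d(2)[of s] n that(2) by linarith
      qed (use \<omega> e in simp)
      then have "\<omega> \<in> A n" using \<omega>(1) by (simp add: A_def)
      then show ?case using elim by blast
    qed
    then show False by simp
  qed
  then obtain n where n: "prob (A n) > 0" by blast
  define B where "B = {\<omega> \<in> space M. \<not> ereal (\<delta> n) < \<zeta> \<omega>}"
  have B [measurable]: "B \<in> events" unfolding B_def by measurable
  have "prob B = 1 - prob {\<omega> \<in> space M. ereal (\<delta> n) < \<zeta> \<omega>}"
    unfolding B_def by (rule prob_neg) measurable
  then have PB: "prob B > 0"
    using lifetime_exponential[of "\<delta> n"] \<delta>[of n] rate_pos by simp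
  have "B = \<zeta> -` {..ereal (\<delta> n)} \<inter> space M" by (auto simp: B_def not_less)
  then have "B \<in> sets (vimage_algebra (space M) \<zeta> borel)"
    using in_vimage_algebra[of "{..ereal (\<delta> n)}" borel \<zeta> "space M"] by simp
  then have "prob (A n \<inter> B) = prob (A n) * prob B"
    using Ap[of n] unfolding path_algebra_def by (intro indep_setD[OF lifetime_indep])
  then have c: "prob (A n \<inter> B) > 0" using n PB by simp
  have "AE \<omega> in M. \<omega> \<in> A n \<inter> B \<longrightarrow> - e \<le> overall_infimum \<xi> \<zeta> \<omega>"
    using AE_regular_outcome
  proof eventually_elim
    case (elim \<omega>)
    then have \<omega>: "\<omega> \<in> space M" "0 < \<zeta> \<omega>" by (auto simp: regular_outcome_def)
    show ?case
    proof
      assume AB: "\<omega> \<in> A n \<inter> B"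
      have "0 \<in> dyadics" using dyadic_mem[of 0 0] by simp
      moreover have "ereal 0 < \<zeta> \<omega>" using \<omega> by (simp flip: zero_ereal_def)
      ultimately have ne: "{s \<in> dyadics. ereal s < \<zeta> \<omega>} \<noteq> {}" by blast
      show "- e \<le> overall_infimum \<xi> \<zeta> \<omega>"
        unfolding overall_infimum_dyadics[OF \<omega>(1)]
      proof (rule cINF_greatest[OF ne])
        fix s assume s: "s \<in> {s \<in> dyadics. ereal s < \<zeta> \<omega>}"
        have "\<zeta> \<omega> \<le> ereal (\<delta> n)" using AB by (simp add: B_def not_less)
        moreover have "ereal s < \<zeta> \<omega>" using s by simp
        ultimately have "ereal s < ereal (\<delta> n)" by (rule less_le_trans[rotated])
        then have "s \<le> \<delta> n" by simp
        then show "- e \<le> \<xi> s \<omega>" using AB s by (auto simp: A_def)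
      qed
    qed
  qed
  then have ae: "AE \<omega> in M. indicator (A n \<inter> B) \<omega> * exp (- e * x) \<le> exp (x * min (overall_infimum \<xi> \<zeta> \<omega>) 0)"
    if "x \<ge> 0" for x
  proof eventually_elim
    case (elim \<omega>)
    show ?case
    proof (cases "\<omega> \<in> A n \<inter> B")
      case True
      then have "- e \<le> min (overall_infimum \<xi> \<zeta> \<omega>) 0" using elim e by auto
      then have "x * - e \<le> x * min (overall_infimum \<xi> \<zeta> \<omega>) 0" using that by (rule mult_left_mono)
      then show ?thesis using True by (simp add: mult.commute)
    qed simp
  qed
  have "prob (A n \<inter> B) * exp (- e * x) \<le> norm (infimum_laplace (of_real x))" if x: "x \<ge> 0" for x
  proof -
    have AB: "A n \<inter> B \<in> events" using A B by blast
    have "(\<integral>\<omega>. indicator (A n \<inter> B) \<omega> * exp (- e * x) \<partial>M) \<le> (\<integral>\<omega>. exp (x * min (overall_infimum \<xi> \<zeta> \<omega>) 0) \<partial>M)"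
    proof (rule integral_mono_AE[OF _ _ ae[OF x]])
      show "integrable M (\<lambda>\<omega>. indicator (A n \<inter> B) \<omega> * exp (- e * x))"
        using AB by (intro integrable_mult_left integrable_real_indicator) (simp_all add: less_top[symmetric])
      show "integrable M (\<lambda>\<omega>. exp (x * min (overall_infimum \<xi> \<zeta> \<omega>) 0))"
        by (rule integrable_const_bound[where B=1]) (use x in \<open>auto simp: mult_nonneg_nonpos\<close>)
    qed
    also have "(\<integral>\<omega>. indicator (A n \<inter> B) \<omega> * exp (- e * x) \<partial>M) = prob (A n \<inter> B) * exp (- e * x)"
      using AB by simp
    also have "(\<integral>\<omega>. exp (x * min (overall_infimum \<xi> \<zeta> \<omega>) 0) \<partial>M) = Re (infimum_laplace (of_real x))"
    proof -
      have "infimum_laplace (of_real x) = (\<integral>\<omega>. of_real (exp (x * min (overall_infimum \<xi> \<zeta> \<omega>) 0)) \<partial>M)"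
        unfolding infimum_laplace_def by (simp flip: of_real_mult exp_of_real)
      then show ?thesis by (simp only: integral_complex_of_real Re_complex_of_real)
    qed
    also have "\<dots> \<le> norm (infimum_laplace (of_real x))" by (rule complex_Re_le_cmod)
    finally show ?thesis .
  qed
  then show ?thesis using c by blast
qed

lemma infimum_laplace_nonzero:
  assumes w: "Re w \<ge> 0"
  shows "infimum_laplace w \<noteq> 0"
proof -
  obtain c where c: "c > 0" "\<And>x. x \<ge> 0 \<Longrightarrow> c * exp (- 1 * x) \<le> norm (infimum_laplace (of_real x))"
    using infimum_laplace_real_lower_bound[of 1] by auto
  have "0 < c * exp (- 1 * norm w)" using c(1) by simp
  also have "\<dots> \<le> norm (infimum_laplace (of_real (norm w)))" by (rule c(2)) simp
  finally have "0 < norm (infimum_laplace (of_real (norm w))) ^ 4" by simp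
  then have "0 < norm (infimum_laplace w)" using infimum_laplace_lower_bound[OF w] by (rule less_le_trans)
  then show ?thesis by simp
qed

lemma inverse_infimum_laplace_bound:
  assumes e: "e > 0"
  shows "\<exists>C. \<forall>w. Re w \<ge> 0 \<longrightarrow> norm (inverse (infimum_laplace w)) \<le> C * exp (e * norm w)"
proof -
  \<comment> \<open>A quarter of e, because the passage from real to complex arguments costs a
    fourth power.\<close>
  obtain c where c: "c > 0" "\<And>x. x \<ge> 0 \<Longrightarrow> c * exp (- (e / 4) * x) \<le> norm (infimum_laplace (of_real x))"
    using infimum_laplace_real_lower_bound[of "e / 4"] e by auto
  have "norm (inverse (infimum_laplace w)) \<le> inverse (c ^ 4) * exp (e * norm w)" if w: "Re w \<ge> 0" for w
  proof -
    have "(c * exp (- (e / 4) * norm w)) ^ 4 \<le> norm (infimum_laplace (of_real (norm w))) ^ 4"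
      using c by (intro power_mono) auto
    also have "\<dots> \<le> norm (infimum_laplace w)" by (rule infimum_laplace_lower_bound[OF w])
    finally have "c ^ 4 * exp (- e * norm w) \<le> norm (infimum_laplace w)"
      by (simp add: power_mult_distrib exp_of_nat_mult[symmetric])
    then have "inverse (norm (infimum_laplace w)) \<le> inverse (c ^ 4 * exp (- e * norm w))"
      using c(1) by (intro le_imp_inverse_le) auto
    then show ?thesis by (simp add: norm_inverse exp_minus)
  qed
  then show ?thesis by blast
qed

section \<open>Factorisation of the killed exponent\<close>

lemma killed_char_step:
  assumes \<Phi>: "has_killed_char_exponent M \<xi> \<zeta> \<Phi>" and t: "0 \<le> t"
  shows "exp (- q * t) * (\<integral>x. iexp (l * x) \<partial>distr M borel (\<xi> t)) = exp (of_real t * \<Phi> l)"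
proof -
  note lifetime_measurable[measurable]
  have [measurable]: "\<xi> t \<in> borel_measurable M" by (rule measurable_process[OF t])
  define g :: "ereal \<Rightarrow> complex" where "g z = (if ereal t < z then 1 else 0)" for z
  have g: "g \<in> borel_measurable borel" unfolding g_def by measurable
  note [measurable] = measurable_path_algebra[OF t] g
  have ind: "indep_var borel (\<lambda>\<omega>. iexp (l * \<xi> t \<omega>)) borel (\<lambda>\<omega>. g (\<zeta> \<omega>))"
    by (rule indep_path_lifetime[OF _ _ g]) measurable
  have "exp (of_real t * \<Phi> l) = (\<integral>\<omega>. iexp (l * \<xi> t \<omega>) * g (\<zeta> \<omega>) \<partial>M)"
    using \<Phi> t unfolding has_killed_char_exponent_def g_def by (simp add: indicator_def of_bool_def)
  also have "\<dots> = (\<integral>\<omega>. iexp (l * \<xi> t \<omega>) \<partial>M) * (\<integral>\<omega>. g (\<zeta> \<omega>) \<partial>M)"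
    by (rule indep_var_lebesgue_integral[OF ind])
      (auto intro!: integrable_const_bound[where B=1] AE_I2 simp: g_def)
  also have "(\<integral>\<omega>. g (\<zeta> \<omega>) \<partial>M) = (\<integral>\<omega>. indicator {\<omega> \<in> space M. ereal t < \<zeta> \<omega>} \<omega> \<partial>M)"
    by (rule Bochner_Integration.integral_cong) (auto simp: g_def)
  also have "\<dots> = exp (- q * t)" by (subst integral_indicator_complex) (simp_all add: lifetime_exponential[OF t])
  also have "(\<integral>\<omega>. iexp (l * \<xi> t \<omega>) \<partial>M) = (\<integral>x. iexp (l * x) \<partial>distr M borel (\<xi> t))"
    by (subst integral_distr) auto
  finally show ?thesis by (simp add: mult.commute)
qed

text \<open>At time 1 the killed characteristic function has modulus at most exp (- q) < 1, whereas
  \<Phi> l = 0 would make it 1.\<close>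

lemma killed_exponent_nonzero:
  assumes \<Phi>: "has_killed_char_exponent M \<xi> \<zeta> \<Phi>"
  shows "\<Phi> l \<noteq> 0"
proof
  assume 0: "\<Phi> l = 0"
  interpret D: real_distribution "distr M borel (\<xi> 1)" by (rule step_distribution) simp
  have "exp (- q) * norm (char (distr M borel (\<xi> 1)) l) \<le> exp (- q) * 1"
    by (intro mult_left_mono D.cmod_char_le_1) simp
  also have "\<dots> < 1" using rate_pos by simp
  finally have "norm (exp (- q * 1) * char (distr M borel (\<xi> 1)) l) < 1" by (simp add: norm_mult)
  then show False using killed_char_step[OF \<Phi>, of 1 l] 0 by (simp add: char_def)
qed

text \<open>On the grid of mesh h the product of the two factors is (1 - exp (- q h)) / (1 - exp (h
  \<Phi>)), because the survival probability times the characteristic function of a step is exp (h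
  \<Phi>). As h tends to 0 this tends to - q / \<Phi>.\<close>

theorem wiener_hopf_factorisation:
  assumes \<Phi>: "has_killed_char_exponent M \<xi> \<zeta> \<Phi>"
  shows "infimum_laplace (\<i> * of_real l) *
    strictly_killed_levy_process.infimum_laplace M (\<lambda>t \<omega>. - \<xi> t \<omega>) \<zeta> (- (\<i> * of_real l)) = - of_real q / \<Phi> l"
proof -
  interpret neg: strictly_killed_levy_process M q "\<lambda>t \<omega>. - \<xi> t \<omega>" \<zeta> by (rule strictly_killed_uminus)
  let ?w = "\<i> * complex_of_real l"
  let ?h = "\<lambda>m::nat. 1 / 2 ^ m :: real"
  let ?\<mu> = "\<lambda>m. distr M borel (\<xi> (?h m))"
  let ?p = "\<lambda>m. exp (- q * ?h m)"
  have \<mu>': "distr M borel (\<lambda>\<omega>. - \<xi> (?h m) \<omega>) = distr (?\<mu> m) borel uminus" for m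
    using measurable_process[of "?h m"] by (simp add: distr_distr comp_def)
  have "(\<lambda>m. geometric_min_laplace (?\<mu> m) (?p m) ?w
      * geometric_min_laplace (distr (?\<mu> m) borel uminus) (?p m) (- ?w))
      \<longlonglongrightarrow> infimum_laplace ?w * neg.infimum_laplace (- ?w)"
    unfolding \<mu>'[symmetric]
    by (intro tendsto_mult infimum_laplace_limit neg.infimum_laplace_limit) auto
  \<comment> \<open>Numerator and denominator are both divided by the mesh, which exhibits two
    difference quotients at 0.\<close>
  moreover have "geometric_min_laplace (?\<mu> m) (?p m) ?w
      * geometric_min_laplace (distr (?\<mu> m) borel uminus) (?p m) (- ?w)
      = ((1 - exp (- of_real q * of_real (?h m))) / of_real (?h m))
        / ((1 - exp (of_real (?h m) * \<Phi> l)) / of_real (?h m))" for m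
  proof -
    have "geometric_min_laplace (?\<mu> m) (?p m) ?w
        * geometric_min_laplace (distr (?\<mu> m) borel uminus) (?p m) (- ?w)
        = (1 - of_real (?p m)) / (1 - ?p m * (\<integral>x. exp (?w * of_real x) \<partial>?\<mu> m))"
      by (rule geometric_min_laplace_factorisation) (use rate_pos in \<open>auto intro: step_distribution\<close>)
    also have "(\<integral>x. exp (?w * of_real x) \<partial>?\<mu> m) = (\<integral>x. iexp (l * x) \<partial>?\<mu> m)"
      by (simp add: mult.assoc)
    also have "?p m * \<dots> = exp (of_real (?h m) * \<Phi> l)" by (rule killed_char_step[OF \<Phi>]) simp
    also have "1 - complex_of_real (?p m) = 1 - exp (- of_real q * of_real (?h m))"
      by (simp flip: exp_of_real)
    finally show ?thesis by simp
  qed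
  moreover have lim: "(\<lambda>m. (1 - exp (of_real (?h m) * c)) / of_real (?h m)) \<longlonglongrightarrow> - c" for c :: complex
  proof -
    have "((\<lambda>z. 1 - exp (z * c)) has_field_derivative - c) (at 0)"
      by (auto intro!: derivative_eq_intros)
    then have "((\<lambda>z. (1 - exp (z * c)) / z) \<longlongrightarrow> - c) (at 0)"
      by (simp add: has_field_derivative_iff)
    moreover have "filterlim (\<lambda>m. complex_of_real (?h m)) (at 0) sequentially"
    proof (rule filterlim_atI)
      have "?h \<longlonglongrightarrow> 0" by real_asymp
      then show "(\<lambda>m. complex_of_real (?h m)) \<longlonglongrightarrow> 0" by (metis of_real_0 tendsto_of_real)
    qed auto
    ultimately show ?thesis by (rule filterlim_compose)
  qed
  have "(\<lambda>m. ((1 - exp (of_real (?h m) * - of_real q)) / of_real (?h m))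
        / ((1 - exp (of_real (?h m) * \<Phi> l)) / of_real (?h m))) \<longlonglongrightarrow> - (- of_real q) / - \<Phi> l"
    by (intro tendsto_divide lim) (simp add: killed_exponent_nonzero[OF \<Phi>])
  ultimately have "infimum_laplace ?w * neg.infimum_laplace (- ?w) = - (- of_real q) / - \<Phi> l"
    by (intro LIMSEQ_unique[of _ "infimum_laplace ?w * neg.infimum_laplace (- ?w)"]) (simp_all add: mult.commute)
  then show ?thesis by simp
qed

end

section \<open>Complex Beta integrals\<close>

lemma analytic_identity_real:
  fixes f g :: "complex \<Rightarrow> complex"
  assumes f: "f holomorphic_on S" and g: "g holomorphic_on S" and S: "open S" "connected S"
    and T: "T \<subseteq> S" "x \<in> S" "x islimpt T"
    and eq: "\<And>z. z \<in> T \<Longrightarrow> f z = g z" and z: "z \<in> S"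
  shows "f z = g z"
proof -
  have "f z - g z = 0"
    by (rule analytic_continuation[of "\<lambda>z. f z - g z" S T x])
      (use assms in \<open>auto intro!: holomorphic_intros\<close>)
  then show ?thesis by simp
qed

lemma real_islimpt:
  fixes x :: real
  assumes "open U" "x \<in> U"
  shows "complex_of_real x islimpt of_real ` U"
  unfolding islimpt_approachable
proof (intro allI impI)
  fix e :: real assume "e > 0"
  have "x islimpt U" using assms by (intro interior_limit_point) (simp add: interior_open)
  then obtain y where "y \<in> U" "y \<noteq> x" "dist y x < e"
    unfolding islimpt_approachable using \<open>e > 0\<close> by blast
  then show "\<exists>x'\<in>of_real ` U. x' \<noteq> complex_of_real x \<and> dist x' (complex_of_real x) < e"
    by (intro bexI[of _ "of_real y"]) (auto simp: dist_norm simp flip: of_real_diff)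
qed

lemma
  assumes "a > 0" "b > (0::real)"
  shows set_integrable_Beta: "set_integrable lborel {0<..<1} (\<lambda>x. x powr (a - 1) * (1 - x) powr (b - 1))"
    and set_integral_Beta: "(LINT x:{0<..<1}|lborel. x powr (a - 1) * (1 - x) powr (b - 1)) = Beta a b"
proof -
  have eq: "indicator {0<..<1} x *\<^sub>R (x powr (a - 1) * (1 - x) powr (b - 1))
      = indicator {0..1} x *\<^sub>R (x powr (a - 1) * (1 - x) powr (b - 1))" for x :: real
    by (auto simp: indicator_def)
  show "set_integrable lborel {0<..<1} (\<lambda>x. x powr (a - 1) * (1 - x) powr (b - 1))"
    using integrable_Beta[OF assms] unfolding set_integrable_def eq .
  have "(LINT x:{0..1}|lborel. x powr (a - 1) * (1 - x) powr (b - 1)) = Beta a b"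
    using set_borel_integral_eq_integral(2)[OF integrable_Beta[OF assms]]
      integral_unique[OF has_integral_Beta_real[OF assms]] by simp
  then show "(LINT x:{0<..<1}|lborel. x powr (a - 1) * (1 - x) powr (b - 1)) = Beta a b"
    unfolding set_lebesgue_integral_def eq .
qed

text \<open>The power x^s for x > 0, written with the real logarithm: it is entire in s and
  measurable in x, with no branch of a complex power to watch.\<close>

definition cpow :: "real \<Rightarrow> complex \<Rightarrow> complex" where
  "cpow x s = exp (s * of_real (ln x))"

lemma norm_cpow: "x > 0 \<Longrightarrow> norm (cpow x s) = x powr Re s"
  by (simp add: cpow_def powr_def)

lemma cpow_of_real: "x > 0 \<Longrightarrow> cpow x (of_real a) = of_real (x powr a)"
  by (simp add: cpow_def powr_def exp_of_real flip: of_real_mult)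

lemma cpow_add: "cpow x (s + t) = cpow x s * cpow x t"
  by (simp add: cpow_def ring_distribs exp_add)

lemma cpow_0 [simp]: "cpow x 0 = 1"
  by (simp add: cpow_def)

lemma measurable_cpow [measurable]: "(\<lambda>x. cpow x s) \<in> borel_measurable borel"
  unfolding cpow_def by measurable

lemma holomorphic_cpow [holomorphic_intros]:
  "f holomorphic_on A \<Longrightarrow> (\<lambda>s. cpow x (f s)) holomorphic_on A"
  unfolding cpow_def by (intro holomorphic_intros)

text \<open>For real z this is the classical Beta integral. Both sides are holomorphic for Re z > 0,
  and the identity theorem carries the equation over from the positive axis.\<close>

lemma
  assumes b: "b > (0::real)" and z: "Re z > 0"
  shows set_integrable_complex_Beta:
      "set_integrable lborel {0<..<1} (\<lambda>x. cpow x (z - 1) * of_real ((1 - x) powr (b - 1)))"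
    and set_integral_complex_Beta:
      "(LINT x:{0<..<1}|lborel. cpow x (z - 1) * of_real ((1 - x) powr (b - 1))) = Beta z (of_real b)"
proof -
  define f where "f z x = indicator {0<..<1} x *\<^sub>R (cpow x (z - 1) * of_real ((1 - x) powr (b - 1)))" for z and x :: real
  have m: "f z \<in> borel_measurable lborel" for z unfolding f_def by measurable
  have bound: "norm (f u x) \<le> indicator {0<..<1} x *\<^sub>R (x powr (r - 1) * (1 - x) powr (b - 1))"
    if "Re u \<ge> r" for u r x
    using that by (auto simp: f_def indicator_def norm_mult norm_cpow intro!: mult_right_mono powr_mono')
  show "set_integrable lborel {0<..<1} (\<lambda>x. cpow x (z - 1) * of_real ((1 - x) powr (b - 1)))"
    unfolding set_integrable_def
    by (rule Bochner_Integration.integrable_bound[OF set_integrable_Beta[OF z b, unfolded set_integrable_def] m[unfolded f_def]])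
      (use bound[of "Re z" z] in \<open>auto intro!: AE_I2 order_trans[OF _ abs_ge_self] simp: f_def\<close>)
  have "(\<integral>x. f z x \<partial>lborel) = Beta z (of_real b)"
  proof (rule analytic_identity_real[where f="\<lambda>z. \<integral>x. f z x \<partial>lborel" and g="\<lambda>z. Beta z (of_real b)" and S="{z. Re z > 0}" and T="of_real ` {0<..}" and x=1])
    show "(\<lambda>z. \<integral>x. f z x \<partial>lborel) holomorphic_on {z. Re z > 0}"
    proof (rule holomorphic_on_dominated_integral)
      fix u :: complex assume u: "u \<in> {z. Re z > 0}"
      show "\<exists>r>0. cball u r \<subseteq> {z. 0 < Re z} \<and> (\<exists>g. integrable lborel g \<and>
          (\<forall>v\<in>cball u r. \<forall>x\<in>space lborel. cmod (f v x) \<le> g x))"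
      proof (intro exI[of _ "Re u / 2"] conjI exI[of _ "\<lambda>x. indicator {0<..<1} x *\<^sub>R (x powr (Re u / 2 - 1) * (1 - x) powr (b - 1))"] ballI)
        have R: "Re v \<ge> Re u / 2" if "v \<in> cball u (Re u / 2)" for v
          using that abs_Re_le_cmod[of "u - v"] by (auto simp: dist_norm)
        show "cball u (Re u / 2) \<subseteq> {z. 0 < Re z}" using R u by force
        show "cmod (f v x) \<le> indicator {0<..<1} x *\<^sub>R (x powr (Re u / 2 - 1) * (1 - x) powr (b - 1))"
          if "v \<in> cball u (Re u / 2)" for v x
          by (rule bound[OF R[OF that]])
        show "integrable lborel (\<lambda>x. indicator {0<..<1} x *\<^sub>R (x powr (Re u / 2 - 1) * (1 - x) powr (b - 1)))"
          using set_integrable_Beta[of "Re u / 2" b] u b unfolding set_integrable_def by auto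
      qed (use u in auto)
    qed (auto simp: f_def m open_halfspace_Re_gt intro!: holomorphic_intros m[unfolded f_def])
    show "(\<lambda>z. Beta z (of_real b)) holomorphic_on {z. Re z > 0}"
    proof (intro holomorphic_intros)
      have "complex_of_real b \<notin> \<int>\<^sub>\<le>\<^sub>0"
        using b nonpos_Ints_nonpos[of b] by (auto simp: of_real_in_nonpos_Ints_iff)
      then show "z \<notin> \<int>\<^sub>\<le>\<^sub>0" "complex_of_real b \<notin> \<int>\<^sub>\<le>\<^sub>0" if "z \<in> {z. Re z > 0}" for z
        using that by (auto elim!: nonpos_Ints_cases)
    qed
    show "connected {z. Re z > 0}" by (intro convex_connected convex_halfspace_Re_gt)
    show "1 islimpt complex_of_real ` {0<..}" using real_islimpt[of "{0<..}" 1] by simp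
    show "(\<integral>x. f z x \<partial>lborel) = Beta z (of_real b)" if "z \<in> complex_of_real ` {0<..}" for z
    proof -
      obtain a where a: "z = of_real a" "a > 0" using \<open>z \<in> _\<close> by auto
      have "f z x = of_real (indicator {0<..<1} x *\<^sub>R (x powr (a - 1) * (1 - x) powr (b - 1)))" for x
        using cpow_of_real[of x "a - 1"] by (auto simp: f_def a indicator_def)
      then have "(\<integral>x. f z x \<partial>lborel) = of_real (\<integral>x. indicator {0<..<1} x *\<^sub>R (x powr (a - 1) * (1 - x) powr (b - 1)) \<partial>lborel)"
        by (simp only: integral_complex_of_real)
      also have "\<dots> = of_real (Beta a b)"
        using set_integral_Beta[OF a(2) b] by (simp only: set_lebesgue_integral_def)
      finally show ?thesis unfolding a by (simp add: Beta_complex_of_real)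
    qed
  qed (use z open_halfspace_Re_gt[of 0] in auto)
  then show "(LINT x:{0<..<1}|lborel. cpow x (z - 1) * of_real ((1 - x) powr (b - 1))) = Beta z (of_real b)"
    unfolding set_lebesgue_integral_def f_def .
qed

text \<open>Taylor's formula at 1 along the segment from 1/2 to 1, where the principal complex power
  is holomorphic with bounded derivatives. The first-order bound serves real powers in
  \<open>powr_taylor_bound\<close>, the second-order bound the integrability of
  \<open>beta_kernel\<close>.\<close>

lemma cpow_taylor_bounds:
  fixes s :: complex
  shows "\<exists>C\<ge>0. \<forall>x\<in>{1/2..<1}. norm (cpow x s - 1) \<le> C * (1 - x) \<and> norm (cpow x s - 1 - s * (complex_of_real x - 1)) \<le> C * (1 - x)\<^sup>2"
proof -
  let ?S = "closed_segment (1/2) (1::complex)"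
  \<comment> \<open>The function z^s and its first two derivatives, indexed as
    \<open>field_Taylor\<close> expects them.\<close>
  define f where "f i z = (if i = 0 then z powr s else if i = 1 then s * z powr (s - 1) else s * (s - 1) * z powr (s - 2))"
    for i :: nat and z
  have pos: "Re z > 0" if "z \<in> ?S" for z
  proof -
    have "?S \<subseteq> {z. Re z \<ge> 1/2}"
      by (intro closed_segment_subset convex_halfspace_Re_ge) auto
    then have "z \<in> {z. Re z \<ge> 1/2}" using that by (rule subsetD)
    then show ?thesis by simp
  qed
  then have nz: "z \<notin> \<real>\<^sub>\<le>\<^sub>0" if "z \<in> ?S" for z using pos[OF that] by (auto simp: complex_nonpos_Reals_iff)
  have d: "(f i has_field_derivative f (Suc i) z) (at z within ?S)" if "z \<in> ?S" "i \<le> 1" for i z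
  proof -
    have *: "((\<lambda>z. z powr t) has_field_derivative t * z powr (t - 1)) (at z within ?S)" for t
      using has_field_derivative_powr[OF nz[OF that(1)], of t] by (rule has_field_derivative_at_within)
    have "i = 0 \<or> i = 1" using that by auto
    then show ?thesis
    proof
      assume "i = 0"
      then show ?thesis using *[of s] by (simp add: f_def[abs_def])
    next
      assume "i = 1"
      moreover have "((\<lambda>z. s * z powr (s - 1)) has_field_derivative s * ((s - 1) * z powr (s - 1 - 1))) (at z within ?S)"
        by (rule DERIV_cmult[OF *])
      ultimately show ?thesis by (simp add: f_def[abs_def] mult.assoc)
    qed
  qed
  have "bounded (f i ` ?S)" for i
    unfolding f_def
  proof (intro compact_imp_bounded compact_continuous_image compact_segment)
    have "continuous_on ?S (\<lambda>z. z powr t)" for t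
      by (rule holomorphic_on_imp_continuous_on) (use nz in \<open>auto intro!: holomorphic_intros\<close>)
    then show "continuous_on ?S (\<lambda>z. if i = 0 then z powr s else if i = 1 then s * z powr (s - 1) else s * (s - 1) * z powr (s - 2))"
      by (cases "i = 0"; cases "i = 1") (auto intro!: continuous_on_mult continuous_on_const)
  qed
  then have "\<forall>i. \<exists>b. \<forall>z\<in>?S. norm (f i z) \<le> b" by (auto simp: bounded_iff)
  then obtain B where B': "\<forall>i. \<forall>z\<in>?S. norm (f i z) \<le> B i" by (rule choice[THEN exE])
  then have B: "norm (f i z) \<le> B i" if "z \<in> ?S" for i z using that by blast
  have B0: "B i \<ge> 0" for i by (rule order_trans[OF norm_ge_zero B[OF ends_in_segment(2)]])
  show ?thesis
  proof (intro exI[of _ "B 1 + B 2"] conjI ballI)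
    show "0 \<le> B 1 + B 2" using B0 by simp
    fix x :: real assume x: "x \<in> {1/2..<1}"
    have xS: "of_real x \<in> ?S"
      unfolding in_segment by (rule exI[of _ "2 * x - 1"]) (use x in \<open>auto simp: complex_eq_iff field_simps\<close>)
    have "norm (of_real x - 1 :: complex) = \<bar>x - 1\<bar>"
      using norm_of_real[of "x - 1", where 'a=complex] by (simp del: norm_of_real)
    then have n: "norm (of_real x - 1 :: complex) = 1 - x" using x by simp
    have f0: "f 0 (of_real x) = cpow x s" using x by (simp add: f_def cpow_def powr_def Ln_of_real)
    have f1: "f 0 1 = 1" "f 1 1 = s" by (auto simp: f_def)
    have "norm (f 0 (of_real x) - (\<Sum>i\<le>0. f i 1 * (complex_of_real x - 1) ^ i / fact i)) \<le> B 1 * norm (of_real x - 1 :: complex) ^ Suc 0 / fact 0"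
    proof (rule field_Taylor[OF convex_closed_segment])
      show "(f i has_field_derivative f (Suc i) z) (at z within ?S)" if "z \<in> ?S" "i \<le> 0" for i z
        using d[OF that(1), of i] that(2) by (simp only: le_0_eq zero_le)
      show "norm (f (Suc 0) z) \<le> B 1" if "z \<in> ?S" for z using B[OF that, of 1] by (simp only: One_nat_def)
    qed (rule ends_in_segment xS)+
    then have a: "norm (cpow x s - 1) \<le> B 1 * (1 - x)" by (simp add: f0 f1 n)
    have "norm (f 0 (of_real x) - (\<Sum>i\<le>1. f i 1 * (complex_of_real x - 1) ^ i / fact i)) \<le> B 2 * norm (of_real x - 1 :: complex) ^ Suc 1 / fact 1"
    proof (rule field_Taylor[OF convex_closed_segment])
      show "(f i has_field_derivative f (Suc i) z) (at z within ?S)" if "z \<in> ?S" "i \<le> 1" for i z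
        by (rule d[OF that])
      show "norm (f (Suc 1) z) \<le> B 2" if "z \<in> ?S" for z using B[OF that, of 2] by (simp only: numeral_2_eq_2 One_nat_def)
    qed (rule ends_in_segment xS)+
    then have b: "norm (cpow x s - 1 - s * (complex_of_real x - 1)) \<le> B 2 * (1 - x)\<^sup>2"
      by (simp add: f0 f1 f1(2)[unfolded One_nat_def] n power2_eq_square algebra_simps)
    have "B 1 * (1 - x) \<le> (B 1 + B 2) * (1 - x)" "B 2 * (1 - x)\<^sup>2 \<le> (B 1 + B 2) * (1 - x)\<^sup>2"
      using B0 x by (auto intro!: mult_right_mono)
    with a b show "norm (cpow x s - 1) \<le> (B 1 + B 2) * (1 - x)"
        "norm (cpow x s - 1 - s * (complex_of_real x - 1)) \<le> (B 1 + B 2) * (1 - x)\<^sup>2"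
      by linarith+
  qed
qed

lemma cpow_second_order_bound:
  fixes s :: complex
  shows "\<exists>C\<ge>0. \<forall>x\<in>{0<..<1}. norm (cpow x s - 1 - s * (complex_of_real x - 1)) \<le> C * (1 - x)\<^sup>2 * (1 + x powr Re s)"
proof -
  obtain C where C: "C \<ge> 0" "\<And>x. x \<in> {1/2..<1} \<Longrightarrow> norm (cpow x s - 1 - s * (complex_of_real x - 1)) \<le> C * (1 - x)\<^sup>2"
    using cpow_taylor_bounds[of s] by auto
  \<comment> \<open>Below 1/2 the factor (1 - x)^2 is at least 1/4, so 4 (1 + |s|) absorbs the crude
    triangle bound; above 1/2 the Taylor constant \<open>C\<close> is enough.\<close>
  define D where "D = max C (4 * (1 + norm s))"
  have D: "D \<ge> 0" "C \<le> D" "4 * (1 + norm s) \<le> D" using C(1) by (auto simp: D_def le_max_iff_disj)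
  have "norm (cpow x s - 1 - s * (complex_of_real x - 1)) \<le> D * (1 - x)\<^sup>2 * (1 + x powr Re s)" if x: "x \<in> {0<..<1}" for x
  proof (cases "x \<ge> 1/2")
    case True
    then have "norm (cpow x s - 1 - s * (complex_of_real x - 1)) \<le> C * (1 - x)\<^sup>2" using C x by auto
    also have "\<dots> \<le> D * (1 - x)\<^sup>2" using D by (intro mult_right_mono) auto
    also have "\<dots> \<le> D * (1 - x)\<^sup>2 * (1 + x powr Re s)" using D mult_left_mono[of 1 "1 + x powr Re s" "D * (1 - x)\<^sup>2"] by simp
    finally show ?thesis .
  next
    case False
    have "norm (of_real x - 1 :: complex) = \<bar>x - 1\<bar>"
      using norm_of_real[of "x - 1", where 'a=complex] by (simp del: norm_of_real)
    then have n: "norm (of_real x - 1 :: complex) \<le> 1" using x by simp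
    have "norm (cpow x s - 1 - s * (complex_of_real x - 1)) \<le> norm (cpow x s) + 1 + norm s * norm (of_real x - 1 :: complex)"
      using norm_triangle_ineq4[of "cpow x s - 1" "s * (complex_of_real x - 1)"] norm_triangle_ineq4[of "cpow x s" 1]
      by (simp add: norm_mult)
    also have "\<dots> \<le> x powr Re s + 1 + norm s"
      using x mult_left_le[OF n, of "norm s"] by (simp add: norm_cpow)
    also have "\<dots> \<le> (1 + norm s) * (1 + x powr Re s)" by (simp add: algebra_simps)
    also have "\<dots> \<le> (D * (1 - x)\<^sup>2) * (1 + x powr Re s)"
    proof (intro mult_right_mono)
      have "(1/2)\<^sup>2 \<le> (1 - x)\<^sup>2" using False x by (intro power_mono) auto
      then have "(4 * (1 + norm s)) * (1/4) \<le> D * (1 - x)\<^sup>2"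
        using D by (intro mult_mono) (auto simp: power2_eq_square)
      then show "1 + norm s \<le> D * (1 - x)\<^sup>2" by simp
    qed simp
    finally show ?thesis by simp
  qed
  then show ?thesis using D by blast
qed

text \<open>Subtracting the first-order Taylor polynomial of x^s at 1 leaves a zero of second order,
  so the singularity (1 - x)^(-a-1) is integrable at 1 for Re a < 2. The parameter a is complex so
  that the integral can be continued analytically in it.\<close>

definition beta_kernel :: "complex \<Rightarrow> complex \<Rightarrow> real \<Rightarrow> complex" where
  "beta_kernel s a x = (cpow x s - 1 - s * (complex_of_real x - 1)) * cpow (1 - x) (- a - 1)"

text \<open>The Beta integral with its second argument continued analytically to \<open>-a\<close>, \<open>Re a < 2\<close>.\<close>

lemma
  assumes s: "Re s > -1"
  shows set_integrable_beta_kernel: "Re a < 2 \<Longrightarrow> set_integrable lborel {0<..<1} (beta_kernel s a)"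
    and set_integral_beta_kernel: "Re a < 2 \<Longrightarrow> a \<noteq> 0 \<Longrightarrow> a \<noteq> 1 \<Longrightarrow>
      (LINT x:{0<..<1}|lborel. beta_kernel s a x)
        = Gamma (s + 1) * Gamma (- a) * rGamma (s + 1 - a) + 1 / a + s / (1 - a)"
proof -
  obtain C where C: "C \<ge> 0" "\<And>x. x \<in> {0<..<1} \<Longrightarrow>
      norm (cpow x s - 1 - s * (complex_of_real x - 1)) \<le> C * (1 - x)\<^sup>2 * (1 + x powr Re s)"
    using cpow_second_order_bound[of s] by auto
  define f where "f a x = indicator {0<..<1} x *\<^sub>R beta_kernel s a x" for a x
  define g where "g r x = C * (indicator {0<..<1} x *\<^sub>R (x powr (1 - 1) * (1 - x) powr ((2 - r) - 1))
      + indicator {0<..<1} x *\<^sub>R (x powr ((Re s + 1) - 1) * (1 - x) powr ((2 - r) - 1)))" for r x :: real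
  have m: "f a \<in> borel_measurable lborel" for a unfolding f_def beta_kernel_def by measurable
  have bound: "norm (f a x) \<le> g r x" if "Re a \<le> r" for a x r
  proof (cases "x \<in> {0<..<1}")
    case True
    have "norm (f a x) = norm (cpow x s - 1 - s * (complex_of_real x - 1)) * (1 - x) powr (- Re a - 1)"
      using True by (simp add: f_def beta_kernel_def norm_mult norm_cpow)
    also have "\<dots> \<le> (C * (1 - x)\<^sup>2 * (1 + x powr Re s)) * (1 - x) powr (- r - 1)"
      using True that C by (intro mult_mono powr_mono') auto
    also have "(1 - x)\<^sup>2 = (1 - x) powr 2" using True by (simp add: powr_realpow flip: powr_numeral)
    also have "(C * (1 - x) powr 2 * (1 + x powr Re s)) * (1 - x) powr (- r - 1)
        = C * (1 + x powr Re s) * ((1 - x) powr 2 * (1 - x) powr (- r - 1))" by simp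
    also have "(1 - x) powr 2 * (1 - x) powr (- r - 1) = (1 - x) powr ((2 - r) - 1)"
      by (simp flip: powr_add)
    also have "C * (1 + x powr Re s) * (1 - x) powr ((2 - r) - 1) = g r x"
      using True by (simp add: g_def algebra_simps)
    finally show ?thesis .
  qed (simp add: f_def g_def)
  have gi: "integrable lborel (g r)" if "r < 2" for r
    unfolding g_def
    by (intro integrable_mult_right Bochner_Integration.integrable_add set_integrable_Beta[unfolded set_integrable_def])
      (use that s in auto)
  show int: "set_integrable lborel {0<..<1} (beta_kernel s a)" if a: "Re a < 2" for a
    unfolding set_integrable_def
    by (rule Bochner_Integration.integrable_bound[OF gi[OF a] m[unfolded f_def]])
      (use bound[of a "Re a"] in \<open>auto intro!: AE_I2 order_trans[OF _ abs_ge_self] simp: f_def\<close>)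
  show "(LINT x:{0<..<1}|lborel. beta_kernel s a x)
        = Gamma (s + 1) * Gamma (- a) * rGamma (s + 1 - a) + 1 / a + s / (1 - a)"
    if a: "Re a < 2" "a \<noteq> 0" "a \<noteq> 1"
  proof -
    \<comment> \<open>In the half-plane Re a < 2 the poles of Gamma (- a), 1 / a and 1 / (1 - a) are
      only 0 and 1; removing two points keeps the region connected.\<close>
    let ?S = "{a. Re a < 2} - {0, 1::complex}"
    have "(\<integral>x. f a x \<partial>lborel) = Gamma (s + 1) * Gamma (- a) * rGamma (s + 1 - a) + 1 / a + s / (1 - a)"
    proof (rule analytic_identity_real[where f="\<lambda>a. \<integral>x. f a x \<partial>lborel"
        and g="\<lambda>a. Gamma (s + 1) * Gamma (- a) * rGamma (s + 1 - a) + 1 / a + s / (1 - a)" and S="?S" and T="of_real ` {..<0}" and x="-1"])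
      have "(\<lambda>a. \<integral>x. f a x \<partial>lborel) holomorphic_on {a. Re a < 2}"
      proof (rule holomorphic_on_dominated_integral)
        fix u :: complex assume u: "u \<in> {a. Re a < 2}"
        define r where "r = (2 - Re u) / 2"
        show "\<exists>r>0. cball u r \<subseteq> {a. Re a < 2} \<and> (\<exists>g. integrable lborel g \<and>
            (\<forall>v\<in>cball u r. \<forall>x\<in>space lborel. cmod (f v x) \<le> g x))"
        proof (intro exI[of _ r] conjI exI[of _ "g (Re u + r)"] ballI)
          have R: "Re v \<le> Re u + r" if "v \<in> cball u r" for v
            using that abs_Re_le_cmod[of "u - v"] by (auto simp: dist_norm)
          show "cball u r \<subseteq> {a. Re a < 2}"
          proof
            fix v assume "v \<in> cball u r"
            then have "Re v \<le> Re u + r" by (rule R)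
            then show "v \<in> {a. Re a < 2}" using u by (simp add: r_def field_simps)
          qed
          show "cmod (f v x) \<le> g (Re u + r) x" if "v \<in> cball u r" for v x by (rule bound[OF R[OF that]])
          show "integrable lborel (g (Re u + r))" by (rule gi) (use u in \<open>auto simp: r_def field_simps\<close>)
        qed (use u in \<open>auto simp: r_def\<close>)
      qed (auto simp: f_def beta_kernel_def open_halfspace_Re_lt intro!: holomorphic_intros m[unfolded f_def beta_kernel_def])
      then show "(\<lambda>a. \<integral>x. f a x \<partial>lborel) holomorphic_on ?S" by (rule holomorphic_on_subset) auto
      have np: "- z \<notin> \<int>\<^sub>\<le>\<^sub>0" if "z \<in> ?S" for z
      proof
        assume "- z \<in> \<int>\<^sub>\<le>\<^sub>0"
        then obtain n :: nat where n: "z = of_nat n" by (auto elim!: nonpos_Ints_cases')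
        then have "real n < 2" using that by auto
        then have "n = 0 \<or> n = 1" by auto
        then show False using that n by auto
      qed
      show "(\<lambda>a. Gamma (s + 1) * Gamma (- a) * rGamma (s + 1 - a) + 1 / a + s / (1 - a)) holomorphic_on ?S"
        by (intro holomorphic_intros) (use np in auto)
      show "open ?S" using open_halfspace_Re_lt[of 2] by (intro open_Diff) auto
      show "connected ?S"
        by (rule connected_open_delete_finite)
          (auto simp: open_halfspace_Re_lt intro!: convex_connected convex_halfspace_Re_lt)
      show "-1 islimpt complex_of_real ` {..<0}" using real_islimpt[of "{..<0}" "-1"] by simp
      \<comment> \<open>For real a < 0 the three summands of the kernel are integrable one by one
        and give B (s + 1, - a) - B (1, - a) + s B (1, 1 - a).\<close>
      show "(\<integral>x. f z x \<partial>lborel) = Gamma (s + 1) * Gamma (- z) * rGamma (s + 1 - z) + 1 / z + s / (1 - z)"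
        if "z \<in> complex_of_real ` {..<0}" for z
      proof -
        obtain r where r: "z = of_real r" "r < 0" using \<open>z \<in> _\<close> by auto
        have B: "set_integrable lborel {0<..<1} (\<lambda>x. cpow x (u - 1) * of_real ((1 - x) powr (b - 1)))"
          "(LINT x:{0<..<1}|lborel. cpow x (u - 1) * of_real ((1 - x) powr (b - 1))) = Beta u (of_real b)"
          if "Re u > 0" "b > 0" for u b
          using set_integrable_complex_Beta[OF that(2,1)] set_integral_complex_Beta[OF that(2,1)] by auto
        have B1: "Beta 1 (complex_of_real b) = 1 / of_real b" if "b > 0" for b
        proof -
          have nz: "complex_of_real b \<notin> \<int>\<^sub>\<le>\<^sub>0"
            using that nonpos_Ints_nonpos[of b] by (auto simp: of_real_in_nonpos_Ints_iff)
          show ?thesis using Gamma_plus1[of "complex_of_real b"] nz that Gamma_eq_zero_iff[of "complex_of_real b"]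
            by (simp add: Beta_def add.commute)
        qed
        have "beta_kernel s z x = cpow x ((s + 1) - 1) * of_real ((1 - x) powr (- r - 1))
            - cpow x (1 - 1) * of_real ((1 - x) powr (- r - 1))
            + s * (cpow x (1 - 1) * of_real ((1 - x) powr ((1 - r) - 1)))" if x: "x \<in> {0<..<1}" for x
        proof -
          have c: "cpow (1 - x) (- z - 1) = of_real ((1 - x) powr (- r - 1))"
            using cpow_of_real[of "1 - x" "- r - 1"] x by (simp add: r)
          have "(1 - x) powr ((1 - r) - 1) = (1 - x) * (1 - x) powr (- r - 1)"
            using x by (simp add: powr_mult_base)
          then have e: "complex_of_real ((1 - x) powr ((1 - r) - 1))
              = (1 - complex_of_real x) * of_real ((1 - x) powr (- r - 1))"
            by (simp only: of_real_mult of_real_diff of_real_1)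
          show ?thesis unfolding beta_kernel_def c e by (simp add: ring_distribs)
        qed
        then have "(LINT x:{0<..<1}|lborel. beta_kernel s z x) = (LINT x:{0<..<1}|lborel.
            (cpow x ((s + 1) - 1) * of_real ((1 - x) powr (- r - 1))
            - cpow x (1 - 1) * of_real ((1 - x) powr (- r - 1)))
            + s * (cpow x (1 - 1) * of_real ((1 - x) powr ((1 - r) - 1))))"
          by (intro set_lebesgue_integral_cong) auto
        also have "\<dots> = (Beta (s + 1) (of_real (- r)) - Beta 1 (of_real (- r))) + s * Beta 1 (of_real (1 - r))"
        proof -
          have 1: "Re (s + 1) > 0" "- r > 0" and 2: "Re 1 > 0" "- r > 0" and 3: "Re 1 > 0" "1 - r > 0"
            using s r by auto
          note I = B(1)[OF 1] B(1)[OF 2] B(1)[OF 3]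
          show ?thesis
            unfolding set_integral_add(2)[OF set_integral_diff(1)[OF I(1,2)] set_integrable_mult_right[OF I(3)]]
              set_integral_diff(2)[OF I(1,2)] set_integral_mult_right B(2)[OF 1] B(2)[OF 2] B(2)[OF 3] ..
        qed
        also have "Beta (s + 1) (of_real (- r)) = Gamma (s + 1) * Gamma (- z) * rGamma (s + 1 - z)"
          by (simp add: Beta_altdef r)
        finally show ?thesis
          using r B1[of "- r"] B1[of "1 - r"] unfolding f_def set_lebesgue_integral_def by simp
      qed
    qed (use a in auto)
    then show ?thesis unfolding f_def set_lebesgue_integral_def .
  qed
qed

section \<open>The integral in the Lamperti exponent\<close>

lemma emeasure_exp_tail: "(\<integral>\<^sup>+u. ennreal (exp (- u)) * indicator {a..} u \<partial>lborel) = ennreal (exp (- a))"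
proof -
  have "(\<integral>\<^sup>+u. ennreal (exp (- u)) * indicator {a..} u \<partial>lborel) = ennreal (0 - (- exp (- a)))"
  proof (rule nn_integral_FTC_atLeast)
    show "((\<lambda>u. - exp (- u)) \<longlongrightarrow> (0::real)) at_top" by real_asymp
  qed (auto intro!: derivative_eq_intros)
  then show ?thesis by simp
qed

text \<open>If u is standard exponential, then exp (- u) is uniform on (0, 1). Stated for measures
  and checked on distribution functions, this change of variables applies to complex integrands
  without any regularity.\<close>

lemma distr_exp_neg:
  "distr (density lborel (\<lambda>u. ennreal (indicator {0<..} u * exp (- u)))) borel (\<lambda>u. exp (- u))
    = density lborel (\<lambda>x. ennreal (indicator {0<..<1::real} x))" (is "?M = ?N")
proof -
  have M: "emeasure ?M A = (\<integral>\<^sup>+u. ennreal (indicator {0<..} u * exp (- u)) * indicator {u. exp (- u) \<in> A} u \<partial>lborel)"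
    if "A \<in> sets borel" for A
    using that by (subst emeasure_distr) (auto simp: emeasure_density vimage_def intro!: nn_integral_cong)
  have N: "emeasure ?N A = emeasure lborel ({0<..<1} \<inter> A)" if "A \<in> sets borel" for A
  proof -
    have "emeasure ?N A = (\<integral>\<^sup>+u. ennreal (indicator {0<..<1} u) * indicator A u \<partial>lborel)"
      using that by (subst emeasure_density) auto
    also have "\<dots> = (\<integral>\<^sup>+u. indicator ({0<..<1} \<inter> A) u \<partial>lborel)"
      by (intro nn_integral_cong) (auto split: split_indicator)
    finally have "emeasure ?N A = (\<integral>\<^sup>+u. indicator ({0<..<1} \<inter> A) u \<partial>lborel)" .
    then show ?thesis using that by simp
  qed
  have one: "(\<integral>\<^sup>+u. ennreal (indicator {0<..} u * exp (- u)) \<partial>lborel) = 1"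
  proof -
    have "(\<integral>\<^sup>+u. ennreal (indicator {0<..} u * exp (- u)) \<partial>lborel)
        = (\<integral>\<^sup>+u. ennreal (exp (- u)) * indicator {0::real..} u \<partial>lborel)"
      by (rule nn_integral_cong_AE)
        (use AE_lborel_singleton[of "0::real"] in \<open>eventually_elim, auto simp: indicator_def\<close>)
    then show ?thesis by (simp add: emeasure_exp_tail)
  qed
  have eq: "emeasure ?M {..x} = emeasure ?N {..x}" for x
  proof -
    consider "x \<le> 0" | "0 < x" "x < 1" | "1 \<le> x" by linarith
    then show ?thesis
    proof cases
      case 1
      then have "exp (- u) \<le> x \<longleftrightarrow> False" for u :: real
        using exp_gt_zero[of "- u"] by (auto simp: not_le simp del: exp_gt_zero)
      then have a: "emeasure ?M {..x} = 0" by (subst M) auto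
      have "{0<..<1} \<inter> {..x} = {}" using 1 by auto
      then show ?thesis using a by (subst N) auto
    next
      case 2
      have *: "exp (- u) \<le> x \<longleftrightarrow> - ln x \<le> u" for u :: real
        using 2 ln_ge_iff[of x "- u"] by auto
      have "- ln x > 0" using 2 by simp
      then have "emeasure ?M {..x} = (\<integral>\<^sup>+u. ennreal (exp (- u)) * indicator {- ln x..} u \<partial>lborel)"
        by (subst M) (auto intro!: nn_integral_cong simp: * indicator_def)
      also have "\<dots> = ennreal x" using 2 by (simp add: emeasure_exp_tail)
      finally have a: "emeasure ?M {..x} = ennreal x" .
      have "{0<..<1} \<inter> {..x} = {0<..x}" using 2 by auto
      then show ?thesis unfolding a using 2 by (subst N) auto
    next
      case 3
      have "emeasure ?M {..x} = (\<integral>\<^sup>+u. ennreal (indicator {0<..} u * exp (- u)) \<partial>lborel)"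
      proof (subst M)
        show "(\<integral>\<^sup>+u. ennreal (indicator {0<..} u * exp (- u)) * indicator {u. exp (- u) \<in> {..x}} u \<partial>lborel)
            = (\<integral>\<^sup>+u. ennreal (indicator {0<..} u * exp (- u)) \<partial>lborel)"
        proof (rule nn_integral_cong)
          fix u :: real
          have "exp (- u) \<le> x" if "u > 0"
            using that 3 order_trans[of "exp (- u)" 1 x] by simp
          then show "ennreal (indicator {0<..} u * exp (- u)) * indicator {u. exp (- u) \<in> {..x}} u
              = ennreal (indicator {0<..} u * exp (- u))" by (auto simp: indicator_def)
        qed
      qed simp
      moreover have "{0<..<1} \<inter> {..x} = {0<..<1}" using 3 by auto
      ultimately show ?thesis using one by (subst N) auto
    qed
  qed
  have "finite_borel_measure ?M" "finite_borel_measure ?N"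
    by (intro finite_borel_measure.intro finite_measureI finite_borel_measure_axioms.intro;
        use one in \<open>simp add: M N del: emeasure_density\<close>)+
  then show ?thesis
    by (rule cdf_unique') (simp add: fun_eq_iff cdf_def measure_def eq)
qed

lemma
  fixes g :: "real \<Rightarrow> complex"
  assumes [measurable]: "g \<in> borel_measurable borel"
  shows integrable_exp_neg_iff: "integrable lborel (\<lambda>u. indicator {0<..} u *\<^sub>R (exp (- u) *\<^sub>R g (exp (- u))))
      \<longleftrightarrow> set_integrable lborel {0<..<1} g"
    and integral_exp_neg: "(\<integral>u. indicator {0<..} u *\<^sub>R (exp (- u) *\<^sub>R g (exp (- u))) \<partial>lborel)
      = (LINT x:{0<..<1}|lborel. g x)"
proof -
  let ?D = "density lborel (\<lambda>u. ennreal (indicator {0<..} u * exp (- u)))"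
  have a: "integrable (density lborel (\<lambda>x. ennreal (indicator {0<..<1} x))) g \<longleftrightarrow> set_integrable lborel {0<..<1} g"
    unfolding set_integrable_def by (subst integrable_density) auto
  have b: "integrable (distr ?D borel (\<lambda>u. exp (- u))) g
      \<longleftrightarrow> integrable lborel (\<lambda>u. indicator {0<..} u *\<^sub>R (exp (- u) *\<^sub>R g (exp (- u))))"
    by (subst integrable_distr_eq, simp, simp, subst integrable_density) auto
  show "integrable lborel (\<lambda>u. indicator {0<..} u *\<^sub>R (exp (- u) *\<^sub>R g (exp (- u))))
      \<longleftrightarrow> set_integrable lborel {0<..<1} g"
    using a b unfolding distr_exp_neg by simp
  have c: "(\<integral>x. g x \<partial>density lborel (\<lambda>x. ennreal (indicator {0<..<1} x))) = (LINT x:{0<..<1}|lborel. g x)"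
    unfolding set_lebesgue_integral_def by (subst integral_density) auto
  have d: "(\<integral>x. g x \<partial>distr ?D borel (\<lambda>u. exp (- u)))
      = (\<integral>u. indicator {0<..} u *\<^sub>R (exp (- u) *\<^sub>R g (exp (- u))) \<partial>lborel)"
    by (subst integral_distr, simp, simp, subst integral_density) auto
  show "(\<integral>u. indicator {0<..} u *\<^sub>R (exp (- u) *\<^sub>R g (exp (- u))) \<partial>lborel) = (LINT x:{0<..<1}|lborel. g x)"
    using c d unfolding distr_exp_neg by simp
qed

lemma powr_taylor_bound:
  fixes p :: real
  shows "\<exists>C\<ge>0. \<forall>x\<in>{1/2..<1}. \<bar>1 - x powr p\<bar> \<le> C * (1 - x)"
proof -
  obtain C where C: "C \<ge> 0" "\<forall>x\<in>{1/2..<1}. norm (cpow x (of_real p) - 1) \<le> C * (1 - x)"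
    using cpow_taylor_bounds[of "of_real p"] by blast
  have "\<bar>1 - x powr p\<bar> \<le> C * (1 - x)" if "x \<in> {1/2..<1}" for x
  proof -
    have "norm (cpow x (of_real p) - 1) = \<bar>x powr p - 1\<bar>"
      using cpow_of_real[of x p] norm_of_real[of "x powr p - 1", where 'a=complex] that by simp
    then show ?thesis using C(2) that by (metis abs_minus_commute)
  qed
  then show ?thesis using C(1) by blast
qed

text \<open>Difference between the compensators \<open>e\<^sup>y - 1\<close> and \<open>1 - e\<^sup>-\<^sup>y\<close> on the positive half-line, after
  the substitution \<open>x = e\<^sup>-\<^sup>y\<close>.\<close>

definition compensator_defect :: "real \<Rightarrow> real \<Rightarrow> real" where
  "compensator_defect \<alpha> x = (1 - x) powr (- \<alpha>) * (1 - x powr (\<alpha> - 2) * indicator {1/2<..} x)"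

text \<open>Near 1 the bracket is of order 1 - x and lowers the order of the singularity by one; on
  (0, 1/2] the indicator vanishes and the function is bounded.\<close>

lemma set_integrable_compensator_defect:
  assumes \<alpha>: "\<alpha> < 2"
  shows "set_integrable lborel {0<..<1} (compensator_defect \<alpha>)"
proof -
  obtain C where C: "C \<ge> 0" "\<forall>x\<in>{1/2..<1}. \<bar>1 - x powr (\<alpha> - 2)\<bar> \<le> C * (1 - x)"
    using powr_taylor_bound by blast
  have *: "(1 - x) powr (- \<alpha>) * (1 - x) = (1 - x) powr ((2 - \<alpha>) - 1)" if "x < 1" for x
    using that by (simp add: powr_mult_base mult.commute)
  have "\<bar>compensator_defect \<alpha> x\<bar> \<le> (C + 2) * (x powr (1 - 1) * (1 - x) powr ((2 - \<alpha>) - 1))"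
    if x: "x \<in> {0<..<1}" for x
  proof (cases "x > 1/2")
    case True
    then have "\<bar>compensator_defect \<alpha> x\<bar> = (1 - x) powr (- \<alpha>) * \<bar>1 - x powr (\<alpha> - 2)\<bar>"
      by (simp add: compensator_defect_def abs_mult)
    also have "\<dots> \<le> (1 - x) powr (- \<alpha>) * ((C + 2) * (1 - x))"
    proof (intro mult_left_mono)
      have "\<bar>1 - x powr (\<alpha> - 2)\<bar> \<le> C * (1 - x)" using C True x by auto
      also have "\<dots> \<le> (C + 2) * (1 - x)" using x by (intro mult_right_mono) auto
      finally show "\<bar>1 - x powr (\<alpha> - 2)\<bar> \<le> (C + 2) * (1 - x)" .
    qed simp
    also have "\<dots> = (C + 2) * ((1 - x) powr (- \<alpha>) * (1 - x))" by simp
    finally show ?thesis using x * by simp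
  next
    case False
    then have "\<bar>compensator_defect \<alpha> x\<bar> = (1 - x) powr (- \<alpha>) * 1"
      by (simp add: compensator_defect_def)
    also have "\<dots> \<le> (1 - x) powr (- \<alpha>) * ((C + 2) * (1 - x))"
    proof (intro mult_left_mono)
      have "2 * (1/2) \<le> (C + 2) * (1 - x)" using False C by (intro mult_mono) auto
      then show "1 \<le> (C + 2) * (1 - x)" by simp
    qed simp
    also have "\<dots> = (C + 2) * ((1 - x) powr (- \<alpha>) * (1 - x))" by simp
    finally show ?thesis using x * by simp
  qed
  then have b: "norm (indicator {0<..<1} x *\<^sub>R compensator_defect \<alpha> x)
      \<le> (C + 2) * (indicator {0<..<1} x *\<^sub>R (x powr (1 - 1) * (1 - x) powr ((2 - \<alpha>) - 1)))" for x
    by (cases "x \<in> {0<..<1}") auto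
  show ?thesis
    unfolding set_integrable_def
  proof (rule Bochner_Integration.integrable_bound)
    show "integrable lborel (\<lambda>x. (C + 2) * (indicator {0<..<1} x *\<^sub>R (x powr (1 - 1) * (1 - x) powr ((2 - \<alpha>) - 1))))"
      using set_integrable_Beta[of 1 "2 - \<alpha>"] \<alpha> unfolding set_integrable_def by (intro integrable_mult_right) auto
    show "(\<lambda>x. indicator {0<..<1} x *\<^sub>R compensator_defect \<alpha> x) \<in> borel_measurable lborel"
      unfolding compensator_defect_def by measurable
    show "AE x in lborel. norm (indicator {0<..<1} x *\<^sub>R compensator_defect \<alpha> x)
      \<le> norm ((C + 2) * (indicator {0<..<1} x *\<^sub>R (x powr (1 - 1) * (1 - x) powr ((2 - \<alpha>) - 1))))"
      by (intro AE_I2 order_trans[OF b]) simp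
  qed
qed

text \<open>There are explicit primitives \<open>F\<close> on [0, 1/2] and \<open>G\<close> on
  [1/2, 1], and the boundary terms cancel because x / (1 - x) = 1 at x = 1/2. Exchanging the
  compensator on the positive half-line therefore adds no drift.\<close>

lemma set_integral_compensator_defect:
  assumes \<alpha>: "\<alpha> < 2" "\<alpha> \<noteq> 1"
  shows "(LINT x:{0<..<1}|lborel. compensator_defect \<alpha> x) = 0"
proof -
  define F where "F x = (1 - x) powr (1 - \<alpha>) / (\<alpha> - 1)" for x :: real
  \<comment> \<open>For \<alpha> > 1 the primitives of (1 - x)^(-\<alpha>) and of its multiple by
    x^(\<alpha>-2) are each unbounded at 1. In their difference the factor 1 - x^(\<alpha>-1)
    restores the limit 0.\<close>
  define G where "G x = (1 - x) powr (1 - \<alpha>) * (1 - x powr (\<alpha> - 1)) / (\<alpha> - 1)" for x :: real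
  obtain C where C: "C \<ge> 0" "\<forall>x\<in>{1/2..<1}. \<bar>1 - x powr (\<alpha> - 1)\<bar> \<le> C * (1 - x)"
    using powr_taylor_bound by blast
  have "((\<lambda>x. (1 - x) powr (- \<alpha>)) has_integral F (1/2) - F 0) {0..1/2}"
  proof (rule fundamental_theorem_of_calculus)
    fix x :: real assume x: "x \<in> {0..1/2}"
    have "(F has_real_derivative (1 - x) powr (- \<alpha>)) (at x)"
    proof -
      have "((\<lambda>x. (1 - x) powr (1 - \<alpha>)) has_real_derivative (1 - \<alpha>) * (1 - x) powr (1 - \<alpha> - 1) * (-1)) (at x)"
        using x by (auto intro!: derivative_eq_intros)
      then have "(F has_real_derivative (1 - \<alpha>) * (1 - x) powr (1 - \<alpha> - 1) * (-1) / (\<alpha> - 1)) (at x)"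
        unfolding F_def by (rule DERIV_cdivide)
      moreover have "(1 - \<alpha>) * (1 - x) powr (1 - \<alpha> - 1) * (-1) = (1 - x) powr (- \<alpha>) * (\<alpha> - 1)"
        by (simp add: algebra_simps)
      ultimately have "(F has_real_derivative (1 - x) powr (- \<alpha>) * (\<alpha> - 1) / (\<alpha> - 1)) (at x)"
        by (simp only:)
      then show ?thesis using \<alpha> by simp
    qed
    then show "(F has_vector_derivative (1 - x) powr (- \<alpha>)) (at x within {0..1/2})"
      by (auto simp: has_real_derivative_iff_has_vector_derivative[symmetric] intro: DERIV_subset)
  qed simp
  then have 1: "(compensator_defect \<alpha> has_integral F (1/2) - F 0) {0..1/2}"
    by (rule has_integral_eq[rotated]) (auto simp: compensator_defect_def)
  have "((\<lambda>x. (1 - x) powr (- \<alpha>) * (1 - x powr (\<alpha> - 2))) has_integral G 1 - G (1/2)) {1/2..1}"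
  proof (rule fundamental_theorem_of_calculus_interior)
    have c1: "isCont G x" if "x \<in> {1/2..<1}" for x
      unfolding G_def using that \<alpha> by (intro continuous_intros) auto
    have c2: "(G \<longlongrightarrow> G 1) (at 1 within {1/2..1})"
    proof -
      have "(G \<longlongrightarrow> 0) (at 1 within {1/2..1})"
      proof (rule Lim_null_comparison)
        show "\<forall>\<^sub>F x in at 1 within {1/2..1}. norm (G x) \<le> C / \<bar>\<alpha> - 1\<bar> * (1 - x) powr (2 - \<alpha>)"
        proof (rule eventually_at_filter[THEN iffD2], rule always_eventually, intro allI impI)
          fix x :: real assume x: "x \<noteq> 1" "x \<in> {1/2..1}"
          have "norm (G x) = (1 - x) powr (1 - \<alpha>) * \<bar>1 - x powr (\<alpha> - 1)\<bar> / \<bar>\<alpha> - 1\<bar>"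
            by (simp add: G_def abs_mult)
          also have "\<dots> \<le> (1 - x) powr (1 - \<alpha>) * (C * (1 - x)) / \<bar>\<alpha> - 1\<bar>"
            using C x by (intro divide_right_mono mult_left_mono) auto
          also have "\<dots> = C / \<bar>\<alpha> - 1\<bar> * ((1 - x) * (1 - x) powr (1 - \<alpha>))" by simp
          also have "(1 - x) * (1 - x) powr (1 - \<alpha>) = (1 - x) powr (2 - \<alpha>)"
            using x by (simp add: powr_mult_base)
          finally show "norm (G x) \<le> C / \<bar>\<alpha> - 1\<bar> * (1 - x) powr (2 - \<alpha>)" .
        qed
        have "((\<lambda>x. C / \<bar>\<alpha> - 1\<bar> * (1 - x) powr (2 - \<alpha>)) \<longlongrightarrow> C / \<bar>\<alpha> - 1\<bar> * (1 - 1) powr (2 - \<alpha>)) (at 1 within {1/2..1})"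
          using \<alpha> by (intro tendsto_mult tendsto_const tendsto_powr' tendsto_diff tendsto_ident_at)
            (auto simp: eventually_at_filter)
        then show "((\<lambda>x. C / \<bar>\<alpha> - 1\<bar> * (1 - x) powr (2 - \<alpha>)) \<longlongrightarrow> 0) (at 1 within {1/2..1})" by simp
      qed
      then show ?thesis by (simp add: G_def)
    qed
    show "continuous_on {1/2..1} G"
      unfolding continuous_on_eq_continuous_within
    proof (intro ballI)
      fix x :: real assume x: "x \<in> {1/2..1}"
      show "continuous (at x within {1/2..1}) G"
      proof (cases "x = 1")
        case True
        then show ?thesis using c2 by (simp add: continuous_within)
      next
        case False
        then have "isCont G x" using x by (intro c1) auto
        then show ?thesis by (rule continuous_at_imp_continuous_at_within)
      qed
    qed
    fix x :: real assume x: "x \<in> {1/2<..<1}"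
    have "(G has_real_derivative (1 - x) powr (- \<alpha>) * (1 - x powr (\<alpha> - 2))) (at x)"
    proof -
      have "((\<lambda>x. (1 - x) powr (1 - \<alpha>)) has_real_derivative (1 - \<alpha>) * (1 - x) powr (1 - \<alpha> - 1) * (-1)) (at x)"
        using x by (auto intro!: derivative_eq_intros)
      moreover have "((\<lambda>x. 1 - x powr (\<alpha> - 1)) has_real_derivative 0 - (\<alpha> - 1) * x powr (\<alpha> - 1 - 1)) (at x)"
        using x by (intro derivative_intros) (auto intro!: derivative_eq_intros)
      ultimately have "(G has_real_derivative ((1 - \<alpha>) * (1 - x) powr (1 - \<alpha> - 1) * (-1) * (1 - x powr (\<alpha> - 1))
          + (0 - (\<alpha> - 1) * x powr (\<alpha> - 1 - 1)) * (1 - x) powr (1 - \<alpha>)) / (\<alpha> - 1)) (at x)"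
        unfolding G_def by (intro DERIV_cdivide DERIV_mult)
      moreover have "(1 - \<alpha>) * (1 - x) powr (1 - \<alpha> - 1) * (-1) * (1 - x powr (\<alpha> - 1))
          + (0 - (\<alpha> - 1) * x powr (\<alpha> - 1 - 1)) * (1 - x) powr (1 - \<alpha>)
          = (1 - x) powr (- \<alpha>) * (1 - x powr (\<alpha> - 2)) * (\<alpha> - 1)"
      proof -
        have e: "(1 - x) powr (1 - \<alpha>) = (1 - x) * (1 - x) powr (- \<alpha>)"
          "x powr (\<alpha> - 1) = x * x powr (\<alpha> - 2)"
          "1 - \<alpha> - 1 = - \<alpha>" "\<alpha> - 1 - 1 = \<alpha> - 2"
          using x powr_mult_base[of "1 - x" "- \<alpha>"] powr_mult_base[of x "\<alpha> - 2"] by simp_all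
        show ?thesis unfolding e by (simp add: algebra_simps)
      qed
      ultimately have "(G has_real_derivative (1 - x) powr (- \<alpha>) * (1 - x powr (\<alpha> - 2)) * (\<alpha> - 1) / (\<alpha> - 1)) (at x)"
        by (simp only:)
      then show ?thesis using \<alpha> by simp
    qed
    then show "(G has_vector_derivative (1 - x) powr (- \<alpha>) * (1 - x powr (\<alpha> - 2))) (at x)"
      by (simp add: has_real_derivative_iff_has_vector_derivative)
  qed simp
  then have 2: "(compensator_defect \<alpha> has_integral G 1 - G (1/2)) {1/2..1}"
    by (rule has_integral_spike[where S="{1/2}", rotated 2]) (auto simp: compensator_defect_def)
  have "(compensator_defect \<alpha> has_integral (F (1/2) - F 0) + (G 1 - G (1/2))) {0..1}"
    by (rule has_integral_combine[OF _ _ 1 2]) auto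
  moreover have "(F (1/2) - F 0) + (G 1 - G (1/2)) = 0"
  proof -
    have "(1/2) powr (1 - \<alpha>) * (1/2) powr (\<alpha> - 1) = (1::real)" by (simp flip: powr_add)
    then show ?thesis by (simp add: F_def G_def right_diff_distrib flip: diff_divide_distrib add_divide_distrib)
  qed
  ultimately have "(compensator_defect \<alpha> has_integral 0) {0<..<1}"
    by (simp add: has_integral_Icc_iff_Ioo)
  then show ?thesis
    using set_borel_integral_eq_integral(2)[OF set_integrable_compensator_defect[OF \<alpha>(1)]] by (simp add: integral_unique)
qed

definition lamperti_integrand :: "real \<Rightarrow> real \<Rightarrow> real \<Rightarrow> real \<Rightarrow> real \<Rightarrow> complex" where
  "lamperti_integrand \<alpha> cp cm l y =
    (iexp (l * y) - 1 - \<i> * complex_of_real (l * (exp y - 1)) * indicator {y. \<bar>exp y - 1\<bar> < 1} y)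
      * complex_of_real (lamperti_density \<alpha> cp cm y)"

lemma measurable_lamperti_integrand [measurable]: "lamperti_integrand \<alpha> cp cm l \<in> borel_measurable borel"
  unfolding lamperti_integrand_def lamperti_density_def stable_density_def by measurable

text \<open>Both half-lines are mapped to (0, 1) by x = exp (- |y|). Negative jumps give
  \<open>beta_kernel\<close> with exponent s. Positive jumps give x^(\<alpha>-1-s) - x^(\<alpha>-1),
  a difference of two kernels up to the choice of compensator, and that discrepancy integrates to 0
  by \<open>set_integral_compensator_defect\<close>. The closed form has poles at \<alpha> = 1, so
  this value is treated separately.\<close>

lemma
  fixes l :: real
  assumes \<alpha>: "0 < \<alpha>" "\<alpha> < 2" "\<alpha> \<noteq> 1"
  defines "s \<equiv> \<i> * of_real l"
  shows integrable_lamperti_integrand: "integrable lborel (lamperti_integrand \<alpha> cp cm l)"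
    and integral_lamperti_integrand: "(\<integral>y. lamperti_integrand \<alpha> cp cm l y \<partial>lborel) =
      of_real cp * (Gamma (of_real \<alpha> - s) * Gamma (- of_real \<alpha>) * rGamma (- s) - s / (1 - of_real \<alpha>))
      + of_real cm * (Gamma (s + 1) * Gamma (- of_real \<alpha>) * rGamma (s + 1 - of_real \<alpha>) + 1 / of_real \<alpha> + s / (1 - of_real \<alpha>))"
proof -
  let ?F = "lamperti_integrand \<alpha> cp cm l"
  \<comment> \<open>The difference of the two kernels is compensated by s (1 - x), that is s (1 -
    exp (- y)). The last summand exchanges this for the prescribed compensator, which acts where exp
    y - 1 < 1, that is, where x > 1/2.\<close>
  define gp where "gp x = of_real cp * (beta_kernel (of_real \<alpha> - 1 - s) (of_real \<alpha>) x - beta_kernel (of_real \<alpha> - 1) (of_real \<alpha>) x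
      + s * of_real (compensator_defect \<alpha> x))" for x
  define gm where "gm x = of_real cm * beta_kernel s (of_real \<alpha>) x" for x
  have gm: "gp \<in> borel_measurable borel" "gm \<in> borel_measurable borel"
    unfolding gp_def gm_def beta_kernel_def compensator_defect_def by measurable
  have Fp: "?F u = exp (- u) *\<^sub>R gp (exp (- u))" if u: "u > 0" for u
  proof -
    define x where "x = exp (- u)"
    have x: "0 < x" "x < 1" "u = - ln x" using u by (auto simp: x_def)
    have x4: "exp u = 1 / x" by (simp add: x_def exp_minus divide_simps)
    define A where "A = x powr (\<alpha> - 2)"
    define B where "B = (1 - x) powr (- \<alpha> - 1)"
    define I where "I = (indicator {1/2<..} x :: real)"
    have pA: "x powr (\<alpha> - 1) = x * A" "x powr \<alpha> = x * (x * A)"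
      using x powr_mult_base[of x "\<alpha> - 2"] powr_mult_base[of x "\<alpha> - 1"] by (auto simp: A_def)
    have pB: "(1 - x) powr (- \<alpha>) = (1 - x) * B"
      using x powr_mult_base[of "1 - x" "- \<alpha> - 1"] by (auto simp: B_def)
    have e1: "exp u - 1 = (1 - x) / x" using x(1) by (simp add: x4 diff_divide_distrib)
    have ind: "indicator {y. \<bar>exp y - 1\<bar> < 1} u = complex_of_real I"
      using x unfolding I_def indicator_def mem_Collect_eq e1 by (auto simp: field_simps)
    have "lamperti_density \<alpha> cp cm u = (1 / x) * (cp * ((1 - x) / x) powr (- \<alpha> - 1))"
      unfolding lamperti_density_def stable_density_def e1 unfolding x4
      using x(1,2) by (auto simp: indicator_def divide_less_0_iff)
    also have "((1 - x) / x) powr (- \<alpha> - 1) = B * x powr (\<alpha> + 1)"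
    proof -
      have "- \<alpha> - 1 = - (\<alpha> + 1)" by simp
      then have "x powr (- \<alpha> - 1) = inverse (x powr (\<alpha> + 1))" by (simp only: powr_minus)
      moreover have "((1 - x) / x) powr (- \<alpha> - 1) = (1 - x) powr (- \<alpha> - 1) / x powr (- \<alpha> - 1)"
        by (rule powr_divide)
      ultimately show ?thesis by (simp add: B_def divide_inverse)
    qed
    also have "x powr (\<alpha> + 1) = x * (x * (x * A))" using x pA powr_mult_base[of x \<alpha>] by (simp add: add.commute)
    finally have d: "lamperti_density \<alpha> cp cm u = cp * B * (x * (x * A))" using x by simp
    have i: "iexp (l * u) = cpow x (- s)"
      using x by (simp add: cpow_def s_def mult_ac)
    have c1: "cpow x (of_real \<alpha> - 1 - s) = of_real (x * A) * cpow x (- s)"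
      using cpow_add[of x "of_real (\<alpha> - 1)" "- s"] cpow_of_real[OF x(1), of "\<alpha> - 1"] pA by simp
    have c2: "cpow x (of_real \<alpha> - 1) = of_real (x * A)"
      using cpow_of_real[OF x(1), of "\<alpha> - 1"] pA by simp
    have c3: "cpow (1 - x) (- of_real \<alpha> - 1) = of_real B"
      using cpow_of_real[of "1 - x" "- \<alpha> - 1"] x by (simp add: B_def)
    have z: "compensator_defect \<alpha> x = (1 - x) * B * (1 - A * I)"
      by (simp add: compensator_defect_def pB A_def I_def)
    have xn: "complex_of_real x \<noteq> 0" using x by simp
    have "?F u = (cpow x (- s) - 1 - s * of_real ((1 - x) / x) * of_real I) * of_real (cp * B * (x * (x * A)))"
      unfolding lamperti_integrand_def i d e1 ind by (simp add: s_def mult_ac)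
    also have "\<dots> = of_real x * gp x"
      unfolding gp_def beta_kernel_def c1 c2 c3 z using xn by (simp add: field_simps)
    finally show ?thesis by (simp add: x_def scaleR_conv_of_real)
  qed
  have Fm: "?F (- u) = exp (- u) *\<^sub>R gm (exp (- u))" if u: "u > 0" for u
  proof -
    define x where "x = exp (- u)"
    have x: "0 < x" "x < 1" "- u = ln x" using u by (auto simp: x_def)
    have ex: "exp (- u) = x" by (simp add: x_def)
    have ind: "indicator {y. \<bar>exp y - 1\<bar> < 1} (- u) = (1 :: complex)"
      using x(1,2) by (simp add: indicator_def ex)
    have d: "lamperti_density \<alpha> cp cm (- u) = x * (cm * (1 - x) powr (- \<alpha> - 1))"
      using x(1,2) by (simp add: lamperti_density_def stable_density_def ex)
    have i: "iexp (l * - u) = cpow x s"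
      unfolding x(3) by (simp add: cpow_def s_def mult_ac)
    have c3: "cpow (1 - x) (- of_real \<alpha> - 1) = of_real ((1 - x) powr (- \<alpha> - 1))"
      using cpow_of_real[of "1 - x" "- \<alpha> - 1"] x by simp
    have "?F (- u) = (cpow x s - 1 - s * of_real (x - 1)) * of_real (x * (cm * (1 - x) powr (- \<alpha> - 1)))"
      unfolding lamperti_integrand_def i d ind ex by (simp add: s_def mult_ac)
    also have "\<dots> = of_real x * gm x"
      unfolding gm_def beta_kernel_def c3 by (simp add: mult_ac)
    finally show ?thesis by (simp add: x_def scaleR_conv_of_real)
  qed
  have s: "Re s = 0" by (simp add: s_def)
  have Ia: "set_integrable lborel {0<..<1} (beta_kernel (of_real \<alpha> - 1 - s) (of_real \<alpha>))"
    "set_integrable lborel {0<..<1} (beta_kernel (of_real \<alpha> - 1) (of_real \<alpha>))"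
    "set_integrable lborel {0<..<1} (beta_kernel s (of_real \<alpha>))"
    using \<alpha> s by (auto intro!: set_integrable_beta_kernel)
  have Id: "set_integrable lborel {0<..<1} (\<lambda>x. complex_of_real (compensator_defect \<alpha> x))"
    "(LINT x:{0<..<1}|lborel. complex_of_real (compensator_defect \<alpha> x)) = 0"
    using set_integrable_compensator_defect[OF \<alpha>(2)] set_integral_compensator_defect[OF \<alpha>(2,3)]
    unfolding set_integrable_def set_lebesgue_integral_def
    by (auto simp: scaleR_conv_of_real integral_complex_of_real simp flip: of_real_mult)
  have Ip: "set_integrable lborel {0<..<1} gp"
    unfolding gp_def by (intro set_integrable_mult_right set_integral_add set_integral_diff Ia Id)
  have Im: "set_integrable lborel {0<..<1} gm"
    unfolding gm_def by (intro set_integrable_mult_right Ia)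
  have "(LINT x:{0<..<1}|lborel. gp x) = of_real cp *
      ((LINT x:{0<..<1}|lborel. beta_kernel (of_real \<alpha> - 1 - s) (of_real \<alpha>) x)
      - (LINT x:{0<..<1}|lborel. beta_kernel (of_real \<alpha> - 1) (of_real \<alpha>) x))"
    unfolding gp_def using Id(2)
    by (simp add: set_integral_add(2)[OF set_integral_diff(1)[OF Ia(1,2)] set_integrable_mult_right[OF Id(1)]]
        set_integral_diff(2)[OF Ia(1,2)])
  also have "(LINT x:{0<..<1}|lborel. beta_kernel (of_real \<alpha> - 1 - s) (of_real \<alpha>) x)
      = Gamma (of_real \<alpha> - 1 - s + 1) * Gamma (- of_real \<alpha>) * rGamma (of_real \<alpha> - 1 - s + 1 - of_real \<alpha>) + 1 / of_real \<alpha> + (of_real \<alpha> - 1 - s) / (1 - of_real \<alpha>)"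
    by (rule set_integral_beta_kernel) (use \<alpha> s in auto)
  also have "(LINT x:{0<..<1}|lborel. beta_kernel (of_real \<alpha> - 1) (of_real \<alpha>) x)
      = Gamma (of_real \<alpha> - 1 + 1) * Gamma (- of_real \<alpha>) * rGamma (of_real \<alpha> - 1 + 1 - of_real \<alpha>) + 1 / of_real \<alpha> + (of_real \<alpha> - 1) / (1 - of_real \<alpha>)"
    by (rule set_integral_beta_kernel) (use \<alpha> s in auto)
  finally have Vp: "(LINT x:{0<..<1}|lborel. gp x) = of_real cp *
      (Gamma (of_real \<alpha> - s) * Gamma (- of_real \<alpha>) * rGamma (- s) - s / (1 - of_real \<alpha>))"
    by (simp add: diff_divide_distrib)
  have "(LINT x:{0<..<1}|lborel. gm x) = of_real cm * (LINT x:{0<..<1}|lborel. beta_kernel s (of_real \<alpha>) x)"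
    unfolding gm_def by simp
  also have "(LINT x:{0<..<1}|lborel. beta_kernel s (of_real \<alpha>) x)
      = Gamma (s + 1) * Gamma (- of_real \<alpha>) * rGamma (s + 1 - of_real \<alpha>) + 1 / of_real \<alpha> + s / (1 - of_real \<alpha>)"
    by (rule set_integral_beta_kernel) (use \<alpha> s in auto)
  finally have Vm: "(LINT x:{0<..<1}|lborel. gm x) = of_real cm *
      (Gamma (s + 1) * Gamma (- of_real \<alpha>) * rGamma (s + 1 - of_real \<alpha>) + 1 / of_real \<alpha> + s / (1 - of_real \<alpha>))" .
  have P: "(\<lambda>u. indicator {0<..} u *\<^sub>R ?F u) = (\<lambda>u. indicator {0<..} u *\<^sub>R (exp (- u) *\<^sub>R gp (exp (- u))))"
    by (auto simp: fun_eq_iff indicator_def Fp)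
  have Q: "(\<lambda>u. indicator {0<..} u *\<^sub>R ?F (- u)) = (\<lambda>u. indicator {0<..} u *\<^sub>R (exp (- u) *\<^sub>R gm (exp (- u))))"
    by (auto simp: fun_eq_iff indicator_def Fm)
  have P1: "integrable lborel (\<lambda>u. indicator {0<..} u *\<^sub>R ?F u)"
    "(\<integral>u. indicator {0<..} u *\<^sub>R ?F u \<partial>lborel) = (LINT x:{0<..<1}|lborel. gp x)"
    unfolding P by (rule integrable_exp_neg_iff[OF gm(1), THEN iffD2, OF Ip], rule integral_exp_neg[OF gm(1)])
  have Q1: "integrable lborel (\<lambda>u. indicator {0<..} u *\<^sub>R ?F (- u))"
    "(\<integral>u. indicator {0<..} u *\<^sub>R ?F (- u) \<partial>lborel) = (LINT x:{0<..<1}|lborel. gm x)"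
    unfolding Q by (rule integrable_exp_neg_iff[OF gm(2), THEN iffD2, OF Im], rule integral_exp_neg[OF gm(2)])
  have neg: "indicator {..<0} (0 + -1 * u) *\<^sub>R ?F (0 + -1 * u) = indicator {0<..} u *\<^sub>R ?F (- u)" for u
    by (auto simp: indicator_def)
  have Q2: "integrable lborel (\<lambda>y. indicator {..<0} y *\<^sub>R ?F y)"
    using lborel_integrable_real_affine_iff[of "-1" "\<lambda>y. indicator {..<0} y *\<^sub>R ?F y" 0] Q1(1) unfolding neg by simp
  have Q3: "(\<integral>y. indicator {..<0} y *\<^sub>R ?F y \<partial>lborel) = (LINT x:{0<..<1}|lborel. gm x)"
    using lborel_integral_real_affine[of "-1" "\<lambda>y. indicator {..<0} y *\<^sub>R ?F y" 0] Q1(2) unfolding neg by simp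
  have F: "?F = (\<lambda>y. indicator {0<..} y *\<^sub>R ?F y + indicator {..<0} y *\<^sub>R ?F y)"
  proof
    fix y :: real
    have "?F 0 = 0" by (simp add: lamperti_integrand_def)
    then show "?F y = indicator {0<..} y *\<^sub>R ?F y + indicator {..<0} y *\<^sub>R ?F y"
      by (cases y "0 :: real" rule: linorder_cases) auto
  qed
  show "integrable lborel ?F"
    by (subst F) (intro Bochner_Integration.integrable_add P1 Q2)
  show "(\<integral>y. ?F y \<partial>lborel) =
      of_real cp * (Gamma (of_real \<alpha> - s) * Gamma (- of_real \<alpha>) * rGamma (- s) - s / (1 - of_real \<alpha>))
      + of_real cm * (Gamma (s + 1) * Gamma (- of_real \<alpha>) * rGamma (s + 1 - of_real \<alpha>) + 1 / of_real \<alpha> + s / (1 - of_real \<alpha>))"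
    using P1 Q2 Q3 Vp Vm by (subst F) simp
qed

section \<open>Strictly stable laws on the half-line\<close>

lemma Ioi_FTC:
  fixes F f :: "real \<Rightarrow> real"
  assumes d: "\<And>x. 0 < x \<Longrightarrow> DERIV F x :> f x" and c: "\<And>x. 0 < x \<Longrightarrow> isCont f x"
    and A: "(F \<longlongrightarrow> A) (at_right 0)" and B: "(F \<longlongrightarrow> B) at_top"
  shows set_integrable_Ioi_FTC_nonneg: "(\<And>x. 0 < x \<Longrightarrow> 0 \<le> f x) \<Longrightarrow> set_integrable lborel {0<..} f"
    and set_integral_Ioi_FTC: "set_integrable lborel {0<..} f \<Longrightarrow> (LINT x:{0<..}|lborel. f x) = B - A"
proof -
  have e: "einterval 0 \<infinity> = {0<..}" by (auto simp: einterval_def)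
  have A': "((F \<circ> real_of_ereal) \<longlongrightarrow> A) (at_right 0)" and B': "((F \<circ> real_of_ereal) \<longlongrightarrow> B) (at_left \<infinity>)"
    using A B by (simp_all add: zero_ereal_def ereal_tendsto_simps)
  show "set_integrable lborel {0<..} f" if "\<And>x. 0 < x \<Longrightarrow> 0 \<le> f x"
    unfolding e[symmetric]
    by (rule interval_integral_FTC_nonneg(1)[OF _ _ _ _ A' B']) (use d c that in auto)
  show "(LINT x:{0<..}|lborel. f x) = B - A" if "set_integrable lborel {0<..} f"
  proof -
    have "(LBINT x=0..\<infinity>. f x) = B - A"
    proof (rule interval_integral_FTC_integrable[OF _ _ _ _ A' B'])
      show "(F has_vector_derivative f x) (at x)" if "0 < ereal x" "ereal x < \<infinity>" for x
        using d[of x] that by (simp add: has_real_derivative_iff_has_vector_derivative)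
    qed (use c that e in auto)
    then show ?thesis by (simp add: interval_lebesgue_integral_def e)
  qed
qed

lemma set_integrable_bound_Ioi:
  fixes f :: "real \<Rightarrow> 'a::{banach, second_countable_topology}"
  assumes "set_integrable lborel A g" "f \<in> borel_measurable borel" "A \<in> sets borel"
    and "\<And>x. x \<in> A \<Longrightarrow> norm (f x) \<le> g x"
  shows "set_integrable lborel A f"
  unfolding set_integrable_def
proof (rule Bochner_Integration.integrable_bound[OF assms(1)[unfolded set_integrable_def]])
  show "(\<lambda>x. indicator A x *\<^sub>R f x) \<in> borel_measurable lborel" using assms(2,3) by simp
  show "AE x in lborel. norm (indicator A x *\<^sub>R f x) \<le> norm (indicator A x *\<^sub>R g x)"
  proof (intro AE_I2)
    fix x
    show "norm (indicator A x *\<^sub>R f x) \<le> norm (indicator A x *\<^sub>R g x)"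
      using order_trans[OF assms(4) abs_ge_self, of x] by (cases "x \<in> A") auto
  qed
qed

context
  fixes \<alpha> A :: real
  assumes \<alpha>: "0 < \<alpha>" and A: "0 < A"
begin

lemma set_integrable_exp_powr: "set_integrable lborel {0<..} (\<lambda>t. exp (- A * t powr \<alpha>) * t powr (\<alpha> - 1))"
proof (rule set_integrable_Ioi_FTC_nonneg[where F="\<lambda>t. - exp (- A * t powr \<alpha>) / (A * \<alpha>)"])
  show "((\<lambda>t. - exp (- A * t powr \<alpha>) / (A * \<alpha>)) has_real_derivative exp (- A * x powr \<alpha>) * x powr (\<alpha> - 1)) (at x)"
    if "0 < x" for x
    using that \<alpha> A by (auto intro!: derivative_eq_intros)
  have "((\<lambda>t. t powr \<alpha>) \<longlongrightarrow> 0) (at_right 0)" using \<alpha> by real_asymp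
  then show "((\<lambda>t. - exp (- A * t powr \<alpha>) / (A * \<alpha>)) \<longlongrightarrow> - exp (- A * 0) / (A * \<alpha>)) (at_right 0)"
    using \<alpha> A by (intro tendsto_intros) auto
  show "((\<lambda>t. - exp (- A * t powr \<alpha>) / (A * \<alpha>)) \<longlongrightarrow> 0) at_top"
    using \<alpha> A by real_asymp
qed (auto intro!: continuous_intros)

text \<open>In the variable v = t^\<alpha> this is the Laplace transform of the cosine, with its
  elementary primitive.\<close>

lemma set_integral_exp_cos_powr:
  "(LINT t:{0<..}|lborel. exp (- A * t powr \<alpha>) * t powr (\<alpha> - 1) * cos (c * t powr \<alpha>)) = A / (\<alpha> * (A\<^sup>2 + c\<^sup>2))"
proof -
  let ?D = "\<alpha> * (A\<^sup>2 + c\<^sup>2)"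
  have D: "?D > 0" using \<alpha> A by (intro mult_pos_pos add_pos_nonneg) auto
  then have Dn: "?D \<noteq> 0" by linarith
  let ?F = "\<lambda>t. exp (- A * t powr \<alpha>) * (c * sin (c * t powr \<alpha>) - A * cos (c * t powr \<alpha>)) / ?D"
  have lim0: "((\<lambda>t. t powr \<alpha>) \<longlongrightarrow> 0) (at_right 0)" using \<alpha> by real_asymp
  have "(LINT t:{0<..}|lborel. exp (- A * t powr \<alpha>) * t powr (\<alpha> - 1) * cos (c * t powr \<alpha>)) = 0 - (- A / ?D)"
  proof (rule set_integral_Ioi_FTC)
    fix x :: real assume x: "0 < x"
    have "(?F has_real_derivative
        (exp (- A * x powr \<alpha>) * (c * (cos (c * x powr \<alpha>) * (c * (\<alpha> * x powr (\<alpha> - 1))))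
          - A * (- sin (c * x powr \<alpha>) * (c * (\<alpha> * x powr (\<alpha> - 1)))))
        + exp (- A * x powr \<alpha>) * (- A * (\<alpha> * x powr (\<alpha> - 1))) * (c * sin (c * x powr \<alpha>) - A * cos (c * x powr \<alpha>))) / ?D) (at x)"
      using x \<alpha> A by (auto intro!: derivative_eq_intros)
    also have "(exp (- A * x powr \<alpha>) * (c * (cos (c * x powr \<alpha>) * (c * (\<alpha> * x powr (\<alpha> - 1))))
          - A * (- sin (c * x powr \<alpha>) * (c * (\<alpha> * x powr (\<alpha> - 1)))))
        + exp (- A * x powr \<alpha>) * (- A * (\<alpha> * x powr (\<alpha> - 1))) * (c * sin (c * x powr \<alpha>) - A * cos (c * x powr \<alpha>)))
        = exp (- A * x powr \<alpha>) * x powr (\<alpha> - 1) * cos (c * x powr \<alpha>) * ?D"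
      by (simp add: algebra_simps power2_eq_square)
    finally show "(?F has_real_derivative exp (- A * x powr \<alpha>) * x powr (\<alpha> - 1) * cos (c * x powr \<alpha>)) (at x)"
      unfolding nonzero_mult_div_cancel_right[OF Dn] .
    show "isCont (\<lambda>t. exp (- A * t powr \<alpha>) * t powr (\<alpha> - 1) * cos (c * t powr \<alpha>)) x"
      using x by (intro continuous_intros) auto
  next
    have "(?F \<longlongrightarrow> exp (- A * 0) * (c * sin (c * 0) - A * cos (c * 0)) / ?D) (at_right 0)"
      using D by (intro tendsto_intros lim0) auto
    then show "(?F \<longlongrightarrow> - A / ?D) (at_right 0)" by simp
    show "(?F \<longlongrightarrow> 0) at_top"
    proof (rule Lim_null_comparison)
      show "\<forall>\<^sub>F t in at_top. norm (?F t) \<le> exp (- A * t powr \<alpha>) * (\<bar>c\<bar> + A) / ?D"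
      proof (intro always_eventually allI)
        fix t :: real
        have "\<bar>c * sin (c * t powr \<alpha>) - A * cos (c * t powr \<alpha>)\<bar> \<le> \<bar>c * sin (c * t powr \<alpha>)\<bar> + \<bar>A * cos (c * t powr \<alpha>)\<bar>"
          by (rule abs_triangle_ineq4)
        also have "\<dots> \<le> \<bar>c\<bar> * 1 + A * 1"
          unfolding abs_mult using A by (intro add_mono mult_mono) auto
        finally show "norm (?F t) \<le> exp (- A * t powr \<alpha>) * (\<bar>c\<bar> + A) / ?D"
          using D \<alpha> by (simp add: abs_mult divide_right_mono mult_left_mono)
      qed
      have "((\<lambda>t. exp (- A * t powr \<alpha>)) \<longlongrightarrow> 0) at_top" using \<alpha> A by real_asymp
      then have "((\<lambda>t. exp (- A * t powr \<alpha>) * (\<bar>c\<bar> + A) / ?D) \<longlongrightarrow> 0 * (\<bar>c\<bar> + A) / ?D) at_top"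
        using D by (intro tendsto_intros) auto
      then show "((\<lambda>t. exp (- A * t powr \<alpha>) * (\<bar>c\<bar> + A) / ?D) \<longlongrightarrow> 0) at_top" by simp
    qed
    show "set_integrable lborel {0<..} (\<lambda>t. exp (- A * t powr \<alpha>) * t powr (\<alpha> - 1) * cos (c * t powr \<alpha>))"
      by (rule set_integrable_bound_Ioi[OF set_integrable_exp_powr])
        (auto simp: abs_mult intro!: mult_left_le)
  qed
  then show ?thesis by simp
qed

lemma set_integrable_exp_sin_powr:
  "set_integrable lborel {0<..} (\<lambda>t. exp (- A * t powr \<alpha>) * sin (b * t powr \<alpha>) / t)"
proof (rule set_integrable_bound_Ioi)
  show "set_integrable lborel {0<..} (\<lambda>t. \<bar>b\<bar> * (exp (- A * t powr \<alpha>) * t powr (\<alpha> - 1)))"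
    by (rule set_integrable_mult_right[OF set_integrable_exp_powr])
  show "norm (exp (- A * t powr \<alpha>) * sin (b * t powr \<alpha>) / t) \<le> \<bar>b\<bar> * (exp (- A * t powr \<alpha>) * t powr (\<alpha> - 1))"
    if "t \<in> {0<..}" for t
  proof -
    have t: "t > 0" using that by simp
    have "\<bar>sin (b * t powr \<alpha>)\<bar> \<le> \<bar>b\<bar> * t powr \<alpha>"
      using abs_sin_x_le_abs_x[of "b * t powr \<alpha>"] by (simp add: abs_mult)
    then have "exp (- A * t powr \<alpha>) * \<bar>sin (b * t powr \<alpha>)\<bar> / t \<le> exp (- A * t powr \<alpha>) * (\<bar>b\<bar> * t powr \<alpha>) / t"
      using t by (intro divide_right_mono mult_left_mono) auto
    also have "\<dots> = \<bar>b\<bar> * (exp (- A * t powr \<alpha>) * (t powr \<alpha> / t))" by simp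
    also have "t powr \<alpha> / t = t powr (\<alpha> - 1)" using t by (simp add: powr_diff)
    finally show ?thesis using t by (simp add: abs_mult)
  qed
qed auto

text \<open>The quotient sin (b t^\<alpha>) / t is the integral of t^(\<alpha>-1) cos (c t^\<alpha>)
  over c from 0 to b. Exchanging the integrals leaves A / (\<alpha> (A^2 + c^2)), whose primitive in
  c is an arctangent.\<close>

lemma set_integral_exp_sin_powr_nonneg:
  assumes b: "0 \<le> b"
  shows "(LINT t:{0<..}|lborel. exp (- A * t powr \<alpha>) * sin (b * t powr \<alpha>) / t) = arctan (b / A) / \<alpha>"
proof -
  define f where "f t c = (indicator {0<..} t * exp (- A * t powr \<alpha>) * t powr (\<alpha> - 1) * cos (c * t powr \<alpha>)) * indicator {0..b} c"
    for t c :: real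
  have inner: "has_bochner_integral lborel (f t) (indicator {0<..} t * (exp (- A * t powr \<alpha>) * sin (b * t powr \<alpha>) / t))" for t
  proof (cases "t > 0")
    case True
    have "has_bochner_integral lborel (\<lambda>c. (exp (- A * t powr \<alpha>) * t powr (\<alpha> - 1) * cos (c * t powr \<alpha>)) * indicator {0..b} c)
        (exp (- A * t powr \<alpha>) * sin (b * t powr \<alpha>) / t - exp (- A * t powr \<alpha>) * sin (0 * t powr \<alpha>) / t)"
    proof (rule has_bochner_integral_FTC_Icc_real[OF b])
      fix c :: real
      have "((\<lambda>c. exp (- A * t powr \<alpha>) * sin (c * t powr \<alpha>) / t) has_real_derivative
          exp (- A * t powr \<alpha>) * (cos (c * t powr \<alpha>) * t powr \<alpha>) / t) (at c)"
        using True by (auto intro!: derivative_eq_intros)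
      moreover have "t powr \<alpha> = t * t powr (\<alpha> - 1)" using True by (simp add: powr_mult_base)
      ultimately show "((\<lambda>c. exp (- A * t powr \<alpha>) * sin (c * t powr \<alpha>) / t) has_real_derivative
          exp (- A * t powr \<alpha>) * t powr (\<alpha> - 1) * cos (c * t powr \<alpha>)) (at c)"
        using True by (simp add: mult_ac)
    qed (intro continuous_intros)
    then show ?thesis using True by (simp add: f_def[abs_def])
  qed (simp add: f_def[abs_def] has_bochner_integral_zero)
  have m: "case_prod f \<in> borel_measurable (lborel \<Otimes>\<^sub>M lborel)"
    unfolding f_def[abs_def] by measurable
  have int: "integrable (lborel \<Otimes>\<^sub>M lborel) (case_prod f)"
  proof (rule lborel_pair.Fubini_integrable[OF m])
    show "AE t in lborel. integrable lborel (\<lambda>c. case_prod f (t, c))"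
      using inner by (auto simp: has_bochner_integral_iff)
    show "integrable lborel (\<lambda>t. \<integral>c. norm (case_prod f (t, c)) \<partial>lborel)"
    proof (rule Bochner_Integration.integrable_bound)
      show "integrable lborel (\<lambda>t. b * (indicator {0<..} t *\<^sub>R (exp (- A * t powr \<alpha>) * t powr (\<alpha> - 1))))"
        using set_integrable_exp_powr unfolding set_integrable_def by (rule integrable_mult_right)
      show "(\<lambda>t. \<integral>c. norm (case_prod f (t, c)) \<partial>lborel) \<in> borel_measurable lborel"
        using m by measurable
      show "AE t in lborel. norm (\<integral>c. norm (case_prod f (t, c)) \<partial>lborel)
          \<le> norm (b * (indicator {0<..} t *\<^sub>R (exp (- A * t powr \<alpha>) * t powr (\<alpha> - 1))))"
      proof (intro AE_I2)
        fix t :: real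
        let ?k = "indicator {0<..} t * (exp (- A * t powr \<alpha>) * t powr (\<alpha> - 1))"
        have k: "?k \<ge> 0" by simp
        have le: "norm (f t c) \<le> ?k * indicator {0..b} c" for c
          using mult_left_le[OF abs_cos_le_one[of "c * t powr \<alpha>"] k]
          by (auto simp: f_def abs_mult indicator_def mult_ac)
        have "(\<integral>c. norm (f t c) \<partial>lborel) \<le> (\<integral>c. ?k * indicator {0..b} c \<partial>lborel)"
        proof (rule integral_mono[OF _ _ le])
          show "integrable lborel (\<lambda>c. norm (f t c))"
            using inner[of t] by (auto simp: has_bochner_integral_iff)
          show "integrable lborel (\<lambda>c. ?k * indicator {0..b} c)"
            by (intro integrable_mult_right integrable_real_indicator) (auto simp: emeasure_lborel_Icc_eq)
        qed
        also have "\<dots> = b * ?k" using b by simp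
        finally show "norm (\<integral>c. norm (case_prod f (t, c)) \<partial>lborel)
            \<le> norm (b * (indicator {0<..} t *\<^sub>R (exp (- A * t powr \<alpha>) * t powr (\<alpha> - 1))))"
          using b k by simp
      qed
    qed
  qed
  have "(LINT t:{0<..}|lborel. exp (- A * t powr \<alpha>) * sin (b * t powr \<alpha>) / t) = (\<integral>t. \<integral>c. f t c \<partial>lborel \<partial>lborel)"
    unfolding set_lebesgue_integral_def using inner by (simp add: has_bochner_integral_iff)
  also have "\<dots> = (\<integral>c. \<integral>t. f t c \<partial>lborel \<partial>lborel)"
    using lborel_pair.Fubini_integral[OF int] by simp
  also have "\<dots> = (\<integral>c. (A / (\<alpha> * (A\<^sup>2 + c\<^sup>2))) * indicator {0..b} c \<partial>lborel)"
  proof (rule Bochner_Integration.integral_cong)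
    fix c :: real
    have "(\<integral>t. f t c \<partial>lborel) = (\<integral>t. indicator {0<..} t *\<^sub>R (exp (- A * t powr \<alpha>) * t powr (\<alpha> - 1) * cos (c * t powr \<alpha>)) \<partial>lborel) * indicator {0..b} c"
      unfolding f_def by (cases "c \<in> {0..b}") (simp_all add: mult.assoc)
    then show "(\<integral>t. f t c \<partial>lborel) = (A / (\<alpha> * (A\<^sup>2 + c\<^sup>2))) * indicator {0..b} c"
      using set_integral_exp_cos_powr[of c] by (simp add: set_lebesgue_integral_def)
  qed simp
  also have "\<dots> = arctan (b / A) / \<alpha> - arctan (0 / A) / \<alpha>"
  proof (rule has_bochner_integral_integral_eq, rule has_bochner_integral_FTC_Icc_real[OF b])
    fix c :: real
    have nz: "A\<^sup>2 + c\<^sup>2 > 0" using A by (intro add_pos_nonneg) auto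
    have "((\<lambda>c. arctan (c / A) / \<alpha>) has_real_derivative (inverse (1 + (c / A)\<^sup>2) * (1 / A)) / \<alpha>) (at c)"
      using A \<alpha> by (auto intro!: derivative_eq_intros)
    also have "inverse (1 + (c / A)\<^sup>2) * (1 / A) = A / (A\<^sup>2 + c\<^sup>2)"
      using A nz by (simp add: field_simps power2_eq_square)
    finally show "((\<lambda>c. arctan (c / A) / \<alpha>) has_real_derivative A / (\<alpha> * (A\<^sup>2 + c\<^sup>2))) (at c)"
      by (simp add: mult.commute)
    show "isCont (\<lambda>c. A / (\<alpha> * (A\<^sup>2 + c\<^sup>2))) c" using \<alpha> nz by (intro continuous_intros) auto
  qed
  finally show ?thesis by simp
qed

lemma set_integral_exp_sin_powr:
  "(LINT t:{0<..}|lborel. exp (- A * t powr \<alpha>) * sin (b * t powr \<alpha>) / t) = arctan (b / A) / \<alpha>"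
proof (cases "0 \<le> b")
  case False
  have "(LINT t:{0<..}|lborel. exp (- A * t powr \<alpha>) * sin (b * t powr \<alpha>) / t)
      = - (LINT t:{0<..}|lborel. exp (- A * t powr \<alpha>) * sin (- b * t powr \<alpha>) / t)"
    by (simp add: set_lebesgue_integral_def)
  then show ?thesis using set_integral_exp_sin_powr_nonneg[of "- b"] False by (simp add: arctan_minus)
qed (rule set_integral_exp_sin_powr_nonneg)

end

section \<open>Sign probabilities from the characteristic function\<close>

lemma (in real_distribution) char_minus: "char M (- t) = cnj (char M t)"
proof -
  have "(\<integral>x. cnj (iexp (t * x)) \<partial>M) = cnj (\<integral>x. iexp (t * x) \<partial>M)"
    by (rule integral_bounded_linear[OF bounded_linear_cnj]) (rule integrable_iexp, auto)
  then show ?thesis by (simp add: char_def exp_cnj)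
qed

text \<open>\<open>P(X = 0)\<close> is at most \<open>E exp (- n\<^sup>2 X\<^sup>2 / 2) = E \<phi>(n Z)\<close> with \<open>Z\<close> standard normal.\<close>

lemma (in real_distribution) no_atom_at_0:
  assumes lim: "(char M \<longlongrightarrow> 0) at_top"
  shows "prob {0} = 0"
proof -
  interpret Z: real_distribution std_normal_distribution by (rule real_dist_normal_dist)
  interpret P: pair_prob_space M std_normal_distribution ..
  have eq: "(\<integral>z. char M (real n * z) \<partial>std_normal_distribution) = (\<integral>x. exp (- (real n * x)\<^sup>2 / 2) \<partial>M)" for n
  proof -
    have int: "integrable (M \<Otimes>\<^sub>M std_normal_distribution) (\<lambda>(x, z). iexp (real n * z * x))"
      by (rule P.integrable_const_bound[where B=1]) auto
    have "(\<integral>z. char M (real n * z) \<partial>std_normal_distribution) = (\<integral>z. \<integral>x. iexp (real n * z * x) \<partial>M \<partial>std_normal_distribution)"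
      unfolding char_def ..
    also have "\<dots> = (\<integral>x. \<integral>z. iexp (real n * z * x) \<partial>std_normal_distribution \<partial>M)"
      using P.Fubini_integral[OF int] by simp
    also have "\<dots> = (\<integral>x. char std_normal_distribution (real n * x) \<partial>M)"
      by (simp add: char_def mult_ac)
    also have "\<dots> = (\<integral>x. complex_of_real (exp (- (real n * x)\<^sup>2 / 2)) \<partial>M)"
      by (simp add: char_std_normal_distribution)
    finally show ?thesis by (simp only: integral_complex_of_real)
  qed
  have "(\<lambda>n. \<integral>z. char M (real n * z) \<partial>std_normal_distribution) \<longlonglongrightarrow> (\<integral>z. 0 \<partial>std_normal_distribution)"
  proof (rule integral_dominated_convergence[where w="\<lambda>_. 1"])
    show "AE z in std_normal_distribution. (\<lambda>n. char M (real n * z)) \<longlonglongrightarrow> 0"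
    proof -
      have "AE z in std_normal_distribution. z \<noteq> 0"
        by (subst AE_density) (use AE_lborel_singleton[of "0::real"] in auto)
      then show ?thesis
      proof eventually_elim
        case (elim z)
        have pos: "(\<lambda>n. char M (real n * y)) \<longlonglongrightarrow> 0" if "y > 0" for y
        proof -
          have "filterlim (\<lambda>n. real n * y) at_top sequentially" using that by real_asymp
          then show ?thesis by (rule filterlim_compose[OF lim])
        qed
        show ?case
        proof (cases "z > 0")
          case False
          then have "(\<lambda>n. cnj (char M (real n * (- z)))) \<longlonglongrightarrow> cnj 0"
            using elim by (intro tendsto_cnj pos) auto
          then show ?thesis by (simp add: char_minus[symmetric])
        qed (rule pos)
      qed
    qed
    show "AE z in std_normal_distribution. norm (char M (real n * z)) \<le> 1" for n
      by (intro AE_I2 cmod_char_le_1)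
  qed auto
  then have l: "(\<lambda>n. complex_of_real (\<integral>x. exp (- (real n * x)\<^sup>2 / 2) \<partial>M)) \<longlonglongrightarrow> 0"
    unfolding eq by simp
  have "(\<lambda>n. \<integral>x. exp (- (real n * x)\<^sup>2 / 2) \<partial>M) \<longlonglongrightarrow> 0"
    using tendsto_Re[OF l] by simp
  moreover have "prob {0} \<le> (\<integral>x. exp (- (real n * x)\<^sup>2 / 2) \<partial>M)" for n
  proof -
    have "prob {0} = (\<integral>x. indicator {0} x \<partial>M)" by simp
    also have "\<dots> \<le> (\<integral>x. exp (- (real n * x)\<^sup>2 / 2) \<partial>M)"
      by (rule integral_mono, simp add: less_top[symmetric], rule integrable_const_bound[where B=1])
        (auto simp: indicator_def)
    finally show ?thesis .
  qed
  ultimately have "prob {0} \<le> 0" by (intro LIMSEQ_le_const) auto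
  then show ?thesis by (simp add: measure_le_0_iff)
qed

text \<open>The arctangent of x / e is the integral of exp (- e t) sin (x t) / t, so its expectation
  brings in the imaginary part of the characteristic function. Taking the difference for two
  parameters makes the kernel (exp (- e t) - exp (- L t)) / t integrable, and Fubini applies to laws
  without any moments.\<close>

lemma (in real_distribution) expectation_arctan_diff:
  assumes e: "0 < e" "e < L"
  shows "(\<integral>x. arctan (x / e) - arctan (x / L) \<partial>M)
    = (LINT t:{0<..}|lborel. (exp (- e * t) - exp (- L * t)) / t * Im (char M t))"
proof -
  define k where "k t = indicator {0<..} t * ((exp (- e * t) - exp (- L * t)) / t)" for t :: real
  define f where "f t x = k t * sin (t * x)" for t x :: real
  interpret P: pair_sigma_finite lborel M ..
  have k: "0 \<le> k t" "k t \<le> (L - e) * (indicator {0<..} t *\<^sub>R (exp (- e * t powr 1) * t powr (1 - 1)))" for t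
  proof -
    have "0 \<le> k t \<and> k t \<le> (L - e) * exp (- e * t)" if t: "t > 0"
    proof -
      have le: "exp (- L * t) \<le> exp (- e * t)" using e t by simp
      have "1 + - ((L - e) * t) \<le> exp (- ((L - e) * t))" by (rule exp_ge_add_one_self)
      then have "exp (- e * t) * (1 - exp (- ((L - e) * t))) \<le> exp (- e * t) * ((L - e) * t)"
        by (intro mult_left_mono) auto
      also have "exp (- e * t) * (1 - exp (- ((L - e) * t))) = exp (- e * t) - exp (- L * t)"
        by (simp add: right_diff_distrib exp_add[symmetric] algebra_simps)
      finally show ?thesis using t le by (simp add: k_def divide_simps mult_ac)
    qed
    then show "0 \<le> k t" "k t \<le> (L - e) * (indicator {0<..} t *\<^sub>R (exp (- e * t powr 1) * t powr (1 - 1)))"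
      by (cases "t > 0"; simp add: k_def)+
  qed
  have [measurable]: "k \<in> borel_measurable borel" unfolding k_def by measurable
  have ki: "integrable lborel k"
  proof (rule Bochner_Integration.integrable_bound)
    show "integrable lborel (\<lambda>t. (L - e) * (indicator {0<..} t *\<^sub>R (exp (- e * t powr 1) * t powr (1 - 1))))"
      using set_integrable_exp_powr[of 1 e] e unfolding set_integrable_def by (intro integrable_mult_right) auto
    show "AE t in lborel. norm (k t) \<le> norm ((L - e) * (indicator {0<..} t *\<^sub>R (exp (- e * t powr 1) * t powr (1 - 1))))"
    proof (intro AE_I2)
      fix t
      show "norm (k t) \<le> norm ((L - e) * (indicator {0<..} t *\<^sub>R (exp (- e * t powr 1) * t powr (1 - 1))))"
        using k(1)[of t] k(2)[of t] unfolding real_norm_def by linarith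
    qed
  qed simp
  have fk: "norm (f t x) \<le> k t" for t x
    using mult_left_le[OF abs_sin_le_one[of "t * x"] k(1)[of t]] k(1)[of t] by (simp add: f_def abs_mult)
  have fi: "integrable M (f t)" for t
    by (rule integrable_const_bound[where B="k t"]) (use fk in \<open>auto simp: f_def[abs_def]\<close>)
  have m: "case_prod f \<in> borel_measurable (lborel \<Otimes>\<^sub>M M)"
    unfolding f_def[abs_def] by measurable
  have int: "integrable (lborel \<Otimes>\<^sub>M M) (case_prod f)"
  proof (rule P.Fubini_integrable[OF m])
    show "AE t in lborel. integrable M (\<lambda>x. case_prod f (t, x))" using fi by auto
    show "integrable lborel (\<lambda>t. \<integral>x. norm (case_prod f (t, x)) \<partial>M)"
    proof (rule Bochner_Integration.integrable_bound[OF ki])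
      show "AE t in lborel. norm (\<integral>x. norm (case_prod f (t, x)) \<partial>M) \<le> norm (k t)"
      proof (intro AE_I2)
        fix t
        have "(\<integral>x. norm (f t x) \<partial>M) \<le> (\<integral>x. k t \<partial>M)"
          by (rule integral_mono) (use fi fk in auto)
        then show "norm (\<integral>x. norm (case_prod f (t, x)) \<partial>M) \<le> norm (k t)" using k by (simp add: prob_space[simplified])
      qed
    qed (use m in measurable)
  qed
  have "(\<integral>x. arctan (x / e) - arctan (x / L) \<partial>M) = (\<integral>x. \<integral>t. f t x \<partial>lborel \<partial>M)"
  proof (rule Bochner_Integration.integral_cong)
    fix x
    have S: "set_integrable lborel {0<..} (\<lambda>t. exp (- a * t) * sin (x * t) / t)"
      "(LINT t:{0<..}|lborel. exp (- a * t) * sin (x * t) / t) = arctan (x / a)" if "a > 0" for a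
    proof -
      have *: "(\<lambda>t. indicator {0<..} t *\<^sub>R (exp (- a * t powr 1) * sin (x * t powr 1) / t))
          = (\<lambda>t. indicator {0<..} t *\<^sub>R (exp (- a * t) * sin (x * t) / t))"
        by (auto simp: indicator_def)
      show "set_integrable lborel {0<..} (\<lambda>t. exp (- a * t) * sin (x * t) / t)"
        using set_integrable_exp_sin_powr[of 1 a x] that unfolding set_integrable_def * by simp
      show "(LINT t:{0<..}|lborel. exp (- a * t) * sin (x * t) / t) = arctan (x / a)"
        using set_integral_exp_sin_powr[of 1 a x] that unfolding set_lebesgue_integral_def * by simp
    qed
    have "(\<integral>t. f t x \<partial>lborel) = (LINT t:{0<..}|lborel. exp (- e * t) * sin (x * t) / t - exp (- L * t) * sin (x * t) / t)"
      unfolding set_lebesgue_integral_def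
    proof (rule Bochner_Integration.integral_cong)
      fix t :: real
      show "f t x = indicator {0<..} t *\<^sub>R (exp (- e * t) * sin (x * t) / t - exp (- L * t) * sin (x * t) / t)"
        by (cases "t > 0") (simp_all add: f_def k_def diff_divide_distrib left_diff_distrib right_diff_distrib mult_ac)
    qed simp
    also have "\<dots> = arctan (x / e) - arctan (x / L)"
      using set_integral_diff(2)[OF S(1)[of e] S(1)[of L]] S(2)[of e] S(2)[of L] e by simp
    finally show "arctan (x / e) - arctan (x / L) = (\<integral>t. f t x \<partial>lborel)" ..
  qed simp
  also have "\<dots> = (\<integral>t. \<integral>x. f t x \<partial>M \<partial>lborel)"
    using P.Fubini_integral[OF int] by simp
  also have "\<dots> = (LINT t:{0<..}|lborel. (exp (- e * t) - exp (- L * t)) / t * Im (char M t))"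
    unfolding set_lebesgue_integral_def
  proof (rule Bochner_Integration.integral_cong)
    fix t :: real
    have "Im (char M t) = (\<integral>x. sin (t * x) \<partial>M)"
      unfolding char_def using integral_Im[OF integrable_iexp[of "\<lambda>x. t * x"]] by (simp add: Im_exp)
    then show "(\<integral>x. f t x \<partial>M) = indicator {0<..} t *\<^sub>R ((exp (- e * t) - exp (- L * t)) / t * Im (char M t))"
      by (simp add: f_def k_def)
  qed simp
  finally show ?thesis .
qed

text \<open>Inversion in the style of Gil-Pelaez: as e tends to 0 and L to infinity, arctan (x / e)
  - arctan (x / L) tends to pi / 2 times sgn x, so the integral of Im (char t) / t equals pi / 2
  times P(X > 0) - P(X < 0). For char t = exp (- t^\<alpha> (A - i B)) that integral is arctan (B /
  A) / \<alpha>, and the absence of an atom at 0 turns the result into a formula for P(X \<le>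
  0).\<close>

theorem (in real_distribution) stable_negativity:
  assumes \<alpha>: "0 < \<alpha>" and A: "0 < A"
    and char: "\<And>t. 0 < t \<Longrightarrow> char M t = exp (- of_real (t powr \<alpha>) * Complex A (- B))"
  shows "prob {..0} = 1 / 2 - arctan (B / A) / (pi * \<alpha>)"
proof -
  have norm_char: "norm (char M t) = exp (- A * t powr \<alpha>)" if "0 < t" for t
    using char[OF that] by simp
  have Im_char: "Im (char M t) = exp (- A * t powr \<alpha>) * sin (B * t powr \<alpha>)" if "0 < t" for t
    using char[OF that] by (simp add: Im_exp mult_ac)
  have "((\<lambda>t. exp (- A * t powr \<alpha>)) \<longlongrightarrow> 0) at_top" using \<alpha> A by real_asymp
  then have "((\<lambda>t. norm (char M t)) \<longlongrightarrow> 0) at_top"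
  proof (rule Lim_transform_eventually)
    show "\<forall>\<^sub>F t in at_top. exp (- A * t powr \<alpha>) = norm (char M t)"
      using eventually_gt_at_top[of 0] by eventually_elim (simp only: norm_char)
  qed
  then have atom: "prob {0} = 0" by (rule no_atom_at_0[OF tendsto_norm_zero_cancel])
  \<comment> \<open>The shift by 2 keeps e < L strictly for every index, n = 0 included.\<close>
  define e where "e n = 1 / real (n + 2)" for n
  define L where "L n = real (n + 2)" for n
  have eL: "0 < e n" "e n < L n" "0 < L n" for n
  proof -
    show "0 < e n" "0 < L n" by (auto simp: e_def L_def)
    have "e n \<le> 1" "1 < L n" by (auto simp: e_def L_def)
    then show "e n < L n" by linarith
  qed
  have e0: "e \<longlonglongrightarrow> 0" and Linf: "filterlim L at_top sequentially"
    unfolding e_def L_def by real_asymp+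
  have lhs: "(\<lambda>n. \<integral>x. arctan (x / e n) - arctan (x / L n) \<partial>M) \<longlonglongrightarrow> (\<integral>x. pi / 2 * sgn x \<partial>M)"
  proof (rule integral_dominated_convergence[where w="\<lambda>_. pi"])
    have p: "(\<lambda>n. arctan (x / e n) - arctan (x / L n)) \<longlonglongrightarrow> pi / 2" if "x > 0" for x
    proof -
      have "(\<lambda>n. arctan (x / e n) - arctan (x / L n)) \<longlonglongrightarrow> pi / 2 - arctan 0"
      proof (intro tendsto_diff)
        have "filterlim (\<lambda>n. x / e n) at_top sequentially" unfolding e_def using that by real_asymp
        then show "(\<lambda>n. arctan (x / e n)) \<longlonglongrightarrow> pi / 2" by (rule filterlim_compose[OF tendsto_arctan_at_top])
        have "(\<lambda>n. x / L n) \<longlonglongrightarrow> 0" unfolding L_def by real_asymp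
        then show "(\<lambda>n. arctan (x / L n)) \<longlonglongrightarrow> arctan 0" by (rule tendsto_arctan)
      qed
      then show ?thesis by simp
    qed
    show "AE x in M. (\<lambda>n. arctan (x / e n) - arctan (x / L n)) \<longlonglongrightarrow> pi / 2 * sgn x"
    proof (intro AE_I2)
      fix x :: real
      show "(\<lambda>n. arctan (x / e n) - arctan (x / L n)) \<longlonglongrightarrow> pi / 2 * sgn x"
      proof (cases x "0 :: real" rule: linorder_cases)
        case less
        then have "(\<lambda>n. - (arctan (- x / e n) - arctan (- x / L n))) \<longlonglongrightarrow> - (pi / 2)"
          by (intro tendsto_minus p) simp
        then show ?thesis using less by (simp add: arctan_minus)
      next
        case equal
        then show ?thesis by simp
      next
        case greater
        then show ?thesis using p[OF greater] by simp
      qed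
    qed
    show "AE x in M. norm (arctan (x / e n) - arctan (x / L n)) \<le> pi" for n
    proof (intro AE_I2)
      fix x
      show "norm (arctan (x / e n) - arctan (x / L n)) \<le> pi"
        using arctan_bounded[of "x / e n"] arctan_bounded[of "x / L n"] by (simp add: abs_le_iff)
    qed
  qed auto
  have "(\<lambda>n. LINT t:{0<..}|lborel. (exp (- e n * t) - exp (- L n * t)) / t * Im (char M t))
      \<longlonglongrightarrow> (LINT t:{0<..}|lborel. exp (- A * t powr \<alpha>) * sin (B * t powr \<alpha>) / t)"
    unfolding set_lebesgue_integral_def
  proof (rule integral_dominated_convergence[where w="\<lambda>t. norm (indicator {0<..} t *\<^sub>R (exp (- A * t powr \<alpha>) * sin (B * t powr \<alpha>) / t))"])
    show "integrable lborel (\<lambda>t. norm (indicator {0<..} t *\<^sub>R (exp (- A * t powr \<alpha>) * sin (B * t powr \<alpha>) / t)))"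
      using set_integrable_exp_sin_powr[OF \<alpha> A] unfolding set_integrable_def by (rule integrable_norm)
    show "AE t in lborel. (\<lambda>n. indicator {0<..} t *\<^sub>R ((exp (- e n * t) - exp (- L n * t)) / t * Im (char M t)))
        \<longlonglongrightarrow> indicator {0<..} t *\<^sub>R (exp (- A * t powr \<alpha>) * sin (B * t powr \<alpha>) / t)"
    proof (intro AE_I2)
      fix t :: real
      show "(\<lambda>n. indicator {0<..} t *\<^sub>R ((exp (- e n * t) - exp (- L n * t)) / t * Im (char M t)))
          \<longlonglongrightarrow> indicator {0<..} t *\<^sub>R (exp (- A * t powr \<alpha>) * sin (B * t powr \<alpha>) / t)"
      proof (cases "t > 0")
        case True
        have "(\<lambda>n. exp (- e n * t)) \<longlonglongrightarrow> exp (- 0 * t)" by (intro tendsto_intros e0)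
        moreover have "(\<lambda>n. exp (- L n * t)) \<longlonglongrightarrow> 0" unfolding L_def using True by real_asymp
        ultimately have "(\<lambda>n. exp (- e n * t) - exp (- L n * t)) \<longlonglongrightarrow> exp (- 0 * t) - 0"
          by (rule tendsto_diff)
        then have "(\<lambda>n. (exp (- e n * t) - exp (- L n * t)) / t * Im (char M t)) \<longlonglongrightarrow> (exp (- 0 * t) - 0) / t * Im (char M t)"
          using True by (intro tendsto_mult tendsto_divide tendsto_const) auto
        then show ?thesis using True by (simp add: Im_char)
      qed simp
    qed
    show "AE t in lborel. norm (indicator {0<..} t *\<^sub>R ((exp (- e n * t) - exp (- L n * t)) / t * Im (char M t)))
        \<le> norm (indicator {0<..} t *\<^sub>R (exp (- A * t powr \<alpha>) * sin (B * t powr \<alpha>) / t))" for n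
    proof (intro AE_I2)
      fix t :: real
      show "norm (indicator {0<..} t *\<^sub>R ((exp (- e n * t) - exp (- L n * t)) / t * Im (char M t)))
        \<le> norm (indicator {0<..} t *\<^sub>R (exp (- A * t powr \<alpha>) * sin (B * t powr \<alpha>) / t))"
      proof (cases "t > 0")
        case True
        have "exp (- L n * t) \<le> exp (- e n * t)" using eL(2)[of n] True by simp
        moreover have "exp (- e n * t) \<le> 1" using eL(1)[of n] True by simp
        moreover have "exp (- L n * t) > 0" by simp
        ultimately have "\<bar>exp (- e n * t) - exp (- L n * t)\<bar> \<le> 1" by linarith
        then have "\<bar>exp (- e n * t) - exp (- L n * t)\<bar> * (\<bar>Im (char M t)\<bar> / t) \<le> 1 * (\<bar>Im (char M t)\<bar> / t)"
          using True by (intro mult_right_mono) auto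
        then show ?thesis using True by (simp add: Im_char abs_mult)
      qed simp
    qed
  qed (use char_measurable in measurable)
  from LIMSEQ_unique[OF lhs[unfolded expectation_arctan_diff[OF eL(1,2)]] this]
  have "(\<integral>x. pi / 2 * sgn x \<partial>M) = arctan (B / A) / \<alpha>"
    by (simp only: set_integral_exp_sin_powr[OF \<alpha> A])
  moreover have "(\<integral>x. pi / 2 * sgn x \<partial>M) = pi / 2 * (1 - 2 * prob {..0})"
  proof -
    have "AE x in M. x \<noteq> 0" using atom by (subst (asm) prob_eq_0) auto
    then have "(\<integral>x. pi / 2 * sgn x \<partial>M) = (\<integral>x. pi / 2 * (1 - 2 * indicator {..0} x) \<partial>M)"
      by (intro integral_cong_AE) (auto simp: indicator_def sgn_if)
    also have "\<dots> = pi / 2 * (1 - 2 * prob {..0})"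
    proof -
      have "integrable M (indicator {..0::real} :: real \<Rightarrow> real)" by (simp add: less_top[symmetric])
      then show ?thesis by (simp add: prob_space[simplified])
    qed
    finally show ?thesis .
  qed
  ultimately have *: "pi / 2 * (1 - 2 * prob {..0}) = arctan (B / A) / \<alpha>" by simp
  have "1 - 2 * prob {..0} = (2 / pi) * (pi / 2 * (1 - 2 * prob {..0}))" by simp
  also have "\<dots> = 2 * (arctan (B / A) / (pi * \<alpha>))" unfolding * by simp
  finally show ?thesis by linarith
qed

section \<open>Characteristic exponents of stable processes\<close>

lemma
  assumes p: "p > (-1::real)"
  shows set_integrable_powr_Ioo: "set_integrable lborel {0<..<1} (\<lambda>y. y powr p)"
    and set_integral_powr_Ioo: "(LINT y:{0<..<1}|lborel. y powr p) = 1 / (p + 1)"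
proof -
  have eq: "indicator {0<..<1} y *\<^sub>R (y powr (p + 1 - 1) * (1 - y) powr (1 - 1)) = indicator {0<..<1} y *\<^sub>R (y powr p)"
    for y :: real by (auto simp: indicator_def)
  show "set_integrable lborel {0<..<1} (\<lambda>y. y powr p)"
    using set_integrable_Beta[of "p + 1" 1] p unfolding set_integrable_def eq by simp
  have "(LINT y:{0<..<1}|lborel. y powr p) = Beta (p + 1) 1"
    using set_integral_Beta[of "p + 1" 1] p unfolding set_lebesgue_integral_def eq by simp
  also have "\<dots> = 1 / (p + 1)"
  proof -
    have "p + 1 \<notin> \<int>\<^sub>\<le>\<^sub>0" using p nonpos_Ints_nonpos[of "p + 1"] by auto
    moreover have "0 < Gamma (p + 1)" by (rule Gamma_real_pos) (use p in simp)
    ultimately show ?thesis using Gamma_plus1[of "p + 1"] by (simp add: Beta_def)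
  qed
  finally show "(LINT y:{0<..<1}|lborel. y powr p) = 1 / (p + 1)" .
qed

lemma
  assumes p: "p < (-1::real)"
  shows set_integrable_powr_Ici: "set_integrable lborel {1..} (\<lambda>y. y powr p)"
    and set_integral_powr_Ici: "(LINT y:{1..}|lborel. y powr p) = - 1 / (p + 1)"
proof -
  have "(\<integral>\<^sup>+y. ennreal (y powr p) * indicator {1..} y \<partial>lborel) = ennreal (0 - 1 powr (p + 1) / (p + 1))"
  proof (rule nn_integral_FTC_atLeast[where F="\<lambda>y. y powr (p + 1) / (p + 1)" and a=1 and T=0])
    show "((\<lambda>y. y powr (p + 1) / (p + 1)) has_real_derivative y powr p) (at y)" if "1 \<le> y" for y
      using that p by (auto intro!: derivative_eq_intros)
    have "((\<lambda>y::real. y powr (p + 1)) \<longlongrightarrow> 0) at_top" using p by real_asymp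
    then show "((\<lambda>y. y powr (p + 1) / (p + 1)) \<longlongrightarrow> 0) at_top" by (rule tendsto_divide_zero)
  qed auto
  moreover have "(\<integral>\<^sup>+y. ennreal (y powr p) * indicator {1..} y \<partial>lborel) = (\<integral>\<^sup>+y. ennreal (indicator {1..} y *\<^sub>R y powr p) \<partial>lborel)"
    by (rule nn_integral_cong) (auto simp: indicator_def)
  ultimately have "(\<integral>\<^sup>+y. ennreal (indicator {1..} y *\<^sub>R y powr p) \<partial>lborel) = ennreal (- 1 / (p + 1))" by simp
  then have "integrable lborel (\<lambda>y. indicator {1..} y *\<^sub>R y powr p) \<and> (\<integral>y. indicator {1..} y *\<^sub>R y powr p \<partial>lborel) = - 1 / (p + 1)"
    by (subst (asm) nn_integral_eq_integrable) (use p in \<open>auto simp: divide_nonpos_neg\<close>)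
  then show "set_integrable lborel {1..} (\<lambda>y. y powr p)" "(LINT y:{1..}|lborel. y powr p) = - 1 / (p + 1)"
    unfolding set_integrable_def set_lebesgue_integral_def by auto
qed

lemma set_integrable_split_powr:
  assumes "p > (-1::real)" "q < (-1::real)"
  shows "set_integrable lborel {0<..} (\<lambda>y. C * (y powr p * indicator {..<1} y + y powr q * indicator {1..} y))"
proof -
  have eq: "indicator {0<..} y *\<^sub>R (C * (y powr p * indicator {..<1} y + y powr q * indicator {1..} y))
      = C * (indicator {0<..<1} y *\<^sub>R y powr p + indicator {1..} y *\<^sub>R y powr q)" for y :: real
    by (auto simp: indicator_def)
  show ?thesis
    using set_integrable_powr_Ioo[OF assms(1)] set_integrable_powr_Ici[OF assms(2)]
    unfolding set_integrable_def eq by (intro integrable_mult_right Bochner_Integration.integrable_add)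
qed

lemma set_integral_Ioi_pos:
  fixes f :: "real \<Rightarrow> real"
  assumes i: "set_integrable lborel {0<..} f" and nn: "\<And>y. 0 < y \<Longrightarrow> 0 \<le> f y"
    and pos: "\<And>y. 0 < y \<Longrightarrow> y < 1 \<Longrightarrow> 0 < f y"
  shows "0 < (LINT y:{0<..}|lborel. f y)"
proof -
  let ?g = "\<lambda>y. indicator {0<..} y *\<^sub>R f y"
  have g0: "0 \<le> ?g y" for y using nn by (simp add: indicator_def)
  have "(\<integral>y. ?g y \<partial>lborel) \<ge> 0" by (rule integral_nonneg_AE) (use g0 in auto)
  moreover have "(\<integral>y. ?g y \<partial>lborel) \<noteq> 0"
  proof
    assume "(\<integral>y. ?g y \<partial>lborel) = 0"
    then have "AE y in lborel. ?g y = 0"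
      using integral_nonneg_eq_0_iff_AE[OF i[unfolded set_integrable_def]] g0 by auto
    then have "AE y in lborel. y \<notin> {0<..<1::real}"
    proof eventually_elim
      case (elim y)
      then show ?case using pos[of y] by auto
    qed
    then have "emeasure lborel {0<..<1::real} = 0"
      by (subst (asm) AE_iff_measurable[where N="{0<..<1}"]) auto
    then show False by simp
  qed
  ultimately show ?thesis unfolding set_lebesgue_integral_def by linarith
qed

lemma exp_taylor_bounds:
  fixes u :: complex
  assumes "Re u \<le> 0"
  shows "norm (exp u - 1) \<le> norm u" "norm (exp u - 1 - u) \<le> (norm u)\<^sup>2" "norm (exp u) \<le> 1"
proof -
  have c: "convex {z. Re z \<le> 0}" by (rule convex_halfspace_Re_le)
  have T: "norm (exp u - (\<Sum>i\<le>n. exp 0 * (u - 0) ^ i / fact i)) \<le> 1 * norm (u - 0) ^ Suc n / fact n" for n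
    by (rule field_Taylor[OF c, where f="\<lambda>_. exp"]) (use assms in \<open>auto intro!: derivative_eq_intros\<close>)
  show "norm (exp u - 1) \<le> norm u" using T[of 0] by simp
  show "norm (exp u - 1 - u) \<le> (norm u)\<^sup>2" using T[of 1] by (simp add: power2_eq_square algebra_simps)
  show "norm (exp u) \<le> 1" using assms by simp
qed

text \<open>Either \<open>0 < \<alpha> < 1\<close> without compensation, or \<open>1 < \<alpha> < 2\<close> with full linear compensation: in both
  cases the integral below scales exactly.\<close>

definition stable_kernel :: "real \<Rightarrow> real \<Rightarrow> complex \<Rightarrow> real \<Rightarrow> complex" where
  "stable_kernel e \<alpha> z y = (exp (- z * of_real y) - 1 + of_real e * z * of_real y) * of_real (y powr (- \<alpha> - 1))"

context
  fixes e \<alpha> :: real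
  assumes e\<alpha>: "(e = 0 \<and> 0 < \<alpha> \<and> \<alpha> < 1) \<or> (e = 1 \<and> 1 < \<alpha> \<and> \<alpha> < 2)"
begin

lemma stable_kernel_bound:
  assumes z: "Re z \<ge> 0" "norm z \<le> R" and y: "0 < y"
  shows "norm (stable_kernel e \<alpha> z y)
    \<le> (R + R\<^sup>2 + 2) * (y powr (e - \<alpha>) * indicator {..<1} y + y powr (e - \<alpha> - 1) * indicator {1..} y)"
proof -
  define u where "u = - z * of_real y"
  have u: "Re u \<le> 0" "norm u \<le> R * y" using z y by (auto simp: u_def norm_mult)
  have R: "R \<ge> 0" using z norm_ge_zero[of z] by linarith
  have K: "norm (stable_kernel e \<alpha> z y) = norm (exp u - 1 - of_real e * u) * y powr (- \<alpha> - 1)"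
    by (simp add: stable_kernel_def u_def norm_mult mult.assoc)
  have p: "y powr (e - \<alpha>) = (y * y powr e) * y powr (- \<alpha> - 1)" "y powr (e - \<alpha> - 1) = y powr e * y powr (- \<alpha> - 1)"
  proof -
    have q: "e - \<alpha> - 1 = e + (- \<alpha> - 1)" "e - \<alpha> = 1 + (e + (- \<alpha> - 1))" by simp_all
    show "y powr (e - \<alpha>) = (y * y powr e) * y powr (- \<alpha> - 1)" unfolding q(2) powr_add using y by simp
    show "y powr (e - \<alpha> - 1) = y powr e * y powr (- \<alpha> - 1)" unfolding q(1) powr_add ..
  qed
  have e: "e = 0 \<or> e = 1" using e\<alpha> by auto
  have "norm (exp u - 1 - of_real e * u)
    \<le> (R + R\<^sup>2 + 2) * ((y * y powr e) * indicator {..<1} y + y powr e * indicator {1..} y)"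
  proof (cases "y < 1")
    case True
    have "norm (exp u - 1 - of_real e * u) \<le> (R + R\<^sup>2) * (y * y powr e)"
    proof (cases "e = 0")
      case True
      have "norm (exp u - 1) \<le> R * y" using exp_taylor_bounds(1)[OF u(1)] u(2) by linarith
      also have "\<dots> \<le> (R + R\<^sup>2) * y" using y by (intro mult_right_mono) auto
      finally show ?thesis using True y by simp
    next
      case False
      then have e1: "e = 1" using e by simp
      have "norm (exp u - 1 - u) \<le> (R * y)\<^sup>2"
        using exp_taylor_bounds(2)[OF u(1)] power_mono[OF u(2) norm_ge_zero, of 2] by linarith
      also have "\<dots> = R\<^sup>2 * (y * y)" by (simp add: power2_eq_square)
      also have "\<dots> \<le> (R + R\<^sup>2) * (y * y)" using R y by (intro mult_right_mono) auto
      finally show ?thesis using e1 y by simp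
    qed
    also have "\<dots> \<le> (R + R\<^sup>2 + 2) * (y * y powr e)" using y by (intro mult_right_mono) auto
    finally show ?thesis using True by simp
  next
    case False
    then have y1: "y \<ge> 1" by simp
    have n2: "norm (exp u - 1) \<le> 2"
      using norm_triangle_ineq4[of "exp u" 1] exp_taylor_bounds(3)[OF u(1)] norm_one[where 'a=complex] by linarith
    have "norm (exp u - 1 - of_real e * u) \<le> (R + 2) * y powr e"
    proof (cases "e = 0")
      case True
      then show ?thesis using n2 R y by simp
    next
      case False
      then have e1: "e = 1" using e by simp
      have "norm (exp u - 1 - u) \<le> norm (exp u - 1) + norm u" by (rule norm_triangle_ineq4)
      also have "\<dots> \<le> 2 * y + R * y" using n2 u(2) y1 by linarith
      finally show ?thesis using e1 y by (simp add: algebra_simps)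
    qed
    also have "\<dots> \<le> (R + R\<^sup>2 + 2) * y powr e" by (intro mult_right_mono) auto
    finally show ?thesis using False by simp
  qed
  then have "norm (exp u - 1 - of_real e * u) * y powr (- \<alpha> - 1)
      \<le> (R + R\<^sup>2 + 2) * ((y * y powr e) * indicator {..<1} y + y powr e * indicator {1..} y) * y powr (- \<alpha> - 1)"
    by (rule mult_right_mono) simp
  also have "\<dots> = (R + R\<^sup>2 + 2) * (y powr (e - \<alpha>) * indicator {..<1} y + y powr (e - \<alpha> - 1) * indicator {1..} y)"
    unfolding p by (simp add: algebra_simps)
  finally show ?thesis unfolding K .
qed

lemma stable_dominator:
  "integrable lborel (\<lambda>y. indicator {0<..} y *\<^sub>R
    (C * (y powr (e - \<alpha>) * indicator {..<1} y + y powr (e - \<alpha> - 1) * indicator {1..} y)))"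
proof -
  have "e - \<alpha> > -1" "e - \<alpha> - 1 < -1" using e\<alpha> by auto
  from set_integrable_split_powr[OF this] show ?thesis unfolding set_integrable_def .
qed

lemma stable_kernel_dominated:
  assumes z: "Re z \<ge> 0" "norm z \<le> R"
  shows "norm (indicator {0<..} y *\<^sub>R stable_kernel e \<alpha> z y) \<le> indicator {0<..} y *\<^sub>R
    ((R + R\<^sup>2 + 2) * (y powr (e - \<alpha>) * indicator {..<1} y + y powr (e - \<alpha> - 1) * indicator {1..} y))"
  using stable_kernel_bound[OF z, of y] by (cases "0 < y") simp_all

lemma measurable_stable_kernel:
  "(\<lambda>y. indicator {0<..} y *\<^sub>R stable_kernel e \<alpha> z y) \<in> borel_measurable lborel"
  unfolding stable_kernel_def by measurable

lemma set_integrable_stable_kernel: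
  assumes z: "Re z \<ge> 0"
  shows "set_integrable lborel {0<..} (stable_kernel e \<alpha> z)"
  unfolding set_integrable_def
proof (rule Bochner_Integration.integrable_bound[OF stable_dominator measurable_stable_kernel])
  show "AE y in lborel. norm (indicator {0<..} y *\<^sub>R stable_kernel e \<alpha> z y) \<le> norm (indicator {0<..} y *\<^sub>R
    ((norm z + (norm z)\<^sup>2 + 2) * (y powr (e - \<alpha>) * indicator {..<1} y + y powr (e - \<alpha> - 1) * indicator {1..} y)))"
  proof (intro AE_I2)
    fix y
    show "norm (indicator {0<..} y *\<^sub>R stable_kernel e \<alpha> z y) \<le> norm (indicator {0<..} y *\<^sub>R
    ((norm z + (norm z)\<^sup>2 + 2) * (y powr (e - \<alpha>) * indicator {..<1} y + y powr (e - \<alpha> - 1) * indicator {1..} y)))"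
      using order_trans[OF stable_kernel_dominated[OF z order_refl, of y] abs_ge_self] by simp
  qed
qed

definition stable_G :: "complex \<Rightarrow> complex" where
  "stable_G z = (\<integral>y. indicator {0<..} y *\<^sub>R stable_kernel e \<alpha> z y \<partial>lborel)"

lemma continuous_stable_G: "continuous_on {z. Re z \<ge> 0} stable_G"
  unfolding stable_G_def[abs_def]
proof (rule continuous_on_dominated_integral)
  show "continuous_on {z. 0 \<le> Re z} (\<lambda>z. indicator {0<..} y *\<^sub>R stable_kernel e \<alpha> z y)" for y
    unfolding stable_kernel_def by (intro continuous_intros)
  fix z :: complex
  show "\<exists>r>0. \<exists>g. integrable lborel g \<and> (\<forall>u\<in>{z. 0 \<le> Re z} \<inter> cball z r. \<forall>y\<in>space lborel.
      norm (indicator {0<..} y *\<^sub>R stable_kernel e \<alpha> u y) \<le> g y)"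
  proof (rule exI[of _ 1], intro conjI, simp, rule exI, intro conjI ballI)
    show "norm (indicator {0<..} y *\<^sub>R stable_kernel e \<alpha> u y) \<le> indicator {0<..} y *\<^sub>R
      (((norm z + 1) + (norm z + 1)\<^sup>2 + 2) * (y powr (e - \<alpha>) * indicator {..<1} y + y powr (e - \<alpha> - 1) * indicator {1..} y))"
      if "u \<in> {z. 0 \<le> Re z} \<inter> cball z 1" for u y
    proof (rule stable_kernel_dominated)
      show "Re u \<ge> 0" using that by simp
      show "norm u \<le> norm z + 1" using that norm_triangle_ineq2[of u z] by (simp add: dist_norm norm_minus_commute)
    qed
  qed (rule stable_dominator)
qed (rule measurable_stable_kernel)

lemma holomorphic_stable_G: "stable_G holomorphic_on {z. Re z > 0}"
  unfolding stable_G_def[abs_def]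
proof (rule holomorphic_on_dominated_integral)
  show op: "open {z. 0 < Re z}" by (rule open_halfspace_Re_gt)
  show "(\<lambda>z. indicator {0<..} y *\<^sub>R stable_kernel e \<alpha> z y) holomorphic_on {z. 0 < Re z}" for y
    unfolding stable_kernel_def scaleR_conv_of_real by (intro holomorphic_intros)
  fix z :: complex assume "z \<in> {z. 0 < Re z}"
  then obtain r where r: "r > 0" "cball z r \<subseteq> {z. 0 < Re z}" using op open_contains_cball by blast
  show "\<exists>r>0. cball z r \<subseteq> {z. 0 < Re z} \<and> (\<exists>g. integrable lborel g \<and> (\<forall>u\<in>cball z r. \<forall>y\<in>space lborel.
      norm (indicator {0<..} y *\<^sub>R stable_kernel e \<alpha> u y) \<le> g y))"
  proof (rule exI[of _ r], intro conjI, fact, fact, rule exI, intro conjI ballI)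
    show "norm (indicator {0<..} y *\<^sub>R stable_kernel e \<alpha> u y) \<le> indicator {0<..} y *\<^sub>R
      (((norm z + r) + (norm z + r)\<^sup>2 + 2) * (y powr (e - \<alpha>) * indicator {..<1} y + y powr (e - \<alpha> - 1) * indicator {1..} y))"
      if "u \<in> cball z r" for u y
    proof (rule stable_kernel_dominated)
      have "u \<in> {z. 0 < Re z}" using that r(2) by (rule subsetD[rotated])
      then show "Re u \<ge> 0" by simp
      show "norm u \<le> norm z + r" using that norm_triangle_ineq2[of u z] by (simp add: dist_norm norm_minus_commute)
    qed
  qed (rule stable_dominator)
qed (rule measurable_stable_kernel)

lemma stable_G_real_scaling:
  assumes r: "r > 0"
  shows "stable_G (of_real r) = of_real r powr of_real \<alpha> * stable_G 1"
proof -
  have "stable_G 1 = \<bar>r\<bar> *\<^sub>R (\<integral>y. indicator {0<..} (0 + r * y) *\<^sub>R stable_kernel e \<alpha> 1 (0 + r * y) \<partial>lborel)"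
    unfolding stable_G_def by (rule lborel_integral_real_affine) (use r in simp)
  also have "\<dots> = \<bar>r\<bar> *\<^sub>R (\<integral>y. of_real (r powr (- \<alpha> - 1)) * (indicator {0<..} y *\<^sub>R stable_kernel e \<alpha> (of_real r) y) \<partial>lborel)"
  proof (intro arg_cong[where f="\<lambda>x. \<bar>r\<bar> *\<^sub>R x"] Bochner_Integration.integral_cong refl)
    fix y :: real
    show "indicator {0<..} (0 + r * y) *\<^sub>R stable_kernel e \<alpha> 1 (0 + r * y)
        = of_real (r powr (- \<alpha> - 1)) * (indicator {0<..} y *\<^sub>R stable_kernel e \<alpha> (of_real r) y)"
      using r by (cases "y > 0") (simp_all add: stable_kernel_def powr_mult zero_less_mult_iff mult_ac)
  qed
  also have "\<dots> = \<bar>r\<bar> *\<^sub>R (of_real (r powr (- \<alpha> - 1)) * stable_G (of_real r))"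
    unfolding stable_G_def integral_mult_right_zero ..
  also have "\<dots> = of_real (r * r powr (- \<alpha> - 1)) * stable_G (of_real r)"
    using r by (simp add: scaleR_conv_of_real)
  also have "r * r powr (- \<alpha> - 1) = r powr (- \<alpha>)" using r by (simp add: powr_mult_base)
  finally have "stable_G 1 = of_real (r powr (- \<alpha>)) * stable_G (of_real r)" .
  moreover have "r powr \<alpha> * r powr (- \<alpha>) = 1" using r by (simp flip: powr_add)
  ultimately have "of_real (r powr \<alpha>) * stable_G 1 = stable_G (of_real r)"
    by (simp flip: mult.assoc of_real_mult)
  then show ?thesis using r powr_of_real[of r \<alpha>] by simp
qed

text \<open>The substitution of r y for y gives the power law at real arguments, the identity
  theorem extends it to Re z > 0, and continuity extends it to the imaginary axis, where the
  characteristic exponent is read off.\<close>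

lemma stable_G_scaling:
  assumes z: "Re z \<ge> 0" "z \<noteq> 0"
  shows "stable_G z = z powr of_real \<alpha> * stable_G 1"
proof -
  have open_half: "stable_G w = w powr of_real \<alpha> * stable_G 1" if w: "Re w > 0" for w
  proof (rule analytic_identity_real[where f=stable_G and g="\<lambda>w. w powr of_real \<alpha> * stable_G 1"
        and S="{z. Re z > 0}" and T="of_real ` {0<..}" and x=1])
    show "(\<lambda>w. w powr complex_of_real \<alpha> * stable_G 1) holomorphic_on {z. 0 < Re z}"
      by (intro holomorphic_intros) (auto simp: complex_nonpos_Reals_iff)
    show "connected {z. 0 < Re z}" by (intro convex_connected convex_halfspace_Re_gt)
    show "1 islimpt complex_of_real ` {0<..}" using real_islimpt[of "{0<..}" 1] by simp
    show "stable_G v = v powr of_real \<alpha> * stable_G 1" if "v \<in> complex_of_real ` {0<..}" for v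
      using that stable_G_real_scaling by auto
  qed (use w open_halfspace_Re_gt[of 0] holomorphic_stable_G in auto)
  define Z where "Z n = z + of_real (1 / real (Suc n))" for n
  have Zp: "Re (Z n) > 0" for n
  proof -
    have "0 < 1 / real (Suc n)" by simp
    then show ?thesis using z unfolding Z_def plus_complex.sel Re_complex_of_real by linarith
  qed
  have Z: "Z \<longlonglongrightarrow> z"
  proof -
    have "(\<lambda>n. z + of_real (1 / real (Suc n))) \<longlonglongrightarrow> z + of_real 0"
      by (intro tendsto_add tendsto_const tendsto_of_real) real_asymp
    then show ?thesis by (simp add: Z_def[abs_def])
  qed
  have nz: "z \<notin> \<real>\<^sub>\<le>\<^sub>0" using z by (auto simp: complex_nonpos_Reals_iff complex_eq_iff)
  have "(\<lambda>n. stable_G (Z n)) \<longlonglongrightarrow> stable_G z"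
  proof -
    have "(stable_G \<circ> Z) \<longlonglongrightarrow> stable_G z"
      using continuous_stable_G[unfolded continuous_on_sequentially] Z Zp z(1)
      by (metis (mono_tags, lifting) less_imp_le mem_Collect_eq)
    then show ?thesis by (simp add: comp_def)
  qed
  moreover have "(\<lambda>n. Z n powr of_real \<alpha> * stable_G 1) \<longlonglongrightarrow> z powr of_real \<alpha> * stable_G 1"
    by (intro tendsto_mult tendsto_powr_complex Z nz tendsto_const)
  moreover have "stable_G (Z n) = Z n powr of_real \<alpha> * stable_G 1" for n
    by (rule open_half[OF Zp])
  ultimately show ?thesis using LIMSEQ_unique by simp
qed

text \<open>In closed form this is Gamma (- \<alpha>). What enters later is the sign of its product
  with cos (pi \<alpha> / 2); the value itself cancels in the ratio that determines \<rho>.\<close>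

definition stable_g :: real where
  "stable_g = (LINT y:{0<..}|lborel. (exp (- y) - 1 + e * y) * y powr (- \<alpha> - 1))"

lemma stable_G_1: "stable_G 1 = of_real stable_g"
proof -
  have "indicator {0<..} y *\<^sub>R stable_kernel e \<alpha> 1 y
      = of_real (indicator {0<..} y *\<^sub>R ((exp (- y) - 1 + e * y) * y powr (- \<alpha> - 1)))" for y
    by (simp add: stable_kernel_def scaleR_conv_of_real flip: exp_of_real)
  then show ?thesis
    unfolding stable_G_def stable_g_def set_lebesgue_integral_def by (simp only: integral_complex_of_real)
qed

text \<open>For \<alpha> < 1 the function exp (- y) - 1 is negative and the cosine positive; for
  \<alpha> > 1 both signs are reversed. This is what makes the modulus of the characteristic
  function decay.\<close>

lemma stable_g_cos_neg: "stable_g * cos (pi * \<alpha> / 2) < 0"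
proof -
  let ?f = "\<lambda>y. (exp (- y) - 1 + e * y) * y powr (- \<alpha> - 1)"
  have i: "set_integrable lborel {0<..} ?f"
  proof -
    have "integrable lborel (\<lambda>y. Re (indicator {0<..} y *\<^sub>R stable_kernel e \<alpha> 1 y))"
      using set_integrable_stable_kernel[of 1] unfolding set_integrable_def by (intro integrable_Re) simp
    moreover have "(\<lambda>y. Re (indicator {0<..} y *\<^sub>R stable_kernel e \<alpha> 1 y)) = (\<lambda>y. indicator {0<..} y *\<^sub>R ?f y)"
      by (rule ext) (simp add: stable_kernel_def exp_of_real[symmetric] Re_exp)
    ultimately show ?thesis unfolding set_integrable_def by (simp only:)
  qed
  consider "e = 0" "0 < \<alpha>" "\<alpha> < 1" | "e = 1" "1 < \<alpha>" "\<alpha> < 2" using e\<alpha> by linarith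
  then show ?thesis
  proof cases
    case 1
    have "0 < (LINT y:{0<..}|lborel. - ?f y)"
    proof (rule set_integral_Ioi_pos)
      have neg: "0 < - ?f y" if "0 < y" for y using that 1 by (simp add: mult_neg_pos)
      show "0 \<le> - ?f y" if "0 < y" for y using neg[OF that] by linarith
      show "0 < - ?f y" if "0 < y" "y < 1" for y using neg[OF that(1)] .
      show "set_integrable lborel {0<..} (\<lambda>y. - ?f y)"
        using set_integrable_mult_right[OF i, of "-1"] by simp
    qed
    then have "stable_g < 0" unfolding stable_g_def set_lebesgue_integral_def by simp
    moreover have "cos (pi * \<alpha> / 2) > 0"
    proof (rule cos_gt_zero_pi)
      have "pi * \<alpha> < pi * 1" using 1 by (intro mult_strict_left_mono) simp_all
      moreover have "0 < pi * \<alpha>" using 1 by simp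
      ultimately
      show "- (pi / 2) < pi * \<alpha> / 2" "pi * \<alpha> / 2 < pi / 2" using pi_gt_zero by linarith+
    qed
    ultimately show ?thesis by (simp add: mult_neg_pos)
  next
    case 2
    have "0 < (LINT y:{0<..}|lborel. ?f y)"
    proof (rule set_integral_Ioi_pos[OF i])
      have pos: "0 < ?f y" if "0 < y" for y
      proof -
        \<comment> \<open>Strictness comes from squaring 1 - y / 2 \<le> exp (- y / 2), which
          produces the extra term (y / 2)^2; beyond y = 2 the left-hand side is negative.\<close>
        have "1 - y < exp (- y)"
        proof (cases "y \<le> 2")
          case True
          have "1 + - (y / 2) \<le> exp (- (y / 2))" by (rule exp_ge_add_one_self)
          then have "(1 + - (y / 2))\<^sup>2 \<le> (exp (- (y / 2)))\<^sup>2" using True by (intro power_mono) auto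
          also have "(exp (- (y / 2)))\<^sup>2 = exp (- y)" by (simp add: power2_eq_square flip: exp_add)
          also have "(1 + - (y / 2))\<^sup>2 = 1 - y + (y / 2)\<^sup>2" by (simp add: power2_eq_square algebra_simps)
          moreover have "(y / 2)\<^sup>2 > 0" using that by simp
          ultimately show ?thesis by linarith
        next
          case False
          have "0 < exp (- y)" by simp
          then show ?thesis using False by linarith
        qed
        then show ?thesis using that 2 by simp
      qed
      show "0 \<le> ?f y" if "0 < y" for y using pos[OF that] by linarith
      show "0 < ?f y" if "0 < y" "y < 1" for y using pos[OF that(1)] .
    qed
    then have "stable_g > 0" unfolding stable_g_def .
    moreover have "cos (pi * \<alpha> / 2) < 0"
    proof -
      have "cos (pi - pi * \<alpha> / 2) > 0"
      proof (rule cos_gt_zero_pi)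
        have "pi * \<alpha> < pi * 2" "pi * 1 < pi * \<alpha>" using 2 by (intro mult_strict_left_mono; simp)+
        then show "- (pi / 2) < pi - pi * \<alpha> / 2" "pi - pi * \<alpha> / 2 < pi / 2" by linarith+
      qed
      then show ?thesis by simp
    qed
    ultimately show ?thesis by (simp add: mult_pos_neg)
  qed
qed

lemma stable_G_imag:
  assumes t: "t > 0"
  shows "stable_G (- (\<i> * of_real t)) = of_real (t powr \<alpha> * stable_g) * exp (- (\<i> * of_real (pi * \<alpha> / 2)))"
    and "stable_G (\<i> * of_real t) = of_real (t powr \<alpha> * stable_g) * exp (\<i> * of_real (pi * \<alpha> / 2))"
proof -
  have tt: "complex_of_real (t powr \<alpha>) = exp (of_real \<alpha> * of_real (ln t))"
    using t by (simp add: powr_def exp_of_real flip: of_real_mult)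
  have e: "- (\<i> * complex_of_real t) = of_real t * (- \<i>)" by simp
  have L: "Ln (- (\<i> * of_real t)) = of_real (ln t) + Ln (- \<i>)"
    unfolding e by (subst Ln_times_of_real) (use t in \<open>auto simp: Ln_of_real\<close>)
  have m: "of_real \<alpha> * (of_real (ln t) + Ln (- \<i>)) = of_real \<alpha> * of_real (ln t) + - (\<i> * of_real (pi * \<alpha> / 2))"
    by (simp add: algebra_simps)
  have "(- (\<i> * of_real t)) powr of_real \<alpha> = exp (of_real \<alpha> * (of_real (ln t) + Ln (- \<i>)))"
    using t unfolding powr_def L by simp
  then have "(- (\<i> * of_real t)) powr of_real \<alpha> = of_real (t powr \<alpha>) * exp (- (\<i> * of_real (pi * \<alpha> / 2)))"
    unfolding tt m exp_add .
  then show "stable_G (- (\<i> * of_real t)) = of_real (t powr \<alpha> * stable_g) * exp (- (\<i> * of_real (pi * \<alpha> / 2)))"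
    using stable_G_scaling[of "- (\<i> * of_real t)"] t by (simp add: stable_G_1)
  have e: "\<i> * complex_of_real t = of_real t * \<i>" by simp
  have L: "Ln (\<i> * of_real t) = of_real (ln t) + Ln \<i>"
    unfolding e by (subst Ln_times_of_real) (use t in \<open>auto simp: Ln_of_real\<close>)
  have m: "of_real \<alpha> * (of_real (ln t) + Ln \<i>) = of_real \<alpha> * of_real (ln t) + \<i> * of_real (pi * \<alpha> / 2)"
    by (simp add: algebra_simps)
  have "(\<i> * of_real t) powr of_real \<alpha> = exp (of_real \<alpha> * (of_real (ln t) + Ln \<i>))"
    using t unfolding powr_def L by simp
  then have "(\<i> * of_real t) powr of_real \<alpha> = of_real (t powr \<alpha>) * exp (\<i> * of_real (pi * \<alpha> / 2))"
    unfolding tt m exp_add .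
  then show "stable_G (\<i> * of_real t) = of_real (t powr \<alpha> * stable_g) * exp (\<i> * of_real (pi * \<alpha> / 2))"
    using stable_G_scaling[of "\<i> * of_real t"] t by (simp add: stable_G_1)
qed

text \<open>The prescribed compensator cuts off at 1, while exact scaling asks for none (\<alpha> <
  1) or for the full linear one (\<alpha> > 1). The difference has the same integral 1 / (1 -
  \<alpha>) in both regimes, which explains the drift (cp - cm) / (1 - \<alpha>).\<close>

lemma
  shows set_integrable_stable_compensator:
      "set_integrable lborel {0<..} (\<lambda>y. (indicator {..<1} y - e) * y powr (- \<alpha>))"
    and set_integral_stable_compensator:
      "(LINT y:{0<..}|lborel. (indicator {..<1} y - e) * y powr (- \<alpha>)) = 1 / (1 - \<alpha>)"
proof -
  consider "e = 0" "0 < \<alpha>" "\<alpha> < 1" | "e = 1" "1 < \<alpha>" "\<alpha> < 2" using e\<alpha> by linarith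
  then have "set_integrable lborel {0<..} (\<lambda>y. (indicator {..<1} y - e) * y powr (- \<alpha>)) \<and>
    (LINT y:{0<..}|lborel. (indicator {..<1} y - e) * y powr (- \<alpha>)) = 1 / (1 - \<alpha>)"
  proof cases
    case 1
    have eq: "indicator {0<..} y *\<^sub>R ((indicator {..<1} y - e) * y powr (- \<alpha>)) = indicator {0<..<1} y *\<^sub>R (y powr (- \<alpha>))"
      for y :: real using 1 by (auto simp: indicator_def)
    have "- \<alpha> > -1" using 1 by simp
    from set_integrable_powr_Ioo[OF this] set_integral_powr_Ioo[OF this] show ?thesis
      unfolding set_integrable_def set_lebesgue_integral_def eq by simp
  next
    case 2
    have eq: "indicator {0<..} y *\<^sub>R ((indicator {..<1} y - e) * y powr (- \<alpha>)) = - (indicator {1..} y *\<^sub>R (y powr (- \<alpha>)))"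
      for y :: real using 2 by (auto simp: indicator_def)
    have "- \<alpha> < -1" using 2 by simp
    from set_integrable_powr_Ici[OF this] set_integral_powr_Ici[OF this] show ?thesis
      unfolding set_integrable_def set_lebesgue_integral_def eq by (simp add: minus_divide_right)
  qed
  then show "set_integrable lborel {0<..} (\<lambda>y. (indicator {..<1} y - e) * y powr (- \<alpha>))"
    "(LINT y:{0<..}|lborel. (indicator {..<1} y - e) * y powr (- \<alpha>)) = 1 / (1 - \<alpha>)" by simp_all
qed

text \<open>Positive jumps contribute \<open>stable_G\<close> at -i t and negative jumps at i t,
  where the values are t^\<alpha> times conjugate phases of angle pi \<alpha> / 2; the drift cancels
  the two compensator terms.\<close>

lemma stable_exponent_eq:
  assumes t: "t > 0"
  shows "stable_exponent \<alpha> cp cm t = - of_real (t powr \<alpha>) *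
    Complex (- stable_g * (cp + cm) * cos (pi * \<alpha> / 2)) (- (- stable_g * (cp - cm) * sin (pi * \<alpha> / 2)))"
proof -
  define F where "F y = (iexp (t * y) - 1 - \<i> * complex_of_real (t * y) * indicator {y. \<bar>y\<bar> < 1} y)
        * complex_of_real (stable_density \<alpha> cp cm y)" for y
  define D where "D y = (indicator {..<1} y - e) * y powr (- \<alpha>)" for y :: real
  define H where "H c z y = indicator {0<..} y *\<^sub>R (of_real c * (stable_kernel e \<alpha> z y + z * of_real (D y)))" for c z y
  let ?z = "\<i> * complex_of_real t"
  have \<alpha>1: "\<alpha> \<noteq> 1" using e\<alpha> by auto
  have Dy: "D y = (indicator {..<1} y - e) * y * y powr (- \<alpha> - 1)" if "y > 0" for y
    using that by (simp add: D_def powr_mult_base mult.assoc)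
  have pos: "indicator {0<..} y *\<^sub>R F y = H cp (- ?z) y" for y
  proof (cases "y > 0")
    case True
    have i: "indicator {y. \<bar>y\<bar> < 1} y = complex_of_real (indicator {..<1} y)" using True by (simp add: indicator_def)
    show ?thesis using True unfolding F_def H_def Dy[OF True] stable_kernel_def stable_density_def i
      by (simp add: algebra_simps)
  qed (simp add: H_def)
  have neg: "indicator {..<0} (0 + -1 * y) *\<^sub>R F (0 + -1 * y) = H cm ?z y" for y
  proof (cases "y > 0")
    case True
    have i: "indicator {y. \<bar>y\<bar> < 1} (- y) = complex_of_real (indicator {..<1} y)" using True by (simp add: indicator_def)
    show ?thesis using True unfolding F_def H_def Dy[OF True] stable_kernel_def stable_density_def
      by (simp add: algebra_simps i)
  qed (simp add: H_def)
  have DI: "integrable lborel (\<lambda>y. indicator {0<..} y *\<^sub>R complex_of_real (D y))"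
    "(\<integral>y. indicator {0<..} y *\<^sub>R complex_of_real (D y) \<partial>lborel) = of_real (1 / (1 - \<alpha>))"
  proof -
    have eq: "indicator {0<..} y *\<^sub>R complex_of_real (D y) = complex_of_real (indicator {0<..} y *\<^sub>R D y)" for y
      by (simp add: scaleR_conv_of_real)
    show "integrable lborel (\<lambda>y. indicator {0<..} y *\<^sub>R complex_of_real (D y))"
    proof -
      have "integrable lborel (\<lambda>y. indicator {0<..} y *\<^sub>R D y)"
        using set_integrable_stable_compensator unfolding set_integrable_def D_def .
      then show ?thesis unfolding eq by (rule integrable_of_real)
    qed
    show "(\<integral>y. indicator {0<..} y *\<^sub>R complex_of_real (D y) \<partial>lborel) = of_real (1 / (1 - \<alpha>))"
      unfolding eq integral_complex_of_real using set_integral_stable_compensator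
      by (simp only: set_lebesgue_integral_def D_def)
  qed
  have H: "integrable lborel (H c z)" "(\<integral>y. H c z y \<partial>lborel) = of_real c * (stable_G z + z * of_real (1 / (1 - \<alpha>)))"
    if z: "Re z \<ge> 0" for c z
  proof -
    have eq: "H c z = (\<lambda>y. of_real c * (indicator {0<..} y *\<^sub>R stable_kernel e \<alpha> z y + z * (indicator {0<..} y *\<^sub>R of_real (D y))))"
      unfolding H_def by (auto simp: fun_eq_iff scaleR_conv_of_real algebra_simps)
    have k: "integrable lborel (\<lambda>y. indicator {0<..} y *\<^sub>R stable_kernel e \<alpha> z y)"
      using set_integrable_stable_kernel[OF z] unfolding set_integrable_def .
    note zD = integrable_mult_right[OF DI(1), of z]
    show "integrable lborel (H c z)"
      unfolding eq by (intro integrable_mult_right Bochner_Integration.integrable_add k DI(1))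
    show "(\<integral>y. H c z y \<partial>lborel) = of_real c * (stable_G z + z * of_real (1 / (1 - \<alpha>)))"
      unfolding eq integral_mult_right_zero Bochner_Integration.integral_add[OF k zD] DI(2) stable_G_def ..
  qed
  have P: "integrable lborel (\<lambda>y. indicator {0<..} y *\<^sub>R F y)"
    "(\<integral>y. indicator {0<..} y *\<^sub>R F y \<partial>lborel) = of_real cp * (stable_G (- ?z) + - ?z * of_real (1 / (1 - \<alpha>)))"
    unfolding pos by (rule H, simp)+
  have N: "integrable lborel (\<lambda>y. indicator {..<0} y *\<^sub>R F y)"
    "(\<integral>y. indicator {..<0} y *\<^sub>R F y \<partial>lborel) = of_real cm * (stable_G ?z + ?z * of_real (1 / (1 - \<alpha>)))"
    using lborel_integrable_real_affine_iff[of "-1" "\<lambda>y. indicator {..<0} y *\<^sub>R F y" 0]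
      lborel_integral_real_affine[of "-1" "\<lambda>y. indicator {..<0} y *\<^sub>R F y" 0] H[of ?z cm]
    unfolding neg by simp_all
  have F: "F = (\<lambda>y. indicator {0<..} y *\<^sub>R F y + indicator {..<0} y *\<^sub>R F y)"
  proof
    fix y :: real
    have "F 0 = 0" by (simp add: F_def)
    then show "F y = indicator {0<..} y *\<^sub>R F y + indicator {..<0} y *\<^sub>R F y"
      by (cases y "0 :: real" rule: linorder_cases) auto
  qed
  have "(\<integral>y. F y \<partial>lborel) = of_real cp * (stable_G (- ?z) + - ?z * of_real (1 / (1 - \<alpha>)))
      + of_real cm * (stable_G ?z + ?z * of_real (1 / (1 - \<alpha>)))"
    by (subst F) (simp only: Bochner_Integration.integral_add[OF P(1) N(1)] P(2) N(2))
  then have "stable_exponent \<alpha> cp cm t = of_real cp * stable_G (- ?z) + of_real cm * stable_G ?z"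
    using \<alpha>1 unfolding stable_exponent_def stable_drift_def F_def[symmetric]
    by (simp add: algebra_simps diff_divide_distrib)
  also have "\<dots> = of_real (t powr \<alpha> * stable_g) * (of_real cp * exp (- (\<i> * of_real (pi * \<alpha> / 2))) + of_real cm * exp (\<i> * of_real (pi * \<alpha> / 2)))"
    unfolding stable_G_imag[OF t] by (simp add: algebra_simps)
  also have "\<dots> = - of_real (t powr \<alpha>) *
    Complex (- stable_g * (cp + cm) * cos (pi * \<alpha> / 2)) (- (- stable_g * (cp - cm) * sin (pi * \<alpha> / 2)))"
    by (simp add: complex_eq_iff Re_exp Im_exp algebra_simps)
  finally show ?thesis .
qed

end

text \<open>Pairing y with -y cancels the compensator and the imaginary part and leaves -2 c (1 -
  cos (t u)) / u^2, whose integral is linear in t by scaling. Positivity of the constant is enough,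
  since it enters \<rho> only through arctan (0 / \<kappa>).\<close>

lemma cauchy_exponent_eq:
  assumes c: "c > 0"
  obtains \<kappa> where "\<kappa> > 0" "\<And>t. t > 0 \<Longrightarrow> stable_exponent 1 c c t = - of_real (t powr 1) * Complex \<kappa> (- 0)"
proof -
  define h where "h t u = (1 - cos (t * u)) * u powr (-2)" for t u :: real
  have hb: "norm (h t u) \<le> (t\<^sup>2 + 2) * (u powr 0 * indicator {..<1} u + u powr (-2) * indicator {1..} u)" if "u > 0" for t u
  proof (cases "u < 1")
    case True
    have "1 - cos (t * u) = 2 * (sin (t * u / 2))\<^sup>2" using cos_double_sin[of "t * u / 2"] by simp
    also have "\<dots> \<le> 2 * (t * u / 2)\<^sup>2"
      by (intro mult_left_mono abs_le_square_iff[THEN iffD1, OF abs_sin_x_le_abs_x]) simp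
    also have "\<dots> \<le> t\<^sup>2 * u\<^sup>2"
    proof -
      have "2 * (t * u / 2)\<^sup>2 = (t\<^sup>2 * u\<^sup>2) / 2" by (simp add: power2_eq_square)
      moreover have "0 \<le> t\<^sup>2 * u\<^sup>2" by simp
      ultimately show ?thesis by linarith
    qed
    finally have "(1 - cos (t * u)) * u powr (-2) \<le> t\<^sup>2 * u\<^sup>2 * u powr (-2)" by (rule mult_right_mono) simp
    also have "\<dots> = t\<^sup>2" using that by (simp add: powr_minus powr_numeral)
    finally show ?thesis using True that cos_le_one[of "t * u"] by (simp add: h_def)
  next
    case False
    have "\<bar>1 - cos (t * u)\<bar> \<le> t\<^sup>2 + 2"
      using cos_le_one[of "t * u"] cos_ge_minus_one[of "t * u"] zero_le_power2[of t] unfolding abs_le_iff by linarith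
    then have "\<bar>1 - cos (t * u)\<bar> * u powr (-2) \<le> (t\<^sup>2 + 2) * u powr (-2)" by (rule mult_right_mono) simp
    then show ?thesis using False by (simp add: h_def abs_mult)
  qed
  have hi: "set_integrable lborel {0<..} (h t)" for t
  proof (rule set_integrable_bound_Ioi[OF set_integrable_split_powr[of 0 "-2" "t\<^sup>2 + 2"]])
    show "h t \<in> borel_measurable borel" unfolding h_def[abs_def] by measurable
    show "norm (h t u) \<le> (t\<^sup>2 + 2) * (u powr 0 * indicator {..<1} u + u powr (-2) * indicator {1..} u)"
      if "u \<in> {0<..}" for u by (rule hb) (use that in simp)
  qed simp_all
  define \<kappa> where "\<kappa> = 2 * c * (LINT u:{0<..}|lborel. h 1 u)"
  have "0 < (LINT u:{0<..}|lborel. h 1 u)"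
  proof (rule set_integral_Ioi_pos[OF hi])
    show "0 \<le> h 1 y" for y by (simp add: h_def)
    show "0 < h 1 y" if "0 < y" "y < 1" for y
    proof -
      have "0 < sin (y / 2)" using that pi_gt3 by (intro sin_gt_zero) auto
      moreover have "1 - cos y = 2 * (sin (y / 2))\<^sup>2" using cos_double_sin[of "y / 2"] by simp
      ultimately show ?thesis using that by (simp add: h_def)
    qed
  qed
  then have \<kappa>: "\<kappa> > 0" using c by (simp add: \<kappa>_def)
  have scal: "(LINT u:{0<..}|lborel. h t u) = t * (LINT u:{0<..}|lborel. h 1 u)" if t: "t > 0" for t
  proof -
    have "(LINT u:{0<..}|lborel. h 1 u) = \<bar>t\<bar> *\<^sub>R (\<integral>u. indicator {0<..} (0 + t * u) *\<^sub>R h 1 (0 + t * u) \<partial>lborel)"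
      unfolding set_lebesgue_integral_def by (rule lborel_integral_real_affine) (use t in simp)
    also have "(\<lambda>u. indicator {0<..} (0 + t * u) *\<^sub>R h 1 (0 + t * u)) = (\<lambda>u. t powr (-2) * (indicator {0<..} u *\<^sub>R h t u))"
    proof
      fix u
      show "indicator {0<..} (0 + t * u) *\<^sub>R h 1 (0 + t * u) = t powr (-2) * (indicator {0<..} u *\<^sub>R h t u)"
        using t by (cases "u > 0") (simp_all add: h_def powr_mult zero_less_mult_iff mult_ac)
    qed
    also have "\<bar>t\<bar> *\<^sub>R (\<integral>u. t powr (-2) * (indicator {0<..} u *\<^sub>R h t u) \<partial>lborel) = (t * t powr (-2)) * (LINT u:{0<..}|lborel. h t u)"
      using t by (simp add: set_lebesgue_integral_def)
    also have "t * t powr (-2) = 1 / t" using t by (simp add: powr_minus powr_numeral power2_eq_square divide_simps)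
    finally show ?thesis using t by simp
  qed
  have "stable_exponent 1 c c t = - of_real (t powr 1) * Complex \<kappa> (- 0)" if t: "t > 0" for t
  proof -
    define F where "F y = (iexp (t * y) - 1 - \<i> * complex_of_real (t * y) * indicator {y. \<bar>y\<bar> < 1} y)
          * complex_of_real (stable_density 1 c c y)" for y
    have F_minus: "F (- y) = cnj (F y)" for y
      by (cases y "0 :: real" rule: linorder_cases) (simp_all add: F_def stable_density_def exp_cnj indicator_def)
    have Fb: "norm (F u) \<le> c * ((t\<^sup>2 + 2) * (u powr 0 * indicator {..<1} u + u powr (-2) * indicator {1..} u))" if u: "u > 0" for u
    proof -
      have e: "Re (\<i> * complex_of_real (t * u)) \<le> 0" by simp
      have d: "stable_density 1 c c u = c * u powr (-2)" using u by (simp add: stable_density_def)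
      show ?thesis
      proof (cases "u < 1")
        case True
        have "norm (F u) \<le> (norm (\<i> * complex_of_real (t * u)))\<^sup>2 * (c * u powr (-2))"
          unfolding F_def d norm_mult using True u exp_taylor_bounds(2)[OF e] c
          by (intro mult_mono) (auto simp: norm_mult abs_mult)
        also have "\<dots> = c * (t\<^sup>2 * (u\<^sup>2 * u powr (-2)))" using u by (simp add: norm_mult power_mult_distrib)
        also have "u\<^sup>2 * u powr (-2) = 1" using u by (simp add: powr_minus powr_numeral)
        finally show ?thesis using True u c by (simp add: distrib_left)
      next
        case False
        have "norm (iexp (t * u) - 1) \<le> 2"
          using norm_triangle_ineq4[of "iexp (t * u)" 1] by simp
        then have "norm (F u) \<le> 2 * (c * u powr (-2))"
          unfolding F_def d norm_mult using False c by (intro mult_mono) (auto simp: abs_mult norm_mult)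
        also have "\<dots> \<le> c * ((t\<^sup>2 + 2) * u powr (-2))" using c by (simp add: algebra_simps)
        finally show ?thesis using False by simp
      qed
    qed
    have mF: "F \<in> borel_measurable borel" unfolding F_def stable_density_def by measurable
    have P: "set_integrable lborel {0<..} F"
      by (rule set_integrable_bound_Ioi[OF set_integrable_mult_right[OF set_integrable_split_powr[of 0 "-2" "t\<^sup>2 + 2"], of c] mF _ Fb]) auto
    have "set_integrable lborel {0<..} (\<lambda>y. cnj (F y))"
    proof (rule set_integrable_bound_Ioi[OF set_integrable_mult_right[OF set_integrable_split_powr[of 0 "-2" "t\<^sup>2 + 2"], of c]])
      show "(\<lambda>y. cnj (F y)) \<in> borel_measurable borel"
        unfolding F_minus[symmetric] using mF by measurable
      show "norm (cnj (F u)) \<le> c * ((t\<^sup>2 + 2) * (u powr 0 * indicator {..<1} u + u powr (-2) * indicator {1..} u))"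
        if "u \<in> {0<..}" for u
        unfolding complex_mod_cnj by (rule Fb) (use that in simp)
    qed simp_all
    then have Pc: "integrable lborel (\<lambda>y. indicator {0<..} y *\<^sub>R cnj (F y))" unfolding set_integrable_def .
    have neg: "indicator {..<0} (0 + -1 * y) *\<^sub>R F (0 + -1 * y) = indicator {0<..} y *\<^sub>R cnj (F y)" for y
      using F_minus[of y] by (simp add: indicator_def)
    have N: "integrable lborel (\<lambda>y. indicator {..<0} y *\<^sub>R F y)"
      "(\<integral>y. indicator {..<0} y *\<^sub>R F y \<partial>lborel) = (\<integral>y. indicator {0<..} y *\<^sub>R cnj (F y) \<partial>lborel)"
      using lborel_integrable_real_affine_iff[of "-1" "\<lambda>y. indicator {..<0} y *\<^sub>R F y" 0] Pc
        lborel_integral_real_affine[of "-1" "\<lambda>y. indicator {..<0} y *\<^sub>R F y" 0]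
      unfolding neg by simp_all
    have F: "F = (\<lambda>y. indicator {0<..} y *\<^sub>R F y + indicator {..<0} y *\<^sub>R F y)"
    proof
      fix y :: real
      have "F 0 = 0" by (simp add: F_def)
      then show "F y = indicator {0<..} y *\<^sub>R F y + indicator {..<0} y *\<^sub>R F y"
        by (cases y "0 :: real" rule: linorder_cases) auto
    qed
    have Pi: "integrable lborel (\<lambda>y. indicator {0<..} y *\<^sub>R F y)" using P unfolding set_integrable_def .
    have "(\<integral>y. F y \<partial>lborel) = (\<integral>y. indicator {0<..} y *\<^sub>R F y \<partial>lborel) + (\<integral>y. indicator {0<..} y *\<^sub>R cnj (F y) \<partial>lborel)"
      by (subst F) (simp only: Bochner_Integration.integral_add[OF Pi N(1)] N(2))
    also have "\<dots> = (\<integral>y. indicator {0<..} y *\<^sub>R F y + indicator {0<..} y *\<^sub>R cnj (F y) \<partial>lborel)"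
      by (rule Bochner_Integration.integral_add[OF Pi Pc, symmetric])
    also have "\<dots> = (\<integral>y. complex_of_real ((- 2 * c) * (indicator {0<..} y *\<^sub>R h t y)) \<partial>lborel)"
    proof (rule Bochner_Integration.integral_cong)
      fix y :: real
      show "indicator {0<..} y *\<^sub>R F y + indicator {0<..} y *\<^sub>R cnj (F y) = complex_of_real ((- 2 * c) * (indicator {0<..} y *\<^sub>R h t y))"
        by (cases "y > 0") (simp_all add: F_def h_def stable_density_def complex_eq_iff Re_exp Im_exp algebra_simps indicator_def)
    qed simp
    also have "\<dots> = complex_of_real ((- 2 * c) * (LINT u:{0<..}|lborel. h t u))"
      unfolding integral_complex_of_real set_lebesgue_integral_def by simp
    also have "\<dots> = - of_real t * of_real \<kappa>" unfolding scal[OF t] \<kappa>_def by simp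
    finally have "(\<integral>y. F y \<partial>lborel) = - of_real t * of_real \<kappa>" .
    then show ?thesis using t unfolding stable_exponent_def stable_drift_def F_def[symmetric]
      by (simp add: complex_eq_iff)
  qed
  with \<kappa> show thesis by (rule that)
qed

section \<open>Hypergeometric exponents\<close>

lemma Re_pos_not_nonpos_Ints: "Re z > 0 \<Longrightarrow> z \<notin> \<int>\<^sub>\<le>\<^sub>0"
  by (auto elim!: nonpos_Ints_cases)

lemma Gamma_rGamma_nonzero:
  fixes z :: complex
  assumes "Re z > 0"
  shows "Gamma z \<noteq> 0" "rGamma z \<noteq> 0" "Gamma z * rGamma z = 1"
proof -
  note np = Re_pos_not_nonpos_Ints[OF assms]
  show "Gamma z \<noteq> 0" "rGamma z \<noteq> 0" using np by (simp_all add: Gamma_eq_zero_iff rGamma_eq_zero_iff)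
  then show "Gamma z * rGamma z = 1" by (simp add: rGamma_inverse_Gamma)
qed

text \<open>On (0, 1) a factor x^v with Re v \<ge> 0 has modulus at most 1, so the Beta integral is
  largest in modulus at v = 0.\<close>

lemma norm_complex_Beta_le:
  assumes a: "a > 0" and c: "c > (0::real)" and v: "Re v \<ge> 0"
  shows "norm (Beta (of_real a + v) (of_real c)) \<le> Beta a c"
proof -
  have az: "Re (of_real a + v) > 0" using a v by simp
  have "norm (Beta (of_real a + v) (of_real c))
      \<le> (\<integral>x. norm (indicator {0<..<1} x *\<^sub>R (cpow x (of_real a + v - 1) * of_real ((1 - x) powr (c - 1)))) \<partial>lborel)"
    unfolding set_integral_complex_Beta[OF c az, symmetric] set_lebesgue_integral_def by (rule integral_norm_bound)
  also have "\<dots> \<le> (\<integral>x. indicator {0<..<1} x *\<^sub>R (x powr (a - 1) * (1 - x) powr (c - 1)) \<partial>lborel)"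
  proof (rule integral_mono)
    show "integrable lborel (\<lambda>x. norm (indicator {0<..<1} x *\<^sub>R (cpow x (of_real a + v - 1) * of_real ((1 - x) powr (c - 1)))))"
      using set_integrable_complex_Beta[OF c az] unfolding set_integrable_def by (rule integrable_norm)
    show "integrable lborel (\<lambda>x. indicator {0<..<1} x *\<^sub>R (x powr (a - 1) * (1 - x) powr (c - 1)))"
      using set_integrable_Beta[OF a c] unfolding set_integrable_def .
    show "norm (indicator {0<..<1} x *\<^sub>R (cpow x (of_real a + v - 1) * of_real ((1 - x) powr (c - 1))))
        \<le> indicator {0<..<1} x *\<^sub>R (x powr (a - 1) * (1 - x) powr (c - 1))" for x
    proof (cases "x \<in> {0<..<1}")
      case True
      then have "x powr (a + Re v - 1) \<le> x powr (a - 1)" using v by (intro powr_mono') auto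
      then show ?thesis using True by (simp add: norm_mult norm_cpow mult_right_mono)
    qed simp
  qed
  also have "\<dots> = Beta a c" using set_integral_Beta[OF a c] by (simp only: set_lebesgue_integral_def)
  finally show ?thesis .
qed

text \<open>Two applications of the functional equation raise the second argument to b + 2 + v. The
  quotient becomes a Beta function, bounded on the half-plane, times two linear factors. The
  remaining parameter c = b + 2 - a is positive for both quotients that occur: 1 against 1 - r, and
  r against \<alpha>.\<close>

lemma Gamma_ratio_bound:
  assumes a: "a > 0" and b: "b > (0::real)" and ab: "a < b + 2"
  shows "\<exists>K\<ge>0. \<forall>v. Re v \<ge> 0 \<longrightarrow>
    norm (Gamma (of_real a + v) * rGamma (of_real b + v)) \<le> K * (b + 1 + norm v)\<^sup>2"
proof -
  define c where "c = b + 2 - a"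
  have c: "c > 0" using ab by (simp add: c_def)
  define K where "K = Beta a c / Gamma c"
  have gc: "Gamma c > 0" by (rule Gamma_real_pos[OF c])
  have K: "K \<ge> 0"
    using norm_complex_Beta_le[OF a c, of 0] gc order_trans[OF norm_ge_zero] unfolding K_def by (intro divide_nonneg_pos) auto
  have "norm (Gamma (of_real a + v) * rGamma (of_real b + v)) \<le> K * (b + 1 + norm v)\<^sup>2" if v: "Re v \<ge> 0" for v
  proof -
    let ?b = "of_real b + v"
    have e: "?b + 1 + 1 = (of_real a + v) + of_real c" by (simp add: c_def)
    have "rGamma ?b = ?b * ((?b + 1) * rGamma (?b + 1 + 1))" by (simp only: rGamma_plus1)
    then have R: "rGamma ?b = ?b * ((?b + 1) * rGamma ((of_real a + v) + of_real c))" unfolding e .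
    have B: "Gamma (of_real a + v) * rGamma ((of_real a + v) + of_real c) = Beta (of_real a + v) (of_real c) / of_real (Gamma c)"
      using gc by (simp add: Beta_altdef Gamma_complex_of_real)
    have "Gamma (of_real a + v) * rGamma ?b = ?b * ((?b + 1) * (Gamma (of_real a + v) * rGamma ((of_real a + v) + of_real c)))"
      unfolding R by (simp only: mult_ac)
    then have "Gamma (of_real a + v) * rGamma ?b = ?b * ((?b + 1) * (Beta (of_real a + v) (of_real c) / of_real (Gamma c)))"
      unfolding B .
    then have "norm (Gamma (of_real a + v) * rGamma ?b) = norm ?b * (norm (?b + 1) * (norm (Beta (of_real a + v) (of_real c)) / Gamma c))"
      using gc by (simp add: norm_mult norm_divide)
    also have "\<dots> \<le> (b + 1 + norm v) * ((b + 1 + norm v) * (Beta a c / Gamma c))"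
    proof (intro mult_mono divide_right_mono norm_complex_Beta_le a c v)
      show "norm ?b \<le> b + 1 + norm v" using norm_triangle_ineq[of "of_real b" v] b by simp
      show "norm (?b + 1) \<le> b + 1 + norm v"
      proof -
        have "norm (complex_of_real (b + 1)) = b + 1" using b by (simp only: norm_of_real)
        moreover have "?b + 1 = complex_of_real (b + 1) + v" by simp
        ultimately show ?thesis using norm_triangle_ineq[of "complex_of_real (b + 1)" v] by (simp only:)
      qed
    qed (use b gc K in \<open>auto simp: K_def\<close>)
    finally show ?thesis by (simp add: K_def power2_eq_square mult_ac)
  qed
  then show ?thesis using K by (intro exI[of _ K]) simp
qed

lemma square_subexponential:
  assumes e: "e > (0::real)" and c: "c \<ge> 0"
  shows "\<exists>C\<ge>0. \<forall>x\<ge>0. (c + x)\<^sup>2 \<le> C * exp (e * x)"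
proof -
  \<comment> \<open>Chosen so that c + x \<le> m (1 + e x / 2), where 1 + e x / 2 \<le> exp (e x /
    2).\<close>
  define m where "m = c + 2 / e"
  have m: "m \<ge> 0" using e c by (simp add: m_def)
  have "(c + x)\<^sup>2 \<le> m\<^sup>2 * exp (e * x)" if x: "x \<ge> 0" for x
  proof -
    have "c + x \<le> m * (1 + e * x / 2)"
    proof -
      have "m * (1 + e * x / 2) = c + x + (2 / e + c * (e * x / 2))" using e by (simp add: m_def field_simps)
      moreover have "0 \<le> 2 / e + c * (e * x / 2)" using e c x by simp
      ultimately show ?thesis by linarith
    qed
    also have "\<dots> \<le> m * exp (e * x / 2)" using exp_ge_add_one_self[of "e * x / 2"] m by (intro mult_left_mono) auto
    finally have "(c + x)\<^sup>2 \<le> (m * exp (e * x / 2))\<^sup>2" using c x by (intro power_mono) auto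
    also have "\<dots> = m\<^sup>2 * exp (e * x)" by (simp add: power2_eq_square mult_ac flip: exp_add)
    finally show ?thesis .
  qed
  then show ?thesis by (intro exI[of _ "m\<^sup>2"]) simp
qed

context strictly_killed_levy_process
begin

text \<open>The Gamma factors of \<Phi> are distributed according to the half-plane in which they
  have neither zeros nor poles: Gamma (1 + w) / Gamma (1 - r + w) goes with the infimum on the
  right, Gamma (r - w) / Gamma (\<alpha> - w) with the reciprocal of the supremum factor on the
  left. The Wiener-Hopf identity says that both arrangements agree on the imaginary axis. The
  constant value is read off at 0, where the infimum factor is 1.\<close>

theorem infimum_laplace_hypergeometric:
  fixes \<alpha> r C :: real
  assumes \<Phi>: "has_killed_char_exponent M \<xi> \<zeta> \<Phi>"
    and \<alpha>: "0 < \<alpha>" and r: "0 < r" "r < 1" and C: "C \<noteq> 0"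
    and eq: "\<And>l. \<Phi> l = - of_real C * Gamma (of_real \<alpha> - \<i> * of_real l) * Gamma (1 + \<i> * of_real l)
      * rGamma (of_real r - \<i> * of_real l) * rGamma (1 - of_real r + \<i> * of_real l)"
    and w: "Re w \<ge> 0"
  shows "infimum_laplace w = Gamma (w + 1 - of_real r) * rGamma (w + 1) * rGamma (1 - of_real r)"
proof -
  interpret neg: strictly_killed_levy_process M q "\<lambda>t \<omega>. - \<xi> t \<omega>" \<zeta> by (rule strictly_killed_uminus)
  define f where "f z = infimum_laplace z * (Gamma (of_real 1 + z) * rGamma (of_real (1 - r) + z))" for z
  define g where "g z = of_real (q / C) * (inverse (neg.infimum_laplace (- z)) * (Gamma (of_real r + - z) * rGamma (of_real \<alpha> + - z)))" for z
  have fg: "f z = g z" if z: "Re z = 0" for z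
  proof -
    define l where "l = Im z"
    have zl: "z = \<i> * of_real l" using z by (simp add: complex_eq_iff l_def)
    have S: "neg.infimum_laplace (- z) \<noteq> 0" by (rule neg.infimum_laplace_nonzero) (use z in simp)
    have G: "Gamma (of_real \<alpha> - z) * rGamma (of_real \<alpha> - z) = 1" "Gamma (of_real r - z) * rGamma (of_real r - z) = 1"
      "Gamma (1 + z) * rGamma (1 + z) = 1" "Gamma (1 - of_real r + z) * rGamma (1 - of_real r + z) = 1"
      using \<alpha> r z by (auto intro!: Gamma_rGamma_nonzero(3))
    have "infimum_laplace z * neg.infimum_laplace (- z) = - of_real q / \<Phi> l"
      using wiener_hopf_factorisation[OF \<Phi>, of l] unfolding zl .
    then have "infimum_laplace z * neg.infimum_laplace (- z) * \<Phi> l = - of_real q"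
      using killed_exponent_nonzero[OF \<Phi>, of l] by (simp add: field_simps)
    then have "infimum_laplace z * neg.infimum_laplace (- z) *
        (of_real C * Gamma (of_real \<alpha> - z) * Gamma (1 + z) * rGamma (of_real r - z) * rGamma (1 - of_real r + z)) = of_real q"
      unfolding eq zl[symmetric] by (simp add: algebra_simps)
    then have "(infimum_laplace z * neg.infimum_laplace (- z) *
        (of_real C * Gamma (of_real \<alpha> - z) * Gamma (1 + z) * rGamma (of_real r - z) * rGamma (1 - of_real r + z)))
        * (rGamma (of_real \<alpha> - z) * Gamma (of_real r - z)) = of_real q * (rGamma (of_real \<alpha> - z) * Gamma (of_real r - z))"
      by simp
    moreover have "(infimum_laplace z * neg.infimum_laplace (- z) *
        (of_real C * Gamma (of_real \<alpha> - z) * Gamma (1 + z) * rGamma (of_real r - z) * rGamma (1 - of_real r + z)))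
        * (rGamma (of_real \<alpha> - z) * Gamma (of_real r - z))
        = (infimum_laplace z * (Gamma (1 + z) * rGamma (1 - of_real r + z))) * neg.infimum_laplace (- z) * of_real C
          * (Gamma (of_real \<alpha> - z) * rGamma (of_real \<alpha> - z)) * (Gamma (of_real r - z) * rGamma (of_real r - z))"
      by (simp only: mult_ac)
    ultimately have "(infimum_laplace z * (Gamma (1 + z) * rGamma (1 - of_real r + z))) * neg.infimum_laplace (- z) * of_real C
        = of_real q * (rGamma (of_real \<alpha> - z) * Gamma (of_real r - z))"
      unfolding G by simp
    then show ?thesis using S C unfolding f_def g_def by (simp add: field_simps)
  qed
  have np1: "of_real 1 + z \<notin> \<int>\<^sub>\<le>\<^sub>0" if "Re z \<ge> 0" for z using that by (intro Re_pos_not_nonpos_Ints) simp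
  have np2: "of_real r + - z \<notin> \<int>\<^sub>\<le>\<^sub>0" if "Re z \<le> 0" for z using that r by (intro Re_pos_not_nonpos_Ints) simp
  have hol1: "(\<lambda>z. Gamma (of_real 1 + z) * rGamma (of_real (1 - r) + z)) holomorphic_on {z. Re z \<ge> 0}"
    by (intro holomorphic_intros) (use np1 in auto)
  have hol2: "(\<lambda>z. Gamma (of_real r + - z) * rGamma (of_real \<alpha> + - z)) holomorphic_on {z. Re z \<le> 0}"
    by (intro holomorphic_intros) (use np2 in auto)
  define F where "F z = (if Re z \<ge> 0 then f z else g z)" for z
  have ns: "neg.infimum_laplace (- z) \<noteq> 0" if "Re z \<le> 0" for z
    by (rule neg.infimum_laplace_nonzero) (use that in simp)
  have cn: "continuous_on {z. Re z \<le> 0} (\<lambda>z. neg.infimum_laplace (- z))"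
    by (rule continuous_on_compose2[OF neg.continuous_infimum_laplace]) (auto intro!: continuous_intros)
  have hn: "(\<lambda>z. neg.infimum_laplace (- z)) holomorphic_on {z. Re z < 0}"
    by (rule holomorphic_on_compose_gen[OF _ neg.holomorphic_infimum_laplace, unfolded comp_def]) (auto intro!: holomorphic_intros)
  have "F holomorphic_on UNIV"
    unfolding F_def[abs_def]
  proof (rule holomorphic_paste_imaginary_axis)
    show "f holomorphic_on {z. Re z > 0}"
      unfolding f_def by (rule holomorphic_on_mult[OF holomorphic_infimum_laplace holomorphic_on_subset[OF hol1]]) auto
    show "continuous_on {z. Re z \<ge> 0} f"
      unfolding f_def by (rule continuous_on_mult[OF continuous_infimum_laplace holomorphic_on_imp_continuous_on[OF hol1]])
    show "g holomorphic_on {z. Re z < 0}"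
      unfolding g_def
      by (intro holomorphic_on_mult holomorphic_on_const holomorphic_on_inverse hn holomorphic_on_subset[OF hol2]) (use ns in auto)
    show "continuous_on {z. Re z \<le> 0} g"
      unfolding g_def
      by (rule continuous_on_mult[OF continuous_on_const continuous_on_mult[OF continuous_on_inverse[OF cn]
            holomorphic_on_imp_continuous_on[OF hol2]]]) (use ns in auto)
  qed (rule fg)
  moreover have "F z \<noteq> 0" for z
  proof (cases "Re z \<ge> 0")
    case True
    have "Gamma (of_real 1 + z) \<noteq> 0" by (rule Gamma_rGamma_nonzero) (use True in simp)
    moreover have "rGamma (of_real (1 - r) + z) \<noteq> 0" by (rule Gamma_rGamma_nonzero) (use True r in simp)
    ultimately show ?thesis using True infimum_laplace_nonzero[OF True] by (simp add: F_def f_def)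
  next
    case False
    then have z: "Re z \<le> 0" by simp
    have "Gamma (of_real r + - z) \<noteq> 0" by (rule Gamma_rGamma_nonzero) (use z r in simp)
    moreover have "rGamma (of_real \<alpha> + - z) \<noteq> 0" by (rule Gamma_rGamma_nonzero) (use z \<alpha> in simp)
    ultimately show ?thesis using False ns[OF z] C rate_pos by (simp add: F_def g_def)
  qed
  moreover have "\<exists>B. \<forall>z. norm (F z) \<le> B * exp (e * norm z)" if e: "e > 0" for e
  proof -
    obtain K1 where K1: "K1 \<ge> 0" "\<forall>v. Re v \<ge> 0 \<longrightarrow>
        norm (Gamma (of_real 1 + v) * rGamma (of_real (1 - r) + v)) \<le> K1 * ((1 - r) + 1 + norm v)\<^sup>2"
      using Gamma_ratio_bound[of 1 "1 - r"] r by auto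
    obtain K2 where K2: "K2 \<ge> 0" "\<forall>v. Re v \<ge> 0 \<longrightarrow>
        norm (Gamma (of_real r + v) * rGamma (of_real \<alpha> + v)) \<le> K2 * (\<alpha> + 1 + norm v)\<^sup>2"
      using Gamma_ratio_bound[of r \<alpha>] r \<alpha> by auto
    obtain B1 where B1: "B1 \<ge> 0" "\<forall>x\<ge>0. ((1 - r) + 1 + x)\<^sup>2 \<le> B1 * exp (e * x)"
      using square_subexponential[OF e, of "(1 - r) + 1"] r by auto
    \<comment> \<open>The exponent is halved because in the left half-plane two factors grow: the
      reciprocal of the supremum transform and the Gamma quotient.\<close>
    obtain B2 where B2: "B2 \<ge> 0" "\<forall>x\<ge>0. (\<alpha> + 1 + x)\<^sup>2 \<le> B2 * exp (e / 2 * x)"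
      using square_subexponential[of "e / 2" "\<alpha> + 1"] e \<alpha> by auto
    obtain B3 where B3: "\<forall>w. Re w \<ge> 0 \<longrightarrow> norm (inverse (neg.infimum_laplace w)) \<le> B3 * exp (e / 2 * norm w)"
      using neg.inverse_infimum_laplace_bound[of "e / 2"] e by auto
    have B3p: "B3 \<ge> 0" using B3[rule_format, of 0] order_trans[OF norm_ge_zero] by fastforce
    have "norm (F z) \<le> (K1 * B1 + \<bar>q / C\<bar> * (B3 * (K2 * B2))) * exp (e * norm z)" for z
    proof (cases "Re z \<ge> 0")
      case True
      have "norm (F z) = norm (infimum_laplace z) * norm (Gamma (of_real 1 + z) * rGamma (of_real (1 - r) + z))"
        using True by (simp add: F_def f_def norm_mult)
      also have "\<dots> \<le> 1 * (K1 * ((1 - r) + 1 + norm z)\<^sup>2)"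
        using norm_infimum_laplace_le[OF True] K1(2) True by (intro mult_mono) auto
      also have "\<dots> \<le> K1 * (B1 * exp (e * norm z))"
        using mult_left_mono[OF B1(2)[rule_format, OF norm_ge_zero[of z]] K1(1)] by simp
      also have "\<dots> \<le> (K1 * B1 + \<bar>q / C\<bar> * (B3 * (K2 * B2))) * exp (e * norm z)"
        using K2(1) B2(1) B3p by (simp add: distrib_right)
      finally show ?thesis .
    next
      case False
      then have z: "Re (- z) \<ge> 0" by simp
      have "norm (F z) = \<bar>q / C\<bar> * (norm (inverse (neg.infimum_laplace (- z))) * norm (Gamma (of_real r + - z) * rGamma (of_real \<alpha> + - z)))"
        using False by (simp add: F_def g_def norm_mult norm_divide)
      also have "\<dots> \<le> \<bar>q / C\<bar> * ((B3 * exp (e / 2 * norm z)) * (K2 * (B2 * exp (e / 2 * norm z))))"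
      proof (intro mult_left_mono mult_mono)
        show "norm (inverse (neg.infimum_laplace (- z))) \<le> B3 * exp (e / 2 * norm z)"
          using B3[rule_format, OF z] by simp
        have "norm (Gamma (of_real r + - z) * rGamma (of_real \<alpha> + - z)) \<le> K2 * (\<alpha> + 1 + norm z)\<^sup>2"
          using K2(2)[rule_format, OF z] by simp
        also have "\<dots> \<le> K2 * (B2 * exp (e / 2 * norm z))"
          by (rule mult_left_mono[OF B2(2)[rule_format, OF norm_ge_zero[of z]] K2(1)])
        finally show "norm (Gamma (of_real r + - z) * rGamma (of_real \<alpha> + - z)) \<le> K2 * (B2 * exp (e / 2 * norm z))" .
      qed (use B3p in auto)
      also have "\<dots> = \<bar>q / C\<bar> * (B3 * (K2 * B2)) * (exp (e / 2 * norm z) * exp (e / 2 * norm z))" by (simp only: mult_ac)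
      also have "exp (e / 2 * norm z) * exp (e / 2 * norm z) = exp (e * norm z)" by (simp flip: exp_add)
      also have "\<bar>q / C\<bar> * (B3 * (K2 * B2)) * exp (e * norm z) \<le> (K1 * B1 + \<bar>q / C\<bar> * (B3 * (K2 * B2))) * exp (e * norm z)"
        using K1(1) B1(1) by (intro mult_right_mono) auto
      finally show ?thesis .
    qed
    then show ?thesis by (rule_tac exI) (rule allI)
  qed
  ultimately have "F w = F 0" by (rule entire_nonvanishing_subexponential)
  then have "infimum_laplace w * (Gamma (1 + w) * rGamma (1 - of_real r + w)) = rGamma (1 - of_real r)"
    using w by (simp add: F_def f_def infimum_laplace_0)
  then have "infimum_laplace w * (Gamma (1 + w) * rGamma (1 - of_real r + w)) * (rGamma (1 + w) * Gamma (1 - of_real r + w))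
      = rGamma (1 - of_real r) * (rGamma (1 + w) * Gamma (1 - of_real r + w))"
    by (rule arg_cong)
  moreover have "infimum_laplace w * (Gamma (1 + w) * rGamma (1 - of_real r + w)) * (rGamma (1 + w) * Gamma (1 - of_real r + w))
      = infimum_laplace w * ((Gamma (1 + w) * rGamma (1 + w)) * (Gamma (1 - of_real r + w) * rGamma (1 - of_real r + w)))"
    by (simp only: mult_ac)
  moreover have "Gamma (1 + w) * rGamma (1 + w) = 1" "Gamma (1 - of_real r + w) * rGamma (1 - of_real r + w) = 1"
    using w r by (auto intro!: Gamma_rGamma_nonzero(3))
  ultimately have "infimum_laplace w = rGamma (1 - of_real r) * (rGamma (1 + w) * Gamma (1 - of_real r + w))"
    by (simp only: mult_1_right)
  also have "\<dots> = Gamma (1 - of_real r + w) * rGamma (1 + w) * rGamma (1 - of_real r)"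
    by (simp only: mult_ac)
  finally have I: "infimum_laplace w = Gamma (1 - of_real r + w) * rGamma (1 + w) * rGamma (1 - of_real r)" .
  have u: "1 - complex_of_real r + w = w + 1 - of_real r" "1 + w = w + 1" by simp_all
  show ?thesis unfolding I u ..
qed

end

text \<open>For both reciprocal Gamma functions left by the Beta integrals, the reflected argument
  lies in the open right half-plane. Reflecting brings out the common factor Gamma (\<alpha> - s)
  Gamma (1 + s) and leaves sines.\<close>

lemma reflection_lamperti:
  fixes s :: complex
  assumes s: "Re s = 0" and \<alpha>: "0 < \<alpha>"
  shows "rGamma (- s) = - (Gamma (1 + s) * sin (of_real pi * s) / of_real pi)"
    and "rGamma (s + 1 - of_real \<alpha>) = Gamma (of_real \<alpha> - s) * sin (of_real pi * (of_real \<alpha> - s)) / of_real pi"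
proof -
  have "rGamma (- s) = rGamma (- s) * (Gamma (1 + s) * rGamma (1 + s))"
    using Gamma_rGamma_nonzero(3)[of "1 + s"] s by simp
  also have "\<dots> = Gamma (1 + s) * (rGamma (- s) * rGamma (1 - (- s)))" by (simp add: mult_ac)
  also have "\<dots> = - (Gamma (1 + s) * sin (of_real pi * s) / of_real pi)"
    unfolding rGamma_reflection_complex by simp
  finally show "rGamma (- s) = - (Gamma (1 + s) * sin (of_real pi * s) / of_real pi)" .
  have "rGamma (s + 1 - of_real \<alpha>) = rGamma (s + 1 - of_real \<alpha>) * (Gamma (of_real \<alpha> - s) * rGamma (of_real \<alpha> - s))"
    using Gamma_rGamma_nonzero(3)[of "of_real \<alpha> - s"] s \<alpha> by simp
  also have "\<dots> = Gamma (of_real \<alpha> - s) * (rGamma (of_real \<alpha> - s) * rGamma (1 - (of_real \<alpha> - s)))"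
    by (simp add: algebra_simps)
  also have "\<dots> = Gamma (of_real \<alpha> - s) * sin (of_real pi * (of_real \<alpha> - s)) / of_real pi"
    unfolding rGamma_reflection_complex by simp
  finally show "rGamma (s + 1 - of_real \<alpha>) = Gamma (of_real \<alpha> - s) * sin (of_real pi * (of_real \<alpha> - s)) / of_real pi" .
qed

text \<open>In this form the cancellations in \<Phi> are visible: s times the drift is removed by
  the linear term of \<Phi>, and cm / \<alpha> by the killing rate, so only the Gamma product
  remains.\<close>

lemma integral_lamperti_integrand_sin:
  fixes l :: real
  assumes \<alpha>: "0 < \<alpha>" "\<alpha> < 2" "\<alpha> \<noteq> 1"
  defines "s \<equiv> \<i> * of_real l"
  shows "(\<integral>y. lamperti_integrand \<alpha> cp cm l y \<partial>lborel) =
      of_real (cm / \<alpha>) - s * of_real (stable_drift \<alpha> cp cm)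
      + Gamma (- of_real \<alpha>) * Gamma (of_real \<alpha> - s) * Gamma (1 + s) / of_real pi
        * (of_real cm * sin (of_real pi * (of_real \<alpha> - s)) - of_real cp * sin (of_real pi * s))"
proof -
  have s: "Re s = 0" by (simp add: s_def)
  have a1: "1 - complex_of_real \<alpha> \<noteq> 0" using \<alpha> by (metis of_real_1 of_real_eq_iff right_minus_eq)
  have I: "(\<integral>y. lamperti_integrand \<alpha> cp cm l y \<partial>lborel) =
      of_real cp * (Gamma (of_real \<alpha> - s) * Gamma (- of_real \<alpha>) * rGamma (- s) - s / (1 - of_real \<alpha>))
      + of_real cm * (Gamma (1 + s) * Gamma (- of_real \<alpha>) * rGamma (s + 1 - of_real \<alpha>) + 1 / of_real \<alpha> + s / (1 - of_real \<alpha>))"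
    using integral_lamperti_integrand[OF \<alpha>, of cp cm l] unfolding s_def by (simp add: add.commute)
  have D: "complex_of_real (stable_drift \<alpha> cp cm) = (of_real cp - of_real cm) / (1 - of_real \<alpha>)"
    using \<alpha> by (simp add: stable_drift_def)
  show ?thesis
    unfolding I D reflection_lamperti[OF s \<alpha>(1)] using a1 by (simp add: diff_divide_distrib algebra_simps)
qed

lemma lamperti_exponent_eq_integral:
  "lamperti_exponent \<alpha> cp cm \<rho> l = \<i> * of_real l * of_real (stable_drift \<alpha> cp cm)
    + (\<integral>y. lamperti_integrand \<alpha> cp cm l y \<partial>lborel) - of_real (killing_rate \<alpha> cp cm \<rho>)"
  unfolding lamperti_exponent_def lamperti_integrand_def by simp

section \<open>Constants of the stable process\<close>

text \<open>Amplitude and phase: the vector (1, x) has length sqrt (1 + x^2) and angle arctan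
  x.\<close>

lemma arctan_tan_combination:
  fixes x :: real
  shows "sqrt (1 + x\<^sup>2) * sin (\<theta> - arctan x) = sin \<theta> - x * cos \<theta>"
    and "sqrt (1 + x\<^sup>2) * cos (\<theta> - arctan x) = cos \<theta> + x * sin \<theta>"
proof -
  have p: "sqrt (1 + x\<^sup>2) > 0" by (simp add: add_pos_nonneg)
  have a: "sqrt (1 + x\<^sup>2) * cos (arctan x) = 1" "sqrt (1 + x\<^sup>2) * sin (arctan x) = x"
    using p by (simp_all add: cos_arctan sin_arctan)
  have "sqrt (1 + x\<^sup>2) * sin (\<theta> - arctan x)
      = sin \<theta> * (sqrt (1 + x\<^sup>2) * cos (arctan x)) - cos \<theta> * (sqrt (1 + x\<^sup>2) * sin (arctan x))"
    unfolding sin_diff by (simp only: right_diff_distrib mult_ac)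
  then show "sqrt (1 + x\<^sup>2) * sin (\<theta> - arctan x) = sin \<theta> - x * cos \<theta>"
    unfolding a by simp
  have "sqrt (1 + x\<^sup>2) * cos (\<theta> - arctan x)
      = cos \<theta> * (sqrt (1 + x\<^sup>2) * cos (arctan x)) + sin \<theta> * (sqrt (1 + x\<^sup>2) * sin (arctan x))"
    unfolding cos_diff by (simp only: distrib_left mult_ac)
  then show "sqrt (1 + x\<^sup>2) * cos (\<theta> - arctan x) = cos \<theta> + x * sin \<theta>"
    unfolding a by simp
qed

lemma levy_process_negativity:
  assumes X: "levy_process M X" and \<psi>: "has_char_exponent M X \<psi>" and \<alpha>: "0 < \<alpha>" and A: "0 < A"
    and eq: "\<And>t. t > 0 \<Longrightarrow> \<psi> t = - of_real (t powr \<alpha>) * Complex A (- B)"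
  shows "measure M {\<omega> \<in> space M. X 1 \<omega> \<le> 0} = 1 / 2 - arctan (B / A) / (pi * \<alpha>)"
proof -
  interpret levy_process M X by (rule X)
  have m: "X 1 \<in> borel_measurable M" by (rule measurable_process) simp
  interpret D: real_distribution "distr M borel (X 1)" by (rule real_distribution_distr[OF m])
  have "D.prob {..0} = 1 / 2 - arctan (B / A) / (pi * \<alpha>)"
  proof (rule D.stable_negativity[OF \<alpha> A])
    fix t :: real assume t: "0 < t"
    have "char (distr M borel (X 1)) t = exp (complex_of_real 1 * \<psi> t)"
      using \<psi> unfolding has_char_exponent_def by (metis zero_le_one)
    then show "char (distr M borel (X 1)) t = exp (- of_real (t powr \<alpha>) * Complex A (- B))"
      using eq[OF t] by simp
  qed
  moreover have "D.prob {..0} = prob (X 1 -` {..0} \<inter> space M)" by (rule measure_distr[OF m]) simp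
  moreover have "X 1 -` {..0} \<inter> space M = {\<omega> \<in> space M. X 1 \<omega> \<le> 0}" by auto
  ultimately show ?thesis by simp
qed

context
  fixes \<alpha> cp cm :: real
  assumes \<alpha>: "0 < \<alpha>" "\<alpha> < 2" "\<alpha> \<noteq> 1" and c: "0 \<le> cp" "0 \<le> cm" "0 < cp + cm"
begin

lemma cos_stable_nonzero: "cos (pi * \<alpha> / 2) \<noteq> 0"
proof -
  obtain e :: real where e: "(e = 0 \<and> 0 < \<alpha> \<and> \<alpha> < 1) \<or> (e = 1 \<and> 1 < \<alpha> \<and> \<alpha> < 2)"
    using \<alpha> by (metis linorder_neqE_linordered_idom)
  then show ?thesis using stable_g_cos_neg[OF e] by auto
qed

text \<open>The constant \<open>stable_g\<close> cancels in the quotient B / A of the stable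
  exponent, which leaves Zolotarev's formula.\<close>

lemma stable_negativity_parameter:
  assumes X: "levy_process M X" "has_char_exponent M X (stable_exponent \<alpha> cp cm)"
  shows "measure M {\<omega> \<in> space M. X 1 \<omega> \<le> 0} = 1 / 2 - arctan ((cp - cm) / (cp + cm) * tan (pi * \<alpha> / 2)) / (pi * \<alpha>)"
proof -
  obtain e :: real where e: "(e = 0 \<and> 0 < \<alpha> \<and> \<alpha> < 1) \<or> (e = 1 \<and> 1 < \<alpha> \<and> \<alpha> < 2)"
    using \<alpha> by (metis linorder_neqE_linordered_idom)
  define g where "g = stable_g e \<alpha>"
  have neg: "g * cos (pi * \<alpha> / 2) < 0" unfolding g_def by (rule stable_g_cos_neg[OF e])
  then have g: "g \<noteq> 0" by auto
  have "- g * (cp + cm) * cos (pi * \<alpha> / 2) = - (g * cos (pi * \<alpha> / 2)) * (cp + cm)" by simp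
  also have "\<dots> > 0" using neg c by (intro mult_pos_pos) auto
  finally have A: "0 < - g * (cp + cm) * cos (pi * \<alpha> / 2)" .
  have "measure M {\<omega> \<in> space M. X 1 \<omega> \<le> 0}
      = 1 / 2 - arctan ((- g * (cp - cm) * sin (pi * \<alpha> / 2)) / (- g * (cp + cm) * cos (pi * \<alpha> / 2))) / (pi * \<alpha>)"
    by (rule levy_process_negativity[OF X \<alpha>(1) A]) (unfold g_def, rule stable_exponent_eq[OF e])
  moreover have "(- g * (cp - cm) * sin (pi * \<alpha> / 2)) / (- g * (cp + cm) * cos (pi * \<alpha> / 2))
      = (cp - cm) / (cp + cm) * tan (pi * \<alpha> / 2)"
    using g by (simp add: tan_def)
  ultimately show ?thesis by simp
qed

lemma Gamma_reflection_real_neg: "Gamma \<alpha> * Gamma (- \<alpha>) * (\<alpha> * sin (pi * \<alpha>)) = - pi"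
proof -
  have "sin (pi * \<alpha>) = 2 * sin (pi * \<alpha> / 2) * cos (pi * \<alpha> / 2)" using sin_double[of "pi * \<alpha> / 2"] by simp
  moreover have "sin (pi * \<alpha> / 2) > 0" using \<alpha> by (intro sin_gt_zero) auto
  ultimately have s: "sin (pi * \<alpha>) \<noteq> 0" using cos_stable_nonzero by simp
  have "Gamma (complex_of_real \<alpha>) * Gamma (complex_of_real (- \<alpha>)) = of_real (- pi / (\<alpha> * sin (pi * \<alpha>)))"
    using Gamma_reflection_complex'[of "of_real \<alpha>"] by (simp flip: sin_of_real)
  then have "complex_of_real (Gamma \<alpha> * Gamma (- \<alpha>)) = of_real (- pi / (\<alpha> * sin (pi * \<alpha>)))"
    unfolding Gamma_complex_of_real by simp
  then have "Gamma \<alpha> * Gamma (- \<alpha>) = - pi / (\<alpha> * sin (pi * \<alpha>))" by (simp only: of_real_eq_iff)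
  then show ?thesis using s \<alpha> by simp
qed

text \<open>The sign is read off the reflection formula: multiplied by the positive number 2
  \<alpha> Gamma \<alpha> sin (pi \<alpha> / 2), the product equals - pi.\<close>

lemma Gamma_neg_cos_neg: "Gamma (- \<alpha>) * cos (pi * \<alpha> / 2) < 0"
proof -
  have s: "sin (pi * \<alpha> / 2) > 0" using \<alpha> by (intro sin_gt_zero) auto
  have "sin (pi * \<alpha>) = 2 * sin (pi * \<alpha> / 2) * cos (pi * \<alpha> / 2)" using sin_double[of "pi * \<alpha> / 2"] by simp
  then have "(Gamma (- \<alpha>) * cos (pi * \<alpha> / 2)) * (Gamma \<alpha> * \<alpha> * 2 * sin (pi * \<alpha> / 2)) = - pi"
    using Gamma_reflection_real_neg by (simp only: mult_ac)
  moreover have "0 < Gamma \<alpha> * \<alpha> * 2 * sin (pi * \<alpha> / 2)" using s \<alpha> by (simp add: Gamma_real_pos)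
  ultimately show ?thesis
    using mult_nonneg_nonneg[of "Gamma (- \<alpha>) * cos (pi * \<alpha> / 2)" "Gamma \<alpha> * \<alpha> * 2 * sin (pi * \<alpha> / 2)"] pi_gt_zero
    by linarith
qed

text \<open>With \<open>c\<close>, \<open>\<beta>\<close> as in \<open>killing_rate\<close>, the constant is
  \<open>c * sqrt (1 + \<beta>\<^sup>2 * (tan (pi * \<alpha> / 2))\<^sup>2)\<close>.\<close>

lemma stable_constants:
  assumes \<rho>: "\<rho> = 1 / 2 - arctan ((cp - cm) / (cp + cm) * tan (pi * \<alpha> / 2)) / (pi * \<alpha>)"
  obtains C where "C > 0" "C * sin (pi * (\<alpha> * \<rho>)) = - Gamma (- \<alpha>) * cm * sin (pi * \<alpha>)"
    "C * cos (pi * (\<alpha> * \<rho>)) = - Gamma (- \<alpha>) * (cp + cm * cos (pi * \<alpha>))"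
    "killing_rate \<alpha> cp cm \<rho> = cm / \<alpha>"
proof -
  define \<theta> where "\<theta> = pi * \<alpha> / 2"
  define x where "x = (cp - cm) / (cp + cm) * tan \<theta>"
  define S where "S = sqrt (1 + x\<^sup>2)"
  define C where "C = - (cp + cm) * Gamma (- \<alpha>) * cos \<theta> * S"
  have S: "S > 0" by (simp add: S_def add_pos_nonneg)
  have co: "cos \<theta> \<noteq> 0" unfolding \<theta>_def by (rule cos_stable_nonzero)
  \<comment> \<open>Zolotarev's formula as an angle: multiplication by pi \<alpha> clears the
    denominator under the arctangent.\<close>
  have r: "pi * (\<alpha> * \<rho>) = \<theta> - arctan x" using \<alpha> unfolding \<rho> x_def \<theta>_def by (simp add: field_simps)
  have xc: "(cp + cm) * (x * cos \<theta>) = (cp - cm) * sin \<theta>" using c co by (simp add: x_def tan_def)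
  have d: "2 * \<theta> = pi * \<alpha>" by (simp add: \<theta>_def)
  have s2: "sin (pi * \<alpha>) = 2 * sin \<theta> * cos \<theta>" and c2: "cos (pi * \<alpha>) = (cos \<theta>)\<^sup>2 - (sin \<theta>)\<^sup>2"
    using sin_double[of \<theta>] cos_double[of \<theta>] unfolding d by simp_all
  have "C * sin (pi * (\<alpha> * \<rho>)) = - Gamma (- \<alpha>) * ((cp + cm) * cos \<theta> * (S * sin (\<theta> - arctan x)))"
    unfolding C_def r by algebra
  also have "(cp + cm) * cos \<theta> * (S * sin (\<theta> - arctan x)) = cos \<theta> * ((cp + cm) * sin \<theta> - (cp + cm) * (x * cos \<theta>))"
    unfolding S_def arctan_tan_combination(1) by (simp add: algebra_simps)
  also have "\<dots> = cm * sin (pi * \<alpha>)" unfolding xc s2 by (simp add: algebra_simps)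
  finally have C1: "C * sin (pi * (\<alpha> * \<rho>)) = - Gamma (- \<alpha>) * cm * sin (pi * \<alpha>)" by simp
  have "C * cos (pi * (\<alpha> * \<rho>)) = - Gamma (- \<alpha>) * ((cp + cm) * cos \<theta> * (S * cos (\<theta> - arctan x)))"
    unfolding C_def r by algebra
  also have "(cp + cm) * cos \<theta> * (S * cos (\<theta> - arctan x)) = (cp + cm) * (cos \<theta>)\<^sup>2 + ((cp + cm) * (x * cos \<theta>)) * sin \<theta>"
    unfolding S_def arctan_tan_combination(2) by (simp add: algebra_simps power2_eq_square)
  also have "\<dots> = cp * ((sin \<theta>)\<^sup>2 + (cos \<theta>)\<^sup>2) + cm * cos (pi * \<alpha>)"
    unfolding xc c2 by algebra
  finally have C2: "C * cos (pi * (\<alpha> * \<rho>)) = - Gamma (- \<alpha>) * (cp + cm * cos (pi * \<alpha>))" by simp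
  have "C = - (Gamma (- \<alpha>) * cos (pi * \<alpha> / 2)) * ((cp + cm) * S)" unfolding C_def \<theta>_def by algebra
  also have "\<dots> > 0" using Gamma_neg_cos_neg c S by (intro mult_pos_pos) auto
  finally have C: "C > 0" .
  have x2: "x\<^sup>2 = ((cp - cm) / (cp + cm))\<^sup>2 * (tan \<theta>)\<^sup>2" unfolding x_def by (rule power_mult_distrib)
  \<comment> \<open>The definition of the rate contains the constant C itself, so C sin (pi \<alpha>
    \<rho>) can be replaced by means of \<open>C1\<close>, and the reflection formula reduces the
    rest to cm / \<alpha>.\<close>
  have "killing_rate \<alpha> cp cm \<rho> = C * Gamma \<alpha> * sin (pi * (\<alpha> * \<rho>)) / pi"
    using \<alpha>(3) unfolding killing_rate_def Let_def C_def S_def x2 \<theta>_def by (simp add: mult.assoc)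
  also have "\<dots> = Gamma \<alpha> * (C * sin (pi * (\<alpha> * \<rho>))) / pi" by simp
  also have "\<dots> = - (Gamma \<alpha> * Gamma (- \<alpha>) * (\<alpha> * sin (pi * \<alpha>))) * (cm / (\<alpha> * pi))"
    unfolding C1 using \<alpha> by simp
  also have "\<dots> = cm / \<alpha>" unfolding Gamma_reflection_real_neg by simp
  finally show thesis using that C C1 C2 by blast
qed

text \<open>Expanded in sin (pi s) and cos (pi s), the trigonometric factor of the integral has, up
  to sign, the coefficients of C sin (pi (r - s)); \<open>C1\<close> and \<open>C2\<close> express
  this matching. The single sine then splits by reflection into 1 / Gamma (r - s) and 1 / Gamma (1 -
  r + s).\<close>

lemma lamperti_exponent_hypergeometric:
  assumes C1: "C * sin (pi * r) = - Gamma (- \<alpha>) * cm * sin (pi * \<alpha>)"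
    and C2: "C * cos (pi * r) = - Gamma (- \<alpha>) * (cp + cm * cos (pi * \<alpha>))"
    and k: "killing_rate \<alpha> cp cm \<rho> = cm / \<alpha>"
  shows "lamperti_exponent \<alpha> cp cm \<rho> l = - of_real C * Gamma (of_real \<alpha> - \<i> * of_real l) * Gamma (1 + \<i> * of_real l)
      * rGamma (of_real r - \<i> * of_real l) * rGamma (1 - of_real r + \<i> * of_real l)"
proof -
  define s where "s = \<i> * complex_of_real l"
  define G where "G = complex_of_real (Gamma (- \<alpha>))"
  have G: "Gamma (- complex_of_real \<alpha>) = G" using Gamma_complex_of_real[of "- \<alpha>"] by (simp add: G_def)
  have c1: "of_real C * sin (of_real pi * of_real r) = - G * of_real cm * sin (of_real pi * of_real \<alpha>)"
    using arg_cong[OF C1, of complex_of_real] by (simp add: G_def flip: sin_of_real)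
  have c2: "of_real C * cos (of_real pi * of_real r) = - G * (of_real cp + of_real cm * cos (of_real pi * of_real \<alpha>))"
    using arg_cong[OF C2, of complex_of_real] by (simp add: G_def flip: cos_of_real)
  have "G * (of_real cm * sin (of_real pi * (of_real \<alpha> - s)) - of_real cp * sin (of_real pi * s))
      = (G * of_real cm * sin (of_real pi * of_real \<alpha>)) * cos (of_real pi * s)
        - (G * (of_real cp + of_real cm * cos (of_real pi * of_real \<alpha>))) * sin (of_real pi * s)"
    unfolding right_diff_distrib[of "of_real pi"] sin_diff by (simp only: algebra_simps)
  also have "\<dots> = - (of_real C * sin (of_real pi * of_real r)) * cos (of_real pi * s)
      + (of_real C * cos (of_real pi * of_real r)) * sin (of_real pi * s)"
    unfolding c1 c2 by simp
  also have "\<dots> = - of_real C * sin (of_real pi * (of_real r - s))"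
    unfolding right_diff_distrib[of "of_real pi"] sin_diff by (simp add: algebra_simps)
  finally have E: "G * (of_real cm * sin (of_real pi * (of_real \<alpha> - s)) - of_real cp * sin (of_real pi * s))
      = - of_real C * sin (of_real pi * (of_real r - s))" .
  have R: "sin (of_real pi * (of_real r - s)) / of_real pi = rGamma (of_real r - s) * rGamma (1 - of_real r + s)"
    using rGamma_reflection_complex[of "of_real r - s"] by (simp add: diff_diff_eq2 add_diff_eq diff_add_eq)
  have "lamperti_exponent \<alpha> cp cm \<rho> l
      = Gamma (- of_real \<alpha>) * Gamma (of_real \<alpha> - s) * Gamma (1 + s) / of_real pi
        * (of_real cm * sin (of_real pi * (of_real \<alpha> - s)) - of_real cp * sin (of_real pi * s))"
    unfolding lamperti_exponent_eq_integral integral_lamperti_integrand_sin[OF \<alpha>] k s_def by simp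
  also have "\<dots> = Gamma (of_real \<alpha> - s) * Gamma (1 + s) / of_real pi
      * (G * (of_real cm * sin (of_real pi * (of_real \<alpha> - s)) - of_real cp * sin (of_real pi * s)))"
    unfolding G by simp
  also have "\<dots> = - of_real C * Gamma (of_real \<alpha> - s) * Gamma (1 + s) * (sin (of_real pi * (of_real r - s)) / of_real pi)"
    unfolding E by simp
  also have "\<dots> = - of_real C * Gamma (of_real \<alpha> - s) * Gamma (1 + s) * (rGamma (of_real r - s) * rGamma (1 - of_real r + s))"
    unfolding R ..
  finally show ?thesis unfolding s_def by (simp only: mult.assoc)
qed

end

text \<open>The case \<open>\<alpha> = 1\<close> is obtained from \<open>\<alpha> > 1\<close> with \<open>cp = cm\<close> by letting \<open>\<alpha>\<close> decrease to 1.\<close>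

lemma integral_lamperti_integrand_Cauchy:
  fixes l c :: real
  assumes c: "0 < c"
  defines "s \<equiv> \<i> * complex_of_real l"
  shows "(\<integral>y. lamperti_integrand 1 c c l y \<partial>lborel) = of_real c - of_real c * (Gamma (1 - s) * Gamma (1 + s) * cos (of_real pi * s))"
proof -
  \<comment> \<open>The index 1 + h stays in (1, 3/2], where the closed form for \<alpha> \<noteq> 1
    applies.\<close>
  define h where "h n = 1 / (real n + 2)" for n
  have h: "0 < h n" "h n \<le> 1 / 2" for n by (auto simp: h_def)
  have h0: "h \<longlonglongrightarrow> 0" unfolding h_def by real_asymp
  define H where "H y = iexp (l * y) - 1 - \<i> * complex_of_real (l * (exp y - 1)) * indicator {y. \<bar>exp y - 1\<bar> < 1} y" for y
  have dens: "stable_density a c c x = c * \<bar>x\<bar> powr (- a - 1)" for a x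
    by (cases x "0 :: real" rule: linorder_cases) (simp_all add: stable_density_def)
  have LI: "lamperti_integrand a c c l y = H y * of_real (exp y * (c * \<bar>exp y - 1\<bar> powr (- a - 1)))" for a y
    unfolding lamperti_integrand_def lamperti_density_def dens H_def ..
  have "(\<lambda>n. \<integral>y. lamperti_integrand (1 + h n) c c l y \<partial>lborel) \<longlonglongrightarrow> (\<integral>y. lamperti_integrand 1 c c l y \<partial>lborel)"
  proof (rule integral_dominated_convergence)
    \<comment> \<open>For indices between 1/2 and 3/2 the power |exp y - 1|^(-\<alpha>-1) lies below
      the sum of its values at the two ends, and the other factors do not depend on the index. Both
      ends differ from 1, so their integrands are known to be integrable.\<close>
    show "integrable lborel (\<lambda>y. norm (lamperti_integrand (1/2) c c l y) + norm (lamperti_integrand (3/2) c c l y))"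
      by (intro Bochner_Integration.integrable_add integrable_norm integrable_lamperti_integrand) auto
    show "AE y in lborel. (\<lambda>n. lamperti_integrand (1 + h n) c c l y) \<longlonglongrightarrow> lamperti_integrand 1 c c l y"
    proof (rule AE_I2)
      fix y :: real
      have "(\<lambda>n. \<bar>exp y - 1\<bar> powr (- (1 + h n) - 1)) \<longlonglongrightarrow> \<bar>exp y - 1\<bar> powr (- (1 + 0) - 1)"
      proof (cases "\<bar>exp y - 1\<bar> = 0")
        case True
        then show ?thesis unfolding True by simp
      next
        case False
        then show ?thesis by (intro tendsto_intros h0) (use False in simp)
      qed
      then show "(\<lambda>n. lamperti_integrand (1 + h n) c c l y) \<longlonglongrightarrow> lamperti_integrand 1 c c l y"
        unfolding LI by (intro tendsto_mult tendsto_const tendsto_of_real) simp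
    qed
    show "AE y in lborel. norm (lamperti_integrand (1 + h n) c c l y)
        \<le> norm (lamperti_integrand (1/2) c c l y) + norm (lamperti_integrand (3/2) c c l y)" for n
    proof (rule AE_I2)
      fix y :: real
      let ?x = "\<bar>exp y - 1\<bar>"
      have nLI: "norm (lamperti_integrand a c c l y) = norm (H y) * (exp y * c) * ?x powr (- a - 1)" for a
        unfolding LI norm_mult norm_of_real using c by (simp add: abs_mult)
      have "?x powr (- (1 + h n) - 1) \<le> ?x powr (- (1/2) - 1) + ?x powr (- (3/2) - 1)"
      proof (cases "?x \<ge> 1")
        case True
        have "?x powr (- (1 + h n) - 1) \<le> ?x powr (- (1/2) - 1)"
          using True h[of n] by (intro powr_mono) auto
        then show ?thesis by (simp add: add_increasing2)
      next
        case False
        have "?x powr (- (1 + h n) - 1) \<le> ?x powr (- (3/2) - 1)"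
          using False h[of n] by (intro powr_mono') auto
        then show ?thesis by (simp add: add_increasing)
      qed
      then have "norm (H y) * (exp y * c) * ?x powr (- (1 + h n) - 1)
          \<le> norm (H y) * (exp y * c) * (?x powr (- (1/2) - 1) + ?x powr (- (3/2) - 1))"
        using c by (intro mult_left_mono) auto
      then show "norm (lamperti_integrand (1 + h n) c c l y)
          \<le> norm (lamperti_integrand (1/2) c c l y) + norm (lamperti_integrand (3/2) c c l y)"
        unfolding nLI by (simp only: distrib_left)
    qed
  qed auto
  moreover have "(\<lambda>n. \<integral>y. lamperti_integrand (1 + h n) c c l y \<partial>lborel) \<longlonglongrightarrow>
      of_real c / (1 + 0) + of_real c * (Gamma (1 - 0) * Gamma (1 + 0 - s) * Gamma (1 + s) / (of_real pi * (1 + 0)) * (- (of_real pi * cos (of_real pi * s))))"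
  proof -
    \<comment> \<open>Gamma (- \<alpha>) has a pole at \<alpha> = 1, but it multiplies sin (pi
      (\<alpha> - s)) - sin (pi s), which vanishes there. In the limit the quotient becomes a
      derivative of the sine, whence the cosine in the result.\<close>
    define z where "z n = complex_of_real (h n)" for n
    have z0: "z \<longlonglongrightarrow> 0" unfolding z_def using tendsto_of_real[OF h0] by simp
    have znz: "z n \<noteq> 0" for n using h[of n] by (simp add: z_def)
    have "((\<lambda>w. sin (of_real pi * (w - s))) has_field_derivative - (of_real pi * cos (of_real pi * s))) (at 1)"
      by (auto intro!: derivative_eq_intros simp: right_diff_distrib cos_diff mult_ac)
    then have "((\<lambda>k. (sin (of_real pi * ((1 + k) - s)) - sin (of_real pi * (1 - s))) / k) \<longlongrightarrow> - (of_real pi * cos (of_real pi * s))) (at 0)"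
      by (simp only: DERIV_def)
    moreover have "filterlim z (at 0) sequentially"
      using z0 znz by (simp add: filterlim_at)
    ultimately have Q: "(\<lambda>n. (sin (of_real pi * ((1 + z n) - s)) - sin (of_real pi * (1 - s))) / z n) \<longlonglongrightarrow> - (of_real pi * cos (of_real pi * s))"
      by (rule filterlim_compose)
    have pole: "1 + 0 - s \<notin> \<int>\<^sub>\<le>\<^sub>0" "1 - 0 \<notin> (\<int>\<^sub>\<le>\<^sub>0 :: complex set)"
      by (rule Re_pos_not_nonpos_Ints, simp add: s_def)+
    have "(\<integral>y. lamperti_integrand (1 + h n) c c l y \<partial>lborel) = of_real c / (1 + z n) + of_real c *
        (Gamma (1 - z n) * Gamma (1 + z n - s) * Gamma (1 + s) / (of_real pi * (1 + z n))
          * ((sin (of_real pi * ((1 + z n) - s)) - sin (of_real pi * (1 - s))) / z n))" for n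
    proof -
      have nz: "1 + z n \<noteq> 0"
      proof
        assume "1 + z n = 0"
        then have "Re (1 + z n) = 0" by (simp only: zero_complex.simps)
        then show False using h[of n] by (simp add: z_def)
      qed
      have "rGamma (- (1 + z n)) = - (1 + z n) * (- z n * rGamma (1 - z n))"
        using rGamma_plus1[of "- (1 + z n)"] rGamma_plus1[of "- z n"] by (simp add: add.commute)
      then have G: "Gamma (- (1 + z n)) = Gamma (1 - z n) / ((1 + z n) * z n)"
        unfolding Gamma_def by (simp add: field_simps)
      have a: "complex_of_real (1 + h n) = 1 + z n" by (simp add: z_def)
      have sn: "sin (of_real pi * (1 - s)) = sin (of_real pi * s)" by (simp add: right_diff_distrib sin_diff)
      have "(\<integral>y. lamperti_integrand (1 + h n) c c l y \<partial>lborel) =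
          of_real (c / (1 + h n)) - s * of_real (stable_drift (1 + h n) c c)
          + Gamma (- of_real (1 + h n)) * Gamma (of_real (1 + h n) - s) * Gamma (1 + s) / of_real pi
            * (of_real c * sin (of_real pi * (of_real (1 + h n) - s)) - of_real c * sin (of_real pi * s))"
        unfolding s_def using h[of n] by (intro integral_lamperti_integrand_sin) auto
      also have "stable_drift (1 + h n) c c = 0" by (simp add: stable_drift_def)
      also have "of_real (c / (1 + h n)) = of_real c / (1 + z n)" unfolding a[symmetric] by (rule of_real_divide)
      finally have "(\<integral>y. lamperti_integrand (1 + h n) c c l y \<partial>lborel) = of_real c / (1 + z n)
          + Gamma (1 - z n) / ((1 + z n) * z n) * Gamma (1 + z n - s) * Gamma (1 + s) / of_real pi
            * (of_real c * (sin (of_real pi * (1 + z n - s)) - sin (of_real pi * (1 - s))))"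
        unfolding a G sn by (simp only: of_real_0 mult_zero_right diff_zero right_diff_distrib)
      also have "Gamma (1 - z n) / ((1 + z n) * z n) * Gamma (1 + z n - s) * Gamma (1 + s) / of_real pi
            * (of_real c * (sin (of_real pi * (1 + z n - s)) - sin (of_real pi * (1 - s))))
          = of_real c * (Gamma (1 - z n) * Gamma (1 + z n - s) * Gamma (1 + s) / (of_real pi * (1 + z n))
          * ((sin (of_real pi * ((1 + z n) - s)) - sin (of_real pi * (1 - s))) / z n))"
        by (simp only: times_divide_eq_left times_divide_eq_right divide_divide_eq_left mult_ac)
      finally show ?thesis .
    qed
    then show ?thesis
      by (simp only:) (intro tendsto_intros z0 Q pole, auto)
  qed
  ultimately have "(\<integral>y. lamperti_integrand 1 c c l y \<partial>lborel) =
    of_real c / (1 + 0) + of_real c * (Gamma (1 - 0) * Gamma (1 + 0 - s) * Gamma (1 + s) / (of_real pi * (1 + 0)) * (- (of_real pi * cos (of_real pi * s))))"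
    by (rule LIMSEQ_unique)
  then show ?thesis by simp
qed

text \<open>Here r = 1/2, the value of \<alpha> \<rho> in the symmetric case: cos (pi s) is the sine
  of pi (1/2 - s), and reflection turns it into pi times the two reciprocal Gamma functions, which
  is the origin of the constant pi c.\<close>

lemma lamperti_exponent_Cauchy:
  assumes c: "0 < c"
  shows "lamperti_exponent 1 c c \<rho> l = - of_real (pi * c) * Gamma (of_real 1 - \<i> * of_real l) * Gamma (1 + \<i> * of_real l)
      * rGamma (of_real (1 / 2) - \<i> * of_real l) * rGamma (1 - of_real (1 / 2) + \<i> * of_real l)"
proof -
  define s where "s = \<i> * complex_of_real l"
  have e: "1 - complex_of_real (1 / 2) + s = 1 - (of_real (1 / 2) - s)" by simp
  have "of_real pi * (of_real (1 / 2) - s) = of_real (pi / 2) - of_real pi * s" by (simp add: algebra_simps)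
  then have "sin (of_real pi * (of_real (1 / 2) - s)) = cos (of_real pi * s)"
    by (simp only: sin_diff flip: sin_of_real cos_of_real) simp
  then have R: "rGamma (of_real (1 / 2) - s) * rGamma (1 - of_real (1 / 2) + s) = cos (of_real pi * s) / of_real pi"
    unfolding e rGamma_reflection_complex by simp
  have "lamperti_exponent 1 c c \<rho> l = - of_real (pi * c) * Gamma (of_real 1 - s) * Gamma (1 + s) * (cos (of_real pi * s) / of_real pi)"
    unfolding lamperti_exponent_eq_integral integral_lamperti_integrand_Cauchy[OF c]
    by (simp add: s_def stable_drift_def killing_rate_def)
  also have "\<dots> = - of_real (pi * c) * Gamma (of_real 1 - s) * Gamma (1 + s)
      * (rGamma (of_real (1 / 2) - s) * rGamma (1 - of_real (1 / 2) + s))"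
    unfolding R ..
  finally show ?thesis unfolding s_def by (simp only: mult.assoc)
qed

section \<open>The law of the infimum\<close>

text \<open>On the imaginary axis \<open>L\<close> gives the characteristic function of the infimum,
  and the complex Beta integral shows that it is also that of the logarithm of a Beta variable.
  Uniqueness identifies the two laws, and exponentiating gives the density.\<close>

lemma (in strictly_killed_levy_process) distributed_exp_overall_infimum:
  fixes r :: real
  assumes r: "0 < r" "r < 1"
    and L: "\<And>w. Re w \<ge> 0 \<Longrightarrow> infimum_laplace w = Gamma (w + 1 - of_real r) * rGamma (w + 1) * rGamma (1 - of_real r)"
  shows "distributed M lborel (\<lambda>\<omega>. exp (overall_infimum \<xi> \<zeta> \<omega>))
    (\<lambda>t. ennreal (1 / Beta (1 - r) r * t powr (- r) * (1 - t) powr (r - 1) * indicator {0<..<1} t))"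
proof -
  note [measurable] = measurable_overall_infimum
  define f where "f t = 1 / Beta (1 - r) r * t powr (- r) * (1 - t) powr (r - 1) * indicator {0<..<1} t" for t
  have f[measurable]: "f \<in> borel_measurable borel" unfolding f_def by measurable
  have B: "Beta (1 - r) r > 0" using r by (simp add: Beta_altdef Gamma_real_pos)
  have f0: "f t \<ge> 0" for t using B by (simp add: f_def indicator_def)
  have fx: "f t = 1 / Beta (1 - r) r * (indicator {0<..<1} t *\<^sub>R (t powr ((1 - r) - 1) * (1 - t) powr (r - 1)))" for t
    by (simp add: f_def)
  have "integrable lborel f"
    unfolding fx[abs_def] using set_integrable_Beta[of "1 - r" r] r
    by (intro integrable_mult_right) (auto simp: set_integrable_def)
  moreover have "(\<integral>t. f t \<partial>lborel) = 1"
    using set_integral_Beta[of "1 - r" r] r B unfolding fx set_lebesgue_integral_def by simp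
  ultimately have n: "(\<integral>\<^sup>+ t. ennreal (f t) \<partial>lborel) = 1"
    using f0 by (simp add: nn_integral_eq_integral)
  define D where "D = density lborel (\<lambda>t. ennreal (f t))"
  have Dsets[measurable_cong]: "sets D = sets borel" by (simp add: D_def)
  interpret D: prob_space D
    by (rule prob_spaceI) (simp add: D_def emeasure_density n)
  have pos: "AE t in D. t > 0"
    unfolding D_def by (subst AE_density) (auto simp: f_def indicator_def intro!: AE_I2)
  have "distr M borel (overall_infimum \<xi> \<zeta>) = distr D borel ln"
  proof (rule Levy_uniqueness)
    show "real_distribution (distr M borel (overall_infimum \<xi> \<zeta>))" by (rule real_distribution_distr) simp
    show "real_distribution (distr D borel ln)" by (rule D.real_distribution_distr) simp
    show "char (distr M borel (overall_infimum \<xi> \<zeta>)) = char (distr D borel ln)"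
    proof
      fix t :: real
      let ?z = "complex_of_real (1 - r) + \<i> * of_real t"
      have z: "Re ?z > 0" using r by simp
      have "char (distr D borel ln) t = (\<integral>x. iexp (t * ln x) \<partial>D)"
        unfolding char_def by (rule integral_distr) measurable
      also have "\<dots> = (\<integral>x. f x *\<^sub>R iexp (t * ln x) \<partial>lborel)"
        unfolding D_def using f0 by (intro integral_density) auto
      also have "\<dots> = (\<integral>x. of_real (1 / Beta (1 - r) r) * (indicator {0<..<1} x *\<^sub>R (cpow x (?z - 1) * of_real ((1 - x) powr (r - 1)))) \<partial>lborel)"
      proof (rule Bochner_Integration.integral_cong[OF refl])
        fix x :: real
        show "f x *\<^sub>R iexp (t * ln x) = of_real (1 / Beta (1 - r) r) * (indicator {0<..<1} x *\<^sub>R (cpow x (?z - 1) * of_real ((1 - x) powr (r - 1))))"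
        proof (cases "x \<in> {0<..<1}")
          case True
          have "cpow x (?z - 1) = exp (of_real (- r * ln x) + \<i> * of_real (t * ln x))"
            unfolding cpow_def by (simp add: algebra_simps)
          also have "\<dots> = of_real (x powr (- r)) * iexp (t * ln x)"
            using True by (simp only: exp_add exp_of_real) (simp add: powr_def)
          finally show ?thesis using True by (simp add: f_def scaleR_conv_of_real)
        qed (simp add: f_def)
      qed
      also have "\<dots> = of_real (1 / Beta (1 - r) r) * Beta ?z (of_real r)"
        using set_integral_complex_Beta[OF r(1) z] unfolding set_lebesgue_integral_def by (simp only: integral_mult_right_zero)
      also have "\<dots> = Gamma ?z * rGamma (?z + of_real r) * rGamma (of_real (1 - r))"
      proof -
        have "Gamma r \<noteq> 0" using Gamma_real_pos[OF r(1)] by simp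
        then have "1 / Beta (1 - r) r = inverse (Gamma r) * rGamma (1 - r)"
          by (simp add: Beta_altdef rGamma_inverse_Gamma divide_inverse)
        then have b: "complex_of_real (1 / Beta (1 - r) r) = inverse (of_real (Gamma r)) * rGamma (of_real (1 - r))"
          by (simp only: of_real_mult of_real_inverse rGamma_complex_of_real)
        show ?thesis unfolding b unfolding Beta_altdef Gamma_complex_of_real[of r] using \<open>Gamma r \<noteq> 0\<close> by simp
      qed
      also have "\<dots> = infimum_laplace (\<i> * of_real t)"
        by (subst L) (simp_all add: add_ac add_diff_eq diff_add_eq)
      also have "\<dots> = (\<integral>\<omega>. iexp (t * overall_infimum \<xi> \<zeta> \<omega>) \<partial>M)"
        unfolding infimum_laplace_eq by (simp add: mult.assoc)
      also have "\<dots> = char (distr M borel (overall_infimum \<xi> \<zeta>)) t"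
        unfolding char_def by (rule integral_distr[symmetric]) measurable
      finally show "char (distr M borel (overall_infimum \<xi> \<zeta>)) t = char (distr D borel ln) t" ..
    qed
  qed
  then have "distr (distr M borel (overall_infimum \<xi> \<zeta>)) borel exp = distr (distr D borel ln) borel exp" by simp
  then have "distr M borel (\<lambda>\<omega>. exp (overall_infimum \<xi> \<zeta> \<omega>)) = distr D borel (\<lambda>x. exp (ln x))"
    by (simp add: distr_distr comp_def)
  also have "\<dots> = distr D borel (\<lambda>x. x)"
  proof (rule distr_cong_AE)
    show "AE x in D. exp (ln x) = x" using pos by eventually_elim simp
  qed auto
  also have "\<dots> = D" by (rule distr_id2) (simp add: Dsets)
  finally have "distr M borel (\<lambda>\<omega>. exp (overall_infimum \<xi> \<zeta> \<omega>)) = D" .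
  moreover have "distr M lborel (\<lambda>\<omega>. exp (overall_infimum \<xi> \<zeta> \<omega>)) = distr M borel (\<lambda>\<omega>. exp (overall_infimum \<xi> \<zeta> \<omega>))"
    by (rule distr_cong) auto
  ultimately have "distr M lborel (\<lambda>\<omega>. exp (overall_infimum \<xi> \<zeta> \<omega>)) = density lborel (\<lambda>t. ennreal (f t))"
    by (simp add: D_def)
  moreover have "(\<lambda>t. ennreal (f t)) \<in> borel_measurable lborel" by measurable
  moreover have "(\<lambda>\<omega>. exp (overall_infimum \<xi> \<zeta> \<omega>)) \<in> measurable M lborel" by measurable
  ultimately show ?thesis unfolding distributed_def f_def[abs_def] by blast
qed

text \<open>For \<alpha> = 1 symmetry gives \<rho> = 1/2. Otherwise the reflection formula turns cm
  > 0 into sin (pi \<alpha> \<rho>) > 0, and since \<alpha> \<rho> lies in [0, 2) this forces 0 <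
  \<alpha> \<rho> < 1: negative jumps are what keep \<alpha> \<rho> strictly below 1.\<close>

lemma lamperti_exponent_hypergeometric_form:
  assumes \<alpha>: "0 < \<alpha>" "\<alpha> < 2" and c: "0 \<le> cp" "0 < cm" and one: "\<alpha> = 1 \<longrightarrow> cp = cm"
    and X: "levy_process M X" "has_char_exponent M X (stable_exponent \<alpha> cp cm)"
    and \<rho>: "\<rho> = measure M {\<omega> \<in> space M. X 1 \<omega> \<le> 0}"
  obtains C where "C > 0" "0 < killing_rate \<alpha> cp cm \<rho>" "0 < \<alpha> * \<rho>" "\<alpha> * \<rho> < 1"
    "\<And>l. lamperti_exponent \<alpha> cp cm \<rho> l = - of_real C * Gamma (of_real \<alpha> - \<i> * of_real l) * Gamma (1 + \<i> * of_real l)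
      * rGamma (of_real (\<alpha> * \<rho>) - \<i> * of_real l) * rGamma (1 - of_real (\<alpha> * \<rho>) + \<i> * of_real l)"
proof (cases "\<alpha> = 1")
  case True
  then have cc: "cp = cm" using one by simp
  obtain \<kappa> where \<kappa>: "\<kappa> > 0" "\<And>t. t > 0 \<Longrightarrow> stable_exponent 1 cm cm t = - of_real (t powr 1) * Complex \<kappa> (- 0)"
    using cauchy_exponent_eq[OF c(2)] by auto
  have "\<rho> = 1 / 2 - arctan (0 / \<kappa>) / (pi * 1)"
    unfolding \<rho> by (rule levy_process_negativity[OF X _ \<kappa>(1)]) (unfold True cc, simp, rule \<kappa>(2))
  then have r: "\<alpha> * \<rho> = 1 / 2" by (simp add: True)
  show thesis
  proof (rule that[of "pi * cm"])
    show "lamperti_exponent \<alpha> cp cm \<rho> l = - of_real (pi * cm) * Gamma (of_real \<alpha> - \<i> * of_real l) * Gamma (1 + \<i> * of_real l)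
      * rGamma (of_real (\<alpha> * \<rho>) - \<i> * of_real l) * rGamma (1 - of_real (\<alpha> * \<rho>) + \<i> * of_real l)" for l
      unfolding r unfolding True cc by (rule lamperti_exponent_Cauchy[OF c(2)])
  qed (use c r in \<open>simp_all add: killing_rate_def True cc\<close>)
next
  case False
  note hyps = \<alpha> False c(1) less_imp_le[OF c(2)] add_nonneg_pos[OF c]
  interpret levy_process M X by (rule X)
  obtain C where C: "C > 0" "C * sin (pi * (\<alpha> * \<rho>)) = - Gamma (- \<alpha>) * cm * sin (pi * \<alpha>)"
    "C * cos (pi * (\<alpha> * \<rho>)) = - Gamma (- \<alpha>) * (cp + cm * cos (pi * \<alpha>))"
    "killing_rate \<alpha> cp cm \<rho> = cm / \<alpha>"
    using stable_constants[OF hyps, of \<rho>] stable_negativity_parameter[OF hyps X] \<rho> by metis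
  have "Gamma \<alpha> * \<alpha> * (C * sin (pi * (\<alpha> * \<rho>))) = - (Gamma \<alpha> * Gamma (- \<alpha>) * (\<alpha> * sin (pi * \<alpha>))) * cm"
    unfolding C by simp
  also have "\<dots> > 0" unfolding Gamma_reflection_real_neg[OF hyps] using c by simp
  finally have "0 < (Gamma \<alpha> * \<alpha> * C) * sin (pi * (\<alpha> * \<rho>))" by (simp only: mult.assoc)
  moreover have "0 < Gamma \<alpha> * \<alpha> * C" using \<alpha> C(1) by (simp add: Gamma_real_pos)
  ultimately have s: "0 < sin (pi * (\<alpha> * \<rho>))" by (rule zero_less_mult_pos)
  have \<rho>01: "0 \<le> \<rho>" "\<rho> \<le> 1" unfolding \<rho> by simp_all
  have r2: "\<alpha> * \<rho> < 2" using mult_left_le[OF \<rho>01(2), of \<alpha>] \<alpha> by linarith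
  have r1: "\<alpha> * \<rho> < 1"
  proof (rule ccontr)
    assume "\<not> \<alpha> * \<rho> < 1"
    then have "sin (pi * (\<alpha> * \<rho>)) \<le> 0" using r2 by (intro sin_le_zero) auto
    then show False using s by simp
  qed
  have "\<alpha> * \<rho> \<noteq> 0" using s by (metis mult_zero_right sin_zero less_irrefl)
  then have r0: "0 < \<alpha> * \<rho>" using \<rho>01 \<alpha> by (simp add: less_le)
  show thesis
    by (rule that[OF C(1) _ r0 r1 lamperti_exponent_hypergeometric[OF hyps C(2-4)]]) (use C(4) c \<alpha> in simp)
qed

theorem proposition1:
  fixes M :: "'a measure" and X :: "real \<Rightarrow> 'a \<Rightarrow> real"
    and N :: "'b measure" and \<xi> :: "real \<Rightarrow> 'b \<Rightarrow> real" and \<zeta> :: "'b \<Rightarrow> ereal"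
    and \<alpha> cp cm \<rho> :: real
  assumes "0 < \<alpha>" "\<alpha> < 2"
    and "0 \<le> cp" "0 \<le> cm" "0 < cp + cm"
    and "\<alpha> = 1 \<longrightarrow> cp = cm"
    and "levy_process M X"
    and "has_char_exponent M X (stable_exponent \<alpha> cp cm)"
    and "\<not> subordinator M X" "\<not> subordinator M (\<lambda>t \<omega>. - X t \<omega>)"
    and "\<rho> = measure M {\<omega> \<in> space M. X 1 \<omega> \<le> 0}"
    and "0 < cm"
    and "killed_levy_process N (killing_rate \<alpha> cp cm \<rho>) \<xi> \<zeta>"
    and "has_killed_char_exponent N \<xi> \<zeta> (lamperti_exponent \<alpha> cp cm \<rho>)"
  shows "(\<forall>l>0. (\<integral>\<omega>. exp (l * overall_infimum \<xi> \<zeta> \<omega>) \<partial>N) =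
            Gamma (l + 1 - \<alpha> * \<rho>) / (Gamma (l + 1) * Gamma (1 - \<alpha> * \<rho>))) \<and>
         distributed N lborel (\<lambda>\<omega>. exp (overall_infimum \<xi> \<zeta> \<omega>))
           (\<lambda>t. ennreal (1 / Beta (1 - \<alpha> * \<rho>) (\<alpha> * \<rho>) * t powr (- \<alpha> * \<rho>)
                         * (1 - t) powr (\<alpha> * \<rho> - 1) * indicator {0<..<1} t))"
proof -
  obtain C where C: "C > 0" and k: "0 < killing_rate \<alpha> cp cm \<rho>" and r: "0 < \<alpha> * \<rho>" "\<alpha> * \<rho> < 1"
    and \<Phi>: "\<And>l. lamperti_exponent \<alpha> cp cm \<rho> l = - of_real C * Gamma (of_real \<alpha> - \<i> * of_real l) * Gamma (1 + \<i> * of_real l)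
      * rGamma (of_real (\<alpha> * \<rho>) - \<i> * of_real l) * rGamma (1 - of_real (\<alpha> * \<rho>) + \<i> * of_real l)"
    using lamperti_exponent_hypergeometric_form[OF assms(1-3,12,6-8,11)] by blast
  interpret N: strictly_killed_levy_process N "killing_rate \<alpha> cp cm \<rho>" \<xi> \<zeta>
    using assms(13) k by (simp add: strictly_killed_levy_process_def strictly_killed_levy_process_axioms_def)
  have L: "N.infimum_laplace w = Gamma (w + 1 - of_real (\<alpha> * \<rho>)) * rGamma (w + 1) * rGamma (1 - of_real (\<alpha> * \<rho>))"
    if "Re w \<ge> 0" for w
    by (rule N.infimum_laplace_hypergeometric[OF assms(14,1) r _ \<Phi> that]) (use C in simp)
  have "(\<integral>\<omega>. exp (l * overall_infimum \<xi> \<zeta> \<omega>) \<partial>N) = Gamma (l + 1 - \<alpha> * \<rho>) / (Gamma (l + 1) * Gamma (1 - \<alpha> * \<rho>))"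
    if l: "l > 0" for l
  proof -
    have "complex_of_real (\<integral>\<omega>. exp (l * overall_infimum \<xi> \<zeta> \<omega>) \<partial>N) = N.infimum_laplace (of_real l)"
      unfolding N.infimum_laplace_eq integral_complex_of_real[symmetric] by (simp only: of_real_mult flip: exp_of_real)
    also have "\<dots> = Gamma (of_real (l + 1 - \<alpha> * \<rho>)) * rGamma (of_real (l + 1)) * rGamma (of_real (1 - \<alpha> * \<rho>))"
      using l by (subst L) simp_all
    also have "\<dots> = of_real (Gamma (l + 1 - \<alpha> * \<rho>) * rGamma (l + 1) * rGamma (1 - \<alpha> * \<rho>))"
      by (simp only: Gamma_complex_of_real rGamma_complex_of_real of_real_mult)
    finally show ?thesis
      by (simp only: of_real_eq_iff) (simp add: rGamma_inverse_Gamma divide_inverse)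
  qed
  then show ?thesis using N.distributed_exp_overall_infimum[OF r L] by simp
qed

end
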